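(* Let $M$ be a smooth manifold and let $\mathbb E$ be a finite-dimensional Banach space. Let $\hat f$ be an essentially non-holonomic Lipschitz-vector-field structure on $M$ modelled by $\mathbb E$, and let $\hat N:M\times\mathbb E\to[0,+\infty)$ be a continuously varying norm. Then the following hold. (i) If $M$ is connected, then $d_{(\hat f,\hat N)}(p,q)<\infty$ for every $p,q\in M$. (ii) $d_{(\hat f,\hat N)}$ induces the manifold topology on $M$. (iii) Let $\{f_n\}_{n\in\mathbb N}$ be a sequence of Lipschitz-vector-field structures on $M$ modelled by $\mathbb E$, and let $\{N_n\}_{n\in\mathbb N}$ be a sequence of continuously varying norms on $M\times\mathbb E$. Assume that $f_n\to\hat f$ in the sense of Lipschitz-vector-field structures, and that $N_n\to\hat N$ uniformly on compact subsets of $M\times\mathbb E$. Then $d_{(f_n,N_n)}\to d_{(\hat f,\hat N)}$ locally uniformly on $M$, i.e., every $o\in M$ has a neighborhood $U$ such that $d_{(f_n,N_n)}\to d_{(\hat f,\hat N)}$ uniformly on $U\times U$ as $n\to+\infty$. (iv) If in the hypotheses of item (iii) we additionally have that $d_{(\hat f,\hat N)}$ is a boundedly compact (or equivalently complete) distance, then $$\lim_{n\to+\infty} d_{(f_n,N_n)}=d_{(\hat f,\hat N)}$$ uniformly on compact subsets of $M\times M$. Moreover, for every $x\in M$, $(M,d_{(f_n,N_n)},x)\to(M,d_{(\hat f,\hat N)},x)$ in the pointed Gromov--Hausdorff topology as $n\to+\infty$.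
   Context: **Lipschitz-vector-field structures.** Let $\mathbb E^*\otimes TM$ be the vector bundle on $M$ with fibers $\mathbb E^*\otimes T_pM$. A section $f$ is a choice, for each $p\in M$, of a linear map $f|_p:\mathbb E\to T_pM$; we write $f(p,v)=f(p)[v]=f|_p[v]$. A family of sections is uniformly locally Lipschitz if for every $p\in M$ there are a coordinate neighborhood of $p$ trivializing the bundle and $L>0$ such that every element of the family is $L$-Lipschitz in this trivialization. A Lipschitz-vector-field structure on $M$ modelled by $\mathbb E$ is a locally Lipschitz section of $\mathbb E^*\otimes TM$. A sequence $f_n$ converges to $f_\infty$ (in the sense of Lipschitz-vector-field structures) if $\{f_n\}_n$ is uniformly locally Lipschitz and every $p\in M$ has a coordinate neighborhood trivializing the bundle on which $f_n\to f_\infty$ uniformly on compact sets. **End-point map.** For $o\in M$, a Lipschitz-vector-field structure $f$, and $u\in L^\infty([0,1];\mathbb E)$, let $\gamma_{(o,f,u)}:[0,1]\to M$ be the absolutely continuous solution of $\gamma'(t)=f|_{\gamma(t)}[u(t)]$ for a.e. $t$, $\gamma(0)=o$, whenever it exists on $[0,1]$, and set $\mathrm{End}^f_o(u):=\gamma_{(o,f,u)}(1)$. **CC distance.** A continuously varying norm is a continuous function $N:M\times\mathbb E\to[0,+\infty)$ such that $N(p,\cdot)$ is a norm on $\mathbb E$ for every $p\in M$. The energy is $J(o,f,u,N):=\operatorname{ess\,sup}_{t\in[0,1]}N(\gamma_{(o,f,u)}(t),u(t))$. The Carnot--Carathéodory (CC) distance is $$d_{(f,N)}(p,q):=\inf\{J(p,f,u,N):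 u\in L^\infty([0,1];\mathbb E),\ \mathrm{End}^f_p(u)=q\}\in[0,+\infty],$$ with $\inf\emptyset=+\infty$. In convergence statements, $|\infty-\infty|$ is read as $0$. A distance is boundedly compact if closed bounded sets are compact. **Essentially open maps.** A continuous map $g:P\to Q$ between topological manifolds of the same dimension $k$ is essentially open at $p\in P$ at scale $U$ if: $U$ is a neighborhood of $p$ homeomorphic to the Euclidean $k$-ball with $\partial U$ homeomorphic to $\mathbb S^{k-1}$; and there is a neighborhood $V$ of $g(p)$ homeomorphic to the Euclidean $k$-ball such that $g(\partial U)\subseteq V\setminus\{g(p)\}$ and the induced homomorphism $g_*:H_{k-1}(\partial U)\cong\mathbb Z\to H_{k-1}(V\setminus\{g(p)\})\cong\mathbb Z$ is not constant (reduced homology if $k=1$). **Essentially non-holonomic.** Let $m=\dim M$, let $\Phi^t_X$ denote the flow of $X$ at time $t$ and $|t|_1=\sum_i|t_i|$. A family $\mathscr F$ of Lipschitz vector fields on $M$ is essentially non-holonomic if for every $T>0$ and every $o\in M$ there are $X_1,\dots,X_m\in\mathscr F$ (not necessarily distinct) and $\hat t\in\mathbb R^m$ with $|\hat t|_1<T$ such that there exists a neighborhood $\Omega_{\hat t}\subseteq B(0,T)\subseteq\mathbb R^m$ of $\hat t$ on which the map $\phi(t_1,\dots,t_m):=\Phi^{t_m}_{X_m}\circ\dots\circ\Phi^{t_1}_{X_1}(o)$ is defined and, restricted to $\Omega_{\hat t}$, is essentially open at $\hat t$ at some scale. A Lipschitz-vector-field structure $f$ is essentially non-holonomic if there is a basis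 $(e_1,\dots,e_r)$ of $\mathbb E$ such that $\{f(\cdot,e_1),\dots,f(\cdot,e_r)\}$ is essentially non-holonomic. *)

theory Defs
  imports "HOL-Analysis.Analysis" "HOL-Probability.Essential_Supremum" "HOL-Homology.Homology"
begin

section \<open>Smooth manifolds\<close>

text \<open>
  The manifold \<open>M\<close> is a whole type \<open>'a\<close> with its type-class topology (Hausdorff and second countable
  wherever it matters), together with a maximal smooth atlas \<open>A\<close> of charts into a Euclidean
  space \<open>'b\<close>; thus \<open>dim M = DIM('b)\<close>, which is at least one.
  A chart is a pair of its domain and its coordinate map; the values of the latter outside the domain
  are irrelevant.
\<close>

type_synonym ('a, 'b) chart = "'a set \<times> ('a \<Rightarrow> 'b)"

abbreviation chart_dom :: "('a, 'b) chart \<Rightarrow> 'a set" where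
  "chart_dom c \<equiv> fst c"

abbreviation chart_map :: "('a, 'b) chart \<Rightarrow> 'a \<Rightarrow> 'b" where
  "chart_map c \<equiv> snd c"

abbreviation chart_inv :: "('a, 'b) chart \<Rightarrow> 'b \<Rightarrow> 'a" where
  "chart_inv c \<equiv> inv_into (fst c) (snd c)"

definition is_chart :: "('a::topological_space, 'b::euclidean_space) chart \<Rightarrow> bool" where
  "is_chart c \<longleftrightarrow> open (chart_dom c) \<and> open (chart_map c ` chart_dom c) \<and>
     homeomorphism (chart_dom c) (chart_map c ` chart_dom c) (chart_map c) (chart_inv c)"

text \<open>For open \<open>S\<close>: all iterated directional derivatives up to order \<open>k\<close> exist as Frechet derivatives
  and those of order \<open>k\<close> are continuous.\<close>

fun Ck_on :: "nat \<Rightarrow> ('b::real_normed_vector \<Rightarrow> 'c::real_normed_vector) \<Rightarrow> 'b set \<Rightarrow> bool" where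
  "Ck_on 0 g S \<longleftrightarrow> continuous_on S g"
| "Ck_on (Suc k) g S \<longleftrightarrow>
     (\<forall>x\<in>S. g differentiable (at x)) \<and> (\<forall>v. Ck_on k (\<lambda>x. frechet_derivative g (at x) v) S)"

definition smooth_on :: "('b::real_normed_vector \<Rightarrow> 'c::real_normed_vector) \<Rightarrow> 'b set \<Rightarrow> bool" where
  "smooth_on g S \<longleftrightarrow> (\<forall>k. Ck_on k g S)"

definition smoothly_compatible ::
    "('a::topological_space, 'b::euclidean_space) chart \<Rightarrow> ('a, 'b) chart \<Rightarrow> bool" where
  "smoothly_compatible c c' \<longleftrightarrow>
     smooth_on (chart_map c' \<circ> chart_inv c) (chart_map c ` (chart_dom c \<inter> chart_dom c')) \<and>
     smooth_on (chart_map c \<circ> chart_inv c') (chart_map c' ` (chart_dom c \<inter> chart_dom c'))"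

definition smooth_structure :: "('a::topological_space, 'b::euclidean_space) chart set \<Rightarrow> bool" where
  "smooth_structure A \<longleftrightarrow>
     (\<forall>c\<in>A. is_chart c) \<and> (\<Union>c\<in>A. chart_dom c) = UNIV \<and>
     (\<forall>c\<in>A. \<forall>c'\<in>A. smoothly_compatible c c') \<and>
     (\<forall>c. is_chart c \<and> (\<forall>c'\<in>A. smoothly_compatible c c') \<longrightarrow> c \<in> A)"

definition charts_at :: "('a, 'b) chart set \<Rightarrow> 'a \<Rightarrow> ('a, 'b) chart set" where
  "charts_at A p = {c \<in> A. p \<in> chart_dom c}"

text \<open>A tangent vector at \<open>p\<close> assigns to every chart at \<open>p\<close> its coordinate vector in that chart,
  with coordinates transforming by the derivatives of the transition maps. Charts that do not contain
  \<open>p\<close> are sent to \<open>0\<close>, so that equality in \<open>T\<^sub>pM\<close> is equality in HOL. The linear structure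
  is the pointwise one.\<close>

type_synonym ('a, 'b) tvec = "('a, 'b) chart \<Rightarrow> 'b"

definition tangent_space ::
    "('a::topological_space, 'b::euclidean_space) chart set \<Rightarrow> 'a \<Rightarrow> ('a, 'b) tvec set" where
  "tangent_space A p = {w.
     (\<forall>c\<in>charts_at A p. \<forall>c'\<in>charts_at A p.
        w c' = frechet_derivative (chart_map c' \<circ> chart_inv c) (at (chart_map c p)) (w c)) \<and>
     (\<forall>c. c \<notin> charts_at A p \<longrightarrow> w c = 0)}"

definition has_velocity ::
    "('a::topological_space, 'b::euclidean_space) chart set \<Rightarrow> (real \<Rightarrow> 'a) \<Rightarrow> ('a, 'b) tvec \<Rightarrow>
      real \<Rightarrow> real set \<Rightarrow> bool" where
  "has_velocity A \<gamma> w t I \<longleftrightarrow>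
     (\<forall>c\<in>charts_at A (\<gamma> t). ((chart_map c \<circ> \<gamma>) has_vector_derivative w c) (at t within I))"


section \<open>Lipschitz-vector-field structures\<close>

text \<open>The coordinate representation of a section of \<open>\<bbbE>\<^sup>* \<otimes> TM\<close> in a chart. The space \<open>\<bbbE>\<close> is
  finite-dimensional, so that linear maps are bounded and \<open>Blinfun\<close> is not applied outside its domain.
  The norm on bounded linear maps is the operator norm.\<close>

definition local_rep ::
    "('a, 'b::euclidean_space) chart \<Rightarrow> ('a \<Rightarrow> 'e::real_normed_vector \<Rightarrow> ('a, 'b) tvec) \<Rightarrow>
      'b \<Rightarrow> 'e \<Rightarrow>\<^sub>L 'b" where
  "local_rep c f x = Blinfun (\<lambda>v. f (chart_inv c x) v c)"

definition bundle_section ::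
    "('a::topological_space, 'b::euclidean_space) chart set \<Rightarrow>
      ('a \<Rightarrow> 'e::real_normed_vector \<Rightarrow> ('a, 'b) tvec) \<Rightarrow> bool" where
  "bundle_section A f \<longleftrightarrow>
     (\<forall>p v. f p v \<in> tangent_space A p) \<and> (\<forall>p c. linear (\<lambda>v. f p v c))"

definition uniformly_locally_lipschitz ::
    "('a::topological_space, 'b::euclidean_space) chart set \<Rightarrow>
      ('a \<Rightarrow> 'e::real_normed_vector \<Rightarrow> ('a, 'b) tvec) set \<Rightarrow> bool" where
  "uniformly_locally_lipschitz A F \<longleftrightarrow>
     (\<forall>p. \<exists>c\<in>charts_at A p. \<exists>L>0. \<forall>f\<in>F.
        L-lipschitz_on (chart_map c ` chart_dom c) (local_rep c f))"

definition lvf_structure ::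
    "('a::topological_space, 'b::euclidean_space) chart set \<Rightarrow>
      ('a \<Rightarrow> 'e::real_normed_vector \<Rightarrow> ('a, 'b) tvec) \<Rightarrow> bool" where
  "lvf_structure A f \<longleftrightarrow> bundle_section A f \<and> uniformly_locally_lipschitz A {f}"

definition lvf_converges ::
    "('a::topological_space, 'b::euclidean_space) chart set \<Rightarrow>
      (nat \<Rightarrow> 'a \<Rightarrow> 'e::real_normed_vector \<Rightarrow> ('a, 'b) tvec) \<Rightarrow>
      ('a \<Rightarrow> 'e \<Rightarrow> ('a, 'b) tvec) \<Rightarrow> bool" where
  "lvf_converges A fs f \<longleftrightarrow>
     uniformly_locally_lipschitz A (range fs) \<and>
     (\<forall>p. \<exists>c\<in>charts_at A p. \<forall>K. compact K \<and> K \<subseteq> chart_map c ` chart_dom c \<longrightarrow>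
        uniform_limit K (\<lambda>n. local_rep c (fs n)) (local_rep c f) sequentially)"


section \<open>End-point map and Carnot--Caratheodory distance\<close>

definition abs_continuous_on_interval :: "real \<Rightarrow> real \<Rightarrow> (real \<Rightarrow> 'b::metric_space) \<Rightarrow> bool" where
  "abs_continuous_on_interval a b g \<longleftrightarrow>
     (\<forall>\<epsilon>>0. \<exists>\<delta>>0. \<forall>D :: (real \<times> real) set.
        finite D \<and> (\<forall>(x, y)\<in>D. a \<le> x \<and> x \<le> y \<and> y \<le> b) \<and>
        pairwise (\<lambda>I J. disjnt {fst I<..<snd I} {fst J<..<snd J}) D \<and>
        (\<Sum>(x, y)\<in>D. y - x) < \<delta>
        \<longrightarrow> (\<Sum>(x, y)\<in>D. dist (g x) (g y)) < \<epsilon>)"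

definition abs_continuous_curve ::
    "('a::topological_space, 'b::euclidean_space) chart set \<Rightarrow> (real \<Rightarrow> 'a) \<Rightarrow> bool" where
  "abs_continuous_curve A \<gamma> \<longleftrightarrow>
     continuous_on {0..1} \<gamma> \<and>
     (\<forall>c\<in>A. \<forall>a b. 0 \<le> a \<and> a \<le> b \<and> b \<le> 1 \<and> \<gamma> ` {a..b} \<subseteq> chart_dom c \<longrightarrow>
        abs_continuous_on_interval a b (chart_map c \<circ> \<gamma>))"

text \<open>Representatives of the elements of \<open>L\<^sup>\<infinity>([0,1]; \<bbbE>)\<close>.\<close>

definition Linf :: "(real \<Rightarrow> 'e::real_normed_vector) set" where
  "Linf = {u. u \<in> borel_measurable (lebesgue_on {0..1}) \<and>
              (\<exists>C. AE t in lebesgue_on {0..1}. norm (u t) \<le> C)}"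

definition is_trajectory ::
    "('a::topological_space, 'b::euclidean_space) chart set \<Rightarrow> 'a \<Rightarrow>
      ('a \<Rightarrow> 'e::real_normed_vector \<Rightarrow> ('a, 'b) tvec) \<Rightarrow> (real \<Rightarrow> 'e) \<Rightarrow> (real \<Rightarrow> 'a) \<Rightarrow> bool" where
  "is_trajectory A x0 f u \<gamma> \<longleftrightarrow>
     abs_continuous_curve A \<gamma> \<and> \<gamma> 0 = x0 \<and>
     (AE t in lebesgue_on {0..1}. has_velocity A \<gamma> (f (\<gamma> t) (u t)) t {0..1})"

text \<open>For a Lipschitz-vector-field structure trajectories are unique on \<open>[0,1]\<close>, so that the choice
  below only affects irrelevant values outside \<open>[0,1]\<close>.\<close>

definition trajectory ::
    "('a::topological_space, 'b::euclidean_space) chart set \<Rightarrow> 'a \<Rightarrow>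
      ('a \<Rightarrow> 'e::real_normed_vector \<Rightarrow> ('a, 'b) tvec) \<Rightarrow> (real \<Rightarrow> 'e) \<Rightarrow> real \<Rightarrow> 'a" where
  "trajectory A x0 f u = (SOME \<gamma>. is_trajectory A x0 f u \<gamma>)"

definition End_defined ::
    "('a::topological_space, 'b::euclidean_space) chart set \<Rightarrow>
      ('a \<Rightarrow> 'e::real_normed_vector \<Rightarrow> ('a, 'b) tvec) \<Rightarrow> 'a \<Rightarrow> (real \<Rightarrow> 'e) \<Rightarrow> bool" where
  "End_defined A f x0 u \<longleftrightarrow> (\<exists>\<gamma>. is_trajectory A x0 f u \<gamma>)"

definition End ::
    "('a::topological_space, 'b::euclidean_space) chart set \<Rightarrow>
      ('a \<Rightarrow> 'e::real_normed_vector \<Rightarrow> ('a, 'b) tvec) \<Rightarrow> 'a \<Rightarrow> (real \<Rightarrow> 'e) \<Rightarrow> 'a" where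
  "End A f x0 u = trajectory A x0 f u 1"

definition continuously_varying_norm ::
    "('a::topological_space \<Rightarrow> 'e::real_normed_vector \<Rightarrow> real) \<Rightarrow> bool" where
  "continuously_varying_norm N \<longleftrightarrow>
     continuous_on UNIV (\<lambda>(p, v). N p v) \<and>
     (\<forall>p. (\<forall>v. 0 \<le> N p v) \<and> (\<forall>v. N p v = 0 \<longleftrightarrow> v = 0) \<and>
          (\<forall>a v. N p (a *\<^sub>R v) = \<bar>a\<bar> * N p v) \<and> (\<forall>v w. N p (v + w) \<le> N p v + N p w))"

definition energy ::
    "('a::topological_space, 'b::euclidean_space) chart set \<Rightarrow> 'a \<Rightarrow>
      ('a \<Rightarrow> 'e::real_normed_vector \<Rightarrow> ('a, 'b) tvec) \<Rightarrow> (real \<Rightarrow> 'e) \<Rightarrow>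
      ('a \<Rightarrow> 'e \<Rightarrow> real) \<Rightarrow> ennreal" where
  "energy A x0 f u N =
     esssup (lebesgue_on {0..1}) (\<lambda>t. ennreal (N (trajectory A x0 f u t) (u t)))"

definition cc_dist ::
    "('a::topological_space, 'b::euclidean_space) chart set \<Rightarrow>
      ('a \<Rightarrow> 'e::real_normed_vector \<Rightarrow> ('a, 'b) tvec) \<Rightarrow> ('a \<Rightarrow> 'e \<Rightarrow> real) \<Rightarrow>
      'a \<Rightarrow> 'a \<Rightarrow> ennreal" where
  "cc_dist A f N p q = Inf {energy A p f u N | u. u \<in> Linf \<and> End_defined A f p u \<and> End A f p u = q}"


section \<open>Distances with values in \<open>[0,\<infinity>]\<close>\<close>

definition ext_distance :: "('x \<Rightarrow> 'x \<Rightarrow> ennreal) \<Rightarrow> bool" where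
  "ext_distance d \<longleftrightarrow>
     (\<forall>x y. d x y = 0 \<longleftrightarrow> x = y) \<and> (\<forall>x y. d x y = d y x) \<and> (\<forall>x y z. d x z \<le> d x y + d y z)"

definition dball :: "('x \<Rightarrow> 'x \<Rightarrow> ennreal) \<Rightarrow> 'x \<Rightarrow> real \<Rightarrow> 'x set" where
  "dball d x r = {y. d x y < ennreal r}"

definition dist_topology :: "('x \<Rightarrow> 'x \<Rightarrow> ennreal) \<Rightarrow> 'x topology" where
  "dist_topology d = topology (\<lambda>S. \<forall>x\<in>S. \<exists>r>0. dball d x r \<subseteq> S)"

lemma openin_dist_topology:
  "openin (dist_topology d) S \<longleftrightarrow> (\<forall>x\<in>S. \<exists>r>0. dball d x r \<subseteq> S)"
proof -
  have mono: "dball d x r \<subseteq> dball d x s" if "r \<le> s" for x r s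
    using ennreal_leI[OF that] order_less_le_trans unfolding dball_def by blast
  have "istopology (\<lambda>S. \<forall>x\<in>S. \<exists>r>0. dball d x r \<subseteq> S)"
    unfolding istopology_def
  proof (intro conjI allI impI ballI)
    fix S T x
    assume "\<forall>x\<in>S. \<exists>r>0. dball d x r \<subseteq> S" "\<forall>x\<in>T. \<exists>r>0. dball d x r \<subseteq> T" "x \<in> S \<inter> T"
    then obtain r s where rs: "r > 0" "s > 0" "dball d x r \<subseteq> S" "dball d x s \<subseteq> T"
      by blast
    have "dball d x (min r s) \<subseteq> S \<inter> T"
      using mono[OF min.cobounded1[of r s], of x] mono[OF min.cobounded2[of r s], of x] rs(3,4)
      by blast
    moreover have "min r s > 0"
      using rs(1,2) by simp
    ultimately show "\<exists>r>0. dball d x r \<subseteq> S \<inter> T"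
      by blast
  next
    fix \<K> x
    assume "\<forall>S\<in>\<K>. \<forall>x\<in>S. \<exists>r>0. dball d x r \<subseteq> S" "x \<in> \<Union>\<K>"
    then show "\<exists>r>0. dball d x r \<subseteq> \<Union>\<K>"
      by (meson Union_iff Union_upper order_trans)
  qed
  then show ?thesis
    unfolding dist_topology_def by (subst topology_inverse') simp_all
qed

definition induces_manifold_topology :: "('a::topological_space \<Rightarrow> 'a \<Rightarrow> ennreal) \<Rightarrow> bool" where
  "induces_manifold_topology d \<longleftrightarrow> ext_distance d \<and> dist_topology d = euclidean"

definition boundedly_compact :: "('x \<Rightarrow> 'x \<Rightarrow> ennreal) \<Rightarrow> bool" where
  "boundedly_compact d \<longleftrightarrow>
     (\<forall>S. closedin (dist_topology d) S \<and> (\<exists>x r. S \<subseteq> dball d x r) \<longrightarrow> compactin (dist_topology d) S)"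

definition complete_distance :: "('x \<Rightarrow> 'x \<Rightarrow> ennreal) \<Rightarrow> bool" where
  "complete_distance d \<longleftrightarrow>
     (\<forall>s. (\<forall>\<epsilon>>0. \<exists>n0. \<forall>m\<ge>n0. \<forall>n\<ge>n0. d (s m) (s n) < ennreal \<epsilon>) \<longrightarrow>
          (\<exists>x. (\<lambda>n. d (s n) x) \<longlonglongrightarrow> 0))"

text \<open>The absolute difference on \<open>[0,\<infinity>]\<close> with \<open>\<bar>\<infinity> - \<infinity>\<bar> = 0\<close>. Subtraction on \<open>ennreal\<close> is truncated
  at \<open>0\<close>, and \<open>\<infinity> - \<infinity> = \<infinity>\<close> there.\<close>

definition ext_absdiff :: "ennreal \<Rightarrow> ennreal \<Rightarrow> ennreal" where
  "ext_absdiff a b = (if a = \<infinity> \<and> b = \<infinity> then 0 else max (a - b) (b - a))"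

definition ext_uniform_limit ::
    "('x \<times> 'x) set \<Rightarrow> (nat \<Rightarrow> 'x \<Rightarrow> 'x \<Rightarrow> ennreal) \<Rightarrow> ('x \<Rightarrow> 'x \<Rightarrow> ennreal) \<Rightarrow> bool" where
  "ext_uniform_limit S ds d \<longleftrightarrow>
     (\<forall>\<epsilon>>0. \<forall>\<^sub>F n in sequentially. \<forall>(p, q)\<in>S. ext_absdiff (ds n p q) (d p q) < ennreal \<epsilon>)"

text \<open>Pointed Gromov--Hausdorff convergence \<open>(X\<^sub>n, d\<^sub>n, x\<^sub>n) \<rightarrow> (Y, d, y)\<close> as in Burago--Burago--Ivanov,
  A Course in Metric Geometry, Definition 8.1.1, where distances may take the value \<open>\<infinity>\<close>: for all
  \<open>r, \<epsilon> > 0\<close> and all large \<open>n\<close> there is a map \<open>F\<close> on the \<open>r\<close>-ball at \<open>x\<^sub>n\<close> that preserves base points,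
  has distortion less than \<open>\<epsilon>\<close>, and whose image has an \<open>\<epsilon>\<close>-neighborhood that contains the
  \<open>(r - \<epsilon>)\<close>-ball at \<open>y\<close>. The values of \<open>F\<close> outside the \<open>r\<close>-ball are irrelevant.\<close>

definition pointed_GH_converges ::
    "(nat \<Rightarrow> 'x \<Rightarrow> 'x \<Rightarrow> ennreal) \<Rightarrow> (nat \<Rightarrow> 'x) \<Rightarrow> ('y \<Rightarrow> 'y \<Rightarrow> ennreal) \<Rightarrow> 'y \<Rightarrow> bool" where
  "pointed_GH_converges ds xs d y \<longleftrightarrow>
     (\<forall>n. ext_distance (ds n)) \<and> ext_distance d \<and>
     (\<forall>r>0. \<forall>\<epsilon>>0. \<forall>\<^sub>F n in sequentially. \<exists>F :: 'x \<Rightarrow> 'y.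
        F (xs n) = y \<and>
        (SUP v\<in>dball (ds n) (xs n) r. SUP w\<in>dball (ds n) (xs n) r.
           ext_absdiff (d (F v) (F w)) (ds n v w)) < ennreal \<epsilon> \<and>
        dball d y (r - \<epsilon>) \<subseteq> (\<Union>v\<in>dball (ds n) (xs n) r. dball d (F v) \<epsilon>))"


section \<open>Essentially open maps\<close>

definition open_ball_space :: "nat \<Rightarrow> (nat \<Rightarrow> real) topology" where
  "open_ball_space k = subtopology (Euclidean_space k) {x. L2_set x {..<k} < 1}"

definition neighborhood_in :: "'x topology \<Rightarrow> 'x \<Rightarrow> 'x set \<Rightarrow> bool" where
  "neighborhood_in X x U \<longleftrightarrow> U \<subseteq> topspace X \<and> (\<exists>W. openin X W \<and> x \<in> W \<and> W \<subseteq> U)"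

text \<open>For \<open>k \<ge> 1\<close>. The boundary of \<open>U\<close> is its topological boundary in \<open>P\<close>. Reduced homology
  in degree \<open>k - 1\<close> is ordinary homology unless \<open>k = 1\<close>, see fact \<open>un_reduced_homology_group\<close>.\<close>

definition essentially_open_at_scale ::
    "nat \<Rightarrow> 'x topology \<Rightarrow> 'y topology \<Rightarrow> ('x \<Rightarrow> 'y) \<Rightarrow> 'x \<Rightarrow> 'x set \<Rightarrow> bool" where
  "essentially_open_at_scale k P Q g p U \<longleftrightarrow>
     continuous_map P Q g \<and>
     neighborhood_in P p U \<and>
     subtopology P U homeomorphic_space open_ball_space k \<and>
     subtopology P (P frontier_of U) homeomorphic_space nsphere (k - 1) \<and>
     (\<exists>V. neighborhood_in Q (g p) V \<and>
          subtopology Q V homeomorphic_space open_ball_space k \<and>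
          g ` (P frontier_of U) \<subseteq> V - {g p} \<and>
          \<not> hom_induced (int k - 1)
              (subtopology P (P frontier_of U)) {} (subtopology Q (V - {g p})) {} g
            constant_on carrier (reduced_homology_group (int k - 1) (subtopology P (P frontier_of U))))"


section \<open>Essentially non-holonomic families and structures\<close>

definition integral_curve_on ::
    "('a::topological_space, 'b::euclidean_space) chart set \<Rightarrow> ('a \<Rightarrow> ('a, 'b) tvec) \<Rightarrow>
      real set \<Rightarrow> (real \<Rightarrow> 'a) \<Rightarrow> bool" where
  "integral_curve_on A X I \<gamma> \<longleftrightarrow>
     continuous_on I \<gamma> \<and> (\<forall>s\<in>I. has_velocity A \<gamma> (X (\<gamma> s)) s I)"

text \<open>The time \<open>t\<close> of a flow may be negative. Integral curves of locally Lipschitz vector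
  fields are unique, so that the choice in \<open>flow\<close> is immaterial where \<open>flow_defined\<close> holds.\<close>

definition flow_defined ::
    "('a::topological_space, 'b::euclidean_space) chart set \<Rightarrow> ('a \<Rightarrow> ('a, 'b) tvec) \<Rightarrow>
      real \<Rightarrow> 'a \<Rightarrow> bool" where
  "flow_defined A X t p \<longleftrightarrow> (\<exists>\<gamma>. \<gamma> 0 = p \<and> integral_curve_on A X (closed_segment 0 t) \<gamma>)"

definition flow ::
    "('a::topological_space, 'b::euclidean_space) chart set \<Rightarrow> ('a \<Rightarrow> ('a, 'b) tvec) \<Rightarrow>
      real \<Rightarrow> 'a \<Rightarrow> 'a" where
  "flow A X t p = (SOME \<gamma>. \<gamma> 0 = p \<and> integral_curve_on A X (closed_segment 0 t) \<gamma>) t"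

text \<open>\<open>flows A X k x0 t\<close> is the composition of the time-\<open>t i\<close> flows of \<open>X i\<close>, with \<open>i\<close> from \<open>0\<close>
  (applied first) to \<open>k - 1\<close>, applied to \<open>x0\<close>. Indices are shifted to start at \<open>0\<close>, in accordance
  with \<open>Euclidean_space\<close>.\<close>

primrec flows ::
    "('a::topological_space, 'b::euclidean_space) chart set \<Rightarrow> (nat \<Rightarrow> 'a \<Rightarrow> ('a, 'b) tvec) \<Rightarrow>
      nat \<Rightarrow> 'a \<Rightarrow> (nat \<Rightarrow> real) \<Rightarrow> 'a" where
  "flows A X 0 x0 t = x0"
| "flows A X (Suc k) x0 t = flow A (X k) (t k) (flows A X k x0 t)"

definition flows_defined ::
    "('a::topological_space, 'b::euclidean_space) chart set \<Rightarrow> (nat \<Rightarrow> 'a \<Rightarrow> ('a, 'b) tvec) \<Rightarrow>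
      nat \<Rightarrow> 'a \<Rightarrow> (nat \<Rightarrow> real) \<Rightarrow> bool" where
  "flows_defined A X k x0 t \<longleftrightarrow> (\<forall>i<k. flow_defined A (X i) (t i) (flows A X i x0 t))"

definition essentially_nonholonomic_family ::
    "('a::topological_space, 'b::euclidean_space) chart set \<Rightarrow> ('a \<Rightarrow> ('a, 'b) tvec) set \<Rightarrow> bool" where
  "essentially_nonholonomic_family A F \<longleftrightarrow>
     (let m = DIM('b) in
      \<forall>T>0. \<forall>x0. \<exists>X. (\<forall>i<m. X i \<in> F) \<and>
        (\<exists>t \<in> topspace (Euclidean_space m). (\<Sum>i<m. \<bar>t i\<bar>) < T \<and>
          (\<exists>\<Omega>. openin (Euclidean_space m) \<Omega> \<and> t \<in> \<Omega> \<and>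
                \<Omega> \<subseteq> {s. L2_set s {..<m} < T} \<and>
                (\<forall>s\<in>\<Omega>. flows_defined A X m x0 s) \<and>
                (\<exists>U. essentially_open_at_scale m (subtopology (Euclidean_space m) \<Omega>) euclidean
                       (flows A X m x0) t U))))"

definition essentially_nonholonomic ::
    "('a::topological_space, 'b::euclidean_space) chart set \<Rightarrow>
      ('a \<Rightarrow> 'e::real_normed_vector \<Rightarrow> ('a, 'b) tvec) \<Rightarrow> bool" where
  "essentially_nonholonomic A f \<longleftrightarrow>
     (\<exists>B. independent B \<and> span B = UNIV \<and>
          essentially_nonholonomic_family A ((\<lambda>e p. f p e) ` B))"

end

theory Submission
  imports Defs
begin

text \<open>The proof rests on uniform local controllability (\<open>locally_controllable\<close>): every point has, for every \<open>r > 0\<close>,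
a neighbourhood in which, for all large \<open>n\<close>, any two points are joined by a curve of \<open>f\<^sub>n\<close> whose energy with
respect to \<open>N\<^sub>n\<close> is at most \<open>r\<close>.

Its source is topological. By non-holonomicity some composition of short flows of \<open>f\<close> from the given point, as a map
of the \<open>m\<close> flow times and read in a chart, is essentially open. Such a map \<open>G\<close> has a \<^emph>\<open>stable value\<close> \<open>q\<close>: every
continuous map uniformly close to \<open>G\<close> also takes the value \<open>q\<close> (\<open>essentially_open_stable_value\<close>). Otherwise every
value could be avoided by arbitrarily small perturbations of \<open>G\<close>. Project radially the image of the boundary sphere to
the unit sphere; this projection extends continuously to the complement of a finite set, and a perturbation of \<open>G\<close>
avoids that set. The composition maps the closed region into the unit sphere, so the restriction to its boundary
would be null-homotopic, hence constant on reduced homology. It does not matter that \<open>q\<close> may differ from the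
value of \<open>G\<close> at the distinguished time. Indeed, the flows are endpoints of trajectories with piecewise constant
controls, and endpoints depend continuously on the starting point, on the control and on the structure. The control
that led to \<open>q\<close> leads, for \<open>f\<^sub>n\<close> and from a starting point \<open>p\<close> near the given one, to a point \<open>y\<close> near \<open>q\<close>, and by
stability \<open>y\<close> is reached from the given point as well. Going to \<open>y\<close> and back joins \<open>p\<close> to the given point.

For the constant sequence, controllability says that small neighbourhoods lie in small balls of the CC distance; as
curves of small energy do not leave a coordinate ball, the CC distance induces the manifold topology. For the
convergence near a point, an almost optimal control for one structure is used for the other one from the same starting
point. By Gronwall's estimate the new curve ends close to the target and its energy is hardly larger, and by
controllability the remaining gap costs little. This argument is symmetric in the two structures
(\<open>cc_dist_locally_uniform\<close>).

The other assertions concern distances that are infima of lengths, in the form of the locale \<open>path_distance\<close>: points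
at distance less than \<open>r\<close> are joined by a path that is \<open>r\<close>-Lipschitz on \<open>[0,1]\<close>. Finiteness then propagates along
connected sets, complete distances on locally compact spaces are boundedly compact (Hopf--Rinow), and locally uniform
convergence becomes uniform on bounded sets of a boundedly compact distance: almost minimal paths are cut into
short pieces, and on short pieces that start in a compact set the distances are close (\<open>compare_on_ball\<close>).

All work with trajectories uses an integral form of the control system (\<open>itraj\<close>). It is equivalent to absolute
continuity and the differential equation almost everywhere by the two halves of the fundamental theorem of calculus,
\<open>absolutely_continuous_has_integral\<close> and \<open>indefinite_integral_has_derivative_ae\<close>.\<close>

section \<open>Finite-dimensional normed spaces\<close>

text \<open>By induction on the basis: the span of the old vectors is complete, hence closed, so the
  new vector has a positive distance \<open>d\<close> from it, and \<open>d\<close> times the new coordinate is at most the norm.\<close>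

lemma coordinates_bounded_by_norm:
  fixes B :: "'e::real_normed_vector set"
  assumes "finite B" "independent B"
  shows "\<exists>C>0. \<forall>a. \<forall>b\<in>B. \<bar>a b\<bar> \<le> C * norm (\<Sum>b\<in>B. a b *\<^sub>R b)"
  using assms
proof (induction B rule: finite_induct)
  case empty
  show ?case by (intro exI[of _ 1]) auto
next
  case (insert b0 B)
  have indB: "independent B" and b0: "b0 \<notin> span B"
    using insert.prems insert.hyps by (auto simp: independent_insert)
  obtain C where C: "C > 0" "\<And>a b. b \<in> B \<Longrightarrow> \<bar>a b\<bar> \<le> C * norm (\<Sum>b\<in>B. a b *\<^sub>R b)"
    using insert.IH[OF indB] by blast
  have "closed (span B)"
    unfolding closed_sequential_limits
  proof (intro allI impI, elim conjE)
    fix x l assume x: "\<forall>n. x n \<in> span B" and l: "x \<longlonglongrightarrow> l"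
    have "\<forall>n. \<exists>a. x n = (\<Sum>b\<in>B. a b *\<^sub>R b)"
      using x insert.hyps(1) by (auto simp: span_finite)
    then obtain a where a: "\<And>n. x n = (\<Sum>b\<in>B. a n b *\<^sub>R b)" by metis
    have "Cauchy (\<lambda>n. a n b)" if "b \<in> B" for b
      unfolding Cauchy_def
    proof (intro allI impI)
      fix e :: real assume "e > 0"
      have "Cauchy x" using l by (rule LIMSEQ_imp_Cauchy)
      then obtain M where M: "\<And>m n. m \<ge> M \<Longrightarrow> n \<ge> M \<Longrightarrow> dist (x m) (x n) < e / C"
        using \<open>e > 0\<close> C(1) unfolding Cauchy_def by (meson divide_pos_pos)
      have "dist (a m b) (a n b) < e" if "m \<ge> M" "n \<ge> M" for m n
      proof -
        have "\<bar>a m b - a n b\<bar> \<le> C * norm (\<Sum>b\<in>B. (a m b - a n b) *\<^sub>R b)"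
          using C(2)[OF \<open>b \<in> B\<close>, of "\<lambda>b. a m b - a n b"] .
        also have "(\<Sum>b\<in>B. (a m b - a n b) *\<^sub>R b) = x m - x n"
          by (simp add: a scaleR_diff_left sum_subtractf)
        also have "C * norm (x m - x n) < e"
          using M[OF that] C(1) by (simp add: dist_norm field_simps)
        finally show ?thesis by (simp add: dist_real_def)
      qed
      then show "\<exists>M. \<forall>m\<ge>M. \<forall>n\<ge>M. dist (a m b) (a n b) < e" by blast
    qed
    then have "\<forall>b\<in>B. \<exists>c. (\<lambda>n. a n b) \<longlonglongrightarrow> c"
      using real_Cauchy_convergent convergent_def by blast
    then obtain c where c: "\<And>b. b \<in> B \<Longrightarrow> (\<lambda>n. a n b) \<longlonglongrightarrow> c b" by metis
    have "x \<longlonglongrightarrow> (\<Sum>b\<in>B. c b *\<^sub>R b)"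
      unfolding a[abs_def] by (intro tendsto_sum tendsto_scaleR c tendsto_const)
    then have "l = (\<Sum>b\<in>B. c b *\<^sub>R b)" using l LIMSEQ_unique by blast
    then show "l \<in> span B" by (simp add: span_sum span_scale span_base)
  qed
  then have d: "infdist b0 (span B) > 0"
    using b0 by (metis empty_iff in_closed_iff_infdist_zero infdist_nonneg less_eq_real_def span_zero)
  define d where "d = infdist b0 (span B)"
  have d0: "d > 0" using d d_def by simp
  have key: "\<bar>a b0\<bar> * d \<le> norm (a b0 *\<^sub>R b0 + (\<Sum>b\<in>B. a b *\<^sub>R b))" for a
  proof (cases "a b0 = 0")
    case False
    let ?y = "- (\<Sum>b\<in>B. (a b / a b0) *\<^sub>R b)"
    have "?y \<in> span B" by (intro span_neg span_sum span_scale span_base)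
    then have "d \<le> norm (b0 - ?y)" unfolding d_def dist_norm[symmetric] by (rule infdist_le)
    then have "\<bar>a b0\<bar> * d \<le> \<bar>a b0\<bar> * norm (b0 - ?y)" by (simp add: mult_left_mono)
    also have "\<dots> = norm (a b0 *\<^sub>R (b0 - ?y))" by simp
    also have "a b0 *\<^sub>R (b0 - ?y) = a b0 *\<^sub>R b0 + (\<Sum>b\<in>B. a b *\<^sub>R b)"
      using False by (simp add: scaleR_add_right scaleR_sum_right)
    finally show ?thesis .
  qed auto
  define K where "K = max (1/d) (C * (1 + norm b0 / d))"
  have K: "K > 0" unfolding K_def using d0 by (simp add: less_max_iff_disj)
  moreover have "\<bar>a b\<bar> \<le> K * norm (\<Sum>b\<in>insert b0 B. a b *\<^sub>R b)" if "b \<in> insert b0 B" for a b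
  proof -
    let ?s = "norm (a b0 *\<^sub>R b0 + (\<Sum>b\<in>B. a b *\<^sub>R b))"
    have s: "(\<Sum>b\<in>insert b0 B. a b *\<^sub>R b) = a b0 *\<^sub>R b0 + (\<Sum>b\<in>B. a b *\<^sub>R b)"
      using insert.hyps by simp
    have a0: "\<bar>a b0\<bar> \<le> (1/d) * ?s" using key[of a] d0 by (simp add: field_simps)
    show ?thesis
    proof (cases "b = b0")
      case True
      have "(1/d) * ?s \<le> K * ?s" unfolding K_def by (intro mult_right_mono) auto
      then show ?thesis using a0 True s by simp
    next
      case False
      then have "b \<in> B" using that by simp
      then have "\<bar>a b\<bar> \<le> C * norm (\<Sum>b\<in>B. a b *\<^sub>R b)" by (rule C(2))
      also have "norm (\<Sum>b\<in>B. a b *\<^sub>R b) \<le> ?s + \<bar>a b0\<bar> * norm b0"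
        using norm_triangle_ineq4[of "a b0 *\<^sub>R b0 + (\<Sum>b\<in>B. a b *\<^sub>R b)" "a b0 *\<^sub>R b0"] by simp
      also have "\<dots> \<le> ?s + ((1/d) * ?s) * norm b0" using mult_right_mono[OF a0, of "norm b0"] by simp
      also have "\<dots> = (1 + norm b0 / d) * ?s" by (simp add: algebra_simps)
      finally have "\<bar>a b\<bar> \<le> C * ((1 + norm b0 / d) * ?s)" using C(1) by simp
      also have "\<dots> = (C * (1 + norm b0 / d)) * ?s" by simp
      also have "\<dots> \<le> K * ?s" unfolding K_def by (intro mult_right_mono) auto
      finally show ?thesis using s by simp
    qed
  qed
  ultimately show ?case by blast
qed

lemma finite_basis_exists:
  fixes S :: "'e::real_vector set"
  assumes "finite S" "span S = UNIV"
  obtains B :: "'e set" where "finite B" "independent B" "span B = UNIV"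
proof -
  obtain B where "B \<subseteq> S" "independent B" "S \<subseteq> span B"
    using maximal_independent_subset by blast
  moreover have "span S \<subseteq> span B" using \<open>S \<subseteq> span B\<close> span_minimal subspace_span by blast
  ultimately show ?thesis using that[of B] assms finite_subset by blast
qed

lemma bounded_linear_finite_dimensional:
  fixes g :: "'e::real_normed_vector \<Rightarrow> 'b::real_normed_vector"
  assumes fd: "\<exists>B :: 'e set. finite B \<and> span B = UNIV" and g: "linear g"
  shows "bounded_linear g"
proof -
  obtain B :: "'e set" where B: "finite B" "independent B" "span B = UNIV"
    using fd finite_basis_exists by metis
  obtain C where C: "C > 0" "\<And>a b. b \<in> B \<Longrightarrow> \<bar>a b\<bar> \<le> C * norm (\<Sum>b\<in>B. a b *\<^sub>R b)"
    using coordinates_bounded_by_norm[OF B(1,2)] by blast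
  have "norm (g v) \<le> norm v * (\<Sum>b\<in>B. C * norm (g b))" for v
  proof -
    have "v \<in> range (\<lambda>u. \<Sum>v\<in>B. u v *\<^sub>R v)" using B by (simp add: span_finite[symmetric])
    then obtain a where a: "v = (\<Sum>b\<in>B. a b *\<^sub>R b)" by blast
    have "norm (g v) = norm (\<Sum>b\<in>B. a b *\<^sub>R g b)"
      using g by (simp add: a linear_sum linear_cmul)
    also have "\<dots> \<le> (\<Sum>b\<in>B. \<bar>a b\<bar> * norm (g b))" by (rule sum_norm_le) simp
    also have "\<dots> \<le> (\<Sum>b\<in>B. (C * norm v) * norm (g b))"
      using C(2)[of _ a] a by (intro sum_mono mult_right_mono) auto
    also have "\<dots> = norm v * (\<Sum>b\<in>B. C * norm (g b))"
      by (simp add: sum_distrib_left mult_ac)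
    finally show ?thesis .
  qed
  then show ?thesis using g
    by (intro bounded_linear_intro[of g]) (auto simp: linear_add linear_cmul)
qed

lemma compact_cball_finite_dimensional:
  assumes fd: "\<exists>B :: 'e::real_normed_vector set. finite B \<and> span B = UNIV"
  shows "compact (cball (0::'e::real_normed_vector) R)"
proof -
  obtain B :: "'e set" where B: "finite B" "independent B" "span B = UNIV"
    using fd finite_basis_exists by metis
  obtain C where C: "C > 0" "\<And>a b. b \<in> B \<Longrightarrow> \<bar>a b\<bar> \<le> C * norm (\<Sum>b\<in>B. a b *\<^sub>R b)"
    using coordinates_bounded_by_norm[OF B(1,2)] by blast
  let ?X = "\<lambda>B. {\<Sum>b\<in>B. a b *\<^sub>R b | a. \<forall>b\<in>B. \<bar>a b\<bar> \<le> C * R}"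
  have cX: "compact (?X B)" using B(1)
  proof (induction B rule: finite_induct)
    case (insert b B)
    have "compact ((\<lambda>t. t *\<^sub>R b) ` cball (0::real) (C * R))"
      by (intro compact_continuous_image continuous_intros compact_cball)
    from compact_sums'[OF this insert.IH]
    have c: "compact (\<Union>x\<in>(\<lambda>t. t *\<^sub>R b) ` cball (0::real) (C * R). \<Union>y\<in>?X B. {x + y})" .
    have "?X (insert b B) = (\<Union>x\<in>(\<lambda>t. t *\<^sub>R b) ` cball (0::real) (C * R). \<Union>y\<in>?X B. {x + y})" (is "?l = ?r")
    proof
      show "?l \<subseteq> ?r" using insert.hyps by (fastforce simp: dist_real_def)
      show "?r \<subseteq> ?l"
      proof
        fix z assume "z \<in> ?r"
        then obtain t a where z: "\<bar>t\<bar> \<le> C * R" "\<forall>b\<in>B. \<bar>a b\<bar> \<le> C * R" "z = t *\<^sub>R b + (\<Sum>b\<in>B. a b *\<^sub>R b)"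
          by (auto simp: dist_real_def)
        have "(\<Sum>b'\<in>B. (a(b := t)) b' *\<^sub>R b') = (\<Sum>b\<in>B. a b *\<^sub>R b)"
          by (rule sum.cong) (use insert.hyps in auto)
        then have "z = (\<Sum>b'\<in>insert b B. (a(b := t)) b' *\<^sub>R b')" using z(3) insert.hyps by simp
        moreover have "\<forall>b'\<in>insert b B. \<bar>(a(b := t)) b'\<bar> \<le> C * R" using z by auto
        ultimately show "z \<in> ?l" by blast
      qed
    qed
    then show ?case using c by simp
  qed auto
  have "cball 0 R \<subseteq> ?X B"
  proof
    fix v :: 'e assume v: "v \<in> cball 0 R"
    have "v \<in> range (\<lambda>u. \<Sum>v\<in>B. u v *\<^sub>R v)" using B by (simp add: span_finite[symmetric])
    then obtain a where a: "v = (\<Sum>b\<in>B. a b *\<^sub>R b)" by blast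
    have "C * norm v \<le> C * R" using v C(1) by simp
    then have "\<forall>b\<in>B. \<bar>a b\<bar> \<le> C * R"
      using C(2)[of _ a] a by fastforce
    then show "v \<in> ?X B" using a by blast
  qed
  then have eq: "cball 0 R \<inter> ?X B = cball 0 R" by (rule Int_absorb2)
  have "compact (cball 0 R \<inter> ?X B)" by (rule closed_Int_compact[OF closed_cball cX])
  then show ?thesis unfolding eq .
qed

lemma countable_dense_finite_dimensional:
  assumes fd: "\<exists>B :: 'e::real_normed_vector set. finite B \<and> span B = UNIV"
  obtains D :: "'e::real_normed_vector set" where "countable D" "\<And>x e. e > 0 \<Longrightarrow> \<exists>d\<in>D. dist d x < e"
proof -
  obtain B :: "'e set" where B: "finite B" "span B = UNIV" using fd by auto
  have "\<exists>D. countable D \<and> (\<forall>x\<in>span B. \<forall>e>0. \<exists>d\<in>D. dist d x < e)" using B(1)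
  proof (induction B rule: finite_induct)
    case empty
    show ?case by (intro exI[of _ "{0}"]) auto
  next
    case (insert b B)
    then obtain D where D: "countable D" "\<And>x e. x \<in> span B \<Longrightarrow> e > 0 \<Longrightarrow> \<exists>d\<in>D. dist d x < e" by blast
    let ?D = "(\<lambda>(q, y). q *\<^sub>R b + y) ` (\<rat> \<times> D)"
    have "\<exists>d\<in>?D. dist d x < e" if x: "x \<in> span (insert b B)" and e: "e > 0" for x e
    proof -
      obtain k where k: "x - k *\<^sub>R b \<in> span B" using x by (auto simp: span_breakdown_eq)
      obtain y where y: "y \<in> D" "dist y (x - k *\<^sub>R b) < e/2" using D(2)[OF k, of "e/2"] e by auto
      have "0 < e / (2 * (norm b + 1))" using e by (intro divide_pos_pos) (auto simp: add_nonneg_pos)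
      then obtain q where q: "q \<in> \<rat>" "k < q" "q < k + e / (2 * (norm b + 1))"
        using Rats_dense_in_real[of k "k + e / (2 * (norm b + 1))"] by auto
      have "norm ((q - k) *\<^sub>R b) \<le> (e / (2 * (norm b + 1))) * norm b"
        unfolding norm_scaleR by (rule mult_right_mono) (use q in auto)
      also have "\<dots> \<le> e/2"
        using e by (simp add: field_simps add_pos_nonneg add_nonneg_pos)
      finally have "norm ((q - k) *\<^sub>R b) \<le> e/2" .
      moreover have "(q *\<^sub>R b + y) - x = (q - k) *\<^sub>R b + (y - (x - k *\<^sub>R b))"
        by (simp add: algebra_simps)
      ultimately have "dist (q *\<^sub>R b + y) x < e"
        using y(2) unfolding dist_norm by (smt (verit) norm_triangle_ineq field_sum_of_halves)
      then show ?thesis using q(1) y(1) by force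
    qed
    moreover have "countable ?D" using D(1) countable_rat by (intro countable_image countable_SIGMA) auto
    ultimately show ?case by blast
  qed
  then show ?thesis using that B(2) by auto
qed

text \<open>A countable dense set of controls writes an open subset of the product as a countable union
  of rectangles, whose preimages are measurable.\<close>

lemma measurable_continuous_pair:
  fixes u :: "real \<Rightarrow> 'e::real_normed_vector" and G :: "'a::topological_space \<times> 'e \<Rightarrow> 'c::topological_space"
  assumes fd: "\<exists>B :: 'e set. finite B \<and> span B = UNIV"
    and G: "continuous_on UNIV G" and g: "continuous_on I g" and I: "I \<in> sets lebesgue"
    and u: "u \<in> borel_measurable (lebesgue_on I)"
  shows "(\<lambda>t. G (g t, u t)) \<in> borel_measurable (lebesgue_on I)"
proof (rule borel_measurableI)
  fix S :: "'c set" assume "open S"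
  obtain D :: "'e set" where D: "countable D" "\<And>x e. e > 0 \<Longrightarrow> \<exists>d\<in>D. dist d x < e"
    using countable_dense_finite_dimensional[OF fd] by auto
  define V where "V = G -` S"
  have V: "open V" unfolding V_def using G \<open>open S\<close> by (simp add: continuous_on_open_vimage)
  define W where "W d j = \<Union>{Y. open Y \<and> Y \<times> ball d (1 / real (Suc j)) \<subseteq> V}" for d j
  have Wo: "open (W d j)" for d j unfolding W_def by blast
  have "V \<subseteq> (\<Union>d\<in>D. \<Union>j. W d j \<times> ball d (1 / real (Suc j)))"
  proof
    fix z assume "z \<in> V"
    obtain p v where z: "z = (p, v)" by force
    obtain Y Z where YZ: "open Y" "open Z" "p \<in> Y" "v \<in> Z" "Y \<times> Z \<subseteq> V"
      using open_prod_elim[OF V \<open>z \<in> V\<close>] z by (metis mem_Sigma_iff)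
    obtain r where r: "r > 0" "ball v r \<subseteq> Z" using YZ open_contains_ball by blast
    obtain j where j: "1 / real (Suc j) < r/2" using r(1) nat_approx_posE[of "r/2"] by auto
    obtain d where d: "d \<in> D" "dist d v < 1 / real (Suc j)" using D(2)[of "1 / real (Suc j)" v] by auto
    have "ball d (1 / real (Suc j)) \<subseteq> Z"
    proof
      fix w assume "w \<in> ball d (1 / real (Suc j))"
      then have "dist v w < r" using d j dist_triangle[of v w d] by (auto simp: dist_commute)
      then show "w \<in> Z" using r by auto
    qed
    then have "p \<in> W d j" unfolding W_def using YZ by blast
    then show "z \<in> (\<Union>d\<in>D. \<Union>j. W d j \<times> ball d (1 / real (Suc j)))" using z d by auto
  qed
  moreover have "(\<Union>d\<in>D. \<Union>j. W d j \<times> ball d (1 / real (Suc j))) \<subseteq> V" unfolding W_def by blast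
  ultimately have "V = (\<Union>d\<in>D. \<Union>j. W d j \<times> ball d (1 / real (Suc j)))" by blast
  then have "(\<lambda>t. G (g t, u t)) -` S \<inter> space (lebesgue_on I) =
     (\<Union>d\<in>D. \<Union>j. {t \<in> I. g t \<in> W d j} \<inter> (u -` ball d (1 / real (Suc j)) \<inter> space (lebesgue_on I)))"
    (is "?l = ?r")
  proof -
    assume V_eq: "V = (\<Union>d\<in>D. \<Union>j. W d j \<times> ball d (1 / real (Suc j)))"
    have "t \<in> ?l \<longleftrightarrow> t \<in> I \<and> (g t, u t) \<in> V" for t unfolding V_def by auto
    moreover have "t \<in> ?r \<longleftrightarrow> t \<in> I \<and> (g t, u t) \<in> (\<Union>d\<in>D. \<Union>j. W d j \<times> ball d (1 / real (Suc j)))" for t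
      by auto
    ultimately show ?thesis using V_eq by blast
  qed
  moreover have "{t \<in> I. g t \<in> W d j} \<in> sets (lebesgue_on I)" for d j
  proof -
    obtain T where "open T" "T \<inter> I = g -` W d j \<inter> I"
      using g Wo by (metis continuous_on_open_invariant)
    then have "{t \<in> I. g t \<in> W d j} = T \<inter> I" by blast
    then show ?thesis using \<open>open T\<close> I by (auto simp: sets_restrict_space_iff lebesgue_openin)
  qed
  moreover have "u -` ball d (1 / real (Suc j)) \<inter> space (lebesgue_on I) \<in> sets (lebesgue_on I)" for d j
    using u by (rule measurable_sets) simp
  ultimately show "(\<lambda>t. G (g t, u t)) -` S \<inter> space (lebesgue_on I) \<in> sets (lebesgue_on I)"
    using D(1) by (auto intro!: sets.countable_UN'')
qed

section \<open>Absolutely continuous functions and almost everywhere derivatives\<close>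

text \<open>A fine tagged division is split by its tags. Where the tag is a point of differentiability,
  the linear approximation controls the error. The intervals with tags in the null set lie in an open set of small
  measure, so that absolute continuity makes the sum of the increments over them small.\<close>

lemma absolutely_continuous_has_integral:
  fixes g :: "real \<Rightarrow> 'b::euclidean_space"
  assumes ab: "a \<le> b" and ac: "abs_continuous_on_interval a b g" and E: "negligible E"
    and der: "\<And>x. x \<in> {a..b} - E \<Longrightarrow> (g has_vector_derivative g' x) (at x within {a..b})"
  shows "(g' has_integral (g b - g a)) {a..b}"
proof -
  define h where "h x = (if x \<in> E then 0 else g' x)" for x
  have "(h has_integral (g b - g a)) (cbox a b)"
    unfolding has_integral
  proof (intro allI impI)
    fix e :: real assume "e > 0"
    define e1 where "e1 = e / (2 * (b - a + 1))"
    have e1: "e1 > 0" and e1': "e1 * (b - a) < e / 2"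
      unfolding e1_def using \<open>e > 0\<close> ab by (auto simp: field_simps)
    have "\<exists>\<delta>>0. \<forall>D :: (real \<times> real) set. finite D \<and> (\<forall>(x, y)\<in>D. a \<le> x \<and> x \<le> y \<and> y \<le> b) \<and>
        pairwise (\<lambda>I J. disjnt {fst I<..<snd I} {fst J<..<snd J}) D \<and>
        (\<Sum>(x, y)\<in>D. y - x) < \<delta> \<longrightarrow> (\<Sum>(x, y)\<in>D. dist (g x) (g y)) < e / 2"
      by (rule ac[unfolded abs_continuous_on_interval_def, THEN spec, THEN mp, OF half_gt_zero[OF \<open>e > 0\<close>]])
    then obtain \<delta> where \<delta>: "\<delta> > 0" and ac0: "\<forall>D :: (real \<times> real) set. finite D \<and> (\<forall>(x, y)\<in>D. a \<le> x \<and> x \<le> y \<and> y \<le> b) \<and>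
        pairwise (\<lambda>I J. disjnt {fst I<..<snd I} {fst J<..<snd J}) D \<and>
        (\<Sum>(x, y)\<in>D. y - x) < \<delta> \<longrightarrow> (\<Sum>(x, y)\<in>D. dist (g x) (g y)) < e / 2"
      by (elim exE conjE)
    have "E \<in> sets lebesgue" using E by (simp add: negligible_iff_null_sets null_setsD2)
    then obtain U where U: "open U" "E \<subseteq> U" "U - E \<in> lmeasurable" "emeasure lebesgue (U - E) < ennreal \<delta>"
      using sets_lebesgue_outer_open[OF _ \<delta>] by metis
    have Um: "U \<in> lmeasurable" and Ulm: "measure lebesgue U < \<delta>"
    proof -
      have UE: "U = (U - E) \<union> E" using U(2) by blast
      have El: "E \<in> lmeasurable" "measure lebesgue E = 0" using E by (auto simp: negligible_iff_measure)
      show Um: "U \<in> lmeasurable" using U(3) El UE by (metis fmeasurable.Un)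
      have "measure lebesgue U \<le> measure lebesgue (U - E) + measure lebesgue E"
        using UE U(3) El by (metis measure_Un_le fmeasurableD)
      then show "measure lebesgue U < \<delta>"
        using El U(3,4) \<delta> by (simp add: emeasure_eq_measure2 ennreal_less_iff)
    qed
    have "\<exists>d>0. (x \<in> E \<longrightarrow> ball x d \<subseteq> U) \<and> (x \<in> {a..b} - E \<longrightarrow>
         (\<forall>y\<in>{a..b}. norm (y-x) < d \<longrightarrow> norm (g y - g x - (y-x) *\<^sub>R g' x) \<le> e1 * norm (y-x)))" for x
    proof (cases "x \<in> E")
      case True
      then show ?thesis using U(1,2) open_contains_ball by blast
    next
      case False
      then show ?thesis
        using der[of x, unfolded has_vector_derivative_def has_derivative_within_alt] e1
        by (cases "x \<in> {a..b}") (auto intro: exI[of _ 1])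
    qed
    then obtain d where d0: "\<And>x. d x > 0" and dE: "\<And>x. x \<in> E \<Longrightarrow> ball x (d x) \<subseteq> U"
      and dd: "\<And>x y. x \<in> {a..b} \<Longrightarrow> x \<notin> E \<Longrightarrow> y \<in> {a..b} \<Longrightarrow> norm (y-x) < d x \<Longrightarrow>
          norm (g y - g x - (y-x) *\<^sub>R g' x) \<le> e1 * norm (y-x)"
      by (metis DiffI)
    show "\<exists>\<gamma>. gauge \<gamma> \<and> (\<forall>\<D>. \<D> tagged_division_of cbox a b \<and> \<gamma> fine \<D> \<longrightarrow>
            norm ((\<Sum>(x, k)\<in>\<D>. measure lborel k *\<^sub>R h x) - (g b - g a)) < e)"
    proof (rule exI, safe)
      show "gauge (\<lambda>x. ball x (d x))" using d0 gauge_ball_dependent by blast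
    next
      fix p assume ptag: "p tagged_division_of cbox a b" and fine: "(\<lambda>x. ball x (d x)) fine p"
      have finp: "finite p" using ptag by blast
      have K: "\<exists>u v. K = {u..v} \<and> u \<le> x \<and> x \<le> v \<and> a \<le> u \<and> v \<le> b \<and> u \<le> v \<and> K \<subseteq> ball x (d x)"
        if xKp: "(x, K) \<in> p" for x K
      proof -
        have "x \<in> K" "K \<subseteq> cbox a b" by (rule tagged_division_ofD(2,3)[OF ptag xKp])+
        moreover obtain u v where "K = cbox u v" using tagged_division_ofD(4)[OF ptag xKp] by auto
        moreover have "K \<subseteq> ball x (d x)" by (rule fineD[OF fine xKp])
        ultimately show ?thesis by auto
      qed
      have ga: "g b - g a = (\<Sum>(x,K)\<in>p. g (Sup K) - g (Inf K))" and ba: "b - a = (\<Sum>(x,K)\<in>p. Sup K - Inf K)"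
        using additive_tagged_division_1[OF ab, of p g] additive_tagged_division_1[OF ab, of p "\<lambda>x. x"] ptag by auto
      let ?G = "\<lambda>(x,K). norm (measure lborel K *\<^sub>R h x - (g (Sup K) - g (Inf K)))"
      let ?pE = "{z \<in> p. fst z \<in> E}"
      let ?pN = "{z \<in> p. fst z \<notin> E}"
      have "norm ((\<Sum>(x, k)\<in>p. measure lborel k *\<^sub>R h x) - (g b - g a))
          = norm (\<Sum>(x,K)\<in>p. measure lborel K *\<^sub>R h x - (g (Sup K) - g (Inf K)))"
        by (simp add: ga sum_subtractf[symmetric] split_def)
      also have "\<dots> \<le> (\<Sum>z\<in>p. ?G z)" by (rule sum_norm_le) auto
      also have "\<dots> = (\<Sum>z\<in>?pN. ?G z) + (\<Sum>z\<in>?pE. ?G z)"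
        using finp by (subst sum.union_disjoint[symmetric]) (auto intro: sum.cong)
      also have "(\<Sum>z\<in>?pN. ?G z) \<le> (\<Sum>(x,K)\<in>?pN. e1 * (Sup K - Inf K))"
      proof (rule sum_mono, clarsimp)
        fix x K assume xK: "(x, K) \<in> p" and xE: "x \<notin> E"
        obtain u v where uv: "K = {u..v}" "u \<le> x" "x \<le> v" "a \<le> u" "v \<le> b" "u \<le> v" "K \<subseteq> ball x (d x)"
          using K[OF xK] by blast
        have "u \<in> K" "v \<in> K" using uv by auto
        then have "u \<in> ball x (d x)" "v \<in> ball x (d x)" using uv(7) by blast+
        then have 1: "norm (g u - g x - (u-x) *\<^sub>R g' x) \<le> e1 * norm (u-x)"
          and 2: "norm (g v - g x - (v-x) *\<^sub>R g' x) \<le> e1 * norm (v-x)"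
          using uv xE dd[of x u] dd[of x v] by (simp_all add: dist_real_def)
        have "(v - u) *\<^sub>R g' x - (g v - g u) = (g u - g x - (u - x) *\<^sub>R g' x) - (g v - g x - (v - x) *\<^sub>R g' x)"
          by (auto simp: algebra_simps)
        then have "norm ((v - u) *\<^sub>R g' x - (g v - g u)) \<le> norm (g u - g x - (u-x) *\<^sub>R g' x) + norm (g v - g x - (v-x) *\<^sub>R g' x)"
          by (metis norm_triangle_ineq4)
        also have "\<dots> \<le> e1 * norm (u-x) + e1 * norm (v-x)" using 1 2 by (rule add_mono)
        also have "\<dots> = e1 * (v - u)" using uv by (simp add: algebra_simps)
        finally show "norm (measure lborel K *\<^sub>R h x - (g (Sup K) - g (Inf K))) \<le> e1 * (Sup K - Inf K)"
          using uv xE by (simp add: h_def)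
      qed
      also have "(\<Sum>(x,K)\<in>?pN. e1 * (Sup K - Inf K)) \<le> (\<Sum>(x,K)\<in>p. e1 * (Sup K - Inf K))"
      proof (rule sum_mono2[OF finp])
        fix z assume z: "z \<in> p - ?pN"
        obtain x k where xk: "z = (x, k)" by force
        then obtain u v where "k = {u..v}" "u \<le> v" using K[of x k] z by blast
        then show "0 \<le> (case z of (x, k) \<Rightarrow> e1 * (Sup k - Inf k))" using xk e1 by simp
      qed auto
      also have "\<dots> = e1 * (b - a)" unfolding ba by (simp add: sum_distrib_left split_def)
      also have "(\<Sum>z\<in>?pE. ?G z) < e / 2"
      proof -
        let ?i = "\<lambda>(x::real, K::real set). (Inf K, Sup K)"
        have inj: "inj_on ?i ?pE"
        proof (rule inj_onI, clarsimp)
          fix x K y L assume A: "(x, K) \<in> p" "(y, L) \<in> p" "Inf K = Inf L" "Sup K = Sup L"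
          obtain u v where uv: "K = {u..v}" "u \<le> x" "x \<le> v" "u \<le> v" using K[OF A(1)] by blast
          obtain u' v' where uv': "L = {u'..v'}" "u' \<le> y" "y \<le> v'" "u' \<le> v'" using K[OF A(2)] by blast
          have KL: "K = L" using A uv uv' by simp
          moreover have "x = y"
          proof (rule ccontr)
            assume "x \<noteq> y"
            then have "interior K \<inter> interior L = {}" using tagged_division_ofD(5)[OF ptag A(1,2)] by auto
            then show False using KL uv uv' \<open>x \<noteq> y\<close> by (simp add: interior_atLeastAtMost_real)
          qed
          ultimately show "x = y \<and> K = L" by simp
        qed
        have "(\<Sum>z\<in>?pE. ?G z) = (\<Sum>(x,K)\<in>?pE. dist (g (Inf K)) (g (Sup K)))"
          by (rule sum.cong) (auto simp: h_def dist_norm norm_minus_commute)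
        also have "\<dots> = (\<Sum>(x, y)\<in>?i ` ?pE. dist (g x) (g y))"
          by (subst sum.reindex[OF inj]) (simp add: split_def o_def)
        also have "\<dots> < e / 2"
        proof (rule ac0[THEN spec, THEN mp], intro conjI)
          show "finite (?i ` ?pE)" using finp by simp
          show "\<forall>(x, y)\<in>?i ` ?pE. a \<le> x \<and> x \<le> y \<and> y \<le> b" using K by fastforce
          show "pairwise (\<lambda>I J. disjnt {fst I<..<snd I} {fst J<..<snd J}) (?i ` ?pE)"
          proof (clarsimp simp: pairwise_def)
            fix x K y L assume A: "(x, K) \<in> p" "(y, L) \<in> p" and ne: "Inf K = Inf L \<longrightarrow> Sup K \<noteq> Sup L"
            obtain u v where uv: "K = {u..v}" "u \<le> v" using K[OF A(1)] by blast
            obtain u' v' where uv': "L = {u'..v'}" "u' \<le> v'" using K[OF A(2)] by blast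
            have "K \<noteq> L" using ne by auto
            then have "interior K \<inter> interior L = {}" using tagged_division_ofD(5)[OF ptag A(1,2)] by auto
            then show "disjnt {Inf K<..<Sup K} {Inf L<..<Sup L}"
              using uv uv' by (simp add: disjnt_def interior_atLeastAtMost_real)
          qed
          have "(\<Sum>(x, y)\<in>?i ` ?pE. y - x) = (\<Sum>(x,K)\<in>?pE. Sup K - Inf K)"
            by (subst sum.reindex[OF inj]) (simp add: split_def o_def)
          also have "\<dots> = (\<Sum>(x,K)\<in>?pE. measure lebesgue K)"
            by (rule sum.cong) (use K in fastforce)+
          also have "\<dots> = (\<Sum>K\<in>snd ` ?pE. measure lebesgue K)"
          proof -
            have "inj_on snd ?pE"
              using inj by (auto simp: inj_on_def)
            then show ?thesis by (simp add: sum.reindex split_def)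
          qed
          also have "\<dots> = measure lebesgue (\<Union>(snd ` ?pE))"
          proof (rule content_division)
            have "?pE tagged_partial_division_of cbox a b"
              using ptag unfolding tagged_division_of_def
              by (elim conjE) (erule tagged_partial_division_subset, auto)
            then show "snd ` ?pE division_of \<Union>(snd ` ?pE)"
              by (rule partial_division_of_tagged_division)
          qed
          also have "\<dots> \<le> measure lebesgue U"
          proof (rule measure_mono_fmeasurable[OF _ _ Um])
            show "\<Union>(snd ` ?pE) \<subseteq> U" using K dE by fastforce
            have "\<Union>(snd ` ?pE) \<in> lmeasurable"
              using finp K by (intro fmeasurable.finite_Union) fastforce+
            then show "\<Union>(snd ` ?pE) \<in> sets lebesgue" by blast
          qed
          finally show "(\<Sum>(x, y)\<in>?i ` ?pE. y - x) < \<delta>" using Ulm by simp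
        qed
        finally show ?thesis .
      qed
      finally show "norm ((\<Sum>(x, k)\<in>p. measure lborel k *\<^sub>R h x) - (g b - g a)) < e"
        using e1' by simp
    qed
  qed
  then have "(h has_integral (g b - g a)) {a..b}" by simp
  then show ?thesis
    by (rule has_integral_spike[OF E, rotated]) (auto simp: h_def)
qed

text \<open>Consider the points at which the difference quotients keep deviating by more than a fixed
  amount. By Vitali's theorem they are covered, up to a null set, by disjoint intervals with such a deviation, and
  Henstock's lemma bounds the total length of these intervals.\<close>

lemma indefinite_integral_has_derivative_ae:
  fixes f :: "real \<Rightarrow> 'b::euclidean_space"
  assumes ab: "a \<le> b" and f: "f integrable_on {a..b}"
  obtains E where "negligible E"
    "\<And>x. x \<in> {a..b} - E \<Longrightarrow> ((\<lambda>t. integral {a..t} f) has_vector_derivative f x) (at x within {a..b})"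
proof -
  define F where "F t = integral {a..t} f" for t
  define v where "v x y = norm (F y - F x - (y - x) *\<^sub>R f x)" for x y
  define E where "E n = {x \<in> {a..b}. \<forall>\<delta>>0. \<exists>y\<in>{a..b}. y \<noteq> x \<and> \<bar>y - x\<bar> < \<delta> \<and> \<bar>y - x\<bar> / real (Suc n) < v x y}" for n
  have FK: "integral {min x y..max x y} f = (if x \<le> y then F y - F x else F x - F y)"
    if "x \<in> {a..b}" "y \<in> {a..b}" for x y
  proof -
    have *: "integral {x..y} f = F y - F x" if "a \<le> x" "x \<le> y" "y \<le> b" for x y
    proof -
      have "f integrable_on {a..y}" by (rule integrable_on_subinterval[OF f]) (use that in auto)
      then have "integral {a..x} f + integral {x..y} f = integral {a..y} f"
        using that by (intro Henstock_Kurzweil_Integration.integral_combine) auto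
      then show ?thesis by (simp add: F_def algebra_simps)
    qed
    show ?thesis using that *[of x y] *[of y x] by (simp add: min_def max_def)
  qed
  have negE: "negligible (E n)" for n
    unfolding negligible_outer_le
  proof (intro allI impI)
    fix e :: real assume "e > 0"
    have e': "e / real (Suc n) > 0" using \<open>e > 0\<close> by simp
    have fi: "f integrable_on cbox a b" using f by simp
    obtain \<gamma> where \<gamma>: "gauge \<gamma>" and hen: "\<And>p. p tagged_partial_division_of cbox a b \<Longrightarrow> \<gamma> fine p \<Longrightarrow>
        (\<Sum>(x, k)\<in>p. norm (measure lborel k *\<^sub>R f x - integral k f)) < e / real (Suc n)"
      by (rule Henstock_lemma[OF fi e']) (use that in blast)
    define K where "K = {(x, y). x \<in> E n \<and> y \<in> {a..b} \<and> y \<noteq> x \<and> closed_segment x y \<subseteq> \<gamma> x \<and> \<bar>y - x\<bar> / real (Suc n) < v x y}"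
    define c where "c = (\<lambda>(x::real, y). (x + y) / 2)"
    define r where "r = (\<lambda>(x::real, y). \<bar>y - x\<bar> / 2)"
    have cb: "cball (c i) (r i) = {min (fst i) (snd i)..max (fst i) (snd i)}" for i
      by (auto simp: c_def r_def split_def dist_real_def min_def max_def abs_if field_simps split: if_splits)
    obtain C where C: "countable C" "C \<subseteq> K"
        "pairwise (\<lambda>i j. disjnt (cball (c i) (r i)) (cball (c j) (r j))) C"
        "negligible (E n - (\<Union>i\<in>C. cball (c i) (r i)))"
    proof (rule Vitali_covering_theorem_cballs[of K r "E n" c])
      show "0 < r i" if "i \<in> K" for i using that by (auto simp: K_def r_def)
      show "\<exists>i. i \<in> K \<and> x \<in> cball (c i) (r i) \<and> r i < d" if x: "x \<in> E n" and d: "0 < d" for x d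
      proof -
        obtain s where s: "s > 0" "ball x s \<subseteq> \<gamma> x"
          using \<gamma> unfolding gauge_def by (metis open_contains_ball)
        have "min s d > 0" using s d by simp
        then obtain y where y: "y \<in> {a..b}" "y \<noteq> x" "\<bar>y - x\<bar> < min s d" "\<bar>y - x\<bar> / real (Suc n) < v x y"
          using x unfolding E_def by blast
        have "closed_segment x y \<subseteq> ball x s"
          using y s(1) by (intro closed_segment_subset) (auto simp: dist_real_def)
        then have "(x, y) \<in> K" using x y s unfolding K_def by blast
        moreover have "x \<in> cball (c (x, y)) (r (x, y))" unfolding cb by auto
        moreover have "r (x, y) < d" using y d by (simp add: r_def)
        ultimately show ?thesis by blast
      qed
    qed (use that in auto)
    have fin: "measure lebesgue (\<Union>i\<in>D. cball (c i) (r i)) \<le> e" if D: "D \<subseteq> C" "finite D" for D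
    proof -
      let ?p = "(\<lambda>(x, y). (x, {min x y..max x y})) ` D"
      have DK: "x \<in> {a..b} \<and> y \<in> {a..b} \<and> y \<noteq> x \<and> closed_segment x y \<subseteq> \<gamma> x \<and> \<bar>y - x\<bar> / real (Suc n) < v x y"
        if "(x, y) \<in> D" for x y using that D C(2) unfolding K_def E_def by auto
      have inj: "inj_on (\<lambda>(x::real, y). (x, {min x y..max x y})) D"
        by (rule inj_onI) (auto simp: min_def max_def split: if_splits)
      have "?p tagged_partial_division_of cbox a b"
        unfolding tagged_partial_division_of_def
      proof (intro conjI allI impI)
        show "finite ?p" using D by simp
        fix x k assume xk: "(x, k) \<in> ?p"
        then obtain y where y: "(x, y) \<in> D" "k = {min x y..max x y}" by auto
        show "x \<in> k" "k \<subseteq> cbox a b" using y DK[OF y(1)] by auto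
        show "\<exists>a b. k = cbox a b" using y by (metis box_real(2))
      next
        fix x1 K1 x2 K2 assume A: "(x1, K1) \<in> ?p \<and> (x2, K2) \<in> ?p \<and> (x1, K1) \<noteq> (x2, K2)"
        then obtain y1 y2 where y: "(x1, y1) \<in> D" "K1 = {min x1 y1..max x1 y1}" "(x2, y2) \<in> D" "K2 = {min x2 y2..max x2 y2}"
          by auto
        then have "(x1, y1) \<noteq> (x2, y2)" using A by auto
        then have "disjnt (cball (c (x1, y1)) (r (x1, y1))) (cball (c (x2, y2)) (r (x2, y2)))"
          using C(3) y D(1) unfolding pairwise_def by blast
        then have "K1 \<inter> K2 = {}" unfolding cb using y by (simp add: disjnt_def)
        then show "interior K1 \<inter> interior K2 = {}" using interior_subset by blast
      qed
      moreover have "\<gamma> fine ?p"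
      proof (rule fineI)
        fix x k assume "(x, k) \<in> ?p"
        then obtain y where y: "(x, y) \<in> D" "k = {min x y..max x y}" by auto
        then have "k = closed_segment x y" by (auto simp: closed_segment_eq_real_ivl)
        then show "k \<subseteq> \<gamma> x" using DK[OF y(1)] by auto
      qed
      ultimately have h: "(\<Sum>(x, k)\<in>?p. norm (measure lborel k *\<^sub>R f x - integral k f)) < e / real (Suc n)"
        by (rule hen)
      have "measure lebesgue (\<Union>i\<in>D. cball (c i) (r i)) \<le> (\<Sum>i\<in>D. measure lebesgue (cball (c i) (r i)))"
        using D by (intro measure_UNION_le) auto
      also have "\<dots> = (\<Sum>(x, y)\<in>D. \<bar>y - x\<bar>)"
        by (rule sum.cong) (auto simp: cb min_def max_def)
      also have "\<dots> \<le> (\<Sum>(x, y)\<in>D. real (Suc n) * v x y)"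
        by (rule sum_mono) (use DK in \<open>fastforce simp: field_simps\<close>)
      also have "\<dots> = real (Suc n) * (\<Sum>(x, y)\<in>D. v x y)"
        by (simp add: sum_distrib_left split_def)
      also have "(\<Sum>(x, y)\<in>D. v x y) = (\<Sum>(x, k)\<in>?p. norm (measure lborel k *\<^sub>R f x - integral k f))"
      proof -
        have "v x y = norm (measure lborel {min x y..max x y} *\<^sub>R f x - integral {min x y..max x y} f)"
          if "(x, y) \<in> D" for x y
        proof (cases "x \<le> y")
          case True
          then show ?thesis unfolding FK[of x y, OF DK[OF that, THEN conjunct1] DK[OF that, THEN conjunct2, THEN conjunct1]] v_def
            by (simp add: norm_minus_commute)
        next
          case False
          then have *: "measure lborel {min x y..max x y} = x - y" by simp
          have eq: "F y - F x - (y - x) *\<^sub>R f x = (x - y) *\<^sub>R f x - (F x - F y)" by (simp add: algebra_simps)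
          then show ?thesis unfolding * FK[of x y, OF DK[OF that, THEN conjunct1] DK[OF that, THEN conjunct2, THEN conjunct1]] v_def eq
            using False by simp
        qed
        then show ?thesis by (subst sum.reindex[OF inj]) (auto intro!: sum.cong)
      qed
      also have "real (Suc n) * \<dots> \<le> e" using h by (simp add: field_simps)
      finally show ?thesis by simp
    qed
    let ?T = "(E n - (\<Union>i\<in>C. cball (c i) (r i))) \<union> (\<Union>i\<in>C. cball (c i) (r i))"
    have U: "(\<Union>i\<in>C. cball (c i) (r i)) \<in> lmeasurable" "measure lebesgue (\<Union>i\<in>C. cball (c i) (r i)) \<le> e"
      using fmeasurable_UN_bound[OF C(1), of "\<lambda>i. cball (c i) (r i)" lebesgue e]
        measure_UN_bound[OF C(1), of "\<lambda>i. cball (c i) (r i)" lebesgue e] fin by auto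
    have N: "E n - (\<Union>i\<in>C. cball (c i) (r i)) \<in> lmeasurable" "measure lebesgue (E n - (\<Union>i\<in>C. cball (c i) (r i))) = 0"
      using C(4) by (auto simp: negligible_iff_measure)
    have "measure lebesgue ?T \<le> measure lebesgue (E n - (\<Union>i\<in>C. cball (c i) (r i))) + measure lebesgue (\<Union>i\<in>C. cball (c i) (r i))"
      by (rule measure_Un_le) (use U N in auto)
    then have "measure lebesgue ?T \<le> e" using U N by simp
    moreover have "?T \<in> lmeasurable" using U N by (intro fmeasurable.Un)
    moreover have "E n \<subseteq> ?T" by blast
    ultimately show "\<exists>T. E n \<subseteq> T \<and> T \<in> lmeasurable \<and> measure lebesgue T \<le> e" by blast
  qed
  have "(F has_vector_derivative f x) (at x within {a..b})" if x: "x \<in> {a..b} - (\<Union>n. E n)" for x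
    unfolding has_vector_derivative_def has_derivative_within_alt
  proof (intro conjI allI impI)
    show "bounded_linear (\<lambda>h. h *\<^sub>R f x)" by (rule bounded_linear_scaleR_left)
    fix e :: real assume "e > 0"
    obtain n where n: "1 / real (Suc n) < e" using nat_approx_posE[OF \<open>e > 0\<close>] by blast
    have "x \<notin> E n" using x by blast
    then obtain \<delta> where \<delta>: "\<delta> > 0" and dv: "\<And>y. y \<in> {a..b} \<Longrightarrow> y \<noteq> x \<Longrightarrow> \<bar>y - x\<bar> < \<delta> \<Longrightarrow> v x y \<le> \<bar>y - x\<bar> / real (Suc n)"
      using x unfolding E_def by fastforce
    have "norm (F y - F x - (y - x) *\<^sub>R f x) \<le> e * norm (y - x)" if y: "y \<in> {a..b}" "norm (y - x) < \<delta>" for y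
    proof (cases "y = x")
      case False
      then have "v x y \<le> (1 / real (Suc n)) * \<bar>y - x\<bar>" using dv[of y] y by simp
      also have "\<dots> \<le> e * \<bar>y - x\<bar>" using n by (intro mult_right_mono) auto
      finally show ?thesis by (simp add: v_def)
    qed simp
    then show "\<exists>d>0. \<forall>y\<in>{a..b}. norm (y - x) < d \<longrightarrow> norm (F y - F x - (y - x) *\<^sub>R f x) \<le> e * norm (y - x)"
      using \<delta> by blast
  qed
  moreover have "negligible (\<Union>n. E n)" by (rule negligible_countable_Union) (auto simp: negE)
  ultimately show ?thesis using that[of "\<Union>n. E n"] unfolding F_def by blast
qed

section \<open>Path distances\<close>

lemma ext_absdiff_lessD:
  assumes "ext_absdiff a b < ennreal e"
  shows "a \<le> b + ennreal e" "b \<le> a + ennreal e"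
proof -
  have e: "ennreal e \<noteq> 0" using assms by auto
  have "a \<le> b + ennreal e \<and> b \<le> a + ennreal e"
  proof (cases "a = \<infinity> \<and> b = \<infinity>")
    case False
    then have "a - b < ennreal e" "b - a < ennreal e" using assms unfolding ext_absdiff_def by auto
    then show ?thesis by (metis add.commute ennreal_minus_le_iff less_imp_le not_less_iff_gr_or_eq top.not_eq_extremum ennreal_top_minus infinity_ennreal_def top_greatest le_less_trans)
  qed auto
  then show "a \<le> b + ennreal e" "b \<le> a + ennreal e" by auto
qed

lemma ext_absdiff_lessI:
  assumes "a \<le> b + ennreal e'" "b \<le> a + ennreal e'" "0 \<le> e'" "e' < e"
  shows "ext_absdiff a b < ennreal e"
proof (cases "a = \<infinity> \<or> b = \<infinity>")
  case True
  then have "a = \<infinity> \<and> b = \<infinity>" using assms(1,2) by (auto simp: top_unique)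
  moreover have "0 < ennreal e" using assms(3,4) by simp
  ultimately show ?thesis unfolding ext_absdiff_def by simp
next
  case False
  then obtain x y where xy: "a = ennreal x" "x \<ge> 0" "b = ennreal y" "y \<ge> 0" by (cases a; cases b) auto
  have "x \<le> y + e'" "y \<le> x + e'"
    using assms(1-3) xy by (simp_all add: ennreal_plus[symmetric] ennreal_le_iff del: ennreal_plus)
  then have "a - b \<le> ennreal e'" "b - a \<le> ennreal e'" using xy assms(3) by (simp_all add: ennreal_minus ennreal_leI)
  moreover have "ennreal e' < ennreal e" using assms by (simp add: ennreal_less_iff)
  moreover have "0 < e" using assms by simp
  ultimately show ?thesis unfolding ext_absdiff_def by (auto simp: le_less_trans)
qed

text \<open>The value \<open>(t - s) * r\<close> in the condition on paths is the length of a piece of a path of length \<open>r\<close>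
  with constant speed; paths of length exactly \<open>d p q\<close> need not exist.\<close>

locale path_distance =
  fixes d :: "'a::t2_space \<Rightarrow> 'a \<Rightarrow> ennreal"
  assumes ext: "ext_distance d"
    and path: "\<And>p q r. d p q < ennreal r \<Longrightarrow> \<exists>\<gamma>. continuous_on {0..1} \<gamma> \<and> \<gamma> 0 = p \<and> \<gamma> 1 = q \<and>
        (\<forall>s t. 0 \<le> s \<longrightarrow> s \<le> t \<longrightarrow> t \<le> 1 \<longrightarrow> d (\<gamma> s) (\<gamma> t) \<le> ennreal ((t - s) * r))"
begin

lemma zero [simp]: "d x x = 0" and zeroD: "d x y = 0 \<Longrightarrow> x = y" and sym: "d x y = d y x"
  and tri: "d x z \<le> d x y + d y z"
  using ext unfolding ext_distance_def by auto

lemma tri_less: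
  assumes "d x y < ennreal a" "d y z < ennreal b"
  shows "d x z < ennreal (a + b)"
proof -
  have ab: "a > 0" "b > 0" using assms by (metis ennreal_neg not_le not_less_zero)+
  have "d x z \<le> d x y + d y z" by (rule tri)
  also have "\<dots> < ennreal a + ennreal b" using assms by (rule add_strict_mono)
  also have "\<dots> = ennreal (a + b)" using ab by simp
  finally show ?thesis .
qed

lemma tri_le:
  assumes "d x y \<le> ennreal a" "d y z \<le> ennreal b" "a \<ge> 0" "b \<ge> 0"
  shows "d x z \<le> ennreal (a + b)"
proof -
  have "d x z \<le> d x y + d y z" by (rule tri)
  also have "\<dots> \<le> ennreal a + ennreal b" using assms by (intro add_mono)
  also have "\<dots> = ennreal (a + b)" using assms by simp
  finally show ?thesis .
qed

lemma tri_le_less: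
  assumes "d x y \<le> ennreal a" "d y z < ennreal b" "a \<ge> 0"
  shows "d x z < ennreal (a + b)"
proof -
  have b: "b > 0" using assms(2) by (metis ennreal_neg not_le not_less_zero)
  obtain s where s: "s > 0" "d y z < ennreal s" "ennreal s < ennreal b"
  proof -
    obtain x where x: "d y z < x" "x < ennreal b" using dense[OF assms(2)] by auto
    then obtain s where "x = ennreal s" "s \<ge> 0" by (cases x) auto
    then show ?thesis using that x by (metis ennreal_0 less_eq_real_def not_less_zero)
  qed
  have "d x z \<le> ennreal (a + s)" by (rule tri_le[OF assms(1)]) (use s assms in auto)
  also have "\<dots> < ennreal (a + b)" using s b assms by (simp add: ennreal_less_iff)
  finally show ?thesis .
qed

lemma midpoint:
  assumes "d x y < ennreal (a + b)" "a \<ge> 0" "b \<ge> 0"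
  shows "\<exists>z. d x z \<le> ennreal a \<and> d z y \<le> ennreal b"
proof -
  have ab: "a + b > 0" using assms(1) by (metis ennreal_neg not_le not_less_zero)
  obtain \<gamma> where \<gamma>: "\<gamma> 0 = x" "\<gamma> 1 = y" "\<forall>s t. 0 \<le> s \<longrightarrow> s \<le> t \<longrightarrow> t \<le> 1 \<longrightarrow> d (\<gamma> s) (\<gamma> t) \<le> ennreal ((t - s) * (a + b))"
    using path[OF assms(1)] by blast
  define t where "t = a / (a + b)"
  have t: "0 \<le> t" "t \<le> 1" "(t - 0) * (a + b) = a" "(1 - t) * (a + b) = b"
    unfolding t_def using assms ab by (auto simp: field_simps)
  have "d x (\<gamma> t) \<le> ennreal a" "d (\<gamma> t) y \<le> ennreal b"
    using \<gamma>(3)[rule_format, of 0 t] \<gamma>(3)[rule_format, of t 1] t \<gamma>(1,2) by auto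
  then show ?thesis by blast
qed

text \<open>The points at finite distance from \<open>x\<close> form a set that is open and closed.\<close>

lemma finite_propagates:
  assumes top: "dist_topology d = euclidean" and S: "connected S" "p \<in> S" "q \<in> S" and x: "d x p < \<infinity>"
  shows "d x q < \<infinity>"
proof -
  have o: "open T" if "\<And>y. y \<in> T \<Longrightarrow> \<exists>r>0. dball d y r \<subseteq> T" for T
  proof -
    have "openin (dist_topology d) T" unfolding openin_dist_topology using that by blast
    then show ?thesis by (simp add: top)
  qed
  have step: "d x z < \<infinity>" if "d x y < \<infinity>" "d y z < ennreal 1" for y z
  proof -
    have "d y z < \<infinity>" by (rule less_trans[OF that(2)]) simp
    then have "d x y + d y z < \<infinity>" using that(1) by simp
    then show ?thesis by (rule le_less_trans[OF tri])
  qed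
  have "open {y. d x y < \<infinity>}"
    by (rule o) (use step in \<open>auto simp: dball_def intro!: exI[of _ 1]\<close>)
  moreover have "open {y. \<not> d x y < \<infinity>}"
    by (rule o) (use step sym in \<open>fastforce simp: dball_def intro!: exI[of _ 1]\<close>)
  ultimately show ?thesis
    using connectedD[OF S(1), of "{y. d x y < \<infinity>}" "{y. \<not> d x y < \<infinity>}"] S(2,3) x by blast
qed

lemma open_dball: "dist_topology d = euclidean \<Longrightarrow> open (dball d x r)"
proof -
  assume top: "dist_topology d = euclidean"
  have "openin (dist_topology d) (dball d x r)"
    unfolding openin_dist_topology
  proof
    fix y assume y: "y \<in> dball d x r"
    then have "d x y < ennreal r" by (simp add: dball_def)
    then obtain z where z: "d x y < z" "z < ennreal r" using dense by blast
    then obtain s where s: "z = ennreal s" "s \<ge> 0" by (cases z) auto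
    have sr: "s < r" using z s by (simp add: ennreal_less_iff)
    have "dball d y (r - s) \<subseteq> dball d x r"
    proof
      fix w assume "w \<in> dball d y (r - s)"
      then have "d x w < ennreal (s + (r - s))" using z s by (intro tri_less) (auto simp: dball_def)
      then show "w \<in> dball d x r" by (simp add: dball_def)
    qed
    then show "\<exists>r'>0. dball d y r' \<subseteq> dball d x r" using sr by (intro exI[of _ "r - s"]) auto
  qed
  then show "open (dball d x r)" by (simp add: top)
qed

lemma open_far:
  assumes top: "dist_topology d = euclidean" and r: "r \<ge> 0"
  shows "open {y. ennreal r < d x y}"
proof -
  have "openin (dist_topology d) {y. ennreal r < d x y}"
    unfolding openin_dist_topology
  proof
    fix y assume "y \<in> {y. ennreal r < d x y}"
    then obtain z where z: "ennreal r < z" "z < d x y" using dense by blast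
    then have "z < \<infinity>" by (metis less_le_trans top_greatest infinity_ennreal_def)
    then obtain s where s: "z = ennreal s" "s \<ge> 0" by (cases z) auto
    have sr: "r < s" using z s r by (simp add: ennreal_less_iff)
    have "dball d y (s - r) \<subseteq> {y. ennreal r < d x y}"
    proof
      fix w assume w: "w \<in> dball d y (s - r)"
      show "w \<in> {y. ennreal r < d x y}"
      proof (rule ccontr)
        assume "w \<notin> {y. ennreal r < d x y}"
        then have "d x w \<le> ennreal r" by (simp add: not_less)
        moreover have "d w y < ennreal (s - r)" using w sym by (simp add: dball_def)
        ultimately have "d x y < ennreal (r + (s - r))" using r by (rule tri_le_less)
        then show False using z s by simp
      qed
    qed
    then show "\<exists>r'>0. dball d y r' \<subseteq> {y. ennreal r < d x y}" using sr by (intro exI[of _ "s - r"]) auto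
  qed
  then show ?thesis by (simp add: top)
qed

lemma closed_ball:
  assumes "dist_topology d = euclidean" "r \<ge> 0"
  shows "closed {y. d x y \<le> ennreal r}"
proof -
  have "- {y. d x y \<le> ennreal r} = {y. ennreal r < d x y}" by auto
  then show ?thesis using open_far[OF assms, of x] by (simp add: closed_def)
qed

lemma path_exits_ball:
  fixes \<gamma> :: "real \<Rightarrow> 'a"
  assumes top: "dist_topology d = euclidean" and \<gamma>: "continuous_on {a..b} \<gamma>" "a \<le> b" "\<gamma> a = x"
    and r: "r > 0" "\<not> d x (\<gamma> b) < ennreal r"
  obtains t where "t \<in> {a..b}" "d x (\<gamma> t) = ennreal r"
proof -
  have "connected (\<gamma> ` {a..b})" by (rule connected_continuous_image[OF \<gamma>(1)]) simp
  have "\<exists>t\<in>{a..b}. d x (\<gamma> t) = ennreal r"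
  proof (rule ccontr)
    assume "\<not> ?thesis"
    then have no: "d x (\<gamma> t) \<noteq> ennreal r" if "t \<in> {a..b}" for t using that by blast
    have cov: "\<gamma> ` {a..b} \<subseteq> dball d x r \<union> {y. ennreal r < d x y}"
    proof
      fix y assume "y \<in> \<gamma> ` {a..b}"
      then have "d x y \<noteq> ennreal r" using no by (elim imageE) simp
      then show "y \<in> dball d x r \<union> {y. ennreal r < d x y}" unfolding dball_def by (simp add: neq_iff)
    qed
    have img: "\<gamma> a \<in> \<gamma> ` {a..b}" "\<gamma> b \<in> \<gamma> ` {a..b}" using \<gamma>(2) by auto
    have "\<gamma> a \<in> dball d x r" "\<gamma> b \<in> {y. ennreal r < d x y}" using \<gamma> r no[of b] by (auto simp: dball_def not_less less_le)
    moreover have "dball d x r \<inter> {y. ennreal r < d x y} = {}" by (auto simp: dball_def)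
    moreover have "open (dball d x r)" "open {y. ennreal r < d x y}" using open_dball[OF top] open_far[OF top] r by auto
    ultimately show False
      using connectedD[OF \<open>connected (\<gamma> ` {a..b})\<close>, of "dball d x r" "{y. ennreal r < d x y}"] cov img by blast
  qed
  then show ?thesis using that by blast
qed

lemma boundedly_compact_closed_ball:
  assumes top: "dist_topology d = euclidean" and bc: "boundedly_compact d" and r: "r \<ge> 0"
  shows "compact {y. d x y \<le> ennreal r}"
proof -
  have "{y. d x y \<le> ennreal r} \<subseteq> dball d x (r + 1)"
    using r by (auto simp: dball_def ennreal_less_iff intro: le_less_trans)
  moreover have "closedin (dist_topology d) {y. d x y \<le> ennreal r}" using closed_ball[OF top r] by (simp add: top)
  ultimately have "compactin (dist_topology d) {y. d x y \<le> ennreal r}" using bc unfolding boundedly_compact_def by blast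
  then show ?thesis by (simp add: top)
qed

text \<open>A Cauchy sequence without limit is eventually away from some ball around every point. Finitely
  many of these balls cover a compact ball that contains a tail of the sequence.\<close>

lemma boundedly_compact_imp_complete:
  assumes top: "dist_topology d = euclidean" and bc: "boundedly_compact d"
  shows "complete_distance d"
  unfolding complete_distance_def
proof (intro allI impI)
  fix s :: "nat \<Rightarrow> 'a" assume cau: "\<forall>\<epsilon>>0. \<exists>n0. \<forall>m\<ge>n0. \<forall>n\<ge>n0. d (s m) (s n) < ennreal \<epsilon>"
  show "\<exists>x. (\<lambda>n. d (s n) x) \<longlonglongrightarrow> 0"
  proof (rule ccontr)
    assume no: "\<nexists>x. (\<lambda>n. d (s n) x) \<longlonglongrightarrow> 0"
    have away: "\<exists>e>0. \<forall>\<^sub>F n in sequentially. \<not> d (s n) x < ennreal e" for x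
    proof -
      have "\<exists>e>0. \<not> (\<forall>\<^sub>F n in sequentially. d (s n) x < ennreal e)"
      proof (rule ccontr)
        assume "\<not> ?thesis"
        then have ev: "\<forall>\<^sub>F n in sequentially. d (s n) x < ennreal e" if "e > 0" for e using that by blast
        have "(\<lambda>n. d (s n) x) \<longlonglongrightarrow> 0"
        proof (rule order_tendstoI)
          fix b :: ennreal assume "0 < b"
          then obtain z where z: "0 < z" "z < b" using dense by blast
          then have "z < \<infinity>" by (metis less_le_trans top_greatest infinity_ennreal_def)
          then obtain e where e: "z = ennreal e" "e \<ge> 0" by (cases z) auto
          have "e > 0" using z e by (cases "e = 0") auto
          from ev[OF this] show "\<forall>\<^sub>F n in sequentially. d (s n) x < b"
            by eventually_elim (use z e in auto)
        qed auto
        then show False using no by blast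
      qed
      then obtain e where e: "e > 0" "\<not> (\<forall>\<^sub>F n in sequentially. d (s n) x < ennreal e)" by blast
      obtain n0 where n0: "\<forall>m\<ge>n0. \<forall>n\<ge>n0. d (s m) (s n) < ennreal (e / 2)" using cau e(1) half_gt_zero by blast
      have "\<not> d (s n) x < ennreal (e / 2)" if n: "n \<ge> n0" for n
      proof
        assume a: "d (s n) x < ennreal (e / 2)"
        have "d (s m) x < ennreal e" if "m \<ge> n0" for m
          using tri_less[of "s m" "s n" "e/2" x "e/2"] n0 that n a by simp
        then show False using e(2) unfolding eventually_sequentially by blast
      qed
      then show ?thesis using e(1) unfolding eventually_sequentially by (intro exI[of _ "e / 2"]) auto
    qed
    then obtain e where e: "\<And>x. e x > 0" "\<And>x. \<forall>\<^sub>F n in sequentially. \<not> d (s n) x < ennreal (e x)" by metis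
    obtain n0 where n0: "\<forall>m\<ge>n0. \<forall>n\<ge>n0. d (s m) (s n) < ennreal 1" using cau zero_less_one by blast
    define C where "C = {y. d (s n0) y \<le> ennreal 1}"
    have "compact C" unfolding C_def by (rule boundedly_compact_closed_ball[OF top bc]) simp
    moreover have "C \<subseteq> (\<Union>x\<in>C. dball d x (e x))" using e(1) by (auto simp: dball_def)
    ultimately obtain T where T: "T \<subseteq> C" "finite T" "C \<subseteq> (\<Union>x\<in>T. dball d x (e x))"
      using compactE_image[of C C "\<lambda>x. dball d x (e x)"] open_dball[OF top] by metis
    have "\<forall>\<^sub>F n in sequentially. \<forall>x\<in>T. \<not> d (s n) x < ennreal (e x)"
      by (rule eventually_ball_finite[OF T(2)]) (use e(2) in blast)
    then have "\<forall>\<^sub>F n in sequentially. False"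
      using eventually_ge_at_top[of n0]
    proof eventually_elim
      case (elim n)
      have "s n \<in> C" unfolding C_def using n0 elim(2) by (simp add: less_imp_le)
      then obtain x where "x \<in> T" "s n \<in> dball d x (e x)" using T(3) by blast
      then show ?case using elim(1) sym by (auto simp: dball_def)
    qed
    then show False by simp
  qed
qed

text \<open>The Hopf--Rinow argument. If some closed ball around \<open>x\<close> is not compact, let \<open>\<rho>'\<close> be the infimum
  of the radii of such balls. Points of the ball of radius \<open>\<rho>'\<close> are close to points of a compact smaller ball,
  by cutting paths, so this ball is totally bounded and, by completeness, compact. Local compactness then gives a
  compact ball with a radius larger than \<open>\<rho>'\<close>, a contradiction. Total boundedness and completeness are those of
  the finite metric \<open>min 1 d\<close>.\<close>

lemma complete_imp_boundedly_compact:
  assumes top: "dist_topology d = euclidean" and com: "complete_distance d"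
    and lc: "\<And>x::'a. \<exists>U K. open U \<and> compact K \<and> x \<in> U \<and> U \<subseteq> K"
  shows "boundedly_compact d"
proof -
  define d' where "d' x y = enn2real (min 1 (d x y))" for x y
  have d'1: "ennreal (d' x y) = min 1 (d x y)" for x y
    unfolding d'_def by (rule ennreal_enn2real) (rule le_less_trans[OF min.cobounded1], simp)
  have d'0: "d' x y \<ge> 0" for x y unfolding d'_def by simp
  have d'less: "d' x y < r \<longleftrightarrow> d x y < ennreal r" if "0 < r" "r \<le> 1" for x y r
  proof -
    have "d' x y < r \<longleftrightarrow> ennreal (d' x y) < ennreal r" using d'0 by (simp add: ennreal_less_iff)
    also have "\<dots> \<longleftrightarrow> d x y < ennreal r"
      unfolding d'1 min_less_iff_disj using that by (auto simp: ennreal_less_one_iff not_less[symmetric])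
    finally show ?thesis .
  qed
  interpret M: Metric_space UNIV d'
  proof
    show "0 \<le> d' x y" for x y by (rule d'0)
    show "d' x y = d' y x" for x y unfolding d'_def by (simp add: sym)
    show "d' x y = 0 \<longleftrightarrow> x = y" for x y
    proof
      assume "d' x y = 0"
      then have "min 1 (d x y) = 0" using d'1[of x y] by simp
      then show "x = y" using zeroD[of x y] by (simp add: min_def split: if_splits)
    qed (simp add: d'_def)
    show "d' x z \<le> d' x y + d' y z" for x y z
    proof -
      have "ennreal (d' x z) \<le> ennreal (d' x y) + ennreal (d' y z)"
      proof (cases "1 \<le> d x y \<or> 1 \<le> d y z")
        case True
        then have "1 \<le> min 1 (d x y) + min 1 (d y z)"
          by (auto simp: min_def intro: order_trans[OF _ add_increasing] order_trans[OF _ add_increasing2])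
        then show ?thesis unfolding d'1 by (auto intro: order_trans[OF min.cobounded1])
      next
        case False
        then have "min 1 (d x y) + min 1 (d y z) = d x y + d y z" by (simp add: min_def)
        then show ?thesis unfolding d'1 using tri[of x z y] by (auto intro: order_trans[OF min.cobounded2])
      qed
      also have "\<dots> = ennreal (d' x y + d' y z)" using d'0 by simp
      finally show ?thesis using d'0 by (simp add: ennreal_le_iff del: ennreal_plus)
    qed
  qed
  have mball: "M.mball x r = dball d x r" if "0 < r" "r \<le> 1" for x r
    using d'less[OF that] by (auto simp: M.mball_def dball_def)
  have mtop: "M.mtopology = euclidean"
  proof -
    have "openin M.mtopology S \<longleftrightarrow> openin (dist_topology d) S" for S
    proof -
      have "(\<exists>r>0. M.mball x r \<subseteq> S) \<longleftrightarrow> (\<exists>r>0. dball d x r \<subseteq> S)" for x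
      proof
        assume "\<exists>r>0. M.mball x r \<subseteq> S"
        then obtain r where r: "r > 0" "M.mball x r \<subseteq> S" by blast
        have "dball d x (min r 1) = M.mball x (min r 1)" using r by (intro mball[symmetric]) auto
        also have "\<dots> \<subseteq> M.mball x r" by (rule M.mball_subset_concentric) simp
        finally show "\<exists>r>0. dball d x r \<subseteq> S" using r by (intro exI[of _ "min r 1"]) auto
      next
        assume "\<exists>r>0. dball d x r \<subseteq> S"
        then obtain r where r: "r > 0" "dball d x r \<subseteq> S" by blast
        have "M.mball x (min r 1) = dball d x (min r 1)" using r by (intro mball) auto
        also have "\<dots> \<subseteq> dball d x r"
          using ennreal_leI[OF min.cobounded1, of r 1] unfolding dball_def by (auto intro: less_le_trans)
        finally show "\<exists>r>0. M.mball x r \<subseteq> S" using r by (intro exI[of _ "min r 1"]) auto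
      qed
      then show ?thesis unfolding M.openin_mtopology openin_dist_topology by auto
    qed
    then show ?thesis using top by (simp add: topology_eq)
  qed
  have mc: "M.mcomplete"
    unfolding M.mcomplete_def
  proof (intro allI impI)
    fix s assume "M.MCauchy s"
    then have cau: "\<forall>\<epsilon>>0. \<exists>n0. \<forall>m n. n0 \<le> m \<longrightarrow> n0 \<le> n \<longrightarrow> d' (s m) (s n) < \<epsilon>" unfolding M.MCauchy_def by simp
    have "\<forall>\<epsilon>>0. \<exists>n0. \<forall>m\<ge>n0. \<forall>n\<ge>n0. d (s m) (s n) < ennreal \<epsilon>"
    proof (intro allI impI)
      fix \<epsilon> :: real assume "\<epsilon> > 0"
      then have m: "0 < min \<epsilon> 1" "min \<epsilon> 1 \<le> 1" by auto
      then obtain n0 where n0: "\<forall>m n. n0 \<le> m \<longrightarrow> n0 \<le> n \<longrightarrow> d' (s m) (s n) < min \<epsilon> 1" using cau by blast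
      have "d (s a) (s b) < ennreal \<epsilon>" if "a \<ge> n0" "b \<ge> n0" for a b
      proof -
        have "d (s a) (s b) < ennreal (min \<epsilon> 1)" using n0 that d'less[OF m] by blast
        also have "\<dots> \<le> ennreal \<epsilon>" by (rule ennreal_leI) simp
        finally show ?thesis .
      qed
      then show "\<exists>n0. \<forall>m\<ge>n0. \<forall>n\<ge>n0. d (s m) (s n) < ennreal \<epsilon>" by blast
    qed
    then obtain x where x: "(\<lambda>n. d (s n) x) \<longlonglongrightarrow> 0" using com unfolding complete_distance_def by blast
    have "limitin M.mtopology s x sequentially"
      unfolding M.limitin_metric
    proof (intro conjI allI impI)
      fix \<epsilon> :: real assume "\<epsilon> > 0"
      then have m: "0 < min \<epsilon> 1" "min \<epsilon> 1 \<le> 1" by auto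
      then have "ennreal (min \<epsilon> 1) > 0" by simp
      from order_tendstoD(2)[OF x this]
      show "\<forall>\<^sub>F n in sequentially. s n \<in> UNIV \<and> d' (s n) x < \<epsilon>"
      proof eventually_elim
        case (elim n)
        then have "d' (s n) x < min \<epsilon> 1" using d'less[OF m] by blast
        then show ?case by simp
      qed
    qed simp
    then show "\<exists>x. limitin M.mtopology s x sequentially" ..
  qed
  have cb: "compact {y. d x y \<le> ennreal \<rho>}" if "\<rho> \<ge> 0" for x \<rho>
  proof (rule ccontr)
    let ?B = "\<lambda>\<rho>. {y. d x y \<le> ennreal \<rho>}"
    assume nc: "\<not> compact (?B \<rho>)"
    have cl: "closed (?B \<sigma>)" if "\<sigma> \<ge> 0" for \<sigma> by (rule closed_ball[OF top that])
    have mono: "compact (?B \<sigma>)" if "compact (?B \<tau>)" "0 \<le> \<sigma>" "\<sigma> \<le> \<tau>" for \<sigma> \<tau>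
    proof -
      have "?B \<sigma> \<subseteq> ?B \<tau>" using ennreal_leI[OF that(3)] by (auto intro: order_trans)
      then show ?thesis using closed_Int_compact[OF cl[OF that(2)] that(1)] by (simp only: Int_absorb2)
    qed
    define S where "S = {\<sigma>. \<sigma> \<ge> 0 \<and> \<not> compact (?B \<sigma>)}"
    define \<rho>' where "\<rho>' = Inf S"
    have S: "\<rho> \<in> S" "bdd_below S" unfolding S_def using nc \<open>\<rho> \<ge> 0\<close> by (auto intro: bdd_belowI[of _ 0])
    have below: "compact (?B \<sigma>)" if "0 \<le> \<sigma>" "\<sigma> < \<rho>'" for \<sigma>
      using that cInf_lower[OF _ S(2), of \<sigma>] unfolding S_def \<rho>'_def by force
    have \<rho>0: "\<rho>' \<ge> 0" unfolding \<rho>'_def by (rule cInf_greatest) (use S in \<open>auto simp: S_def\<close>)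
    have comp: "compact (?B \<rho>')"
    proof -
      have "M.mtotally_bounded (?B \<rho>')"
        unfolding M.mtotally_bounded_def
      proof (intro allI impI)
        fix e0 :: real assume "e0 > 0"
        define e where "e = min e0 1"
        have e: "e > 0" "e \<le> 1" "e \<le> e0" unfolding e_def using \<open>e0 > 0\<close> by auto
        define \<sigma> where "\<sigma> = max 0 (\<rho>' - e / 4)"
        have cS: "compact (?B \<sigma>)"
        proof (cases "\<rho>' - e / 4 \<ge> 0")
          case True then show ?thesis using below[of \<sigma>] e unfolding \<sigma>_def by simp
        next
          case False
          then have "?B \<sigma> = {x}" unfolding \<sigma>_def by (auto dest: zeroD)
          then show ?thesis by simp
        qed
        have "?B \<sigma> \<subseteq> (\<Union>k\<in>?B \<sigma>. dball d k (e / 2))" using e by (auto simp: dball_def)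
        then obtain K where K: "K \<subseteq> ?B \<sigma>" "finite K" "?B \<sigma> \<subseteq> (\<Union>k\<in>K. dball d k (e / 2))"
          using compactE_image[OF cS, of "?B \<sigma>" "\<lambda>k. dball d k (e / 2)"] open_dball[OF top] by metis
        have "\<sigma> \<le> \<rho>'" unfolding \<sigma>_def using \<rho>0 e by auto
        then have KB: "K \<subseteq> ?B \<rho>'" using K(1) ennreal_leI by (blast intro: order_trans)
        have "?B \<rho>' \<subseteq> (\<Union>k\<in>K. M.mball k e0)"
        proof
          fix y assume "y \<in> ?B \<rho>'"
          then have y: "d x y \<le> ennreal \<rho>'" by simp
          have "\<rho>' < \<sigma> + 3 * e / 8" unfolding \<sigma>_def using e by auto
          then have "d x y < ennreal (\<sigma> + 3 * e / 8)" using \<rho>0 by (intro le_less_trans[OF y]) (simp add: ennreal_less_iff)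
          then obtain z where z: "d x z \<le> ennreal \<sigma>" "d z y \<le> ennreal (3 * e / 8)"
            using midpoint[of x y \<sigma> "3 * e / 8"] e unfolding \<sigma>_def by auto
          obtain k where k: "k \<in> K" "d k z < ennreal (e / 2)" using K(3) z(1) by (auto simp: dball_def)
          have "d z y < ennreal (e / 2)" using e by (intro le_less_trans[OF z(2)]) (simp add: ennreal_less_iff)
          then have "d k y < ennreal (e / 2 + e / 2)" by (rule tri_less[OF k(2)])
          then have "d k y < ennreal e" by simp
          then have "d' k y < e" using d'less[OF e(1,2)] by blast
          then show "y \<in> (\<Union>k\<in>K. M.mball k e0)" using k(1) less_le_trans[OF _ e(3)] by (auto simp: M.mball_def)
        qed
        then show "\<exists>K. finite K \<and> K \<subseteq> ?B \<rho>' \<and> ?B \<rho>' \<subseteq> (\<Union>x\<in>K. M.mball x e0)" using K(2) KB by blast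
      qed
      then have "compactin M.mtopology (M.mtopology closure_of (?B \<rho>'))"
        using M.mtotally_bounded_eq_compact_closure_of[OF mc] by blast
      then show ?thesis using cl[OF \<rho>0] by (simp add: mtop closure_closed)
    qed
    have "\<exists>e>0. compact (?B (\<rho>' + e))"
    proof -
      have "\<forall>y::'a. \<exists>e (K::'a set). e > 0 \<and> compact K \<and> dball d y (2 * e) \<subseteq> K"
      proof
        fix y :: 'a
        obtain U K where UK: "open U" "compact K" "y \<in> U" "U \<subseteq> K" using lc[of y] by (elim exE conjE)
        have "openin (dist_topology d) U" using UK(1) by (simp add: top)
        then obtain r where "r > 0" "dball d y r \<subseteq> U" using UK(3) unfolding openin_dist_topology by blast
        then show "\<exists>e K. e > 0 \<and> compact K \<and> dball d y (2 * e) \<subseteq> K"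
          using UK by (intro exI[of _ "r / 2"] exI[of _ K]) auto
      qed
      then obtain e K where eK: "\<And>y. e y > 0" "\<And>y. compact (K y)" "\<And>y. dball d y (2 * e y) \<subseteq> K y" by metis
      have "?B \<rho>' \<subseteq> (\<Union>y\<in>?B \<rho>'. dball d y (e y))" using eK(1) by (auto simp: dball_def)
      then obtain T where T: "T \<subseteq> ?B \<rho>'" "finite T" "?B \<rho>' \<subseteq> (\<Union>y\<in>T. dball d y (e y))"
        using compactE_image[OF comp, of "?B \<rho>'" "\<lambda>y. dball d y (e y)"] open_dball[OF top] by metis
      define m where "m = Min (insert 1 (e ` T))"
      have m: "m > 0" unfolding m_def using T(2) eK(1) by simp
      have "?B (\<rho>' + m / 2) \<subseteq> (\<Union>y\<in>T. K y)"
      proof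
        fix w assume "w \<in> ?B (\<rho>' + m / 2)"
        then have "d x w < ennreal (\<rho>' + 3 * m / 4)" using m \<rho>0 by (intro le_less_trans[of "d x w" "ennreal (\<rho>' + m / 2)"]) (auto simp: ennreal_less_iff simp del: ennreal_plus)
        then obtain z where z: "d x z \<le> ennreal \<rho>'" "d z w \<le> ennreal (3 * m / 4)"
          using midpoint[of x w \<rho>' "3 * m / 4"] m \<rho>0 by auto
        obtain y where y: "y \<in> T" "d y z < ennreal (e y)" using T(3) z(1) by (auto simp: dball_def)
        have "m \<le> e y" unfolding m_def using T(2) y(1) by (intro Min_le) auto
        then have "d z w < ennreal (e y)" using m by (intro le_less_trans[OF z(2)]) (simp add: ennreal_less_iff)
        then have "d y w < ennreal (e y + e y)" by (rule tri_less[OF y(2)])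
        then have "w \<in> dball d y (2 * e y)" by (simp add: dball_def)
        then show "w \<in> (\<Union>y\<in>T. K y)" using eK(3) y(1) by blast
      qed
      moreover have "compact (\<Union>y\<in>T. K y)" using T(2) eK(2) by blast
      moreover have "closed (?B (\<rho>' + m / 2))" using m \<rho>0 by (intro cl) simp
      ultimately have "compact (?B (\<rho>' + m / 2))" using closed_Int_compact by (metis Int_absorb2)
      then show ?thesis using m by (intro exI[of _ "m / 2"]) simp
    qed
    then obtain e where e: "e > 0" "compact (?B (\<rho>' + e))" by blast
    have "\<rho>' + e \<le> \<sigma>" if "\<sigma> \<in> S" for \<sigma> using that mono[OF e(2), of \<sigma>] unfolding S_def by force
    then have "\<rho>' + e \<le> \<rho>'" unfolding \<rho>'_def using S(1) by (intro cInf_greatest) auto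
    then show False using e(1) by simp
  qed
  show ?thesis
    unfolding boundedly_compact_def
  proof (intro allI impI, elim conjE exE)
    fix S x r assume cS: "closedin (dist_topology d) S" and Sr: "S \<subseteq> dball d x r"
    have "S \<subseteq> {y. d x y \<le> ennreal (max 0 r)}"
    proof
      fix y assume "y \<in> S"
      then have "d x y < ennreal r" using Sr by (auto simp: dball_def)
      also have "\<dots> \<le> ennreal (max 0 r)" by (rule ennreal_leI) simp
      finally show "y \<in> {y. d x y \<le> ennreal (max 0 r)}" by simp
    qed
    moreover have "closed S" using cS by (simp add: top)
    ultimately have "compact S" using closed_Int_compact[OF \<open>closed S\<close> cb[of "max 0 r" x]] by (simp add: Int_absorb2)
    then show "compactin (dist_topology d) S" by (simp add: top)
  qed
qed

end

section \<open>Convergence of path distances\<close>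

text \<open>The bound on a step may use the bound reached so far, so that the points of a chain can be kept in a
  given ball while the chain is built.\<close>

lemma chain_bound:
  assumes D: "ext_distance D" and c: "c \<ge> 0"
    and step: "\<And>i. i < J \<Longrightarrow> D (x 0) (x i) \<le> ennreal (real i * c) \<Longrightarrow> D (x i) (x (Suc i)) \<le> ennreal c"
  shows "i \<le> J \<Longrightarrow> D (x 0) (x i) \<le> ennreal (real i * c)"
proof (induction i)
  case 0
  then show ?case using D by (simp add: ext_distance_def)
next
  case (Suc i)
  then have IH: "D (x 0) (x i) \<le> ennreal (real i * c)" by simp
  have "D (x 0) (x (Suc i)) \<le> D (x 0) (x i) + D (x i) (x (Suc i))" using D unfolding ext_distance_def by blast
  also have "\<dots> \<le> ennreal (real i * c) + ennreal c" using IH step[of i] Suc.prems by (intro add_mono) auto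
  also have "\<dots> = ennreal (real (Suc i) * c)" using c by (simp add: ennreal_plus[symmetric] algebra_simps del: ennreal_plus)
  finally show ?case .
qed

lemma ennreal_less_plus_real:
  assumes "a < (\<infinity>::ennreal)" "e > 0"
  obtains r where "r > 0" "a < ennreal r" "ennreal r = a + ennreal e"
proof -
  obtain x where "a = ennreal x" "x \<ge> 0" using assms(1) by (cases a) auto
  then show ?thesis using assms(2) by (intro that[of "x + e"]) (auto simp: ennreal_less_iff simp del: ennreal_plus simp: ennreal_plus[symmetric])
qed

locale path_distances = path_distance d for d :: "'a::t2_space \<Rightarrow> 'a \<Rightarrow> ennreal" +
  fixes ds :: "nat \<Rightarrow> 'a \<Rightarrow> 'a \<Rightarrow> ennreal"
  assumes seq: "\<And>n. path_distance (ds n)"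
    and top: "dist_topology d = euclidean"
    and loc: "\<And>x. \<exists>U. open U \<and> x \<in> U \<and> ext_uniform_limit (U \<times> U) ds d"
begin

text \<open>The number \<open>\<delta>\<close> is a Lebesgue number of the cover of \<open>C\<close> by balls on which the convergence
  is uniform.\<close>

lemma near_diagonal:
  assumes C: "compact C"
  obtains \<delta> where "\<delta> > 0" "\<And>\<epsilon>. \<epsilon> > 0 \<Longrightarrow> \<forall>\<^sub>F n in sequentially. \<forall>x\<in>C. \<forall>y. d x y < ennreal \<delta> \<longrightarrow>
      ext_absdiff (ds n x y) (d x y) < ennreal \<epsilon>"
proof -
  have "\<forall>x. \<exists>e. e > 0 \<and> ext_uniform_limit (dball d x (2 * e) \<times> dball d x (2 * e)) ds d"
  proof
    fix x
    obtain U where U: "open U" "x \<in> U" "ext_uniform_limit (U \<times> U) ds d" using loc by blast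
    have "openin (dist_topology d) U" using U(1) by (simp add: top)
    then obtain r where r: "r > 0" "dball d x r \<subseteq> U" using U(2) unfolding openin_dist_topology by blast
    have "ext_uniform_limit (dball d x r \<times> dball d x r) ds d"
      unfolding ext_uniform_limit_def
    proof (intro allI impI)
      fix \<epsilon> :: real assume "\<epsilon> > 0"
      then have "\<forall>\<^sub>F n in sequentially. \<forall>(p, q)\<in>U \<times> U. ext_absdiff (ds n p q) (d p q) < ennreal \<epsilon>"
        using U(3) unfolding ext_uniform_limit_def by blast
      then show "\<forall>\<^sub>F n in sequentially. \<forall>(p, q)\<in>dball d x r \<times> dball d x r. ext_absdiff (ds n p q) (d p q) < ennreal \<epsilon>"
        by eventually_elim (use r(2) in fast)
    qed
    then show "\<exists>e. e > 0 \<and> ext_uniform_limit (dball d x (2 * e) \<times> dball d x (2 * e)) ds d"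
      using r(1) by (intro exI[of _ "r / 2"]) simp
  qed
  then obtain e where "\<forall>x. e x > 0 \<and> ext_uniform_limit (dball d x (2 * e x) \<times> dball d x (2 * e x)) ds d"
    by (rule choice[THEN exE])
  then have e: "\<And>x. e x > 0" "\<And>x. ext_uniform_limit (dball d x (2 * e x) \<times> dball d x (2 * e x)) ds d" by auto
  have cov: "C \<subseteq> (\<Union>x\<in>C. dball d x (e x))" using e(1) by (auto simp: dball_def)
  obtain T where T: "T \<subseteq> C" "finite T" "C \<subseteq> (\<Union>x\<in>T. dball d x (e x))"
    by (rule compactE_image[OF C _ cov]) (rule open_dball[OF top])
  define \<delta> where "\<delta> = Min (insert 1 (e ` T))"
  show ?thesis
  proof
    show "\<delta> > 0" unfolding \<delta>_def using T(2) e(1) by simp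
    fix \<epsilon> :: real assume \<epsilon>: "\<epsilon> > 0"
    have "\<forall>\<^sub>F n in sequentially. \<forall>z\<in>T. \<forall>(p, q)\<in>dball d z (2 * e z) \<times> dball d z (2 * e z). ext_absdiff (ds n p q) (d p q) < ennreal \<epsilon>"
      by (rule eventually_ball_finite[OF T(2)]) (use e(2) \<epsilon> in \<open>simp add: ext_uniform_limit_def\<close>)
    then show "\<forall>\<^sub>F n in sequentially. \<forall>x\<in>C. \<forall>y. d x y < ennreal \<delta> \<longrightarrow> ext_absdiff (ds n x y) (d x y) < ennreal \<epsilon>"
    proof eventually_elim
      case (elim n)
      show ?case
      proof (intro ballI allI impI)
        fix x y assume x: "x \<in> C" and y: "d x y < ennreal \<delta>"
        obtain z where z: "z \<in> T" "d z x < ennreal (e z)" using T(3) x by (auto simp: dball_def)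
        have "\<delta> \<le> e z" unfolding \<delta>_def using T(2) z(1) by (intro Min_le) auto
        then have "d x y < ennreal (e z)" using y ennreal_leI less_le_trans by blast
        then have "d z y < ennreal (e z + e z)" by (rule tri_less[OF z(2)])
        moreover have "d z x < ennreal (2 * e z)" using e(1)[of z] by (intro less_le_trans[OF z(2)] ennreal_leI) simp
        ultimately have "(x, y) \<in> dball d z (2 * e z) \<times> dball d z (2 * e z)" by (simp add: dball_def)
        then show "ext_absdiff (ds n x y) (d x y) < ennreal \<epsilon>" using elim z(1) by fast
      qed
    qed
  qed
qed

text \<open>An almost minimal path of one distance is cut into \<open>J\<close> equal pieces that are short enough for
  \<open>near_diagonal\<close>, and the errors on the pieces add up to at most \<open>\<epsilon>\<close>. For a path of \<open>ds n\<close> it has to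
  be shown that its pieces are short for \<open>d\<close> as well; this follows from continuity, because a long piece
  would contain a point at intermediate distance, where the two distances are already comparable.\<close>

lemma compare_on_ball:
  assumes bc: "boundedly_compact d" and R: "R > 0" and \<epsilon>: "\<epsilon> > 0"
  shows "\<forall>\<^sub>F n in sequentially. \<forall>p\<in>dball d p0 R. \<forall>q\<in>dball d p0 R.
    ds n p q \<le> d p q + ennreal \<epsilon> \<and> d p q \<le> ds n p q + ennreal \<epsilon>"
proof -
  define C where "C = {y. d p0 y \<le> ennreal (3 * R + 3 * \<epsilon>)}"
  have C: "compact C" unfolding C_def by (rule boundedly_compact_closed_ball[OF top bc]) (use R \<epsilon> in simp)
  obtain \<delta> where \<delta>: "\<delta> > 0" and near: "\<And>e. e > 0 \<Longrightarrow> \<forall>\<^sub>F n in sequentially. \<forall>x\<in>C. \<forall>y. d x y < ennreal \<delta> \<longrightarrow>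
      ext_absdiff (ds n x y) (d x y) < ennreal e"
    by (rule near_diagonal[OF C]) (use that in blast)
  obtain J :: nat where J0: "(2 * R + 2 * \<epsilon>) / (\<delta> / 2) < real J" using reals_Archimedean2 by blast
  have J: "J > 0" "(2 * R + 2 * \<epsilon>) / real J < \<delta> / 2"
  proof -
    have "0 < (2 * R + 2 * \<epsilon>) / (\<delta> / 2)" using R \<epsilon> \<delta> by simp
    then have "real J > 0" using J0 by linarith
    then show "J > 0" by simp
    then show "(2 * R + 2 * \<epsilon>) / real J < \<delta> / 2" using J0 \<delta> by (simp add: field_simps)
  qed
  \<comment> \<open>Half of the error \<open>\<epsilon>\<close> comes from the choice of the path, the other half from its \<open>J\<close> pieces.\<close>
  define e where "e = min (\<epsilon> / (2 * real J)) (\<delta> / 8)"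
  have e: "e > 0" "real J * e \<le> \<epsilon> / 2" "e \<le> \<delta> / 8"
  proof -
    show "e > 0" "e \<le> \<delta> / 8" unfolding e_def using \<epsilon> \<delta> J(1) by auto
    have "e \<le> \<epsilon> / (2 * real J)" unfolding e_def by simp
    then show "real J * e \<le> \<epsilon> / 2" using J(1) by (simp add: field_simps)
  qed
  from near[OF e(1)] show ?thesis
  proof eventually_elim
    case (elim n)
    interpret n: path_distance "ds n" by (rule seq)
    note nearD = ext_absdiff_lessD[OF elim[rule_format]]
    show ?case
    proof (intro ballI)
      fix p q assume p: "p \<in> dball d p0 R" and q: "q \<in> dball d p0 R"
      have "d p q < ennreal (R + R)" using p q sym by (intro tri_less[of p p0]) (auto simp: dball_def)
      then have pq: "d p q < ennreal (2 * R)" by simp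
      have inC: "y \<in> C" if "d p y \<le> ennreal a" "0 \<le> a" "a \<le> 2 * R + 3 * \<epsilon>" for y a
      proof -
        have "d p0 y \<le> ennreal (R + a)" using p that R by (intro tri_le[of p0 p]) (auto simp: dball_def)
        also have "\<dots> \<le> ennreal (3 * R + 3 * \<epsilon>)" using that by (intro ennreal_leI) simp
        finally show ?thesis by (simp add: C_def)
      qed
      have idx: "\<And>i. i < J \<Longrightarrow> 0 \<le> real i / real J \<and> real i / real J \<le> real (Suc i) / real J \<and> real (Suc i) / real J \<le> 1"
        using J(1) by (auto simp: field_simps)
      have len: "\<And>i r. (real (Suc i) / real J - real i / real J) * r = r / real J" using J(1) by (simp add: field_simps)
      have up: "ds n p q \<le> d p q + ennreal \<epsilon>"
      proof -
        have "d p q < \<infinity>" by (rule less_trans[OF pq]) simp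
        then obtain r where r: "r > 0" "d p q < ennreal r" "ennreal r = d p q + ennreal (\<epsilon> / 2)"
          by (rule ennreal_less_plus_real[OF _ half_gt_zero[OF \<epsilon>]])
        have "ennreal r \<le> ennreal (2 * R) + ennreal (\<epsilon> / 2)" unfolding r(3) using pq by (intro add_right_mono) simp
        then have rR: "r \<le> 2 * R + \<epsilon> / 2" using R \<epsilon> by (simp add: ennreal_plus[symmetric] del: ennreal_plus)
        obtain \<gamma> where \<gamma>: "\<gamma> 0 = p" "\<gamma> 1 = q" "\<forall>s t. 0 \<le> s \<longrightarrow> s \<le> t \<longrightarrow> t \<le> 1 \<longrightarrow> d (\<gamma> s) (\<gamma> t) \<le> ennreal ((t - s) * r)"
          using path[OF r(2)] by (elim exE conjE)
        define x where "x i = \<gamma> (real i / real J)" for i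
        have x: "x 0 = p" "x J = q" unfolding x_def using \<gamma> J(1) by auto
        have c: "r / real J + e \<ge> 0" using r e by simp
        have "ds n (x 0) (x J) \<le> ennreal (real J * (r / real J + e))"
        proof (rule chain_bound[OF n.ext c _ order_refl])
          fix i assume i: "i < J"
          have "d p (x i) \<le> ennreal (real i / real J * r)"
            using \<gamma>(3)[rule_format, of 0 "real i / real J"] idx[OF i] \<gamma>(1) by (simp add: x_def)
          moreover have "real i / real J * r \<le> 2 * R + 3 * \<epsilon>"
          proof -
            have "real i / real J * r \<le> 1 * r" using idx[OF i] r(1) by (intro mult_right_mono) auto
            then show ?thesis using rR \<epsilon> by simp
          qed
          moreover have "0 \<le> real i / real J * r" using r(1) by simp
          ultimately have xC: "x i \<in> C" using inC by blast
          have dl: "d (x i) (x (Suc i)) \<le> ennreal (r / real J)"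
            using \<gamma>(3)[rule_format, of "real i / real J" "real (Suc i) / real J"] idx[OF i] unfolding len x_def by blast
          moreover have "r / real J < \<delta>"
          proof -
            have "r / real J \<le> (2 * R + 2 * \<epsilon>) / real J" using rR \<epsilon> by (intro divide_right_mono) auto
            then show ?thesis using J(2) \<delta> by linarith
          qed
          ultimately have "d (x i) (x (Suc i)) < ennreal \<delta>" using r(1) by (intro le_less_trans[OF dl]) (simp add: ennreal_less_iff)
          then have "ds n (x i) (x (Suc i)) \<le> d (x i) (x (Suc i)) + ennreal e" by (rule nearD(1)[OF xC])
          also have "\<dots> \<le> ennreal (r / real J) + ennreal e" using dl by (rule add_right_mono)
          also have "\<dots> = ennreal (r / real J + e)" using r(1) e(1) by simp
          finally show "ds n (x i) (x (Suc i)) \<le> ennreal (r / real J + e)" .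
        qed
        also have "\<dots> = ennreal (r + real J * e)" using J(1) by (simp add: algebra_simps)
        also have "\<dots> \<le> ennreal (r + \<epsilon> / 2)" using e(2) by (intro ennreal_leI) simp
        also have "\<dots> = d p q + (ennreal (\<epsilon> / 2) + ennreal (\<epsilon> / 2))" using r \<epsilon> by (simp add: add.assoc)
        also have "\<dots> = d p q + ennreal \<epsilon>" using \<epsilon> by (simp add: ennreal_plus[symmetric] del: ennreal_plus)
        finally show ?thesis unfolding x .
      qed
      have "d p q \<le> ds n p q + ennreal \<epsilon>"
      proof -
        have dspq: "ds n p q \<le> ennreal (2 * R + \<epsilon>)"
        proof -
          have "ds n p q \<le> ennreal (2 * R) + ennreal \<epsilon>" by (rule order_trans[OF up add_right_mono[OF less_imp_le[OF pq]]])
          then show ?thesis using R \<epsilon> by simp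
        qed
        have "ds n p q < \<infinity>" by (rule le_less_trans[OF dspq]) simp
        then obtain r where r: "r > 0" "ds n p q < ennreal r" "ennreal r = ds n p q + ennreal (\<epsilon> / 2)"
          by (rule ennreal_less_plus_real[OF _ half_gt_zero[OF \<epsilon>]])
        have "ennreal r \<le> ennreal (2 * R + \<epsilon>) + ennreal (\<epsilon> / 2)" unfolding r(3) using dspq by (rule add_right_mono)
        also have "\<dots> = ennreal (2 * R + \<epsilon> + \<epsilon> / 2)" using R \<epsilon> by (intro ennreal_plus[symmetric]) auto
        finally have rR: "r \<le> 2 * R + \<epsilon> + \<epsilon> / 2" using R \<epsilon> by (subst (asm) ennreal_le_iff) simp
        obtain \<gamma> where \<gamma>: "\<gamma> 0 = p" "\<gamma> 1 = q" "\<forall>s t. 0 \<le> s \<longrightarrow> s \<le> t \<longrightarrow> t \<le> 1 \<longrightarrow> ds n (\<gamma> s) (\<gamma> t) \<le> ennreal ((t - s) * r)"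
            and \<gamma>c: "continuous_on {0..1} \<gamma>"
          using n.path[OF r(2)] by (elim exE conjE)
        define x where "x i = \<gamma> (real i / real J)" for i
        have x: "x 0 = p" "x J = q" unfolding x_def using \<gamma> J(1) by auto
        have c: "r / real J + e \<ge> 0" using r e by simp
        have rJ: "r / real J < \<delta> / 2"
        proof -
          have "r / real J \<le> (2 * R + 2 * \<epsilon>) / real J" using rR \<epsilon> by (intro divide_right_mono) auto
          then show ?thesis using J(2) by linarith
        qed
        have Jc: "real J * (r / real J + e) = r + real J * e" using J(1) by (simp add: algebra_simps)
        have "d (x 0) (x J) \<le> ennreal (real J * (r / real J + e))"
        proof (rule chain_bound[OF ext c _ order_refl])
          fix i assume i: "i < J" and IH: "d (x 0) (x i) \<le> ennreal (real i * (r / real J + e))"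
          have "real i * (r / real J + e) \<le> real J * (r / real J + e)" using i c by (intro mult_right_mono) auto
          then have "real i * (r / real J + e) \<le> 2 * R + 3 * \<epsilon>" unfolding Jc using rR e(2) \<epsilon> by linarith
          then have xC: "x i \<in> C" using IH c unfolding x(1) by (intro inC) auto
          let ?a = "real i / real J" and ?b = "real (Suc i) / real J"
          have short: "ds n (x i) (\<gamma> t) \<le> ennreal (r / real J)" if "t \<in> {?a..?b}" for t
          proof -
            have "ds n (x i) (\<gamma> t) \<le> ennreal ((t - ?a) * r)" unfolding x_def using \<gamma>(3) idx[OF i] that by auto
            also have "\<dots> \<le> ennreal ((?b - ?a) * r)" using that r(1) by (intro ennreal_leI mult_right_mono) auto
            finally show ?thesis unfolding len .
          qed
          \<comment> \<open>The piece leaves the ball of radius \<open>3 * \<delta> / 4\<close> only through a point at this distance from \<open>x i\<close>; there \<open>d\<close> is at most \<open>ds n + e\<close>, hence less than \<open>\<delta> / 2 + \<delta> / 8\<close>.\<close>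
          have "d (x i) (x (Suc i)) < ennreal (3 * \<delta> / 4)"
          proof (rule ccontr)
            assume "\<not> ?thesis"
            then have far: "\<not> d (x i) (\<gamma> ?b) < ennreal (3 * \<delta> / 4)" by (simp add: x_def)
            have "continuous_on {?a..?b} \<gamma>" by (rule continuous_on_subset[OF \<gamma>c]) (use idx[OF i] in auto)
            then obtain t where t: "t \<in> {?a..?b}" "d (x i) (\<gamma> t) = ennreal (3 * \<delta> / 4)"
              by (rule path_exits_ball[where \<gamma> = \<gamma> and a = ?a and b = ?b, OF top _ _ _ _ far]) (use idx[OF i] \<delta> in \<open>auto simp: x_def\<close>)
            have "d (x i) (\<gamma> t) < ennreal \<delta>" using t(2) \<delta> by (simp add: ennreal_less_iff)
            then have "d (x i) (\<gamma> t) \<le> ds n (x i) (\<gamma> t) + ennreal e" by (rule nearD(2)[OF xC])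
            also have "\<dots> \<le> ennreal (r / real J) + ennreal e" using short[OF t(1)] by (rule add_right_mono)
            also have "\<dots> = ennreal (r / real J + e)" using r(1) e(1) by simp
            also have "\<dots> < ennreal (3 * \<delta> / 4)" using c rJ e(3) \<delta> by (intro ennreal_lessI) linarith+
            finally show False using t(2) by simp
          qed
          also have "\<dots> < ennreal \<delta>" using \<delta> by (simp add: ennreal_less_iff)
          finally have "d (x i) (x (Suc i)) \<le> ds n (x i) (x (Suc i)) + ennreal e" by (rule nearD(2)[OF xC])
          also have "\<dots> \<le> ennreal (r / real J) + ennreal e"
            using short[of ?b] idx[OF i] unfolding x_def by (intro add_right_mono) auto
          also have "\<dots> = ennreal (r / real J + e)" using r(1) e(1) by simp
          finally show "d (x i) (x (Suc i)) \<le> ennreal (r / real J + e)" .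
        qed
        also have "\<dots> = ennreal (r + real J * e)" using Jc by simp
        also have "\<dots> \<le> ennreal (r + \<epsilon> / 2)" using e(2) by (intro ennreal_leI) simp
        also have "\<dots> = ds n p q + (ennreal (\<epsilon> / 2) + ennreal (\<epsilon> / 2))" using r \<epsilon> by (simp add: add.assoc)
        also have "\<dots> = ds n p q + ennreal \<epsilon>" using \<epsilon> by (simp add: ennreal_plus[symmetric] del: ennreal_plus)
        finally show ?thesis unfolding x .
      qed
      with up show "ds n p q \<le> d p q + ennreal \<epsilon> \<and> d p q \<le> ds n p q + ennreal \<epsilon>" ..
    qed
  qed
qed

text \<open>Near a pair of points at infinite distance there is nothing to estimate: paths of \<open>ds n\<close> are
  continuous and finiteness of \<open>d\<close> propagates along them, so that \<open>ds n\<close> is infinite there, too. Near a pair at finite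
  distance, \<open>compare_on_ball\<close> applies.\<close>

lemma compact_convergence:
  assumes bc: "boundedly_compact d" and K: "compact K"
  shows "ext_uniform_limit K ds d"
  unfolding ext_uniform_limit_def
proof (intro allI impI)
  fix \<epsilon> :: real assume \<epsilon>: "\<epsilon> > 0"
  let ?P = "\<lambda>n (p, q). ext_absdiff (ds n p q) (d p q) < ennreal \<epsilon>"
  have "\<forall>z. \<exists>W. open W \<and> z \<in> W \<and> (\<forall>\<^sub>F n in sequentially. \<forall>w\<in>W. ?P n w)"
  proof
    fix z :: "'a \<times> 'a"
    obtain p0 q0 where z: "z = (p0, q0)" by fastforce
    let ?W = "dball d p0 1 \<times> dball d q0 1"
    have W: "open ?W" "z \<in> ?W" by (intro open_Times open_dball[OF top]) (simp add: z dball_def)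
    have "\<forall>\<^sub>F n in sequentially. \<forall>w\<in>?W. ?P n w"
    proof (cases "d p0 q0 < \<infinity>")
      case True
      then obtain R where R: "R > 0" "d p0 q0 < ennreal R" by (rule ennreal_less_plus_real[OF _ zero_less_one]) (use that in blast)
      have "\<epsilon> / 2 > 0" using \<epsilon> by simp
      from compare_on_ball[OF bc add_pos_pos[OF R(1) zero_less_one] this, of p0] show ?thesis
      proof eventually_elim
        case (elim n)
        show ?case
        proof (clarify)
          fix p q assume "p \<in> dball d p0 1" "q \<in> dball d q0 1"
          then have pq: "d p0 p < ennreal 1" "d q0 q < ennreal 1" by (auto simp: dball_def)
          have "p \<in> dball d p0 (R + 1)" using less_le_trans[OF pq(1) ennreal_leI[of 1 "R + 1"]] R(1) by (simp add: dball_def del: ennreal_plus ennreal_1)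
          moreover have "q \<in> dball d p0 (R + 1)" using tri_less[OF R(2) pq(2)] by (simp add: dball_def del: ennreal_plus ennreal_1)
          ultimately have "ds n p q \<le> d p q + ennreal (\<epsilon> / 2)" "d p q \<le> ds n p q + ennreal (\<epsilon> / 2)" using elim by auto
          then show "ext_absdiff (ds n p q) (d p q) < ennreal \<epsilon>" by (rule ext_absdiff_lessI) (use \<epsilon> in auto)
        qed
      qed
    next
      case False
      have "?P n w" if w: "w \<in> ?W" for n w
      proof -
        obtain p q where pq: "w = (p, q)" "d p0 p < ennreal 1" "d q0 q < ennreal 1" using w by (auto simp: dball_def)
        have "\<not> d p q < \<infinity>"
        proof
          assume fin: "d p q < \<infinity>"
          have "d p0 q0 \<le> d p0 p + d p q0" by (rule tri)
          also have "\<dots> \<le> d p0 p + (d p q + d q q0)" by (intro add_left_mono tri)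
          also have "\<dots> < \<infinity>" using fin less_trans[OF pq(2) ennreal_less_top] less_trans[OF pq(3) ennreal_less_top] sym[of q q0]
            by (simp add: less_top)
          finally show False using False by simp
        qed
        moreover have "\<not> ds n p q < \<infinity>"
        proof
          interpret n: path_distance "ds n" by (rule seq)
          assume "ds n p q < \<infinity>"
          then obtain r where "ds n p q < ennreal r" by (rule ennreal_less_plus_real[OF _ zero_less_one]) (use that in blast)
          from n.path[OF this] obtain \<gamma> :: "real \<Rightarrow> 'a" where \<gamma>: "continuous_on {0..1} \<gamma>" "\<gamma> 0 = p" "\<gamma> 1 = q"
            by (elim exE conjE) (rule that)
          have "connected (\<gamma> ` {0..1})" by (rule connected_continuous_image[OF \<gamma>(1)]) simp
          moreover have "p \<in> \<gamma> ` {0..1}" "q \<in> \<gamma> ` {0..1}" using imageI[of 0 "{0..1}" \<gamma>] imageI[of 1 "{0..1}" \<gamma>] \<gamma> by simp_all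
          ultimately have "d p q < \<infinity>" by (rule finite_propagates[OF top]) simp
          then show False using \<open>\<not> d p q < \<infinity>\<close> by simp
        qed
        ultimately have "ext_absdiff (ds n p q) (d p q) = 0" unfolding ext_absdiff_def by (simp add: less_top[symmetric])
        then show ?thesis using \<epsilon> pq(1) by simp
      qed
      then show ?thesis by (intro always_eventually allI ballI)
    qed
    then show "\<exists>W. open W \<and> z \<in> W \<and> (\<forall>\<^sub>F n in sequentially. \<forall>w\<in>W. ?P n w)" using W by (intro exI[of _ ?W] conjI)
  qed
  then obtain W where "\<forall>z. open (W z) \<and> z \<in> W z \<and> (\<forall>\<^sub>F n in sequentially. \<forall>w\<in>W z. ?P n w)" by (rule choice[THEN exE])
  then have W: "\<And>z. open (W z)" "\<And>z. z \<in> W z" "\<And>z. \<forall>\<^sub>F n in sequentially. \<forall>w\<in>W z. ?P n w" by auto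
  have cov: "K \<subseteq> (\<Union>z\<in>K. W z)" using W(2) by auto
  obtain T where T: "T \<subseteq> K" "finite T" "K \<subseteq> (\<Union>z\<in>T. W z)" by (rule compactE_image[OF K W(1) cov])
  have "\<forall>\<^sub>F n in sequentially. \<forall>z\<in>T. \<forall>w\<in>W z. ?P n w" by (rule eventually_ball_finite[OF T(2)]) (use W(3) in simp)
  then show "\<forall>\<^sub>F n in sequentially. \<forall>w\<in>K. ?P n w" by eventually_elim (use T(3) in blast)
qed

text \<open>The identity is an almost isometry: by continuity of almost minimal paths, the \<open>r\<close>-ball of \<open>ds n\<close> is
  contained in the ball of radius \<open>r + 1\<close> of \<open>d\<close>, on which the two distances are uniformly close.\<close>

lemma pointed_convergence:
  assumes bc: "boundedly_compact d"
  shows "pointed_GH_converges ds (\<lambda>n. x) d x"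
  unfolding pointed_GH_converges_def
proof (intro conjI allI impI)
  show "ext_distance (ds n)" for n by (rule path_distance.ext[OF seq])
  show "ext_distance d" by (rule ext)
  fix r \<epsilon> :: real assume r: "r > 0" and \<epsilon>: "\<epsilon> > 0"
  define e where "e = min (\<epsilon> / 2) (1 / 2)"
  have e: "e > 0" "e \<le> \<epsilon> / 2" "e \<le> 1 / 2" unfolding e_def using \<epsilon> by auto
  have "r + 2 > 0" using r by simp
  from compare_on_ball[OF bc this e(1), of x]
  show "\<forall>\<^sub>F n in sequentially. \<exists>F. F x = x \<and>
     (SUP v\<in>dball (ds n) x r. SUP w\<in>dball (ds n) x r. ext_absdiff (d (F v) (F w)) (ds n v w)) < ennreal \<epsilon> \<and>
     dball d x (r - \<epsilon>) \<subseteq> (\<Union>v\<in>dball (ds n) x r. dball d (F v) \<epsilon>)"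
  proof eventually_elim
    case (elim n)
    interpret n: path_distance "ds n" by (rule seq)
    have up: "ds n p q \<le> d p q + ennreal e" and low: "d p q \<le> ds n p q + ennreal e"
      if "d x p < ennreal (r + 2)" "d x q < ennreal (r + 2)" for p q using elim that by (auto simp: dball_def)
    have x2: "d x x < ennreal (r + 2)" using r by (simp del: ennreal_plus)
    have sub: "d x y < ennreal (r + 1)" if y: "y \<in> dball (ds n) x r" for y
    proof (rule ccontr)
      have "ds n x y < ennreal r" using y by (simp add: dball_def)
      from n.path[OF this] obtain \<gamma> where \<gamma>: "continuous_on {0..1} \<gamma>" "\<gamma> 0 = x" "\<gamma> 1 = y"
          "\<forall>s t. 0 \<le> s \<longrightarrow> s \<le> t \<longrightarrow> t \<le> 1 \<longrightarrow> ds n (\<gamma> s) (\<gamma> t) \<le> ennreal ((t - s) * r)" by (elim exE conjE)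
      assume "\<not> d x y < ennreal (r + 1)"
      then have far: "\<not> d x (\<gamma> 1) < ennreal (r + 1)" using \<gamma>(3) by simp
      have r1: "r + 1 > 0" using r by simp
      obtain t where t: "t \<in> {0..1}" "d x (\<gamma> t) = ennreal (r + 1)"
        by (rule path_exits_ball[OF top \<gamma>(1) _ \<gamma>(2) r1 far]) auto
      have "d x (\<gamma> t) < ennreal (r + 2)" unfolding t(2) using r by (simp only: ennreal_less_iff)
      then have "d x (\<gamma> t) \<le> ds n x (\<gamma> t) + ennreal e" by (rule low[OF x2])
      also have "\<dots> \<le> ennreal (t * r) + ennreal e"
        using \<gamma>(4)[rule_format, of 0 t] t(1) \<gamma>(2) by (intro add_right_mono) auto
      also have "\<dots> = ennreal (t * r + e)" using t(1) r e(1) by simp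
      also have "\<dots> < ennreal (r + 1)"
      proof -
        have "t * r \<le> 1 * r" using t(1) r by (intro mult_right_mono) auto
        then have "t * r + e < r + 1" using e(3) by linarith
        then show ?thesis using r by (intro ennreal_lessI) linarith+
      qed
      finally show False using t(2) by simp
    qed
    have r2: "d x y < ennreal (r + 2)" if "y \<in> dball (ds n) x r" for y
      by (rule less_le_trans[OF sub[OF that]]) (rule ennreal_leI, simp)
    have "ext_absdiff (d v w) (ds n v w) \<le> ennreal (3 * \<epsilon> / 4)" if "v \<in> dball (ds n) x r" "w \<in> dball (ds n) x r" for v w
      by (rule less_imp_le, rule ext_absdiff_lessI[OF low up]) (use that r2 e \<epsilon> in auto)
    then have "(SUP v\<in>dball (ds n) x r. SUP w\<in>dball (ds n) x r. ext_absdiff (d v w) (ds n v w)) \<le> ennreal (3 * \<epsilon> / 4)"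
      by (intro SUP_least)
    also have "\<dots> < ennreal \<epsilon>" using \<epsilon> by (simp add: ennreal_less_iff)
    finally have dist: "(SUP v\<in>dball (ds n) x r. SUP w\<in>dball (ds n) x r. ext_absdiff (d v w) (ds n v w)) < ennreal \<epsilon>" .
    have "dball d x (r - \<epsilon>) \<subseteq> (\<Union>v\<in>dball (ds n) x r. dball d v \<epsilon>)"
    proof
      fix y assume "y \<in> dball d x (r - \<epsilon>)"
      then have y: "d x y < ennreal (r - \<epsilon>)" by (simp add: dball_def)
      then have pos: "r - \<epsilon> > 0" by (metis ennreal_neg not_le not_less_zero)
      have "d x y < ennreal (r + 2)" using \<epsilon> by (intro less_le_trans[OF y] ennreal_leI) simp
      then have "ds n x y \<le> d x y + ennreal e" by (rule up[OF x2])
      also have "\<dots> \<le> ennreal (r - \<epsilon>) + ennreal e" using y by (intro add_right_mono less_imp_le)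
      also have "\<dots> = ennreal (r - \<epsilon> + e)" using pos e(1) by (simp only: ennreal_plus less_imp_le)
      also have "\<dots> < ennreal r" using pos e \<epsilon> by (subst ennreal_less_iff) auto
      finally have "y \<in> dball (ds n) x r" by (simp add: dball_def)
      moreover have "y \<in> dball d y \<epsilon>" using \<epsilon> by (simp add: dball_def)
      ultimately show "y \<in> (\<Union>v\<in>dball (ds n) x r. dball d v \<epsilon>)" by blast
    qed
    then show ?case using dist by (intro exI[of _ "\<lambda>v. v"] conjI refl)
  qed
qed

end

section \<open>Charts and vector fields\<close>

locale smooth_manifold =
  fixes A :: "('a::t2_space, 'b::euclidean_space) chart set"
  assumes smooth: "smooth_structure A"
begin

lemma chart_props:
  assumes "c \<in> A"
  shows "open (chart_dom c)" "open (chart_map c ` chart_dom c)"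
    "continuous_on (chart_dom c) (chart_map c)"
    "continuous_on (chart_map c ` chart_dom c) (chart_inv c)"
    "\<And>p. p \<in> chart_dom c \<Longrightarrow> chart_inv c (chart_map c p) = p"
    "\<And>x. x \<in> chart_map c ` chart_dom c \<Longrightarrow> chart_map c (chart_inv c x) = x"
    "\<And>x. x \<in> chart_map c ` chart_dom c \<Longrightarrow> chart_inv c x \<in> chart_dom c"
proof -
  have "is_chart c" using smooth assms unfolding smooth_structure_def by blast
  then have o: "open (chart_dom c)" "open (chart_map c ` chart_dom c)"
    and h: "homeomorphism (chart_dom c) (chart_map c ` chart_dom c) (chart_map c) (chart_inv c)"
    unfolding is_chart_def by blast+
  show "open (chart_dom c)" "open (chart_map c ` chart_dom c)" by (fact o)+
  show "continuous_on (chart_dom c) (chart_map c)" "continuous_on (chart_map c ` chart_dom c) (chart_inv c)"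
    using h unfolding homeomorphism_def by blast+
  show "\<And>p. p \<in> chart_dom c \<Longrightarrow> chart_inv c (chart_map c p) = p"
    "\<And>x. x \<in> chart_map c ` chart_dom c \<Longrightarrow> chart_map c (chart_inv c x) = x"
    using h unfolding homeomorphism_def by blast+
  show "\<And>x. x \<in> chart_map c ` chart_dom c \<Longrightarrow> chart_inv c x \<in> chart_dom c"
    using h unfolding homeomorphism_def by blast
qed

lemma ex_chart_at: "\<exists>c. c \<in> charts_at A p"
  using smooth unfolding smooth_structure_def charts_at_def by blast

lemma open_chart_overlap:
  assumes "c \<in> A" "open W"
  shows "open (chart_map c ` (chart_dom c \<inter> W))"
proof -
  have "chart_map c ` (chart_dom c \<inter> W) = (chart_map c ` chart_dom c) \<inter> chart_inv c -` W"
    using chart_props(5,6,7)[OF assms(1)] by (auto simp: image_iff)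
  then show ?thesis
    using continuous_open_preimage[OF chart_props(4,2)[OF assms(1)] assms(2)] by simp
qed

abbreviation transition :: "('a, 'b) chart \<Rightarrow> ('a, 'b) chart \<Rightarrow> 'b \<Rightarrow> 'b" where
  "transition c c' \<equiv> chart_map c' \<circ> chart_inv c"

lemma transition_derivative:
  assumes "c \<in> charts_at A p" "c' \<in> charts_at A p"
  shows "(transition c c' has_derivative frechet_derivative (transition c c') (at (chart_map c p))) (at (chart_map c p))"
proof -
  have "smoothly_compatible c c'" using smooth assms unfolding smooth_structure_def charts_at_def by blast
  then have "Ck_on 1 (transition c c') (chart_map c ` (chart_dom c \<inter> chart_dom c'))"
    unfolding smoothly_compatible_def smooth_on_def by blast
  then have "transition c c' differentiable (at (chart_map c p))"
    using assms by (auto simp: charts_at_def)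
  then show ?thesis by (rule frechet_derivative_works[THEN iffD1])
qed

text \<open>Continuous differentiability bounds the derivative on a compact ball, and by the mean value inequality on the
  convex ball this bound is a Lipschitz constant.\<close>

lemma transition_locally_bounded:
  assumes "c \<in> charts_at A p" "c' \<in> charts_at A p"
  obtains r C where "r > 0" "C \<ge> 0" "cball (chart_map c p) r \<subseteq> chart_map c ` (chart_dom c \<inter> chart_dom c')"
    "\<And>y v. y \<in> cball (chart_map c p) r \<Longrightarrow> norm (frechet_derivative (transition c c') (at y) v) \<le> C * norm v"
    "C-lipschitz_on (cball (chart_map c p) r) (transition c c')"
proof -
  let ?S = "chart_map c ` (chart_dom c \<inter> chart_dom c')"
  let ?D = "\<lambda>y. frechet_derivative (transition c c') (at y)"
  have cA: "c \<in> A" "c' \<in> A" using assms by (auto simp: charts_at_def)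
  have "smoothly_compatible c c'" using smooth cA unfolding smooth_structure_def by blast
  then have Ck: "Ck_on (Suc 0) (transition c c') ?S"
    unfolding smoothly_compatible_def smooth_on_def by blast
  then have diff: "\<And>y. y \<in> ?S \<Longrightarrow> transition c c' differentiable (at y)"
    unfolding Ck_on.simps by (elim conjE) (rule bspec)
  have cont: "\<And>v. continuous_on ?S (\<lambda>y. ?D y v)"
    using Ck unfolding Ck_on.simps by (elim conjE) (rule spec)
  have "open ?S" by (rule open_chart_overlap[OF cA(1) chart_props(1)[OF cA(2)]])
  moreover have "chart_map c p \<in> ?S" using assms by (auto simp: charts_at_def)
  ultimately obtain r where r: "r > 0" "cball (chart_map c p) r \<subseteq> ?S"
    using open_contains_cball by blast
  let ?K = "cball (chart_map c p) r"
  have "\<forall>b\<in>Basis. \<exists>B. \<forall>y\<in>?K. norm (?D y b) \<le> B"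
  proof
    fix b :: 'b assume "b \<in> Basis"
    have "compact ((\<lambda>y. ?D y b) ` ?K)"
      by (rule compact_continuous_image[OF continuous_on_subset[OF cont r(2)] compact_cball])
    then have "bounded ((\<lambda>y. ?D y b) ` ?K)" by (rule compact_imp_bounded)
    then show "\<exists>B. \<forall>y\<in>?K. norm (?D y b) \<le> B" unfolding bounded_iff by blast
  qed
  then obtain B where B: "\<And>b y. b \<in> Basis \<Longrightarrow> y \<in> ?K \<Longrightarrow> norm (?D y b) \<le> B b"
    by metis
  define C where "C = (\<Sum>b\<in>Basis. B b)"
  have C0: "C \<ge> 0" unfolding C_def
    using B[of _ "chart_map c p"] r(1) by (intro sum_nonneg) (meson centre_in_cball less_imp_le norm_ge_zero order_trans)
  have bd: "norm (?D y v) \<le> C * norm v" if y: "y \<in> ?K" for y v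
  proof -
    have lin: "linear (?D y)" using diff[of y] y r(2) by (intro linear_frechet_derivative) auto
    have "?D y (\<Sum>b\<in>Basis. (v \<bullet> b) *\<^sub>R b) = (\<Sum>b\<in>Basis. (v \<bullet> b) *\<^sub>R ?D y b)"
      by (simp only: linear_sum[OF lin] linear_cmul[OF lin])
    then have "?D y v = (\<Sum>b\<in>Basis. (v \<bullet> b) *\<^sub>R ?D y b)"
      by (simp only: euclidean_representation)
    also have "norm \<dots> \<le> (\<Sum>b\<in>Basis. norm v * B b)"
    proof (rule sum_norm_le)
      fix b :: 'b assume b: "b \<in> Basis"
      have "norm ((v \<bullet> b) *\<^sub>R ?D y b) = \<bar>v \<bullet> b\<bar> * norm (?D y b)" by simp
      also have "\<dots> \<le> norm v * B b"
        using Basis_le_norm[OF b] B[OF b y] by (intro mult_mono) auto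
      finally show "norm ((v \<bullet> b) *\<^sub>R ?D y b) \<le> norm v * B b" .
    qed
    also have "\<dots> = C * norm v" by (simp add: C_def sum_distrib_left mult.commute)
    finally show ?thesis .
  qed
  have "C-lipschitz_on ?K (transition c c')"
  proof (rule lipschitz_onI[OF _ C0])
    fix x y assume xy: "x \<in> ?K" "y \<in> ?K"
    have "norm (transition c c' x - transition c c' y) \<le> C * norm (x - y)"
    proof (rule differentiable_bound[of ?K])
      show "convex ?K" by (rule convex_cball)
      show "(transition c c' has_derivative ?D z) (at z within ?K)" if "z \<in> ?K" for z
        using diff[of z] that r(2) frechet_derivative_works has_derivative_at_withinI by blast
      show "onorm (?D z) \<le> C" if "z \<in> ?K" for z by (rule onorm_le) (rule bd[OF that])
    qed (use xy in auto)
    then show "dist (transition c c' x) (transition c c' y) \<le> C * dist x y" by (simp add: dist_norm)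
  qed
  then show ?thesis using that[OF r(1) C0 r(2)] bd by blast
qed

text \<open>The transformation law of tangent vectors is the chain rule for the transition map.\<close>

lemma velocity_transfer:
  assumes c: "c \<in> charts_at A (g t)" "c' \<in> charts_at A (g t)" and w: "w \<in> tangent_space A (g t)"
    and cont: "continuous (at t within I) g" and tI: "t \<in> I"
    and der: "((chart_map c \<circ> g) has_vector_derivative w c) (at t within I)"
  shows "((chart_map c' \<circ> g) has_vector_derivative w c') (at t within I)"
proof -
  let ?D = "frechet_derivative (transition c c') (at (chart_map c (g t)))"
  have "(transition c c' has_derivative ?D) (at (chart_map c (g t)))"
    by (rule transition_derivative[OF c])
  then have "((transition c c' \<circ> (chart_map c \<circ> g)) has_derivative (?D \<circ> (\<lambda>h. h *\<^sub>R w c))) (at t within I)"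
    using der unfolding has_vector_derivative_def
    by (intro diff_chain_within) (auto intro: has_derivative_at_withinI)
  moreover have "?D \<circ> (\<lambda>h. h *\<^sub>R w c) = (\<lambda>h. h *\<^sub>R w c')"
  proof
    fix h
    have "linear ?D" using transition_derivative[OF c] has_derivative_linear by blast
    moreover have "w c' = ?D (w c)" using w c unfolding tangent_space_def by blast
    ultimately show "(?D \<circ> (\<lambda>h. h *\<^sub>R w c)) h = h *\<^sub>R w c'" by (simp add: linear_cmul)
  qed
  ultimately have d: "((transition c c' \<circ> (chart_map c \<circ> g)) has_derivative (\<lambda>h. h *\<^sub>R w c')) (at t within I)"
    by simp
  have cA: "c \<in> A" using c by (simp add: charts_at_def)
  have "\<forall>\<^sub>F s in at t within I. g s \<in> chart_dom c"
    using cont chart_props(1)[OF cA] c(1) unfolding continuous_within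
    by (intro topological_tendstoD[where l="g t"]) (auto simp: charts_at_def)
  then have ev: "\<forall>\<^sub>F s in at t within I. (transition c c' \<circ> (chart_map c \<circ> g)) s = (chart_map c' \<circ> g) s"
    by eventually_elim (simp add: chart_props(5)[OF cA])
  have eqt: "(transition c c' \<circ> (chart_map c \<circ> g)) t = (chart_map c' \<circ> g) t"
    using chart_props(5)[OF cA] c(1) by (simp add: charts_at_def)
  show ?thesis unfolding has_vector_derivative_def
    by (rule has_derivative_transform_eventually[OF d ev eqt tI])
qed

lemma bundle_sectionD:
  assumes "bundle_section A f"
  shows "f p v \<in> tangent_space A p" "f p (r *\<^sub>R v) c = r *\<^sub>R f p v c" "f p (v + w) c = f p v c + f p w c"
    "f p 0 c = 0" "f p (v - w) c = f p v c - f p w c" "f p (- v) c = - f p v c"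
proof -
  have l: "linear (\<lambda>v. f p v c)" using assms unfolding bundle_section_def by blast
  show "f p v \<in> tangent_space A p" using assms unfolding bundle_section_def by blast
  show "f p (r *\<^sub>R v) c = r *\<^sub>R f p v c" using linear_cmul[OF l] .
  show "f p (v + w) c = f p v c + f p w c" using linear_add[OF l] .
  show "f p 0 c = 0" using linear_0[OF l] .
  show "f p (v - w) c = f p v c - f p w c" using linear_diff[OF l] .
  show "f p (- v) c = - f p v c" using linear_neg[OF l] .
qed

lemma section_transition:
  assumes "bundle_section A f" "c \<in> charts_at A p" "c' \<in> charts_at A p"
  shows "f p v c' = frechet_derivative (transition c c') (at (chart_map c p)) (f p v c)"
  using bundle_sectionD(1)[OF assms(1), of p v] assms(2,3) unfolding tangent_space_def by blast

end

text \<open>The control space is finite-dimensional, so that the coordinate representation of a section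
  evaluates to the section.\<close>

locale control_manifold = smooth_manifold A
  for A :: "('a::t2_space, 'b::euclidean_space) chart set" +
  fixes control_space :: "'e::banach itself"
  assumes fd: "\<exists>B :: 'e set. finite B \<and> span B = UNIV"
begin

lemma local_rep_apply:
  fixes f :: "'a \<Rightarrow> 'e \<Rightarrow> ('a, 'b) tvec"
  assumes "bundle_section A f"
  shows "blinfun_apply (local_rep c f x) v = f (chart_inv c x) v c"
proof -
  have "linear (\<lambda>v. f (chart_inv c x) v c)" using assms unfolding bundle_section_def by blast
  then have "bounded_linear (\<lambda>v. f (chart_inv c x) v c)" by (rule bounded_linear_finite_dimensional[OF fd])
  then show ?thesis unfolding local_rep_def by (simp add: bounded_linear_Blinfun_apply)
qed

lemma local_rep_apply_chart:
  fixes f :: "'a \<Rightarrow> 'e \<Rightarrow> ('a, 'b) tvec"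
  assumes "bundle_section A f" "c \<in> charts_at A p"
  shows "f p v c = blinfun_apply (local_rep c f (chart_map c p)) v"
  using local_rep_apply[OF assms(1)] assms(2) chart_props(5)[of c p] by (simp add: charts_at_def)

text \<open>The bound holds in the chart in which the field is Lipschitz, and the derivative of the transition
  map carries it to the chart \<open>c'\<close>.\<close>

lemma lvf_locally_bounded:
  fixes f :: "'a \<Rightarrow> 'e \<Rightarrow> ('a, 'b) tvec"
  assumes f: "lvf_structure A f" and c': "c' \<in> charts_at A p"
  shows "\<exists>W C. open W \<and> p \<in> W \<and> C \<ge> 0 \<and> (\<forall>q\<in>W. \<forall>v. norm (f q v c') \<le> C * norm v)"
proof -
  have bs: "bundle_section A f" using f unfolding lvf_structure_def by blast
  obtain c L where c: "c \<in> charts_at A p" and L: "L > 0" "L-lipschitz_on (chart_map c ` chart_dom c) (local_rep c f)"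
    using f unfolding lvf_structure_def uniformly_locally_lipschitz_def by blast
  have cA: "c \<in> A" "c' \<in> A" "p \<in> chart_dom c" "p \<in> chart_dom c'" using c c' by (auto simp: charts_at_def)
  obtain r C where r: "r > 0" "C \<ge> 0" "cball (chart_map c p) r \<subseteq> chart_map c ` (chart_dom c \<inter> chart_dom c')"
    and C: "\<And>y v. y \<in> cball (chart_map c p) r \<Longrightarrow> norm (frechet_derivative (transition c c') (at y) v) \<le> C * norm v"
    using transition_locally_bounded[OF c c'] by metis
  define B where "B = norm (local_rep c f (chart_map c p)) + L * r"
  define W where "W = (chart_dom c \<inter> chart_map c -` ball (chart_map c p) r) \<inter> chart_dom c'"
  have oW: "open W" unfolding W_def
    using chart_props(1,3)[OF cA(1)] chart_props(1)[OF cA(2)] by (intro open_Int continuous_open_preimage) auto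
  have pW: "p \<in> W" unfolding W_def using cA r by simp
  have B0: "B \<ge> 0" unfolding B_def using L r by simp
  have bd: "norm (f q v c') \<le> (C * B) * norm v" if q: "q \<in> W" for q v
  proof -
    have qc: "c \<in> charts_at A q" "c' \<in> charts_at A q" using q cA unfolding W_def charts_at_def by auto
    have qb: "chart_map c q \<in> cball (chart_map c p) r" using q unfolding W_def by auto
    have "norm (local_rep c f (chart_map c q)) \<le> norm (local_rep c f (chart_map c p)) + dist (local_rep c f (chart_map c q)) (local_rep c f (chart_map c p))"
      by (simp add: dist_norm norm_triangle_sub)
    also have "dist (local_rep c f (chart_map c q)) (local_rep c f (chart_map c p)) \<le> L * dist (chart_map c q) (chart_map c p)"
      using L(2) qc c by (intro lipschitz_onD) (auto simp: charts_at_def)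
    also have "L * dist (chart_map c q) (chart_map c p) \<le> L * r"
      using qb L by (intro mult_left_mono) (auto simp: dist_commute)
    finally have nB: "norm (local_rep c f (chart_map c q)) \<le> B" unfolding B_def by simp
    have "norm (f q v c) \<le> norm (local_rep c f (chart_map c q)) * norm v"
      unfolding local_rep_apply_chart[OF bs qc(1)] by (rule norm_blinfun)
    also have "\<dots> \<le> B * norm v" using nB by (intro mult_right_mono) auto
    finally have fB: "norm (f q v c) \<le> B * norm v" .
    have "norm (f q v c') \<le> C * norm (f q v c)"
      unfolding section_transition[OF bs qc] by (rule C[OF qb])
    also have "\<dots> \<le> C * (B * norm v)" by (rule mult_left_mono[OF fB r(2)])
    finally show ?thesis by (simp add: mult.assoc)
  qed
  show ?thesis
    by (intro exI[of _ W] exI[of _ "C * B"] conjI ballI allI oW pW bd) (use r(2) B0 in auto)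
qed

lemma lvf_bounded_on_compact:
  fixes f :: "'a \<Rightarrow> 'e \<Rightarrow> ('a, 'b) tvec"
  assumes f: "lvf_structure A f" and c: "c \<in> A" and K: "compact K" "K \<subseteq> chart_dom c"
  obtains C where "C \<ge> 0" "\<And>q v. q \<in> K \<Longrightarrow> norm (f q v c) \<le> C * norm v"
proof -
  have "\<forall>p\<in>K. \<exists>W C. open W \<and> p \<in> W \<and> C \<ge> 0 \<and> (\<forall>q\<in>W. \<forall>v. norm (f q v c) \<le> C * norm v)"
  proof
    fix p assume "p \<in> K"
    then have "c \<in> charts_at A p" using K c by (auto simp: charts_at_def)
    then show "\<exists>W C. open W \<and> p \<in> W \<and> C \<ge> 0 \<and> (\<forall>q\<in>W. \<forall>v. norm (f q v c) \<le> C * norm v)"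
      by (rule lvf_locally_bounded[OF f])
  qed
  then obtain W where "\<forall>p\<in>K. \<exists>C. open (W p) \<and> p \<in> W p \<and> C \<ge> 0 \<and> (\<forall>q\<in>W p. \<forall>v. norm (f q v c) \<le> C * norm v)"
    by (rule bchoice[THEN exE])
  then obtain C where W: "\<forall>p\<in>K. open (W p) \<and> p \<in> W p \<and> C p \<ge> 0 \<and> (\<forall>q\<in>W p. \<forall>v. norm (f q v c) \<le> C p * norm v)"
    by (rule bchoice[THEN exE])
  obtain T where T: "T \<subseteq> K" "finite T" "K \<subseteq> (\<Union>p\<in>T. W p)"
    using compactE_image[OF K(1), of K W] W by blast
  define C' where "C' = (\<Sum>p\<in>T. C p)"
  have "norm (f q v c) \<le> C' * norm v" if q: "q \<in> K" for q v
  proof -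
    obtain p where p: "p \<in> T" "q \<in> W p" using T q by blast
    then have "norm (f q v c) \<le> C p * norm v" using W T by blast
    also have "\<dots> \<le> C' * norm v" unfolding C'_def
      using p T W by (intro mult_right_mono member_le_sum) auto
    finally show ?thesis .
  qed
  moreover have "C' \<ge> 0" unfolding C'_def using T W by (intro sum_nonneg) blast
  ultimately show ?thesis using that by blast
qed

end

section \<open>Trajectories as solutions of an integral equation\<close>

lemma AE_lebesgue_on_iff:
  assumes "S \<in> sets lebesgue"
  shows "(AE t in lebesgue_on S. P t) \<longleftrightarrow> (\<exists>E. negligible E \<and> (\<forall>t\<in>S - E. P t))"
proof -
  have "(AE t in lebesgue_on S. P t) \<longleftrightarrow> (AE t in lebesgue. t \<in> S \<longrightarrow> P t)"
    using assms by (intro AE_restrict_space_iff) simp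
  also have "\<dots> \<longleftrightarrow> (\<exists>E. negligible E \<and> (\<forall>t\<in>S - E. P t))"
  proof
    assume "AE t in lebesgue. t \<in> S \<longrightarrow> P t"
    then obtain E where E: "\<And>t. t \<in> space lebesgue - E \<Longrightarrow> t \<in> S \<longrightarrow> P t" "E \<in> null_sets lebesgue"
      by (rule AE_E3) (use that in blast)
    show "\<exists>E. negligible E \<and> (\<forall>t\<in>S - E. P t)"
      by (intro exI[of _ E]) (use E in \<open>auto simp: negligible_iff_null_sets\<close>)
  next
    assume "\<exists>E. negligible E \<and> (\<forall>t\<in>S - E. P t)"
    then obtain E where E: "negligible E" "\<And>t. t \<in> S - E \<Longrightarrow> P t" by auto
    show "AE t in lebesgue. t \<in> S \<longrightarrow> P t"
      by (rule AE_I'[of E]) (use E in \<open>auto simp: negligible_iff_null_sets\<close>)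
  qed
  finally show ?thesis .
qed

lemma lipschitz_imp_absolutely_continuous:
  assumes "C-lipschitz_on {a..b} g"
  shows "abs_continuous_on_interval a b g"
  unfolding abs_continuous_on_interval_def
proof (intro allI impI)
  fix e :: real assume "e > 0"
  have C: "C \<ge> 0" using assms by (rule lipschitz_on_nonneg)
  show "\<exists>\<delta>>0. \<forall>D :: (real \<times> real) set. finite D \<and> (\<forall>(x, y)\<in>D. a \<le> x \<and> x \<le> y \<and> y \<le> b) \<and>
        pairwise (\<lambda>I J. disjnt {fst I<..<snd I} {fst J<..<snd J}) D \<and>
        (\<Sum>(x, y)\<in>D. y - x) < \<delta> \<longrightarrow> (\<Sum>(x, y)\<in>D. dist (g x) (g y)) < e"
  proof (intro exI[of _ "e / (C + 1)"] conjI allI impI)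
    show "e / (C + 1) > 0" using C \<open>e > 0\<close> by simp
    fix D :: "(real \<times> real) set"
    assume D: "finite D \<and> (\<forall>(x, y)\<in>D. a \<le> x \<and> x \<le> y \<and> y \<le> b) \<and>
        pairwise (\<lambda>I J. disjnt {fst I<..<snd I} {fst J<..<snd J}) D \<and> (\<Sum>(x, y)\<in>D. y - x) < e / (C + 1)"
    have "(\<Sum>(x, y)\<in>D. dist (g x) (g y)) \<le> (\<Sum>(x, y)\<in>D. (C + 1) * (y - x))"
    proof (rule sum_mono, clarify)
      fix x y assume "(x, y) \<in> D"
      then have xy: "a \<le> x" "x \<le> y" "y \<le> b" using D by auto
      then have "dist (g x) (g y) \<le> C * dist x y" by (intro lipschitz_onD[OF assms]) auto
      also have "\<dots> \<le> (C + 1) * (y - x)" using xy by (simp add: dist_real_def mult_right_mono)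
      finally show "dist (g x) (g y) \<le> (C + 1) * (y - x)" .
    qed
    also have "\<dots> = (C + 1) * (\<Sum>(x, y)\<in>D. y - x)" by (simp add: sum_distrib_left split_def)
    also have "\<dots> < (C + 1) * (e / (C + 1))"
      using D C by (intro mult_strict_left_mono) auto
    also have "\<dots> = e" using C by simp
    finally show "(\<Sum>(x, y)\<in>D. dist (g x) (g y)) < e" .
  qed
qed

lemma locally_lipschitz_on_interval:
  fixes g :: "real \<Rightarrow> 'b::metric_space"
  assumes "a \<le> b" and loc: "\<And>x. x \<in> {a..b} \<Longrightarrow> \<exists>d>0. \<exists>L. L-lipschitz_on ({a..b} \<inter> ball x d) g"
  shows "\<exists>L. L-lipschitz_on {a..b} g"
proof -
  have "a \<le> a \<and> b \<le> b \<longrightarrow> (\<exists>L. L-lipschitz_on {a..b} g)"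
    using \<open>a \<le> b\<close>
  proof (induction rule: Bolzano[where P = "\<lambda>s t. a \<le> s \<and> t \<le> b \<longrightarrow> (\<exists>L. L-lipschitz_on {s..t} g)"])
    case (trans s t r)
    show ?case
    proof
      assume "a \<le> s \<and> r \<le> b"
      then obtain L M where "L-lipschitz_on {s..t} g" "M-lipschitz_on {t..r} g"
        using trans by auto
      then have "(max L M)-lipschitz_on {s..r} (\<lambda>x. if x \<le> t then g x else g x)"
        by (rule lipschitz_on_concat_max) simp
      then show "\<exists>L. L-lipschitz_on {s..r} g" by auto
    qed
  next
    case (local x)
    then obtain d L where d: "d > 0" "L-lipschitz_on ({a..b} \<inter> ball x d) g" using loc[of x] by auto
    show ?case
    proof (rule exI[of _ d], intro conjI allI impI d(1))
      fix s t assume "s \<le> x \<and> x \<le> t \<and> t - s < d" "a \<le> s \<and> t \<le> b"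
      then have "{s..t} \<subseteq> {a..b} \<inter> ball x d" by (auto simp: dist_real_def)
      then show "\<exists>L. L-lipschitz_on {s..t} g" using d(2) lipschitz_on_subset by blast
    qed
  qed
  then show ?thesis by simp
qed

lemma Hausdorff_space_t2: "Hausdorff_space (euclidean :: 'a::t2_space topology)"
  unfolding Hausdorff_space_def disjnt_def using hausdorff by auto

context control_manifold
begin

text \<open>Unlike the differential equation, an integral equation in every chart is visibly stable under restriction, concatenation and change of the control on a null set. The integral is that of
  Henstock and Kurzweil, so that integrability is part of the condition.\<close>

definition itraj :: "('a \<Rightarrow> 'e \<Rightarrow> ('a, 'b) tvec) \<Rightarrow> (real \<Rightarrow> 'e) \<Rightarrow> real \<Rightarrow> real \<Rightarrow> (real \<Rightarrow> 'a) \<Rightarrow> bool" where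
  "itraj f u a b g \<longleftrightarrow> continuous_on {a..b} g \<and>
     (\<forall>c\<in>A. \<forall>s t. a \<le> s \<and> s \<le> t \<and> t \<le> b \<and> g ` {s..t} \<subseteq> chart_dom c \<longrightarrow>
        ((\<lambda>r. f (g r) (u r) c) has_integral (chart_map c (g t) - chart_map c (g s))) {s..t})"

lemma itraj_continuous: "itraj f u a b g \<Longrightarrow> continuous_on {a..b} g"
  by (simp add: itraj_def)

lemma itraj_integral:
  assumes "itraj f u a b g" "c \<in> A" "a \<le> s" "s \<le> t" "t \<le> b" "g ` {s..t} \<subseteq> chart_dom c"
  shows "((\<lambda>r. f (g r) (u r) c) has_integral (chart_map c (g t) - chart_map c (g s))) {s..t}"
  using assms by (simp add: itraj_def)

lemma itrajI:
  assumes "continuous_on {a..b} g"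
    and "\<And>c s t. c \<in> A \<Longrightarrow> a \<le> s \<Longrightarrow> s \<le> t \<Longrightarrow> t \<le> b \<Longrightarrow> g ` {s..t} \<subseteq> chart_dom c \<Longrightarrow>
        ((\<lambda>r. f (g r) (u r) c) has_integral (chart_map c (g t) - chart_map c (g s))) {s..t}"
  shows "itraj f u a b g"
  using assms unfolding itraj_def by simp

lemma itraj_subinterval:
  assumes "itraj f u a b g" "a \<le> a'" "b' \<le> b"
  shows "itraj f u a' b' g"
proof (rule itrajI)
  show "continuous_on {a'..b'} g"
    using itraj_continuous[OF assms(1)] by (rule continuous_on_subset) (use assms in auto)
qed (rule itraj_integral[OF assms(1)], use assms in auto)

lemma itraj_cong:
  assumes g: "itraj f u a b g" and E: "negligible E"
    and eq: "\<And>t. t \<in> {a..b} \<Longrightarrow> g t = g' t" "\<And>t. t \<in> {a..b} - E \<Longrightarrow> u t = u' t"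
  shows "itraj f u' a b g'"
proof (rule itrajI)
  show "continuous_on {a..b} g'"
    using itraj_continuous[OF g] continuous_on_cong[of "{a..b}" "{a..b}" g g'] eq by simp
  fix c s t assume h: "c \<in> A" "a \<le> s" "s \<le> t" "t \<le> b" "g' ` {s..t} \<subseteq> chart_dom c"
  have "g ` {s..t} = g' ` {s..t}" using h eq(1) by (intro image_cong) auto
  then have "((\<lambda>r. f (g r) (u r) c) has_integral (chart_map c (g t) - chart_map c (g s))) {s..t}"
    using h by (intro itraj_integral[OF g]) auto
  then have "((\<lambda>r. f (g' r) (u' r) c) has_integral (chart_map c (g t) - chart_map c (g s))) {s..t}"
    by (rule has_integral_spike[OF E, rotated]) (use h eq in auto)
  then show "((\<lambda>r. f (g' r) (u' r) c) has_integral (chart_map c (g' t) - chart_map c (g' s))) {s..t}"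
    using h eq(1) by simp
qed

lemma itraj_join:
  assumes g: "itraj f u a b g" "itraj f u b d g" and ab: "a \<le> b" "b \<le> d"
  shows "itraj f u a d g"
proof (rule itrajI)
  have "{a..d} = {a..b} \<union> {b..d}" using ab by auto
  then show "continuous_on {a..d} g"
    using itraj_continuous[OF g(1)] itraj_continuous[OF g(2)] by (simp add: continuous_on_closed_Un)
  fix c s t assume h: "c \<in> A" "a \<le> s" "s \<le> t" "t \<le> d" "g ` {s..t} \<subseteq> chart_dom c"
  consider "t \<le> b" | "b \<le> s" | "s \<le> b" "b \<le> t" by linarith
  then show "((\<lambda>r. f (g r) (u r) c) has_integral (chart_map c (g t) - chart_map c (g s))) {s..t}"
  proof cases
    case 1 then show ?thesis using h by (intro itraj_integral[OF g(1)]) auto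
  next
    case 2 then show ?thesis using h by (intro itraj_integral[OF g(2)]) auto
  next
    case 3
    have "g ` {s..b} \<subseteq> chart_dom c" "g ` {b..t} \<subseteq> chart_dom c" using h(5) 3 by auto
    then have "((\<lambda>r. f (g r) (u r) c) has_integral (chart_map c (g b) - chart_map c (g s))) {s..b}"
      "((\<lambda>r. f (g r) (u r) c) has_integral (chart_map c (g t) - chart_map c (g b))) {b..t}"
      using h 3 by (auto intro: itraj_integral[OF g(1)] itraj_integral[OF g(2)])
    from has_integral_combine[OF 3 this] show ?thesis by simp
  qed
qed

lemma itraj_affine:
  assumes bs: "bundle_section A f" and g: "itraj f u (m * a + k) (m * b + k) g" and m: "m > 0"
  shows "itraj f (\<lambda>r. m *\<^sub>R u (m * r + k)) a b (\<lambda>r. g (m * r + k))"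
proof (rule itrajI)
  have im: "(\<lambda>r. m * r + k) ` {s..t} = {m * s + k..m * t + k}" if "s \<le> t" for s t
    using image_affinity_atLeastAtMost[of m k s t] m that by simp
  show "continuous_on {a..b} (\<lambda>r. g (m * r + k))"
  proof (cases "a \<le> b")
    case True
    show ?thesis
      by (rule continuous_on_compose2[OF itraj_continuous[OF g]])
        (use im[OF True] in \<open>auto intro!: continuous_intros\<close>)
  qed simp
  fix c s t assume h: "c \<in> A" "a \<le> s" "s \<le> t" "t \<le> b" "(\<lambda>r. g (m * r + k)) ` {s..t} \<subseteq> chart_dom c"
  have "(\<lambda>r. g (m * r + k)) ` {s..t} = g ` {m * s + k..m * t + k}"
    using im[OF h(3)] by (metis image_image)
  then have "((\<lambda>r. f (g r) (u r) c) has_integral (chart_map c (g (m * t + k)) - chart_map c (g (m * s + k)))) (cbox (m * s + k) (m * t + k))"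
    using itraj_integral[OF g h(1), of "m * s + k" "m * t + k"] h m by simp
  from has_integral_affinity[OF this, of m k]
  have "((\<lambda>x. f (g (m * x + k)) (u (m * x + k)) c) has_integral (1 / m) *\<^sub>R (chart_map c (g (m * t + k)) - chart_map c (g (m * s + k))))
     ((\<lambda>x. (1/m) * x + - (k / m)) ` {m * s + k..m * t + k})"
    using m by simp
  moreover have "(\<lambda>x. (1/m) * x + - (k / m)) ` {m * s + k..m * t + k} = {s..t}"
    using image_affinity_atLeastAtMost[of "1/m" "- (k/m)" "m * s + k" "m * t + k"] m h(3)
    by (simp add: field_simps)
  ultimately have "((\<lambda>x. m *\<^sub>R f (g (m * x + k)) (u (m * x + k)) c) has_integral
      m *\<^sub>R ((1 / m) *\<^sub>R (chart_map c (g (m * t + k)) - chart_map c (g (m * s + k))))) {s..t}"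
    by (intro has_integral_cmul) simp
  then show "((\<lambda>r. f (g (m * r + k)) (m *\<^sub>R u (m * r + k)) c) has_integral
      (chart_map c (g (m * t + k)) - chart_map c (g (m * s + k)))) {s..t}"
    using m by (simp add: bundle_sectionD(2)[OF bs])
qed

lemma itraj_reverse:
  assumes bs: "bundle_section A f" and g: "itraj f u (- b) (- a) g"
  shows "itraj f (\<lambda>r. - u (- r)) a b (\<lambda>r. g (- r))"
proof (rule itrajI)
  show "continuous_on {a..b} (\<lambda>r. g (- r))"
    by (rule continuous_on_compose2[OF itraj_continuous[OF g]]) (auto intro!: continuous_intros)
  fix c s t assume h: "c \<in> A" "a \<le> s" "s \<le> t" "t \<le> b" "(\<lambda>r. g (- r)) ` {s..t} \<subseteq> chart_dom c"
  have "(\<lambda>r. g (- r)) ` {s..t} = g ` {- t..- s}"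
    using image_uminus_atLeastAtMost[of s t] by (metis image_image)
  then have "((\<lambda>r. f (g r) (u r) c) has_integral (chart_map c (g (- s)) - chart_map c (g (- t)))) {- t..- s}"
    using itraj_integral[OF g h(1), of "- t" "- s"] h by simp
  then have "((\<lambda>r. f (g (- r)) (u (- r)) c) has_integral (chart_map c (g (- s)) - chart_map c (g (- t)))) {s..t}"
    using has_integral_reflect_real[of "\<lambda>r. f (g r) (u r) c" _ "- s" "- t"] by simp
  from has_integral_neg[OF this]
  show "((\<lambda>r. f (g (- r)) (- u (- r)) c) has_integral (chart_map c (g (- t)) - chart_map c (g (- s)))) {s..t}"
    by (simp add: bundle_sectionD(6)[OF bs])
qed

lemma itraj_displacement:
  assumes g: "itraj f u a b g" and c: "c \<in> A" and st: "a \<le> s" "s \<le> t" "t \<le> b" and im: "g ` {s..t} \<subseteq> chart_dom c"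
    and B: "\<And>r. r \<in> {s..t} \<Longrightarrow> norm (f (g r) (u r) c) \<le> B"
  shows "norm (chart_map c (g t) - chart_map c (g s)) \<le> B * (t - s)"
proof -
  have "s \<in> {s..t}" using st by simp
  then have "B \<ge> 0" by (rule order_trans[OF norm_ge_zero B])
  have "((\<lambda>r. f (g r) (u r) c) has_integral (chart_map c (g t) - chart_map c (g s))) (cbox s t)"
    using itraj_integral[OF g c st im] by simp
  from has_integral_bound[OF \<open>B \<ge> 0\<close> this] B show ?thesis using st by simp
qed

text \<open>The set of times at which the curves agree is closed. It is open by Gronwall's argument: on an interval so short that
  \<open>d * (L * C) \<le> 1/2\<close>, the maximal distance of the two curves in a chart is at most half of itself.\<close>

lemma itraj_unique:
  assumes f: "lvf_structure A f" and g: "itraj f u a b g" and h: "itraj f u a b h" and gh: "g a = h a"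
    and u: "\<And>r. r \<in> {a..b} \<Longrightarrow> norm (u r) \<le> C" and t: "t \<in> {a..b}"
  shows "g t = h t"
proof -
  have bs: "bundle_section A f" using f by (simp add: lvf_structure_def)
  define Z where "Z = {t \<in> {a..b}. g t = h t}"
  have cg: "continuous_on {a..b} g" and ch: "continuous_on {a..b} h"
    using g h by (simp_all add: itraj_continuous)
  have "closedin (top_of_set {a..b}) {t \<in> topspace (top_of_set {a..b}). g t = h t}"
    by (rule closedin_continuous_maps_eq[of euclidean]) (use cg ch in \<open>auto simp: Hausdorff_space_t2\<close>)
  then have cl: "closedin (top_of_set {a..b}) Z" by (simp add: Z_def)
  have op: "openin (top_of_set {a..b}) Z"
    unfolding openin_euclidean_subtopology_iff
  proof (intro conjI ballI)
    show "Z \<subseteq> {a..b}" by (auto simp: Z_def)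
    fix t assume "t \<in> Z"
    then have t: "t \<in> {a..b}" "g t = h t" by (auto simp: Z_def)
    obtain c L where c: "c \<in> charts_at A (g t)" and L: "L > 0" "L-lipschitz_on (chart_map c ` chart_dom c) (local_rep c f)"
      using f unfolding lvf_structure_def uniformly_locally_lipschitz_def by blast
    have cA: "c \<in> A" "open (chart_dom c)" "g t \<in> chart_dom c" using c chart_props(1) by (auto simp: charts_at_def)
    have nb: "\<exists>d>0. \<forall>s\<in>{a..b}. dist s t < d \<longrightarrow> k s \<in> chart_dom c" if k: "continuous_on {a..b} k" "k t = g t" for k
    proof -
      have "openin (top_of_set {a..b}) ({a..b} \<inter> k -` chart_dom c)"
        using k(1) cA(2) by (simp add: continuous_openin_preimage_gen)
      moreover have "t \<in> {a..b} \<inter> k -` chart_dom c" using t k cA by simp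
      ultimately show ?thesis unfolding openin_euclidean_subtopology_iff by auto
    qed
    obtain d1 where d1: "d1 > 0" "\<forall>s\<in>{a..b}. dist s t < d1 \<longrightarrow> g s \<in> chart_dom c" using nb[OF cg] by auto
    obtain d2 where d2: "d2 > 0" "\<forall>s\<in>{a..b}. dist s t < d2 \<longrightarrow> h s \<in> chart_dom c" using nb[OF ch] t by auto
    have C0: "C \<ge> 0" by (rule order_trans[OF norm_ge_zero u[OF t(1)]])
    define m where "m = min (min d1 d2) (1 / (2 * (L * C + 1)))"
    define d where "d = m / 2"
    have LC: "L * C \<ge> 0" using L C0 by simp
    then have X: "1 / (2 * (L * C + 1)) > 0" by (intro divide_pos_pos) auto
    have m: "m > 0" "m \<le> d1" "m \<le> d2" "m \<le> 1 / (2 * (L * C + 1))" unfolding m_def using d1 d2 X by auto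
    then have d0: "d > 0" and dd: "d < d1" "d < d2" unfolding d_def by auto
    have "d \<le> 1 / (2 * (L * C + 1))" unfolding d_def using m by linarith
    then have "d * (2 * (L * C + 1)) \<le> 1" using LC by (simp add: field_simps)
    then have dLC: "d * (L * C) \<le> 1/2" using d0 by (simp add: algebra_simps)
    define J where "J = {max a (t - d)..min b (t + d)}"
    have J: "J \<subseteq> {a..b}" "t \<in> J" "\<And>s. s \<in> J \<Longrightarrow> \<bar>s - t\<bar> \<le> d" unfolding J_def using t d0 by auto
    have domg: "g s \<in> chart_dom c" and domh: "h s \<in> chart_dom c" if "s \<in> J" for s
      using d1 d2 dd J(1) J(3)[OF that] that by (auto simp: dist_real_def)
    let ?w = "\<lambda>s. norm (chart_map c (g s) - chart_map c (h s))"
    have "continuous_on J ?w"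
    proof (intro continuous_intros)
      show "continuous_on J (\<lambda>s. chart_map c (g s))"
        by (rule continuous_on_compose2[OF chart_props(3)[OF cA(1)] continuous_on_subset[OF cg J(1)]]) (use domg in auto)
      show "continuous_on J (\<lambda>s. chart_map c (h s))"
        by (rule continuous_on_compose2[OF chart_props(3)[OF cA(1)] continuous_on_subset[OF ch J(1)]]) (use domh in auto)
    qed
    then obtain s where s: "s \<in> J" "\<And>r. r \<in> J \<Longrightarrow> ?w r \<le> ?w s"
      using continuous_attains_sup[of J ?w] J(2) unfolding J_def by auto
    have bound: "norm (f (g r) (u r) c - f (h r) (u r) c) \<le> (L * C) * ?w s" if r: "r \<in> J" for r
    proof -
      have cg': "c \<in> charts_at A (g r)" "c \<in> charts_at A (h r)" using domg[OF r] domh[OF r] cA by (auto simp: charts_at_def)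
      have "f (g r) (u r) c - f (h r) (u r) c = blinfun_apply (local_rep c f (chart_map c (g r)) - local_rep c f (chart_map c (h r))) (u r)"
        by (simp add: local_rep_apply_chart[OF bs cg'(1)] local_rep_apply_chart[OF bs cg'(2)] blinfun.diff_left)
      then have "norm (f (g r) (u r) c - f (h r) (u r) c) \<le> norm (local_rep c f (chart_map c (g r)) - local_rep c f (chart_map c (h r))) * norm (u r)"
        by (simp add: norm_blinfun)
      also have "\<dots> \<le> (L * ?w r) * C"
      proof (rule mult_mono)
        show "norm (local_rep c f (chart_map c (g r)) - local_rep c f (chart_map c (h r))) \<le> L * ?w r"
          using lipschitz_onD[OF L(2), of "chart_map c (g r)" "chart_map c (h r)"] domg[OF r] domh[OF r] by (simp add: dist_norm)
        show "norm (u r) \<le> C" using u J(1) r by auto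
      qed (use L in auto)
      also have "\<dots> \<le> (L * ?w s) * C" using s(2)[OF r] L C0 by (intro mult_right_mono mult_left_mono) auto
      finally show ?thesis by (simp add: mult_ac)
    qed
    have main: "norm ((chart_map c (g y) - chart_map c (h y)) - (chart_map c (g x) - chart_map c (h x))) \<le> (L * C * ?w s) * (y - x)"
      if xy: "x \<le> y" "x \<in> J" "y \<in> J" for x y
    proof -
      have sub: "{x..y} \<subseteq> J" using xy unfolding J_def by auto
      have ab: "a \<le> x" "y \<le> b" using xy J(1) by auto
      have ig: "((\<lambda>r. f (g r) (u r) c) has_integral (chart_map c (g y) - chart_map c (g x))) {x..y}"
        by (rule itraj_integral[OF g cA(1) ab(1) xy(1) ab(2)]) (use domg sub in auto)
      have ih: "((\<lambda>r. f (h r) (u r) c) has_integral (chart_map c (h y) - chart_map c (h x))) {x..y}"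
        by (rule itraj_integral[OF h cA(1) ab(1) xy(1) ab(2)]) (use domh sub in auto)
      have "((\<lambda>r. f (g r) (u r) c - f (h r) (u r) c) has_integral
          ((chart_map c (g y) - chart_map c (g x)) - (chart_map c (h y) - chart_map c (h x)))) (cbox x y)"
        using has_integral_diff[OF ig ih] by simp
      then have "norm ((chart_map c (g y) - chart_map c (g x)) - (chart_map c (h y) - chart_map c (h x))) \<le> (L * C * ?w s) * measure lborel (cbox x y)"
        by (intro has_integral_bound[of "L * C * ?w s"]) (use bound sub LC in auto)
      then show ?thesis using xy by (simp add: algebra_simps)
    qed
    have "?w s \<le> (L * C * ?w s) * \<bar>s - t\<bar>"
    proof (cases "t \<le> s")
      case True then show ?thesis using main[OF True J(2) s(1)] t by simp
    next
      case False then show ?thesis using main[of s t] J(2) s(1) t by (simp add: norm_minus_commute)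
    qed
    also have "\<dots> \<le> (L * C * ?w s) * d" using J(3)[OF s(1)] LC by (intro mult_left_mono) auto
    also have "\<dots> = (d * (L * C)) * ?w s" by simp
    also have "\<dots> \<le> (1/2) * ?w s" by (rule mult_right_mono[OF dLC]) simp
    finally have "?w s \<le> 0" by simp
    then have "chart_map c (g r) = chart_map c (h r)" if "r \<in> J" for r
      using s(2)[OF that] norm_ge_zero[of "chart_map c (g r) - chart_map c (h r)"] by simp
    then have eqJ: "g r = h r" if "r \<in> J" for r
      using chart_props(5)[OF cA(1), of "g r"] chart_props(5)[OF cA(1), of "h r"] domg[OF that] domh[OF that] that by metis
    show "\<exists>e>0. \<forall>x'\<in>{a..b}. dist x' t < e \<longrightarrow> x' \<in> Z"
    proof (intro exI[of _ d] conjI d0 ballI impI)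
      fix r assume "r \<in> {a..b}" "dist r t < d"
      then show "r \<in> Z" unfolding Z_def using eqJ[of r] by (auto simp: J_def dist_real_def abs_less_iff)
    qed
  qed
  have "a \<in> Z" unfolding Z_def using gh t by auto
  moreover have "connected {a..b}" by simp
  ultimately have "Z = {a..b}" using cl op unfolding connected_clopen by auto
  then have "t \<in> Z" using t by simp
  then show ?thesis by (simp add: Z_def)
qed

text \<open>Transition maps are locally Lipschitz.\<close>

lemma chart_lipschitz_transfer:
  assumes c: "c \<in> A" "c' \<in> A" and g: "continuous_on {a..b} g" and t: "t \<in> {a..b}"
    and dom: "g t \<in> chart_dom c" "g t \<in> chart_dom c'"
    and lip: "d > 0" "L-lipschitz_on ({a..b} \<inter> ball t d) (chart_map c \<circ> g)"
  shows "\<exists>d>0. \<exists>L. L-lipschitz_on ({a..b} \<inter> ball t d) (chart_map c' \<circ> g)"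
proof -
  have at: "c \<in> charts_at A (g t)" "c' \<in> charts_at A (g t)" using c dom by (auto simp: charts_at_def)
  obtain r C where r: "r > 0" "cball (chart_map c (g t)) r \<subseteq> chart_map c ` (chart_dom c \<inter> chart_dom c')"
    and C: "C-lipschitz_on (cball (chart_map c (g t)) r) (transition c c')"
    using transition_locally_bounded[OF at] by metis
  define W where "W = chart_dom c \<inter> chart_map c -` ball (chart_map c (g t)) r"
  have "open W" unfolding W_def using chart_props(1,3)[OF c(1)] by (intro continuous_open_preimage) auto
  then have "openin (top_of_set {a..b}) ({a..b} \<inter> g -` W)"
    using g by (simp add: continuous_openin_preimage_gen)
  moreover have "t \<in> {a..b} \<inter> g -` W" using t dom r unfolding W_def by simp
  ultimately obtain e where e: "e > 0" "\<forall>s\<in>{a..b}. dist s t < e \<longrightarrow> s \<in> {a..b} \<inter> g -` W"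
    unfolding openin_euclidean_subtopology_iff by blast
  define S where "S = {a..b} \<inter> ball t (min d e)"
  have SW: "g s \<in> W" if "s \<in> S" for s using e that unfolding S_def by (auto simp: dist_commute)
  have "(C * L)-lipschitz_on S (transition c c' \<circ> (chart_map c \<circ> g))"
  proof (rule lipschitz_on_compose)
    show "L-lipschitz_on S (chart_map c \<circ> g)"
      by (rule lipschitz_on_subset[OF lip(2)]) (auto simp: S_def)
    show "C-lipschitz_on ((chart_map c \<circ> g) ` S) (transition c c')"
      by (rule lipschitz_on_subset[OF C]) (use SW in \<open>fastforce simp: W_def\<close>)
  qed
  moreover have "(transition c c' \<circ> (chart_map c \<circ> g)) s = (chart_map c' \<circ> g) s" if "s \<in> S" for s
    using SW[OF that] chart_props(5)[OF c(1)] unfolding W_def by simp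
  ultimately have "(C * L)-lipschitz_on S (chart_map c' \<circ> g)"
    unfolding lipschitz_on_def by simp
  then show ?thesis unfolding S_def using lip(1) e(1) by (intro exI[of _ "min d e"] conjI exI[of _ "C * L"]) auto
qed

text \<open>The curve is Lipschitz in the chart \<open>c\<close> and therefore locally in any other chart. There it is absolutely
  continuous, and its velocity is, almost everywhere, the transformed velocity from the chart \<open>c\<close>.\<close>

lemma itraj_chartI:
  assumes bs: "bundle_section A f" and g: "continuous_on {a..b} g" and c: "c \<in> A" "g ` {a..b} \<subseteq> chart_dom c"
    and int: "\<And>s t. a \<le> s \<Longrightarrow> s \<le> t \<Longrightarrow> t \<le> b \<Longrightarrow>
        ((\<lambda>r. f (g r) (u r) c) has_integral (chart_map c (g t) - chart_map c (g s))) {s..t}"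
    and bound: "\<And>r. r \<in> {a..b} \<Longrightarrow> norm (f (g r) (u r) c) \<le> B"
  shows "itraj f u a b g"
proof (rule itrajI[OF g])
  fix c' s t assume h: "c' \<in> A" "a \<le> s" "s \<le> t" "t \<le> b" "g ` {s..t} \<subseteq> chart_dom c'"
  let ?F = "\<lambda>r. f (g r) (u r) c"
  let ?y = "chart_map c \<circ> g"
  have gst: "continuous_on {s..t} g" by (rule continuous_on_subset[OF g]) (use h in auto)
  have "s \<in> {a..b}" using h by auto
  then have B0: "B \<ge> 0" by (rule order_trans[OF norm_ge_zero bound])
  have yl: "B-lipschitz_on {s..t} ?y"
  proof (rule lipschitz_onI[OF _ B0])
    have *: "dist (?y x) (?y y) \<le> B * dist x y" if xy: "s \<le> x" "x \<le> y" "y \<le> t" for x y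
    proof -
      have "(?F has_integral (?y y - ?y x)) (cbox x y)" using int[of x y] xy h by simp
      then have "norm (?y y - ?y x) \<le> B * measure lborel (cbox x y)"
        by (intro has_integral_bound[of B ?F]) (use B0 bound xy h in auto)
      then show ?thesis using xy by (simp add: dist_norm norm_minus_commute)
    qed
    fix x y assume "x \<in> {s..t}" "y \<in> {s..t}"
    then show "dist (?y x) (?y y) \<le> B * dist x y"
      using *[of x y] *[of y x] by (cases "x \<le> y") (auto simp: dist_commute)
  qed
  have "\<exists>L. L-lipschitz_on {s..t} (chart_map c' \<circ> g)"
  proof (rule locally_lipschitz_on_interval[OF h(3)])
    fix x assume x: "x \<in> {s..t}"
    show "\<exists>d>0. \<exists>L. L-lipschitz_on ({s..t} \<inter> ball x d) (chart_map c' \<circ> g)"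
      by (rule chart_lipschitz_transfer[OF c(1) h(1) gst x, of 1 B])
        (use x h c lipschitz_on_subset[OF yl] in auto)
  qed
  then obtain L where "L-lipschitz_on {s..t} (chart_map c' \<circ> g)" ..
  then have ac: "abs_continuous_on_interval s t (chart_map c' \<circ> g)" by (rule lipschitz_imp_absolutely_continuous)
  have "?F integrable_on {s..t}" using int[of s t] h by auto
  then obtain E where E: "negligible E"
    "\<And>x. x \<in> {s..t} - E \<Longrightarrow> ((\<lambda>r. integral {s..r} ?F) has_vector_derivative ?F x) (at x within {s..t})"
    by (rule indefinite_integral_has_derivative_ae[OF h(3)]) (use that in blast)
  have der: "((chart_map c' \<circ> g) has_vector_derivative f (g x) (u x) c') (at x within {s..t})" if x: "x \<in> {s..t} - E" for x
  proof (rule velocity_transfer)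
    show "c \<in> charts_at A (g x)" "c' \<in> charts_at A (g x)" using x h c by (auto simp: charts_at_def)
    show "f (g x) (u x) \<in> tangent_space A (g x)" by (rule bundle_sectionD(1)[OF bs])
    show "continuous (at x within {s..t}) g" using gst x by (simp add: continuous_on_eq_continuous_within)
    show "x \<in> {s..t}" using x by simp
    have "((\<lambda>r. ?y s + integral {s..r} ?F) has_vector_derivative (0 + ?F x)) (at x within {s..t})"
      by (rule has_vector_derivative_add[OF has_vector_derivative_const E(2)[OF x]])
    moreover have "?y s + integral {s..r} ?F = ?y r" if "r \<in> {s..t}" for r
      using integral_unique[OF int[of s r]] that h by simp
    ultimately show "(?y has_vector_derivative ?F x) (at x within {s..t})"
      using has_vector_derivative_transform[of x "{s..t}" ?y "\<lambda>r. ?y s + integral {s..r} ?F"] x by simp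
  qed
  have "((\<lambda>r. f (g r) (u r) c') has_integral ((chart_map c' \<circ> g) t - (chart_map c' \<circ> g) s)) {s..t}"
    by (rule absolutely_continuous_has_integral[OF h(3) ac E(1) der])
  then show "((\<lambda>r. f (g r) (u r) c') has_integral (chart_map c' (g t) - chart_map c' (g s))) {s..t}" by simp
qed

lemma is_trajectory_imp_itraj:
  assumes "is_trajectory A x0 f u g"
  shows "itraj f u 0 1 g"
proof (rule itrajI)
  have ac: "abs_continuous_curve A g" using assms unfolding is_trajectory_def by simp
  show "continuous_on {0..1} g" using ac unfolding abs_continuous_curve_def by simp
  fix c s t assume h: "c \<in> A" "0 \<le> s" "s \<le> t" "t \<le> 1" "g ` {s..t} \<subseteq> chart_dom c"
  have "AE t in lebesgue_on {0..1}. has_velocity A g (f (g t) (u t)) t {0..1}"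
    using assms unfolding is_trajectory_def by simp
  then obtain E where E: "negligible E" "\<forall>t\<in>{0..1} - E. has_velocity A g (f (g t) (u t)) t {0..1}"
    by (subst (asm) AE_lebesgue_on_iff) auto
  have "((\<lambda>r. f (g r) (u r) c) has_integral ((chart_map c \<circ> g) t - (chart_map c \<circ> g) s)) {s..t}"
  proof (rule absolutely_continuous_has_integral[OF h(3) _ E(1)])
    show "abs_continuous_on_interval s t (chart_map c \<circ> g)"
      using ac h unfolding abs_continuous_curve_def by simp
    fix x assume x: "x \<in> {s..t} - E"
    then have "has_velocity A g (f (g x) (u x)) x {0..1}" using E(2) h by auto
    moreover have "c \<in> charts_at A (g x)" using x h by (auto simp: charts_at_def)
    ultimately have "((chart_map c \<circ> g) has_vector_derivative f (g x) (u x) c) (at x within {0..1})"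
      unfolding has_velocity_def by simp
    then show "((chart_map c \<circ> g) has_vector_derivative f (g x) (u x) c) (at x within {s..t})"
      by (rule has_vector_derivative_within_subset) (use h in auto)
  qed
  then show "((\<lambda>r. f (g r) (u r) c) has_integral (chart_map c (g t) - chart_map c (g s))) {s..t}" by simp
qed

text \<open>One null set has to serve all charts. Intervals with rational endpoints that are mapped into one chart
  domain are countable in number and cover all times; at a time outside the exceptional sets of all of them, the velocity in one
  chart determines the velocities in the others.\<close>

lemma itraj_imp_is_trajectory:
  assumes f: "lvf_structure A f" and g: "itraj f u 0 1 g" and g0: "g 0 = x0"
    and u: "\<And>t. t \<in> {0..1} \<Longrightarrow> norm (u t) \<le> C"
  shows "is_trajectory A x0 f u g"
proof -
  have bs: "bundle_section A f" using f by (simp add: lvf_structure_def)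
  have cg: "continuous_on {0..1} g" by (rule itraj_continuous[OF g])
  have C0: "C \<ge> 0" using order_trans[OF norm_ge_zero u[of 0]] by simp
  have lip: "\<exists>L. L-lipschitz_on {a..b} (chart_map c \<circ> g)"
    if h: "c \<in> A" "0 \<le> a" "a \<le> b" "b \<le> 1" "g ` {a..b} \<subseteq> chart_dom c" for c a b
  proof -
    have "compact (g ` {a..b})"
      by (rule compact_continuous_image[OF continuous_on_subset[OF cg]]) (use h in auto)
    then obtain K where K: "K \<ge> 0" "\<And>q v. q \<in> g ` {a..b} \<Longrightarrow> norm (f q v c) \<le> K * norm v"
      by (rule lvf_bounded_on_compact[OF f h(1) _ h(5)]) (use that in blast)
    have B: "norm (f (g r) (u r) c) \<le> K * C" if "r \<in> {a..b}" for r
    proof -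
      have "norm (f (g r) (u r) c) \<le> K * norm (u r)" using K(2) that by simp
      also have "\<dots> \<le> K * C" using u[of r] that h K(1) by (intro mult_left_mono) auto
      finally show ?thesis .
    qed
    have *: "dist ((chart_map c \<circ> g) x) ((chart_map c \<circ> g) y) \<le> (K * C) * dist x y" if xy: "a \<le> x" "x \<le> y" "y \<le> b" for x y
    proof -
      have im: "g ` {x..y} \<subseteq> chart_dom c" using h(5) xy by auto
      have "norm (chart_map c (g y) - chart_map c (g x)) \<le> (K * C) * (y - x)"
        by (rule itraj_displacement[OF g h(1) _ xy(2) _ im]) (use B xy h in auto)
      then show ?thesis using xy by (simp add: dist_norm norm_minus_commute)
    qed
    have "(K * C)-lipschitz_on {a..b} (chart_map c \<circ> g)"
    proof (rule lipschitz_onI)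
      fix x y assume "x \<in> {a..b}" "y \<in> {a..b}"
      then show "dist ((chart_map c \<circ> g) x) ((chart_map c \<circ> g) y) \<le> (K * C) * dist x y"
        using *[of x y] *[of y x] by (cases "x \<le> y") (auto simp: dist_commute)
    qed (use K C0 in simp)
    then show ?thesis ..
  qed
  have "abs_continuous_curve A g"
    unfolding abs_continuous_curve_def
  proof (intro conjI cg ballI allI impI)
    fix c a b assume "c \<in> A" "0 \<le> a \<and> a \<le> b \<and> b \<le> 1 \<and> g ` {a..b} \<subseteq> chart_dom c"
    then obtain L where "L-lipschitz_on {a..b} (chart_map c \<circ> g)" using lip[of c a b] by auto
    then show "abs_continuous_on_interval a b (chart_map c \<circ> g)" by (rule lipschitz_imp_absolutely_continuous)
  qed
  moreover have "AE t in lebesgue_on {0..1}. has_velocity A g (f (g t) (u t)) t {0..1}"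
  proof -
    define Q where "Q = {(a, b). a \<in> \<rat> \<and> b \<in> \<rat> \<and> 0 \<le> a \<and> a \<le> b \<and> b \<le> 1 \<and> (\<exists>c\<in>A. g ` {a..b} \<subseteq> chart_dom c)}"
    define P where "P = (\<lambda>(a, b) E. negligible E \<and> (\<exists>c\<in>A. g ` {a..b} \<subseteq> chart_dom c \<and> (\<forall>x\<in>{a..b} - E.
         ((chart_map c \<circ> g) has_vector_derivative f (g x) (u x) c) (at x within {a..b}))))"
    have "Q \<subseteq> \<rat> \<times> \<rat>" unfolding Q_def by auto
    then have Qc: "countable Q" by (rule countable_subset) (intro countable_SIGMA countable_rat)
    have "\<forall>z\<in>Q. \<exists>E. P z E"
    proof
      fix z assume "z \<in> Q"
      then obtain a b c where z: "z = (a, b)" and h: "0 \<le> a" "a \<le> b" "b \<le> 1" "c \<in> A" "g ` {a..b} \<subseteq> chart_dom c"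
        unfolding Q_def by blast
      let ?F = "\<lambda>r. f (g r) (u r) c"
      have int: "(?F has_integral (chart_map c (g r) - chart_map c (g a))) {a..r}" if "r \<in> {a..b}" for r
        by (rule itraj_integral[OF g h(4)]) (use that h in auto)
      have "?F integrable_on {a..b}" using int[of b] h by auto
      then obtain E where E: "negligible E"
        "\<And>x. x \<in> {a..b} - E \<Longrightarrow> ((\<lambda>r. integral {a..r} ?F) has_vector_derivative ?F x) (at x within {a..b})"
        by (rule indefinite_integral_has_derivative_ae[OF h(2)]) (use that in blast)
      have "((chart_map c \<circ> g) has_vector_derivative ?F x) (at x within {a..b})" if x: "x \<in> {a..b} - E" for x
      proof -
        have "((\<lambda>r. chart_map c (g a) + integral {a..r} ?F) has_vector_derivative (0 + ?F x)) (at x within {a..b})"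
          by (rule has_vector_derivative_add[OF has_vector_derivative_const E(2)[OF x]])
        moreover have "chart_map c (g a) + integral {a..r} ?F = (chart_map c \<circ> g) r" if "r \<in> {a..b}" for r
          using integral_unique[OF int[OF that]] by simp
        ultimately show ?thesis
          using has_vector_derivative_transform[of x "{a..b}" "chart_map c \<circ> g" "\<lambda>r. chart_map c (g a) + integral {a..r} ?F"] x by simp
      qed
      then show "\<exists>E. P z E" unfolding P_def z prod.case using E(1) h
        by (intro exI[of _ E] conjI bexI[of _ c]) auto
    qed
    then obtain E where E: "\<forall>z\<in>Q. P z (E z)" by (rule bchoice[THEN exE])
    define E' where "E' = (\<Union>z\<in>Q. E z) \<union> {0, 1}"
    have "negligible (\<Union>z\<in>Q. E z)"
      by (rule negligible_countable_Union) (use Qc E in \<open>auto simp: P_def\<close>)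
    then have nE': "negligible E'" unfolding E'_def by (intro negligible_Un) auto
    have "has_velocity A g (f (g t) (u t)) t {0..1}" if t: "t \<in> {0..1} - E'" for t
    proof -
      have t01: "0 < t" "t < 1" using t unfolding E'_def by auto
      obtain c where c: "c \<in> charts_at A (g t)" using ex_chart_at by blast
      have "openin (top_of_set {0..1}) ({0..1} \<inter> g -` chart_dom c)"
        using cg chart_props(1) c by (simp add: continuous_openin_preimage_gen charts_at_def)
      moreover have "t \<in> {0..1} \<inter> g -` chart_dom c" using t c by (auto simp: charts_at_def)
      ultimately obtain d where d: "d > 0" "\<forall>s\<in>{0..1}. dist s t < d \<longrightarrow> s \<in> {0..1} \<inter> g -` chart_dom c"
        unfolding openin_euclidean_subtopology_iff by blast
      obtain a where a: "a \<in> \<rat>" "max 0 (t - d) < a" "a < t" using Rats_dense_in_real[of "max 0 (t - d)" t] t01 d by auto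
      obtain b where b: "b \<in> \<rat>" "t < b" "b < min 1 (t + d)" using Rats_dense_in_real[of t "min 1 (t + d)"] t01 d by auto
      have "g ` {a..b} \<subseteq> chart_dom c"
      proof
        fix q assume "q \<in> g ` {a..b}"
        then obtain s where s: "q = g s" "a \<le> s" "s \<le> b" by auto
        then have "s \<in> {0..1}" "dist s t < d" using a b by (auto simp: dist_real_def abs_less_iff)
        then show "q \<in> chart_dom c" using d(2) s(1) by auto
      qed
      then have "(a, b) \<in> Q" unfolding Q_def using a b c by (auto simp: charts_at_def)
      then have "P (a, b) (E (a, b))" and tE: "t \<notin> E (a, b)" using E t unfolding E'_def by auto
      then obtain c' where c': "c' \<in> A" "g ` {a..b} \<subseteq> chart_dom c'" and
        der: "\<forall>x\<in>{a..b} - E (a, b). ((chart_map c' \<circ> g) has_vector_derivative f (g x) (u x) c') (at x within {a..b})"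
        unfolding P_def by auto
      have tab: "t \<in> {a..b} - E (a, b)" using tE a b by auto
      have d1: "((chart_map c' \<circ> g) has_vector_derivative f (g t) (u t) c') (at t within {a..b})" by (rule bspec[OF der tab])
      have "at t within {a..b} = at t" by (rule at_within_interior) (use a b in \<open>auto simp: interior_atLeastAtMost_real\<close>)
      moreover have "at t within {0..1} = at t" by (rule at_within_interior) (use t01 in \<open>auto simp: interior_atLeastAtMost_real\<close>)
      ultimately have d2: "((chart_map c' \<circ> g) has_vector_derivative f (g t) (u t) c') (at t within {0..1})" using d1 by simp
      show ?thesis unfolding has_velocity_def
      proof
        fix c'' assume c'': "c'' \<in> charts_at A (g t)"
        show "((chart_map c'' \<circ> g) has_vector_derivative f (g t) (u t) c'') (at t within {0..1})"
        proof (rule velocity_transfer[of c' g t c'' "f (g t) (u t)", OF _ c'' _ _ _ d2])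
          show "c' \<in> charts_at A (g t)" using c' tab by (auto simp: charts_at_def)
          show "f (g t) (u t) \<in> tangent_space A (g t)" by (rule bundle_sectionD(1)[OF bs])
          show "continuous (at t within {0..1}) g" using cg t by (simp add: continuous_on_eq_continuous_within)
        qed (use t in simp)
      qed
    qed
    then show ?thesis using nE' by (subst AE_lebesgue_on_iff) auto
  qed
  ultimately show ?thesis unfolding is_trajectory_def using g0 by simp
qed

end

section \<open>Curves of bounded energy and the Carnot--Caratheodory distance\<close>

lemma measurable_lebesgue_on_affine:
  fixes u :: "real \<Rightarrow> 'e::real_normed_vector"
  assumes u: "u \<in> borel_measurable (lebesgue_on {a..b})" and m: "m \<noteq> 0"
    and im: "\<And>t. t \<in> {a'..b'} \<Longrightarrow> m * t + k \<in> {a..b}"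
  shows "(\<lambda>t. u (m * t + k)) \<in> borel_measurable (lebesgue_on {a'..b'})"
proof -
  define U where "U t = (if t \<in> {a..b} then u t else 0)" for t
  have U: "U \<in> borel_measurable lebesgue"
    using measurable_restrict_space_iff[of "{a..b}" lebesgue 0 borel u] u unfolding U_def by simp
  have "(\<lambda>x::real. k + (\<Sum>j\<in>Basis. ((\<lambda>_. m) j * (x \<bullet> j)) *\<^sub>R j)) \<in> lebesgue \<rightarrow>\<^sub>M lebesgue"
    by (rule lebesgue_affine_measurable) (use m in simp)
  then have "(\<lambda>x::real. m * x + k) \<in> lebesgue \<rightarrow>\<^sub>M lebesgue" by (simp add: add.commute)
  then have "(\<lambda>x. U (m * x + k)) \<in> borel_measurable lebesgue" using U by (rule measurable_compose)
  then have "(\<lambda>x. U (m * x + k)) \<in> borel_measurable (lebesgue_on {a'..b'})" by (rule measurable_restrict_space1)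
  then show ?thesis by (rule measurable_cong[THEN iffD1, rotated]) (use im in \<open>auto simp: U_def\<close>)
qed

lemma measurable_lebesgue_on_join:
  fixes u1 u2 :: "real \<Rightarrow> 'e::real_normed_vector"
  assumes u: "u1 \<in> borel_measurable (lebesgue_on {a..b})" "u2 \<in> borel_measurable (lebesgue_on {b..d})"
  shows "(\<lambda>t. if t \<le> b then u1 t else u2 t) \<in> borel_measurable (lebesgue_on {a..d})"
proof -
  have U: "(\<lambda>t. if t \<in> {a..b} then u1 t else 0) \<in> borel_measurable lebesgue"
    "(\<lambda>t. if t \<in> {b..d} then u2 t else 0) \<in> borel_measurable lebesgue"
    using measurable_restrict_space_iff[of "{a..b}" lebesgue 0 borel u1] measurable_restrict_space_iff[of "{b..d}" lebesgue 0 borel u2] u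
    by simp_all
  have "(\<lambda>t. if t \<in> {..b} then (if t \<in> {a..b} then u1 t else 0) else (if t \<in> {b..d} then u2 t else 0)) \<in> borel_measurable lebesgue"
    by (rule measurable_If_set[OF U]) simp
  then have "(\<lambda>t. if t \<in> {..b} then (if t \<in> {a..b} then u1 t else 0) else (if t \<in> {b..d} then u2 t else 0)) \<in> borel_measurable (lebesgue_on {a..d})"
    by (rule measurable_restrict_space1)
  then show ?thesis by (rule measurable_cong[THEN iffD1, rotated]) auto
qed

lemma varying_normD:
  assumes "continuously_varying_norm N"
  shows "continuous_on UNIV (\<lambda>(p, v). N p v)" "0 \<le> N p v" "N p v = 0 \<longleftrightarrow> v = 0" "N p (a *\<^sub>R v) = \<bar>a\<bar> * N p v"
    "N p 0 = 0" "N p (- v) = N p v"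
proof -
  show c: "continuous_on UNIV (\<lambda>(p, v). N p v)" "0 \<le> N p v" "N p v = 0 \<longleftrightarrow> v = 0" "N p (a *\<^sub>R v) = \<bar>a\<bar> * N p v" for a
    using assms unfolding continuously_varying_norm_def by simp_all
  show "N p 0 = 0" using assms unfolding continuously_varying_norm_def by simp
  show "N p (- v) = N p v" using c(4)[of "-1"] by simp
qed

context control_manifold
begin

lemma varying_norm_bounds:
  fixes N :: "'a \<Rightarrow> 'e \<Rightarrow> real"
  assumes N: "continuously_varying_norm N" and K: "compact K"
  obtains m M where "m > 0" "M > 0" "\<And>p v. p \<in> K \<Longrightarrow> m * norm v \<le> N p v" "\<And>p v. p \<in> K \<Longrightarrow> N p v \<le> M * norm v"
proof (cases "K \<times> sphere (0::'e) 1 = {}")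
  case True
  have "v = 0 \<and> N p v = 0" if "p \<in> K" for p and v :: 'e
  proof -
    have "sphere (0::'e) 1 = {}" using True that by auto
    then have "v = 0" by (cases "v = 0") (auto simp: sphere_def dest!: spec[of _ "(1 / norm v) *\<^sub>R v"])
    then show ?thesis using varying_normD(5)[OF N] by simp
  qed
  then show ?thesis using that[of 1 1] by simp
next
  case False
  have "closed (sphere (0::'e) 1)" unfolding sphere_def by (intro closed_Collect_eq continuous_intros)
  then have "compact (cball (0::'e) 1 \<inter> sphere 0 1)"
    by (intro compact_Int_closed compact_cball_finite_dimensional[OF fd])
  moreover have "cball (0::'e) 1 \<inter> sphere 0 1 = sphere 0 1" by auto
  ultimately have KS: "compact (K \<times> sphere (0::'e) 1)" using K by (simp add: compact_Times)
  have cont: "continuous_on (K \<times> sphere (0::'e) 1) (\<lambda>(p, v). N p v)"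
    by (rule continuous_on_subset[OF varying_normD(1)[OF N]]) simp
  obtain p1 v1 where pv1: "p1 \<in> K" "v1 \<in> sphere 0 1" "\<And>p v. p \<in> K \<Longrightarrow> v \<in> sphere 0 1 \<Longrightarrow> N p1 v1 \<le> N p v"
    using continuous_attains_inf[OF KS False cont] by auto
  obtain p2 v2 where pv2: "p2 \<in> K" "v2 \<in> sphere 0 1" "\<And>p v. p \<in> K \<Longrightarrow> v \<in> sphere 0 1 \<Longrightarrow> N p v \<le> N p2 v2"
    using continuous_attains_sup[OF KS False cont] by auto
  have scale: "N p v = norm v * N p ((1 / norm v) *\<^sub>R v)" if "v \<noteq> 0" for p v
    using varying_normD(4)[OF N, of p "1 / norm v" v] that by simp
  have v1: "v1 \<noteq> 0" "v2 \<noteq> 0" using pv1 pv2 by auto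
  have pos: "N p1 v1 > 0" "N p2 v2 > 0"
    using varying_normD(2,3)[OF N] v1 by (metis less_eq_real_def)+
  show ?thesis
  proof (rule that[OF pos])
    fix p and v :: 'e assume p: "p \<in> K"
    have s: "(1 / norm v) *\<^sub>R v \<in> sphere 0 1" if "v \<noteq> 0" using that by simp
    show "N p1 v1 * norm v \<le> N p v"
    proof (cases "v = 0")
      case False
      then show ?thesis using scale[OF False, of p] pv1(3)[OF p s[OF False]] by (simp add: mult.commute mult_left_mono)
    qed (simp add: varying_normD(5)[OF N])
    show "N p v \<le> N p2 v2 * norm v"
    proof (cases "v = 0")
      case False
      then show ?thesis using scale[OF False, of p] pv2(3)[OF p s[OF False]] by (simp add: mult.commute mult_left_mono)
    qed (simp add: varying_normD(5)[OF N])
  qed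
qed

text \<open>The energy bound holds at every time instead of almost every time; a control can be changed on a null set to this effect.\<close>

definition cccurve :: "('a \<Rightarrow> 'e \<Rightarrow> ('a, 'b) tvec) \<Rightarrow> ('a \<Rightarrow> 'e \<Rightarrow> real) \<Rightarrow> real \<Rightarrow> real \<Rightarrow> (real \<Rightarrow> 'a) \<Rightarrow> (real \<Rightarrow> 'e) \<Rightarrow> real \<Rightarrow> bool" where
  "cccurve f N a b g u r \<longleftrightarrow> itraj f u a b g \<and> u \<in> borel_measurable (lebesgue_on {a..b}) \<and> (\<forall>t\<in>{a..b}. N (g t) (u t) \<le> r)"

definition ccpath :: "('a \<Rightarrow> 'e \<Rightarrow> ('a, 'b) tvec) \<Rightarrow> ('a \<Rightarrow> 'e \<Rightarrow> real) \<Rightarrow> 'a \<Rightarrow> 'a \<Rightarrow> real \<Rightarrow> bool" where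
  "ccpath f N p q r \<longleftrightarrow> (\<exists>g u. cccurve f N 0 1 g u r \<and> g 0 = p \<and> g 1 = q)"

lemma ccpathI: "cccurve f N 0 1 g u r \<Longrightarrow> g 0 = p \<Longrightarrow> g 1 = q \<Longrightarrow> ccpath f N p q r"
  unfolding ccpath_def by blast

lemma cccurveD:
  assumes "cccurve f N a b g u r"
  shows "itraj f u a b g" "u \<in> borel_measurable (lebesgue_on {a..b})" "\<And>t. t \<in> {a..b} \<Longrightarrow> N (g t) (u t) \<le> r"
    "continuous_on {a..b} g"
  using assms itraj_continuous unfolding cccurve_def by auto

lemma cccurve_mono: "cccurve f N a b g u r \<Longrightarrow> r \<le> s \<Longrightarrow> cccurve f N a b g u s"
  unfolding cccurve_def by fastforce

lemma ccpath_mono: "ccpath f N p q r \<Longrightarrow> r \<le> s \<Longrightarrow> ccpath f N p q s"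
  unfolding ccpath_def using cccurve_mono by blast

lemma cccurve_affine:
  assumes bs: "bundle_section A f" and N: "continuously_varying_norm N"
    and g: "cccurve f N (m * a + k) (m * b + k) g u r" and m: "m > 0"
  shows "cccurve f N a b (\<lambda>t. g (m * t + k)) (\<lambda>t. m *\<^sub>R u (m * t + k)) (m * r)"
  unfolding cccurve_def
proof (intro conjI ballI)
  show "itraj f (\<lambda>t. m *\<^sub>R u (m * t + k)) a b (\<lambda>t. g (m * t + k))"
    by (rule itraj_affine[OF bs cccurveD(1)[OF g] m])
  have "(\<lambda>t. u (m * t + k)) \<in> borel_measurable (lebesgue_on {a..b})"
    by (rule measurable_lebesgue_on_affine[OF cccurveD(2)[OF g]]) (use m in auto)
  then show "(\<lambda>t. m *\<^sub>R u (m * t + k)) \<in> borel_measurable (lebesgue_on {a..b})"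
    by (rule borel_measurable_const_scaleR)
  fix t assume "t \<in> {a..b}"
  then have "N (g (m * t + k)) (u (m * t + k)) \<le> r" using m by (intro cccurveD(3)[OF g]) auto
  then show "N (g (m * t + k)) (m *\<^sub>R u (m * t + k)) \<le> m * r"
    using m by (simp add: varying_normD(4)[OF N])
qed

lemma cccurve_join:
  assumes g: "cccurve f N a b g1 u1 r" "cccurve f N b d g2 u2 r" and eq: "g1 b = g2 b" and ab: "a \<le> b" "b \<le> d"
  shows "cccurve f N a d (\<lambda>t. if t \<le> b then g1 t else g2 t) (\<lambda>t. if t \<le> b then u1 t else u2 t) r"
  unfolding cccurve_def
proof (intro conjI ballI)
  show "itraj f (\<lambda>t. if t \<le> b then u1 t else u2 t) a d (\<lambda>t. if t \<le> b then g1 t else g2 t)"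
  proof (rule itraj_join[OF _ _ ab])
    show "itraj f (\<lambda>t. if t \<le> b then u1 t else u2 t) a b (\<lambda>t. if t \<le> b then g1 t else g2 t)"
      by (rule itraj_cong[OF cccurveD(1)[OF g(1)] negligible_empty]) auto
    show "itraj f (\<lambda>t. if t \<le> b then u1 t else u2 t) b d (\<lambda>t. if t \<le> b then g1 t else g2 t)"
      by (rule itraj_cong[OF cccurveD(1)[OF g(2)] negligible_sing[of b]]) (use eq in auto)
  qed
  show "(\<lambda>t. if t \<le> b then u1 t else u2 t) \<in> borel_measurable (lebesgue_on {a..d})"
    by (rule measurable_lebesgue_on_join[OF cccurveD(2)[OF g(1)] cccurveD(2)[OF g(2)]])
  show "N (if t \<le> b then g1 t else g2 t) (if t \<le> b then u1 t else u2 t) \<le> r" if "t \<in> {a..d}" for t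
    using that cccurveD(3)[OF g(1), of t] cccurveD(3)[OF g(2), of t] by (cases "t \<le> b") auto
qed

text \<open>Each of the two curves is given a share of the time interval that is proportional to its energy. Both
  then have energy \<open>r + s\<close>, which makes the triangle inequality hold for a supremum energy.\<close>

lemma ccpath_trans:
  assumes bs: "bundle_section A f" and N: "continuously_varying_norm N"
    and p: "ccpath f N p q r" "ccpath f N q z s" and rs: "r > 0" "s > 0"
  shows "ccpath f N p z (r + s)"
proof -
  obtain g1 u1 where g1: "cccurve f N 0 1 g1 u1 r" "g1 0 = p" "g1 1 = q" using p(1) unfolding ccpath_def by auto
  obtain g2 u2 where g2: "cccurve f N 0 1 g2 u2 s" "g2 0 = q" "g2 1 = z" using p(2) unfolding ccpath_def by auto
  define l where "l = r / (r + s)"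
  define m1 where "m1 = (r + s) / r"
  define m2 where "m2 = (r + s) / s"
  define k where "k = - r / s"
  have l: "0 < l" "l < 1" unfolding l_def using rs by auto
  have m: "m1 > 0" "m2 > 0" "m1 * l = 1" "m1 * r = r + s" "m2 * s = r + s" unfolding m1_def m2_def l_def using rs by auto
  have k: "m2 * l + k = 0" "m2 * 1 + k = 1"
  proof -
    have "m2 * l = r / s" unfolding m2_def l_def using rs by simp
    then show "m2 * l + k = 0" unfolding k_def by simp
    show "m2 * 1 + k = 1" unfolding m2_def k_def using rs by (simp add: add_divide_distrib)
  qed
  have c1: "cccurve f N 0 l (\<lambda>t. g1 (m1 * t + 0)) (\<lambda>t. m1 *\<^sub>R u1 (m1 * t + 0)) (r + s)"
    using cccurve_affine[OF bs N _ m(1), of 0 0 l g1 u1 r] g1(1) m by simp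
  have c2: "cccurve f N l 1 (\<lambda>t. g2 (m2 * t + k)) (\<lambda>t. m2 *\<^sub>R u2 (m2 * t + k)) (r + s)"
    using cccurve_affine[OF bs N _ m(2), of l k 1 g2 u2 s] g2(1) m k by simp
  have "cccurve f N 0 1 (\<lambda>t. if t \<le> l then g1 (m1 * t + 0) else g2 (m2 * t + k))
      (\<lambda>t. if t \<le> l then m1 *\<^sub>R u1 (m1 * t + 0) else m2 *\<^sub>R u2 (m2 * t + k)) (r + s)"
    by (rule cccurve_join[OF c1 c2]) (use g1 g2 m k l in auto)
  then show ?thesis by (rule ccpathI) (use g1 g2 m k l in auto)
qed

lemma ccpath_sym:
  assumes bs: "bundle_section A f" and N: "continuously_varying_norm N" and p: "ccpath f N p q r"
  shows "ccpath f N q p r"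
proof -
  obtain g u where g: "cccurve f N 0 1 g u r" "g 0 = p" "g 1 = q" using p unfolding ccpath_def by auto
  have 1: "itraj f (\<lambda>t. - u (- t)) (-1) 0 (\<lambda>t. g (- t))"
    by (rule itraj_reverse[OF bs]) (use cccurveD(1)[OF g(1)] in simp)
  have "itraj f (\<lambda>t. 1 *\<^sub>R - u (- (1 * t + - 1))) 0 1 (\<lambda>t. g (- (1 * t + - 1)))"
    by (rule itraj_affine[OF bs, of "\<lambda>t. - u (- t)" 1 0 "-1" 1 "\<lambda>t. g (- t)"]) (use 1 in auto)
  then have it: "itraj f (\<lambda>t. - u (-1 * t + 1)) 0 1 (\<lambda>t. g (-1 * t + 1))" by simp
  have "(\<lambda>t. u (-1 * t + 1)) \<in> borel_measurable (lebesgue_on {0..1})"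
    by (rule measurable_lebesgue_on_affine[OF cccurveD(2)[OF g(1)]]) auto
  then have "(\<lambda>t. -1 *\<^sub>R u (-1 * t + 1)) \<in> borel_measurable (lebesgue_on {0..1})"
    by (rule borel_measurable_const_scaleR)
  then have me: "(\<lambda>t. - u (-1 * t + 1)) \<in> borel_measurable (lebesgue_on {0..1})" by simp
  have "N (g (-1 * t + 1)) (- u (-1 * t + 1)) \<le> r" if "t \<in> {0..1}" for t
    using cccurveD(3)[OF g(1), of "-1 * t + 1"] that by (simp add: varying_normD(6)[OF N])
  then have "cccurve f N 0 1 (\<lambda>t. g (-1 * t + 1)) (\<lambda>t. - u (-1 * t + 1)) r"
    unfolding cccurve_def using it me by simp
  then show ?thesis by (rule ccpathI) (use g in auto)
qed

lemma ccpath_refl: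
  assumes bs: "bundle_section A f" and N: "continuously_varying_norm N" and r: "r \<ge> 0"
  shows "ccpath f N p p r"
proof -
  have "itraj f (\<lambda>_. 0) 0 1 (\<lambda>_. p)"
    by (rule itrajI) (auto simp: bundle_sectionD(4)[OF bs])
  then have "cccurve f N 0 1 (\<lambda>_. p) (\<lambda>_. 0) r" unfolding cccurve_def using r by (simp add: varying_normD(5)[OF N])
  then show ?thesis by (rule ccpathI) auto
qed

lemma cccurve_sub_ccpath:
  assumes bs: "bundle_section A f" and N: "continuously_varying_norm N" and g: "cccurve f N 0 1 g u r"
    and st: "0 \<le> s" "s \<le> t" "t \<le> 1" and r: "r \<ge> 0"
  shows "ccpath f N (g s) (g t) ((t - s) * r)"
proof (cases "s = t")
  case True
  then show ?thesis using ccpath_refl[OF bs N] by simp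
next
  case False
  have "cccurve f N s t g u r"
    unfolding cccurve_def
  proof (intro conjI ballI)
    show "itraj f u s t g" by (rule itraj_subinterval[OF cccurveD(1)[OF g] st(1,3)])
    show "u \<in> borel_measurable (lebesgue_on {s..t})"
      by (rule measurable_restrict_mono[OF cccurveD(2)[OF g]]) (use st in auto)
    show "N (g x) (u x) \<le> r" if "x \<in> {s..t}" for x by (rule cccurveD(3)[OF g]) (use that st in auto)
  qed
  then have "cccurve f N 0 1 (\<lambda>x. g ((t - s) * x + s)) (\<lambda>x. (t - s) *\<^sub>R u ((t - s) * x + s)) ((t - s) * r)"
    using cccurve_affine[OF bs N, of "t - s" 0 s 1 g u r] st False by simp
  then show ?thesis by (rule ccpathI) auto
qed

lemma cccurve_control_bounded:
  assumes N: "continuously_varying_norm N" and g: "cccurve f N a b g u r"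
  obtains C where "\<And>t. t \<in> {a..b} \<Longrightarrow> norm (u t) \<le> C"
proof -
  have "compact (g ` {a..b})" by (rule compact_continuous_image[OF cccurveD(4)[OF g]]) simp
  then obtain m M where m: "m > 0" "\<And>p v. p \<in> g ` {a..b} \<Longrightarrow> m * norm v \<le> N p v"
    using varying_norm_bounds[OF N] by metis
  have "norm (u t) \<le> r / m" if "t \<in> {a..b}" for t
  proof -
    have "m * norm (u t) \<le> r" using m(2)[of "g t" "u t"] cccurveD(3)[OF g that] that by force
    then show ?thesis using m(1) by (simp add: field_simps)
  qed
  then show ?thesis using that by blast
qed

lemma cc_dist_le:
  assumes f: "lvf_structure A f" and N: "continuously_varying_norm N" and p: "ccpath f N p q r"
  shows "cc_dist A f N p q \<le> ennreal r"
proof -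
  obtain g u where g: "cccurve f N 0 1 g u r" "g 0 = p" "g 1 = q" using p unfolding ccpath_def by auto
  obtain C where C: "\<And>t. t \<in> {0..1} \<Longrightarrow> norm (u t) \<le> C" using cccurve_control_bounded[OF N g(1)] by auto
  have tr: "is_trajectory A p f u g" by (rule itraj_imp_is_trajectory[OF f cccurveD(1)[OF g(1)] g(2) C])
  then have E: "End_defined A f p u" unfolding End_defined_def by blast
  have T: "is_trajectory A p f u (trajectory A p f u)" unfolding trajectory_def by (rule someI[of "is_trajectory A p f u", OF tr])
  have eq: "trajectory A p f u t = g t" if "t \<in> {0..1}" for t
    by (rule itraj_unique[OF f is_trajectory_imp_itraj[OF T] cccurveD(1)[OF g(1)] _ C that])
      (use T g in \<open>auto simp: is_trajectory_def\<close>)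
  have "AE t in lebesgue_on {0..1}. norm (u t) \<le> C"
    using C by (intro AE_I2) auto
  then have L: "u \<in> Linf" unfolding Linf_def using cccurveD(2)[OF g(1)] by auto
  have "(\<lambda>t. (\<lambda>(p, v). N p v) (trajectory A p f u t, u t)) \<in> borel_measurable (lebesgue_on {0..1})"
    by (rule measurable_continuous_pair[OF fd varying_normD(1)[OF N] itraj_continuous[OF is_trajectory_imp_itraj[OF T]] _ cccurveD(2)[OF g(1)]]) simp
  then have "(\<lambda>t. ennreal (N (trajectory A p f u t) (u t))) \<in> borel_measurable (lebesgue_on {0..1})" by simp
  moreover have "AE t in lebesgue_on {0..1}. ennreal (N (trajectory A p f u t) (u t)) \<le> ennreal r"
    using cccurveD(3)[OF g(1)] eq by (intro AE_I2) (auto intro!: ennreal_leI)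
  ultimately have "energy A p f u N \<le> ennreal r" unfolding energy_def by (rule esssup_I)
  moreover have "End A f p u = q" unfolding End_def using eq[of 1] g by simp
  ultimately show ?thesis unfolding cc_dist_def using L E by (intro Inf_lower2[of "energy A p f u N"]) auto
qed

text \<open>Where the energy bound fails, which is on a null set, the control is replaced by \<open>0\<close>; the trajectory remains
  the same.\<close>

lemma cc_dist_less:
  assumes f: "lvf_structure A f" and N: "continuously_varying_norm N" and d: "cc_dist A f N p q < ennreal s"
  obtains r where "0 < r" "r < s" "ccpath f N p q r"
proof -
  obtain u where u: "u \<in> Linf" "End_defined A f p u" "End A f p u = q" and e: "energy A p f u N < ennreal s"
    using d unfolding cc_dist_def Inf_less_iff by auto
  define g where "g = trajectory A p f u"
  obtain g' where "is_trajectory A p f u g'" using u(2) unfolding End_defined_def by blast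
  then have T: "is_trajectory A p f u g" unfolding g_def trajectory_def by (rule someI[of "is_trajectory A p f u"])
  have it: "itraj f u 0 1 g" by (rule is_trajectory_imp_itraj[OF T])
  have s0: "s > 0" using e by (metis ennreal_neg not_le not_less_zero)
  have "energy A p f u N < \<infinity>" using e by (rule less_trans) simp
  then obtain r0 where r0: "r0 \<ge> 0" "energy A p f u N = ennreal r0" by (cases "energy A p f u N") auto
  have r0s: "r0 < s" using e r0 by (simp add: ennreal_less_iff)
  define r where "r = (r0 + s) / 2"
  have r: "0 < r" "r < s" "r0 \<le> r" unfolding r_def using r0 s0 r0s by auto
  have "AE t in lebesgue_on {0..1}. ennreal (N (g t) (u t)) \<le> energy A p f u N"
    unfolding energy_def g_def by (rule esssup_AE)
  then have "AE t in lebesgue_on {0..1}. N (g t) (u t) \<le> r0"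
    using r0 by (simp add: ennreal_le_iff)
  then obtain E where E: "negligible E" "\<forall>t\<in>{0..1} - E. N (g t) (u t) \<le> r0"
    by (subst (asm) AE_lebesgue_on_iff) auto
  define u' where "u' t = (if t \<in> E then 0 else u t)" for t
  have "cccurve f N 0 1 g u' r"
    unfolding cccurve_def
  proof (intro conjI ballI)
    show "itraj f u' 0 1 g" by (rule itraj_cong[OF it E(1)]) (auto simp: u'_def)
    have "u \<in> borel_measurable (lebesgue_on {0..1})" using u(1) unfolding Linf_def by simp
    then have U: "(\<lambda>t. if t \<in> {0..1} then u t else 0) \<in> borel_measurable lebesgue"
      using measurable_restrict_space_iff[of "{0..1}" lebesgue 0 borel u] by simp
    have Es: "E \<in> sets lebesgue" using E(1) by (simp add: negligible_iff_null_sets null_setsD2)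
    have "(\<lambda>t. if t \<in> E then 0 else (if t \<in> {0..1} then u t else 0)) \<in> borel_measurable lebesgue"
      by (rule measurable_If_set[OF _ U]) (use Es in auto)
    then have "(\<lambda>t. if t \<in> E then 0 else (if t \<in> {0..1} then u t else 0)) \<in> borel_measurable (lebesgue_on {0..1})"
      by (rule measurable_restrict_space1)
    then show "u' \<in> borel_measurable (lebesgue_on {0..1})"
      by (rule measurable_cong[THEN iffD1, rotated]) (auto simp: u'_def)
    show "N (g t) (u' t) \<le> r" if "t \<in> {0..1}" for t
      using E(2) that r by (cases "t \<in> E") (auto simp: u'_def varying_normD(5)[OF N] intro: order_trans)
  qed
  moreover have "g 0 = p" using T unfolding is_trajectory_def by simp
  moreover have "g 1 = q" using u(3) unfolding End_def g_def .
  ultimately have "ccpath f N p q r" unfolding ccpath_def by blast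
  then show ?thesis using that r by blast
qed

end

lemma ennreal_real_between:
  assumes "(a::ennreal) < b"
  obtains s where "s > 0" "a < ennreal s" "ennreal s < b"
proof -
  obtain x where x: "a < x" "x < b" using dense[OF assms] by auto
  then have "x < \<infinity>" by (metis order_less_le_trans top_greatest infinity_ennreal_def)
  then obtain s where s: "x = ennreal s" "s \<ge> 0" by (cases x) auto
  have "s \<noteq> 0" using x(1) s by (auto simp: not_less_zero)
  then show ?thesis using that[of s] x s by simp
qed

context control_manifold
begin

text \<open>At the first time at which the curve leaves the ball of radius \<open>\<rho>\<close> it has moved by at most
  \<open>Fm * (r / m)\<close>, which is less than the distance \<open>\<rho> / 2\<close> to the boundary.\<close>

lemma cccurve_trapped:
  assumes N: "continuously_varying_norm N" and c: "c \<in> A" "cball z0 \<rho> \<subseteq> chart_map c ` chart_dom c"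
    and Fm: "Fm \<ge> 0" "\<And>q v. q \<in> chart_dom c \<Longrightarrow> chart_map c q \<in> cball z0 \<rho> \<Longrightarrow> norm (f q v c) \<le> Fm * norm v"
    and m: "m > 0" "\<And>q v. q \<in> chart_dom c \<Longrightarrow> chart_map c q \<in> cball z0 \<rho> \<Longrightarrow> m * norm v \<le> N q v"
    and g: "cccurve f N 0 1 g u r" and g0: "g 0 \<in> chart_dom c" "chart_map c (g 0) \<in> cball z0 (\<rho> / 2)"
    and small: "Fm * (r / m) < \<rho> / 2" and t: "t \<in> {0..1}"
  shows "g t \<in> chart_dom c \<and> chart_map c (g t) \<in> ball z0 \<rho> \<and> norm (u t) \<le> r / m"
proof -
  have "0 \<le> N (g 0) (u 0)" by (rule varying_normD(2)[OF N])
  also have "\<dots> \<le> r" by (rule cccurveD(3)[OF g]) simp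
  finally have r0: "r \<ge> 0" .
  have "0 \<le> Fm * (r / m)" using Fm(1) r0 m(1) by simp
  then have \<rho>: "\<rho> > 0" using small by linarith
  define K where "K = chart_inv c ` cball z0 \<rho>"
  define O' where "O' = chart_dom c \<inter> chart_map c -` ball z0 \<rho>"
  have "compact K" unfolding K_def
    by (rule compact_continuous_image[OF continuous_on_subset[OF chart_props(4)[OF c(1)] c(2)] compact_cball])
  then have clK: "closed K" by (rule compact_imp_closed)
  have KD: "q \<in> chart_dom c \<and> chart_map c q \<in> cball z0 \<rho>" if q: "q \<in> K" for q
  proof -
    obtain x where x: "x \<in> cball z0 \<rho>" "q = chart_inv c x" using q unfolding K_def by auto
    then have "x \<in> chart_map c ` chart_dom c" using c(2) by auto
    then show ?thesis using x chart_props(6,7)[OF c(1)] by simp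
  qed
  have KI: "q \<in> K" if "q \<in> chart_dom c" "chart_map c q \<in> cball z0 \<rho>" for q
    unfolding K_def using chart_props(5)[OF c(1) that(1)] that(2) by (metis image_eqI)
  have oO: "open O'" unfolding O'_def using chart_props(1,3)[OF c(1)] by (intro continuous_open_preimage) auto
  have OK: "O' \<subseteq> K" unfolding O'_def using KI by auto
  have ub: "norm (u s) \<le> r / m" if s: "s \<in> {0..1}" "g s \<in> K" for s
  proof -
    have "m * norm (u s) \<le> N (g s) (u s)" using KD[OF s(2)] by (intro m(2)) auto
    also have "\<dots> \<le> r" by (rule cccurveD(3)[OF g s(1)])
    finally show ?thesis using m(1) by (simp add: field_simps)
  qed
  have speed: "norm (f (g s) (u s) c) \<le> Fm * (r / m)" if s: "s \<in> {0..1}" "g s \<in> K" for s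
  proof -
    have "norm (f (g s) (u s) c) \<le> Fm * norm (u s)" using KD[OF s(2)] by (intro Fm(2)) auto
    also have "\<dots> \<le> Fm * (r / m)" by (rule mult_left_mono[OF ub[OF s] Fm(1)])
    finally show ?thesis .
  qed
  have cg: "continuous_on {0..1} g" by (rule cccurveD(4)[OF g])
  have inO: "g s \<in> O'" if s: "s \<in> {0..1}" for s
  proof (rule ccontr)
    assume "g s \<notin> O'"
    define B where "B = {0..1} \<inter> g -` (- O')"
    have "s \<in> B" unfolding B_def using s \<open>g s \<notin> O'\<close> by simp
    have "closed B" unfolding B_def
      by (rule continuous_closed_preimage[OF cg]) (use oO in auto)
    then have "compact B" unfolding B_def by (metis compact_Int_closed compact_Icc inf.idem inf.assoc inf_commute)
    then obtain \<tau> where \<tau>: "\<tau> \<in> B" "\<And>x. x \<in> B \<Longrightarrow> \<tau> \<le> x"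
      using compact_attains_inf[of B] \<open>s \<in> B\<close> by blast
    have t01: "0 \<le> \<tau>" "\<tau> \<le> 1" using \<tau>(1) unfolding B_def by auto
    have "g 0 \<in> O'" unfolding O'_def using g0 \<rho> by auto
    then have "\<tau> \<noteq> 0" using \<tau>(1) unfolding B_def by auto
    then have tp: "0 < \<tau>" using t01 by simp
    have pre: "g x \<in> K" if "x \<in> {0..<\<tau>}" for x
      using \<tau>(2)[of x] that t01 OK unfolding B_def by fastforce
    have clos: "closure {0..<\<tau>} = {0..\<tau>}" using tp by simp
    have "g ` closure {0..<\<tau>} \<subseteq> K"
      by (rule image_closure_subset[OF _ clK])
        (use pre clos t01 continuous_on_subset[OF cg] in auto)
    then have gK: "g x \<in> K" if "x \<in> {0..\<tau>}" for x using that unfolding clos by auto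
    have "norm (chart_map c (g \<tau>) - chart_map c (g 0)) \<le> (Fm * (r / m)) * (\<tau> - 0)"
      by (rule itraj_displacement[OF cccurveD(1)[OF g] c(1) _ t01(1,2)]) (use gK KD speed t01 in auto)
    also have "\<dots> \<le> (Fm * (r / m)) * 1" by (rule mult_left_mono) (use t01 \<open>0 \<le> Fm * (r / m)\<close> in auto)
    also have "\<dots> = Fm * (r / m)" by (rule mult_1_right)
    finally have "norm (chart_map c (g \<tau>) - chart_map c (g 0)) \<le> Fm * (r / m)" .
    then have "dist (chart_map c (g 0)) (chart_map c (g \<tau>)) < \<rho> / 2"
      using small unfolding dist_norm norm_minus_commute[of "chart_map c (g 0)"] by (rule le_less_trans)
    moreover have "dist z0 (chart_map c (g 0)) \<le> \<rho> / 2" using g0(2) by simp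
    ultimately have "dist z0 (chart_map c (g \<tau>)) < \<rho>"
      using dist_triangle[of z0 "chart_map c (g \<tau>)" "chart_map c (g 0)"] by simp
    then have "g \<tau> \<in> O'" unfolding O'_def using KD[OF gK[of \<tau>]] tp by simp
    then show False using \<tau>(1) unfolding B_def by simp
  qed
  show ?thesis using inO[OF t] ub[OF t] OK unfolding O'_def by auto
qed

lemma cccurve_stays_near:
  fixes f :: "'a \<Rightarrow> 'e \<Rightarrow> ('a, 'b) tvec" and N :: "'a \<Rightarrow> 'e \<Rightarrow> real"
  assumes f: "lvf_structure A f" and N: "continuously_varying_norm N" and W: "open W" "p \<in> W"
  obtains r where "r > 0" "\<And>g u t. cccurve f N 0 1 g u r \<Longrightarrow> g 0 = p \<Longrightarrow> t \<in> {0..1} \<Longrightarrow> g t \<in> W"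
proof -
  obtain c where c: "c \<in> charts_at A p" using ex_chart_at by blast
  have cA: "c \<in> A" "p \<in> chart_dom c" using c by (auto simp: charts_at_def)
  have "open (chart_map c ` (chart_dom c \<inter> W))" by (rule open_chart_overlap[OF cA(1) W(1)])
  then obtain \<rho> where \<rho>: "\<rho> > 0" "cball (chart_map c p) \<rho> \<subseteq> chart_map c ` (chart_dom c \<inter> W)"
    using open_contains_cball[of "chart_map c ` (chart_dom c \<inter> W)"] cA W by blast
  let ?B = "cball (chart_map c p) \<rho>"
  have B: "?B \<subseteq> chart_map c ` chart_dom c" using \<rho>(2) by auto
  have cK: "compact (chart_inv c ` ?B)"
    by (rule compact_continuous_image[OF continuous_on_subset[OF chart_props(4)[OF cA(1)] B] compact_cball])
  have KD: "chart_inv c ` ?B \<subseteq> chart_dom c" using B chart_props(7)[OF cA(1)] by auto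
  have KI: "q \<in> chart_inv c ` ?B" if "q \<in> chart_dom c" "chart_map c q \<in> ?B" for q
    using chart_props(5)[OF cA(1) that(1)] that(2) by (metis image_eqI)
  obtain Fm where Fm: "Fm \<ge> 0" "\<And>q v. q \<in> chart_inv c ` ?B \<Longrightarrow> norm (f q v c) \<le> Fm * norm v"
    by (rule lvf_bounded_on_compact[OF f cA(1) cK KD]) (use that in blast)
  obtain m M where m: "m > 0" "\<And>q v. q \<in> chart_inv c ` ?B \<Longrightarrow> m * norm v \<le> N q v"
    by (rule varying_norm_bounds[OF N cK]) (use that in blast)
  \<comment> \<open>Speed at most \<open>Fm * (r / m)\<close> cannot bridge \<open>\<rho> / 2\<close> in unit time.\<close>
  define r where "r = m * \<rho> / (2 * (Fm + 1))"
  have r: "r > 0" unfolding r_def using m \<rho> Fm by simp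
  have "Fm * (r / m) = (\<rho> / 2) * (Fm / (Fm + 1))" unfolding r_def using m by simp
  also have "\<dots> < (\<rho> / 2) * 1" using \<rho> Fm by (intro mult_strict_left_mono) auto
  finally have small: "Fm * (r / m) < \<rho> / 2" by simp
  show ?thesis
  proof (rule that[OF r])
    fix g u t assume h: "cccurve f N 0 1 g u r" "g 0 = p" "t \<in> {0..(1::real)}"
    have "g t \<in> chart_dom c \<and> chart_map c (g t) \<in> ball (chart_map c p) \<rho> \<and> norm (u t) \<le> r / m"
      by (rule cccurve_trapped[OF N cA(1) B Fm(1) _ m(1) _ h(1) _ _ small h(3)])
        (use KI Fm(2) m(2) h(2) cA \<rho> in auto)
    then have t: "g t \<in> chart_dom c" "chart_map c (g t) \<in> ?B" by auto
    then obtain q where q: "q \<in> chart_dom c" "q \<in> W" "chart_map c (g t) = chart_map c q" using \<rho>(2) by auto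
    then have "g t = q" using chart_props(5)[OF cA(1)] t(1) by metis
    then show "g t \<in> W" using q by simp
  qed
qed

lemma cc_dist_path:
  fixes f :: "'a \<Rightarrow> 'e \<Rightarrow> ('a, 'b) tvec" and N :: "'a \<Rightarrow> 'e \<Rightarrow> real"
  assumes f: "lvf_structure A f" and N: "continuously_varying_norm N" and d: "cc_dist A f N p q < ennreal r"
  obtains \<gamma> where "continuous_on {0..1} \<gamma>" "\<gamma> 0 = p" "\<gamma> 1 = q"
    "\<And>s t. 0 \<le> s \<Longrightarrow> s \<le> t \<Longrightarrow> t \<le> 1 \<Longrightarrow> cc_dist A f N (\<gamma> s) (\<gamma> t) \<le> ennreal ((t - s) * r)"
proof -
  have bs: "bundle_section A f" using f by (simp add: lvf_structure_def)
  obtain r' where r': "0 < r'" "r' < r" "ccpath f N p q r'" by (rule cc_dist_less[OF f N d])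
  then obtain g u where g: "cccurve f N 0 1 g u r'" "g 0 = p" "g 1 = q" unfolding ccpath_def by auto
  have g': "cccurve f N 0 1 g u r" by (rule cccurve_mono[OF g(1)]) (use r' in simp)
  show ?thesis
  proof (rule that[OF cccurveD(4)[OF g(1)] g(2,3)])
    fix s t :: real assume st: "0 \<le> s" "s \<le> t" "t \<le> 1"
    have "ccpath f N (g s) (g t) ((t - s) * r)"
      by (rule cccurve_sub_ccpath[OF bs N g' st]) (use r' in simp)
    then show "cc_dist A f N (g s) (g t) \<le> ennreal ((t - s) * r)" by (rule cc_dist_le[OF f N])
  qed
qed

lemma ext_distance_cc_dist:
  fixes f :: "'a \<Rightarrow> 'e \<Rightarrow> ('a, 'b) tvec" and N :: "'a \<Rightarrow> 'e \<Rightarrow> real"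
  assumes f: "lvf_structure A f" and N: "continuously_varying_norm N"
  shows "ext_distance (cc_dist A f N)"
  unfolding ext_distance_def
proof (intro conjI allI)
  have bs: "bundle_section A f" using f by (simp add: lvf_structure_def)
  let ?d = "cc_dist A f N"
  fix x y
  show "?d x y = 0 \<longleftrightarrow> x = y"
  proof
    assume "x = y"
    then have "?d x y \<le> ennreal 0" using cc_dist_le[OF f N ccpath_refl[OF bs N, of 0 x]] by simp
    then show "?d x y = 0" by simp
  next
    assume 0: "?d x y = 0"
    show "x = y"
    proof (rule ccontr)
      assume "x \<noteq> y"
      then have "open (- {y})" "x \<in> - {y}" by auto
      then obtain r where r: "r > 0" "\<And>g u t. cccurve f N 0 1 g u r \<Longrightarrow> g 0 = x \<Longrightarrow> t \<in> {0..1} \<Longrightarrow> g t \<in> - {y}"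
        by (rule cccurve_stays_near[OF f N]) (use that in blast)
      have "?d x y < ennreal r" using 0 r(1) by simp
      then obtain r' where "r' < r" "ccpath f N x y r'" by (rule cc_dist_less[OF f N])
      then obtain g u where g: "cccurve f N 0 1 g u r'" "g 0 = x" "g 1 = y" unfolding ccpath_def by auto
      have "cccurve f N 0 1 g u r" by (rule cccurve_mono[OF g(1)]) (use \<open>r' < r\<close> in simp)
      then have "g 1 \<in> - {y}" by (rule r(2)) (use g in auto)
      then show False using g by simp
    qed
  qed
next
  have bs: "bundle_section A f" using f by (simp add: lvf_structure_def)
  have le: "cc_dist A f N y x \<le> cc_dist A f N x y" for x y
  proof (rule ccontr)
    assume "\<not> cc_dist A f N y x \<le> cc_dist A f N x y"
    then have "cc_dist A f N x y < cc_dist A f N y x" by simp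
    then obtain s where s: "s > 0" "cc_dist A f N x y < ennreal s" "ennreal s < cc_dist A f N y x" by (rule ennreal_real_between)
    obtain r where r: "0 < r" "r < s" "ccpath f N x y r" by (rule cc_dist_less[OF f N s(2)])
    have "cc_dist A f N y x \<le> ennreal r" by (rule cc_dist_le[OF f N ccpath_sym[OF bs N r(3)]])
    also have "\<dots> \<le> ennreal s" using r by (intro ennreal_leI) simp
    finally show False using s(3) by simp
  qed
  show "cc_dist A f N x y = cc_dist A f N y x" for x y by (rule antisym[OF le le])
next
  have bs: "bundle_section A f" using f by (simp add: lvf_structure_def)
  let ?d = "cc_dist A f N"
  fix x y z
  show "?d x z \<le> ?d x y + ?d y z"
  proof (rule ccontr)
    assume "\<not> ?d x z \<le> ?d x y + ?d y z"
    then have "?d x y + ?d y z < ?d x z" by simp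
    then obtain s where s: "s > 0" "?d x y + ?d y z < ennreal s" "ennreal s < ?d x z" by (rule ennreal_real_between)
    obtain a where a: "?d x y = ennreal a" "a \<ge> 0" using s(2) by (cases "?d x y") auto
    obtain b where b: "?d y z = ennreal b" "b \<ge> 0" using s(2) by (cases "?d y z") auto
    have "a + b < s" using s(2) a b by (simp add: ennreal_plus[symmetric] ennreal_less_iff del: ennreal_plus)
    define e where "e = (s - (a + b)) / 2"
    have e: "e > 0" "a + e + (b + e) = s" unfolding e_def using \<open>a + b < s\<close> by (auto simp: field_simps)
    have "?d x y < ennreal (a + e)" "?d y z < ennreal (b + e)" using a b e by (simp_all add: ennreal_less_iff)
    then obtain r1 r2 where r: "0 < r1" "r1 < a + e" "ccpath f N x y r1" "0 < r2" "r2 < b + e" "ccpath f N y z r2"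
      using cc_dist_less[OF f N] by metis
    have "?d x z \<le> ennreal (r1 + r2)" by (rule cc_dist_le[OF f N ccpath_trans[OF bs N r(3,6,1,4)]])
    also have "\<dots> \<le> ennreal s" using r e by (intro ennreal_leI) simp
    finally show False using s(3) by simp
  qed
qed

end

section \<open>Controlled ordinary differential equations in Euclidean space\<close>

definition ode_solution :: "('b::euclidean_space \<Rightarrow> 'e::real_normed_vector \<Rightarrow>\<^sub>L 'b) \<Rightarrow> (real \<Rightarrow> 'e) \<Rightarrow> 'b \<Rightarrow> (real \<Rightarrow> 'b) \<Rightarrow> bool" where
  "ode_solution F u y0 y \<longleftrightarrow> continuous_on {0..1} y \<and> y 0 = y0 \<and>
     (\<forall>s t. 0 \<le> s \<and> s \<le> t \<and> t \<le> 1 \<longrightarrow> ((\<lambda>r. blinfun_apply (F (y r)) (u r)) has_integral (y t - y s)) {s..t})"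

text \<open>The integral operator is a contraction on the bounded continuous functions because of \<open>L * C \<le> 1 / 2\<close>.
  Functions are extended constantly beyond \<open>[0,1]\<close> to have a complete function space on the whole line.\<close>

lemma ode_solution_exists:
  fixes F :: "'b::euclidean_space \<Rightarrow> 'e::real_normed_vector \<Rightarrow>\<^sub>L 'b"
  assumes fd: "\<exists>B :: 'e set. finite B \<and> span B = UNIV"
    and F: "L-lipschitz_on UNIV F" "\<And>x. norm (F x) \<le> Fm"
    and u: "u \<in> borel_measurable (lebesgue_on {0..1})" "\<And>t. t \<in> {0..1} \<Longrightarrow> norm (u t) \<le> C"
    and LC: "L * C \<le> 1 / 2"
  obtains y where "ode_solution F u y0 y"
proof -
  have C0: "C \<ge> 0" using order_trans[OF norm_ge_zero u(2)[of 0]] by simp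
  have Fm0: "Fm \<ge> 0" using order_trans[OF norm_ge_zero F(2)] .
  have L0: "L \<ge> 0" using F(1) by (rule lipschitz_on_nonneg)
  have contF: "continuous_on UNIV F" by (rule lipschitz_on_continuous_on[OF F(1)])
  let ?h = "\<lambda>\<phi> s. blinfun_apply (F (\<phi> s)) (u s)"
  have hb: "norm (?h \<phi> s) \<le> Fm * C" if "s \<in> {0..1}" for \<phi> :: "real \<Rightarrow> 'b" and s
  proof -
    have "norm (?h \<phi> s) \<le> norm (F (\<phi> s)) * norm (u s)" by (rule norm_blinfun)
    also have "\<dots> \<le> Fm * C" using F(2) u(2)[OF that] Fm0 by (intro mult_mono) auto
    finally show ?thesis .
  qed
  have hint: "?h \<phi> integrable_on {0..1}" if \<phi>: "continuous_on {0..1} \<phi>" for \<phi> :: "real \<Rightarrow> 'b"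
  proof -
    have G: "continuous_on UNIV (\<lambda>z :: 'b \<times> 'e. blinfun_apply (F (fst z)) (snd z))"
      by (intro blinfun.continuous_on continuous_on_compose2[OF contF] continuous_intros) auto
    have "(\<lambda>t. (\<lambda>z. blinfun_apply (F (fst z)) (snd z)) (\<phi> t, u t)) \<in> borel_measurable (lebesgue_on {0..1})"
      by (rule measurable_continuous_pair[OF fd G \<phi> _ u(1)]) simp
    then have "?h \<phi> \<in> borel_measurable (lebesgue_on {0..1})" by simp
    then show ?thesis
      by (rule measurable_bounded_by_integrable_imp_integrable[where g = "\<lambda>_. Fm * C"]) (use hb in auto)
  qed
  define cl where "cl t = max 0 (min 1 t)" for t :: real
  have cl: "cl t \<in> {0..1}" "t \<in> {0..1} \<Longrightarrow> cl t = t" for t unfolding cl_def by auto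
  have ccl: "continuous_on UNIV cl" unfolding cl_def by (intro continuous_intros)
  define T where "T \<phi> t = y0 + integral {0..cl t} (?h \<phi>)" for \<phi> :: "real \<Rightarrow> 'b" and t
  have int_bound: "norm (integral {0..s} k) \<le> B"
    if "s \<in> {0..1}" "k integrable_on {0..1}" "\<And>r. r \<in> {0..1} \<Longrightarrow> norm (k r) \<le> B" for s B and k :: "real \<Rightarrow> 'b"
  proof -
    have B0: "B \<ge> 0" using order_trans[OF norm_ge_zero that(3)[of 0]] by simp
    have "k integrable_on {0..s}" by (rule integrable_on_subinterval[OF that(2)]) (use that(1) in auto)
    then have "(k has_integral integral {0..s} k) (cbox 0 s)" by (simp add: integrable_integral)
    then have "norm (integral {0..s} k) \<le> B * measure lborel (cbox 0 s)"
      by (intro has_integral_bound[of B k]) (use B0 that in auto)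
    also have "\<dots> \<le> B" using that(1) B0 by (simp add: mult_left_le)
    finally show ?thesis .
  qed
  have contT: "continuous_on UNIV (T \<phi>)" if \<phi>: "continuous_on UNIV \<phi>" for \<phi>
  proof -
    have "continuous_on {0..1} (\<lambda>t. integral {0..t} (?h \<phi>))"
      by (rule indefinite_integral_continuous_1[OF hint[OF continuous_on_subset[OF \<phi>]]]) simp
    then have "continuous_on UNIV (\<lambda>t. integral {0..cl t} (?h \<phi>))"
      by (rule continuous_on_compose2[OF _ ccl]) (use cl in auto)
    then show ?thesis unfolding T_def by (intro continuous_intros)
  qed
  have Tb: "T \<phi> \<in> bcontfun" if \<phi>: "continuous_on UNIV \<phi>" for \<phi>
  proof (rule bcontfun_normI[OF contT[OF \<phi>]])
    fix t
    have "norm (T \<phi> t) \<le> norm y0 + norm (integral {0..cl t} (?h \<phi>))" unfolding T_def by (rule norm_triangle_ineq)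
    also have "norm (integral {0..cl t} (?h \<phi>)) \<le> Fm * C"
    proof (rule int_bound[OF cl(1)])
      show "?h \<phi> integrable_on {0..1}" by (rule hint[OF continuous_on_subset[OF \<phi>]]) simp
    qed (rule hb)
    finally show "norm (T \<phi> t) \<le> norm y0 + Fm * C" by simp
  qed
  define P where "P \<phi> = Bcontfun (T (apply_bcontfun \<phi>))" for \<phi> :: "real \<Rightarrow>\<^sub>C 'b"
  have cb: "continuous_on UNIV (apply_bcontfun \<phi>)" for \<phi> :: "real \<Rightarrow>\<^sub>C 'b"
    using apply_bcontfun[of \<phi>] unfolding bcontfun_def by simp
  have Papp: "apply_bcontfun (P \<phi>) = T (apply_bcontfun \<phi>)" for \<phi>
    unfolding P_def by (rule Bcontfun_inverse[OF Tb[OF cb]])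
  have "\<exists>!\<phi>. P \<phi> = \<phi>"
  proof (rule banach_fix_type[where c = "1/2"])
    show "\<forall>\<phi> \<psi>. dist (P \<phi>) (P \<psi>) \<le> 1 / 2 * dist \<phi> \<psi>"
    proof (intro allI dist_bound)
      fix \<phi> \<psi> :: "real \<Rightarrow>\<^sub>C 'b" and t
      let ?\<phi> = "apply_bcontfun \<phi>" and ?\<psi> = "apply_bcontfun \<psi>"
      have i: "?h ?\<phi> integrable_on {0..1}" "?h ?\<psi> integrable_on {0..1}"
        by (rule hint[OF continuous_on_subset[OF cb]]; simp)+
      have i': "?h ?\<phi> integrable_on {0..cl t}" "?h ?\<psi> integrable_on {0..cl t}"
        using i cl(1)[of t] by (auto intro: integrable_on_subinterval)
      have "dist (T ?\<phi> t) (T ?\<psi> t) = norm (integral {0..cl t} (\<lambda>s. ?h ?\<phi> s - ?h ?\<psi> s))"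
        unfolding T_def dist_norm using Henstock_Kurzweil_Integration.integral_diff[OF i'] by simp
      also have "\<dots> \<le> (1/2) * dist \<phi> \<psi>"
      proof (rule int_bound[OF cl(1)])
        show "(\<lambda>s. ?h ?\<phi> s - ?h ?\<psi> s) integrable_on {0..1}" by (rule integrable_diff[OF i])
        fix s :: real assume s: "s \<in> {0..1}"
        have "?h ?\<phi> s - ?h ?\<psi> s = blinfun_apply (F (?\<phi> s) - F (?\<psi> s)) (u s)" by (simp add: blinfun.diff_left)
        then have "norm (?h ?\<phi> s - ?h ?\<psi> s) \<le> norm (F (?\<phi> s) - F (?\<psi> s)) * norm (u s)" by (simp add: norm_blinfun)
        also have "\<dots> \<le> (L * dist \<phi> \<psi>) * C"
        proof (rule mult_mono)
          have "norm (F (?\<phi> s) - F (?\<psi> s)) \<le> L * dist (?\<phi> s) (?\<psi> s)"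
            using lipschitz_onD[OF F(1), of "?\<phi> s" "?\<psi> s"] by (simp add: dist_norm)
          also have "\<dots> \<le> L * dist \<phi> \<psi>" using dist_bounded L0 by (intro mult_left_mono) auto
          finally show "norm (F (?\<phi> s) - F (?\<psi> s)) \<le> L * dist \<phi> \<psi>" .
        qed (use u(2)[OF s] L0 in auto)
        also have "\<dots> = (L * C) * dist \<phi> \<psi>" by simp
        also have "\<dots> \<le> (1/2) * dist \<phi> \<psi>" by (rule mult_right_mono[OF LC]) simp
        finally show "norm (?h ?\<phi> s - ?h ?\<psi> s) \<le> (1/2) * dist \<phi> \<psi>" .
      qed
      finally show "dist (apply_bcontfun (P \<phi>) t) (apply_bcontfun (P \<psi>) t) \<le> 1 / 2 * dist \<phi> \<psi>" unfolding Papp .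
    qed
  qed auto
  then obtain \<phi> where "P \<phi> = \<phi>" by auto
  define y where "y = apply_bcontfun \<phi>"
  have cy: "continuous_on {0..1} y" unfolding y_def by (rule continuous_on_subset[OF cb]) simp
  have yT: "y t = y0 + integral {0..t} (?h y)" if "t \<in> {0..1}" for t
    using Papp[of \<phi>] \<open>P \<phi> = \<phi>\<close> cl(2)[OF that] unfolding T_def y_def by metis
  have "ode_solution F u y0 y"
    unfolding ode_solution_def
  proof (intro conjI allI impI cy)
    show "y 0 = y0" using yT[of 0] by simp
    fix s t assume st: "0 \<le> s \<and> s \<le> t \<and> t \<le> (1::real)"
    have i: "?h y integrable_on {0..t}" "?h y integrable_on {s..t}"
      by (rule integrable_on_subinterval[OF hint[OF cy]]; use st in auto)+
    have "integral {0..s} (?h y) + integral {s..t} (?h y) = integral {0..t} (?h y)"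
      by (rule Henstock_Kurzweil_Integration.integral_combine) (use st i in auto)
    then have "integral {s..t} (?h y) = y t - y s" using yT[of s] yT[of t] st by (simp add: algebra_simps)
    then show "(?h y has_integral (y t - y s)) {s..t}" using i(2) integrable_integral by metis
  qed
  then show ?thesis by (rule that)
qed

text \<open>At a time of maximal distance of the solutions, the Lipschitz term of the integral estimate is at most half of that
  distance and can be absorbed.\<close>

lemma ode_solution_stable:
  fixes F1 F2 :: "'b::euclidean_space \<Rightarrow> 'e::real_normed_vector \<Rightarrow>\<^sub>L 'b"
  assumes y: "ode_solution F1 u1 x1 y1" "ode_solution F2 u2 x2 y2"
    and F: "L-lipschitz_on UNIV F1" "\<And>x. norm (F1 x) \<le> Fm" "\<And>x. norm (F1 x - F2 x) \<le> \<eta>"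
    and u: "\<And>t. t \<in> {0..1} \<Longrightarrow> norm (u1 t) \<le> C" "\<And>t. t \<in> {0..1} \<Longrightarrow> norm (u2 t) \<le> C"
      "\<And>t. t \<in> {0..1} \<Longrightarrow> norm (u1 t - u2 t) \<le> \<delta>"
    and LC: "L * C \<le> 1 / 2" and t: "t \<in> {0..1}"
  shows "norm (y1 t - y2 t) \<le> 2 * (norm (x1 - x2) + \<eta> * C + Fm * \<delta>)"
proof -
  have C0: "C \<ge> 0" using order_trans[OF norm_ge_zero u(1)[of 0]] by simp
  have Fm0: "Fm \<ge> 0" using order_trans[OF norm_ge_zero F(2)] .
  have \<eta>0: "\<eta> \<ge> 0" using order_trans[OF norm_ge_zero F(3)] .
  have L0: "L \<ge> 0" using F(1) by (rule lipschitz_on_nonneg)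
  let ?w = "\<lambda>s. norm (y1 s - y2 s)"
  have "continuous_on {0..1} ?w" using y unfolding ode_solution_def by (intro continuous_intros) auto
  then obtain s where s: "s \<in> {0..1}" "\<And>r. r \<in> {0..1} \<Longrightarrow> ?w r \<le> ?w s"
    using continuous_attains_sup[of "{0..1::real}" ?w] by auto
  define R where "R = (1/2) * ?w s + \<eta> * C + Fm * \<delta>"
  have b: "norm (blinfun_apply (F1 (y1 r)) (u1 r) - blinfun_apply (F2 (y2 r)) (u2 r)) \<le> R" if r: "r \<in> {0..1}" for r
  proof -
    have "blinfun_apply (F1 (y1 r)) (u1 r) - blinfun_apply (F2 (y2 r)) (u2 r)
      = blinfun_apply (F1 (y1 r) - F1 (y2 r)) (u1 r) + (blinfun_apply (F1 (y2 r) - F2 (y2 r)) (u2 r) + blinfun_apply (F1 (y2 r)) (u1 r - u2 r))"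
      by (simp add: blinfun.diff_left blinfun.diff_right)
    then have "norm (blinfun_apply (F1 (y1 r)) (u1 r) - blinfun_apply (F2 (y2 r)) (u2 r))
      \<le> norm (blinfun_apply (F1 (y1 r) - F1 (y2 r)) (u1 r)) + (norm (blinfun_apply (F1 (y2 r) - F2 (y2 r)) (u2 r)) + norm (blinfun_apply (F1 (y2 r)) (u1 r - u2 r)))"
      by (simp only: order_trans[OF norm_triangle_ineq add_left_mono[OF norm_triangle_ineq]])
    moreover have "norm (blinfun_apply (F1 (y1 r) - F1 (y2 r)) (u1 r)) \<le> (1/2) * ?w s"
    proof -
      have "norm (blinfun_apply (F1 (y1 r) - F1 (y2 r)) (u1 r)) \<le> norm (F1 (y1 r) - F1 (y2 r)) * norm (u1 r)" by (rule norm_blinfun)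
      also have "\<dots> \<le> (L * ?w s) * C"
      proof (rule mult_mono)
        have "norm (F1 (y1 r) - F1 (y2 r)) \<le> L * ?w r"
          using lipschitz_onD[OF F(1), of "y1 r" "y2 r"] by (simp add: dist_norm)
        also have "\<dots> \<le> L * ?w s" by (rule mult_left_mono[OF s(2)[OF r] L0])
        finally show "norm (F1 (y1 r) - F1 (y2 r)) \<le> L * ?w s" .
      qed (use u(1)[OF r] L0 in auto)
      also have "\<dots> = (L * C) * ?w s" by simp
      also have "\<dots> \<le> (1/2) * ?w s" by (rule mult_right_mono[OF LC]) simp
      finally show ?thesis .
    qed
    moreover have "norm (blinfun_apply (F1 (y2 r) - F2 (y2 r)) (u2 r)) \<le> \<eta> * C"
      by (rule order_trans[OF norm_blinfun mult_mono[OF F(3) u(2)[OF r] \<eta>0 norm_ge_zero]])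
    moreover have "norm (blinfun_apply (F1 (y2 r)) (u1 r - u2 r)) \<le> Fm * \<delta>"
      by (rule order_trans[OF norm_blinfun mult_mono[OF F(2) u(3)[OF r] Fm0 norm_ge_zero]])
    ultimately show ?thesis unfolding R_def by linarith
  qed
  have R0: "R \<ge> 0" using order_trans[OF norm_ge_zero b[of 0]] by simp
  have i1: "((\<lambda>r. blinfun_apply (F1 (y1 r)) (u1 r)) has_integral (y1 s - y1 0)) {0..s}"
    and i2: "((\<lambda>r. blinfun_apply (F2 (y2 r)) (u2 r)) has_integral (y2 s - y2 0)) {0..s}"
    using y s(1) unfolding ode_solution_def by auto
  have "((\<lambda>r. blinfun_apply (F1 (y1 r)) (u1 r) - blinfun_apply (F2 (y2 r)) (u2 r)) has_integral
      ((y1 s - y1 0) - (y2 s - y2 0))) (cbox 0 s)"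
    using has_integral_diff[OF i1 i2] by simp
  then have "norm ((y1 s - y1 0) - (y2 s - y2 0)) \<le> R * measure lborel (cbox 0 s)"
    by (intro has_integral_bound[of R]) (use R0 b s in auto)
  also have "\<dots> \<le> R" using s(1) R0 by (simp add: mult_left_le)
  finally have "norm ((y1 s - y1 0) - (y2 s - y2 0)) \<le> R" .
  moreover have "?w s \<le> norm ((y1 s - y1 0) - (y2 s - y2 0)) + norm (x1 - x2)"
  proof -
    have "y1 s - y2 s = ((y1 s - y1 0) - (y2 s - y2 0)) + (x1 - x2)"
      using y unfolding ode_solution_def by simp
    then show ?thesis by (metis norm_triangle_ineq)
  qed
  ultimately have "?w s \<le> 2 * (norm (x1 - x2) + \<eta> * C + Fm * \<delta>)" unfolding R_def by simp
  then show ?thesis using s(2)[OF t] by simp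
qed

section \<open>Essentially open maps have stable values\<close>

lemma open_if_homeomorphic_UNIV:
  fixes U :: "'b::euclidean_space set"
  assumes "U homeomorphic (UNIV :: 'b set)"
  shows "open U"
proof -
  have "(UNIV :: 'b set) homeomorphic U" using assms by (rule homeomorphic_sym[THEN iffD1])
  then obtain \<theta> \<theta>' where h: "homeomorphism (UNIV :: 'b set) U \<theta> \<theta>'" unfolding homeomorphic_def by blast
  then have "open (\<theta> ` UNIV)"
    by (intro invariance_of_domain) (auto simp: homeomorphism_def inj_on_def, metis)
  then show ?thesis using h by (simp add: homeomorphism_def)
qed

text \<open>The frontier is the intersection of a decreasing sequence of compact sets, the closures of the images of
  the complements of balls. These complements are connected in dimension at least two.\<close>

lemma connected_frontier_of_open_ball:
  fixes U :: "'b::euclidean_space set"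
  assumes hom: "U homeomorphic (UNIV :: 'b set)" and bU: "bounded U" and dim: "2 \<le> DIM('b)"
  shows "connected (frontier U)"
proof -
  have oU: "open U" by (rule open_if_homeomorphic_UNIV[OF hom])
  have "(UNIV :: 'b set) homeomorphic U" using hom by (rule homeomorphic_sym[THEN iffD1])
  then obtain \<theta> \<theta>' where h: "homeomorphism (UNIV :: 'b set) U \<theta> \<theta>'" unfolding homeomorphic_def by blast
  have c\<theta>: "continuous_on UNIV \<theta>" and im: "\<theta> ` UNIV = U" and inj: "inj \<theta>"
    using h unfolding homeomorphism_def by (auto simp: inj_on_def) metis
  define B where "B n = \<theta> ` cball 0 (real n)" for n
  have cB: "compact (B n)" for n
    unfolding B_def by (rule compact_continuous_image[OF continuous_on_subset[OF c\<theta>]]) auto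
  have UB: "U - B n = \<theta> ` (- cball 0 (real n))" for n
    unfolding B_def im[symmetric] using inj by (simp add: image_set_diff[symmetric] Compl_eq_Diff_UNIV)
  have "connected (closure (U - B n))" for n
  proof (rule connected_imp_connected_closure)
    show "connected (U - B n)" unfolding UB
      by (rule connected_continuous_image[OF continuous_on_subset[OF c\<theta>]])
        (use dim in \<open>auto intro!: connected_complement_bounded_convex\<close>)
  qed
  moreover have "compact (closure (U - B n))" for n
    by (metis bU bounded_diff compact_closure)
  moreover have "closure (U - B n) \<subseteq> closure (U - B k)" if "k \<le> n" for k n
  proof (rule closure_mono)
    have "cball (0::'b) (real k) \<subseteq> cball 0 (real n)" using that by (simp add: subset_cball)
    then show "U - B n \<subseteq> U - B k" unfolding B_def by blast
  qed
  ultimately have con: "connected (\<Inter>n. closure (U - B n))" by (intro connected_nest)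
  have "(\<Inter>n. closure (U - B n)) = frontier U"
  proof
    show "(\<Inter>n. closure (U - B n)) \<subseteq> frontier U"
    proof
      fix x assume x: "x \<in> (\<Inter>n. closure (U - B n))"
      have "x \<in> closure U" using x closure_mono[of "U - B 0" U] by blast
      moreover have "x \<notin> U"
      proof
        assume "x \<in> U"
        then obtain z where z: "x = \<theta> z" using im by blast
        obtain n where n: "norm z < real n" using reals_Archimedean2 by blast
        have "open (\<theta> ` ball 0 (real n))"
          by (rule invariance_of_domain[OF continuous_on_subset[OF c\<theta>]]) (use inj in \<open>auto simp: inj_on_def\<close>)
        moreover have "x \<in> \<theta> ` ball 0 (real n)" using z n by auto
        moreover have "x \<in> closure (U - B n)" using x by blast
        ultimately have "(U - B n) \<inter> \<theta> ` ball 0 (real n) \<noteq> {}"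
          using open_Int_closure_eq_empty by blast
        then show False unfolding B_def using ball_subset_cball by blast
      qed
      ultimately show "x \<in> frontier U" using oU by (simp add: frontier_def interior_open)
    qed
    show "frontier U \<subseteq> (\<Inter>n. closure (U - B n))"
    proof (rule INT_greatest)
      fix n
      show "frontier U \<subseteq> closure (U - B n)"
      proof
        fix x assume "x \<in> frontier U"
        then have x: "x \<in> closure U" "x \<notin> U" using oU by (auto simp: frontier_def interior_open)
        have "B n \<subseteq> U" unfolding B_def using im by blast
        have "U \<subseteq> (U - B n) \<union> B n" by blast
        then have "closure U \<subseteq> closure ((U - B n) \<union> B n)" by (rule closure_mono)
        also have "\<dots> = closure (U - B n) \<union> B n"
          by (simp only: closure_Un closure_closed[OF compact_imp_closed[OF cB]])
        finally show "x \<in> closure (U - B n)" using x \<open>B n \<subseteq> U\<close> by blast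
      qed
    qed
  qed
  then show ?thesis using con by simp
qed

text \<open>The boundary sphere of an essentially open map is a boundary relative to the domain \<open>D\<close>, while the extension
  of maps refers to the complement in the whole space. The relative boundary \<open>S\<close> is open and closed in the frontier, which is
  connected in dimension at least two. In dimension one, both consist of two points.\<close>

lemma frontier_is_relative_frontier:
  fixes U :: "'b::euclidean_space set"
  assumes D: "open D" "bounded D" "U \<subseteq> D" and hom: "U homeomorphic (UNIV :: 'b set)"
    and S: "S = D \<inter> closure U - U" "compact S" "S homeomorphic sphere (0::'b) 1"
  shows "frontier U = S"
proof -
  have oU: "open U" by (rule open_if_homeomorphic_UNIV[OF hom])
  have fr: "frontier U = closure U - U" using oU by (simp add: frontier_def interior_open)
  have bU: "bounded U" using D by (metis bounded_subset)
  have neS: "S \<noteq> {}"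
  proof
    assume "S = {}"
    then have "sphere (0::'b) 1 = {}" using S(3) by (simp add: homeomorphic_empty)
    then show False by simp
  qed
  show ?thesis
  proof (cases "2 \<le> DIM('b)")
    case True
    have con: "connected (frontier U)" by (rule connected_frontier_of_open_ball[OF hom bU True])
    have "openin (top_of_set (frontier U)) S"
      unfolding openin_open by (intro exI[of _ D]) (use D S fr in auto)
    moreover have "closedin (top_of_set (frontier U)) S"
      unfolding closedin_closed by (intro exI[of _ S]) (use S fr in \<open>auto simp: compact_imp_closed\<close>)
    ultimately show ?thesis using con neS unfolding connected_clopen by metis
  next
    case False
    moreover have "DIM('b) \<ge> 1" using DIM_positive[where 'a='b] by linarith
    ultimately have d1: "DIM('b) = 1" by linarith
    obtain x y :: 'b where xy: "sphere (0::'b) 1 = {x, y}"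
      by (rule sphere_1D_doubleton[OF d1, of 1 "0::'b"]) auto
    have "connected U" using hom connected_UNIV homeomorphic_connectedness by blast
    then have "convex U" using connected_convex_1_gen[OF d1] by blast
    have neU: "U \<noteq> {}" using hom unfolding homeomorphic_def homeomorphism_def by auto
    have "aff_dim U = aff_dim (cball (0::'b) 1)"
      using aff_dim_open[OF oU neU] by (simp add: aff_dim_cball)
    then have "rel_frontier U homeomorphic rel_frontier (cball (0::'b) 1)"
      by (intro homeomorphic_rel_frontiers_convex_bounded_sets \<open>convex U\<close> bU) auto
    moreover have "rel_frontier U = frontier U"
      by (rule rel_frontier_nonempty_interior) (use oU neU in \<open>simp add: interior_open\<close>)
    ultimately have "frontier U homeomorphic sphere (0::'b) 1" by (simp add: rel_frontier_cball)
    then obtain f g where "homeomorphism (frontier U) (sphere (0::'b) 1) f g" unfolding homeomorphic_def by blast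
    then have b1: "bij_betw f (frontier U) (sphere (0::'b) 1)"
      unfolding homeomorphism_def bij_betw_def by (metis inj_on_inverseI)
    obtain f' g' where "homeomorphism S (sphere (0::'b) 1) f' g'" using S(3) unfolding homeomorphic_def by blast
    then have b2: "bij_betw f' S (sphere (0::'b) 1)"
      unfolding homeomorphism_def bij_betw_def by (metis inj_on_inverseI)
    have "finite (sphere (0::'b) 1)" using xy by simp
    then have "finite (frontier U)" "card (frontier U) = card S"
      using b1 b2 by (auto simp: bij_betw_same_card bij_betw_finite)
    moreover have "S \<subseteq> frontier U" using S(1) fr by blast
    ultimately show ?thesis by (metis card_subset_eq)
  qed
qed

lemma connected_components_of_top_of_set: "connected_components_of (top_of_set S) = components S"
  unfolding connected_components_of_def components_def connected_component_of_def connected_component_def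
  by (auto simp: connectedin_subtopology)

lemma Euclidean_space_isometry:
  obtains f :: "(nat \<Rightarrow> real) \<Rightarrow> 'b::euclidean_space" and g
  where "homeomorphic_maps (Euclidean_space (DIM('b))) euclidean f g"
    "\<And>x. x \<in> topspace (Euclidean_space (DIM('b))) \<Longrightarrow> norm (f x) = L2_set x {..<DIM('b)}"
proof -
  obtain f :: "(nat \<Rightarrow> real) \<Rightarrow> 'b" and g
    where fg: "homeomorphic_maps (Euclidean_space (DIM('b))) (top_of_set (span Basis)) f g"
      "\<And>x. x \<in> topspace (Euclidean_space (DIM('b))) \<Longrightarrow> (norm (f x))\<^sup>2 = (\<Sum>i<DIM('b). (x i)\<^sup>2)"
    by (rule homeomorphic_maps_Euclidean_space_euclidean_gen[of "Basis :: 'b set", OF independent_Basis orthogonal_Basis refl norm_Basis]) (assumption, erule that, simp)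
  show ?thesis
  proof (rule that)
    show "homeomorphic_maps (Euclidean_space (DIM('b))) euclidean f g" using fg(1) by simp
    fix x assume "x \<in> topspace (Euclidean_space (DIM('b)))"
    then show "norm (f x) = L2_set x {..<DIM('b)}"
      unfolding L2_set_def using fg(2) by (metis norm_ge_zero real_sqrt_abs abs_of_nonneg)
  qed
qed

text \<open>Jordan--Brouwer separation in the spaces \<open>Euclidean_space n\<close>, transferred to an arbitrary
  Euclidean type.\<close>

lemma eqpoll_components_of_complements:
  fixes S T :: "'b::euclidean_space set"
  assumes "compact S" "compact T" "S homeomorphic T"
  shows "components (- S) \<approx> components (- T)"
proof -
  let ?E = "Euclidean_space (DIM('b))"
  obtain f :: "(nat \<Rightarrow> real) \<Rightarrow> 'b" and g where fg: "homeomorphic_maps ?E euclidean f g"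
    by (rule Euclidean_space_isometry) (use that in blast)
  have gf: "homeomorphic_maps euclidean ?E g f" using fg by (rule homeomorphic_maps_sym[THEN iffD1])
  then have g: "homeomorphic_map euclidean ?E g" by (rule homeomorphic_maps_imp_map)
  have im: "g ` UNIV = topspace ?E" using homeomorphic_imp_surjective_map[OF g] unfolding topspace_euclidean .
  have inj: "inj g" using homeomorphic_imp_injective_map[OF g] unfolding topspace_euclidean .
  have cl: "closedin ?E (g ` S)" if "compact S" for S :: "'b set"
    using homeomorphic_map_closedness_eq[OF g, of S] that compact_imp_closed by auto
  have sub: "homeomorphic_map (top_of_set S) (subtopology ?E (g ` S)) g" for S :: "'b set"
    by (rule homeomorphic_map_subtopologies[OF g]) (use im in auto)
  have comp: "components (- S) \<approx> connected_components_of (subtopology ?E (topspace ?E - g ` S))" for S :: "'b set"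
  proof -
    have "g ` (- S) = topspace ?E - g ` S"
      unfolding im[symmetric] using inj by (simp add: image_set_diff[symmetric] Compl_eq_Diff_UNIV)
    then have "connected_components_of (subtopology ?E (topspace ?E - g ` S)) = (`) g ` components (- S)"
      using homeomorphic_map_connected_components_of[OF sub[of "- S"]]
      by (simp add: connected_components_of_top_of_set)
    moreover have "inj_on ((`) g) (components (- S))"
      using inj by (simp add: inj_on_def inj_image_eq_iff)
    ultimately show ?thesis by (metis inj_on_image_eqpoll_self eqpoll_sym)
  qed
  have "top_of_set S homeomorphic_space top_of_set T" using assms(3) by simp
  moreover have "top_of_set S homeomorphic_space subtopology ?E (g ` S)" "top_of_set T homeomorphic_space subtopology ?E (g ` T)"
    using sub homeomorphic_map_imp_homeomorphic_space by blast+
  ultimately have "subtopology ?E (g ` S) homeomorphic_space subtopology ?E (g ` T)"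
    by (meson homeomorphic_space_sym homeomorphic_space_trans)
  then have "connected_components_of (subtopology ?E (topspace ?E - g ` S)) \<approx> connected_components_of (subtopology ?E (topspace ?E - g ` T))"
    by (intro eqpoll_connected_components_Euclidean_complements cl assms)
  then show ?thesis using comp by (meson eqpoll_sym eqpoll_trans)
qed

lemma components_complement_sphere_subset:
  assumes dim: "2 \<le> DIM('b::euclidean_space)"
  shows "components (- sphere (0::'b) 1) \<subseteq> {ball 0 1, - cball 0 1}"
proof
  fix C assume C: "C \<in> components (- sphere (0::'b) 1)"
  have un: "- sphere (0::'b) 1 = ball 0 1 \<union> - cball 0 1" by auto
  have dis: "ball (0::'b) 1 \<inter> - cball 0 1 = {}" by auto
  have conC: "connected C" and subC: "C \<subseteq> - sphere 0 1" and neC: "C \<noteq> {}"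
    using C in_components_connected in_components_subset in_components_nonempty by blast+
  have con2: "connected (- cball (0::'b) 1)" by (rule connected_complement_bounded_convex) (use dim in auto)
  have "C \<inter> ball 0 1 = {} \<or> C \<inter> - cball 0 1 = {}"
  proof (rule ccontr)
    assume "\<not> ?thesis"
    moreover have "open (ball (0::'b) 1)" "open (- cball (0::'b) 1)" by auto
    moreover have "C \<subseteq> ball 0 1 \<union> - cball 0 1" using subC un by simp
    ultimately show False using connectedD[OF conC, of "ball 0 1" "- cball 0 1"] dis by blast
  qed
  then show "C \<in> {ball 0 1, - cball 0 1}"
  proof
    assume a: "C \<inter> ball 0 1 = {}"
    then have "C \<subseteq> - cball 0 1" using subC un by blast
    moreover have "- cball 0 1 \<subseteq> C"
      by (rule components_maximal[OF C con2]) (use un calculation neC in auto)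
    ultimately show ?thesis by blast
  next
    assume a: "C \<inter> - cball 0 1 = {}"
    then have "C \<subseteq> ball 0 1" using subC un by blast
    moreover have "ball 0 1 \<subseteq> C"
      by (rule components_maximal[OF C connected_ball]) (use un calculation neC in auto)
    ultimately show ?thesis by blast
  qed
qed

text \<open>The complement of a topological sphere has at most two components. Two of them are \<open>U\<close> and the unbounded
  one.\<close>

lemma no_bounded_component_outside:
  fixes U :: "'b::euclidean_space set"
  assumes dim: "2 \<le> DIM('b)" and U: "open U" "connected U" "bounded U" "U \<noteq> {}"
    and S: "frontier U homeomorphic sphere (0::'b) 1" and C: "C \<in> components (- closure U)"
  shows "\<not> bounded C"
proof
  assume bC: "bounded C"
  have cS: "compact (frontier U)" using U(3) by (rule compact_frontier_bounded)
  have "components (- frontier U) \<approx> components (- sphere (0::'b) 1)"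
    by (rule eqpoll_components_of_complements[OF cS compact_sphere S])
  moreover have "finite (components (- sphere (0::'b) 1))"
    by (rule finite_subset[OF components_complement_sphere_subset[OF dim]]) simp
  moreover have "card (components (- sphere (0::'b) 1)) \<le> 2"
    by (rule order_trans[OF card_mono[OF _ components_complement_sphere_subset[OF dim]]]) (simp_all add: card_insert_if)
  ultimately have fin: "finite (components (- frontier U))" and c2: "card (components (- frontier U)) \<le> 2"
    using eqpoll_finite_iff eqpoll_iff_card by (blast, metis)
  have dU: "U \<subseteq> - frontier U" using U(1) by (auto simp: frontier_def interior_open)
  have inside: "K \<subseteq> U" if "connected K" "K \<inter> frontier U = {}" "K \<inter> U \<noteq> {}" for K
    using connected_Int_frontier[of K U] that by blast
  have 1: "U \<in> components (- frontier U)"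
    unfolding in_components_maximal
    using U dU inside by blast
  have conC: "connected C" and subC: "C \<subseteq> - closure U" and neC: "C \<noteq> {}"
    using C in_components_connected in_components_subset in_components_nonempty by blast+
  have "C \<subseteq> - frontier U" using subC by (auto simp: frontier_def)
  have 2: "C \<in> components (- frontier U)"
    unfolding in_components_maximal
  proof (intro conjI allI impI neC \<open>C \<subseteq> - frontier U\<close> conC)
    fix K assume K: "K \<noteq> {} \<and> C \<subseteq> K \<and> K \<subseteq> - frontier U \<and> connected K"
    have "K \<inter> U = {}"
    proof (rule ccontr)
      assume "K \<inter> U \<noteq> {}"
      then have "K \<subseteq> U" using K inside by blast
      then show False using K neC subC closure_subset by blast
    qed
    then have "K \<inter> closure U = {}" using K U(1) by (auto simp: frontier_def interior_open)
    then have "K \<subseteq> C" using components_maximal[OF C, of K] K neC by blast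
    then show "K = C" using K by blast
  qed
  have "bounded (- (- frontier U))" using cS compact_imp_bounded by simp
  then obtain x where x: "x \<in> - frontier U" "\<not> bounded (connected_component_set (- frontier U) x)"
    using cobounded_unbounded_component by blast
  define C' where "C' = connected_component_set (- frontier U) x"
  have 3: "C' \<in> components (- frontier U)" unfolding C'_def components_def using x(1) by blast
  have ne: "C' \<noteq> U" "C' \<noteq> C" using x(2) U(3) bC unfolding C'_def by auto
  have "C \<noteq> U" using neC subC closure_subset by blast
  then have "card {U, C, C'} = 3" using ne by auto
  moreover have "card {U, C, C'} \<le> card (components (- frontier U))"
    by (rule card_mono[OF fin]) (use 1 2 3 in auto)
  ultimately show False using c2 by simp
qed

text \<open>As the complement of the closure has no bounded component, \<open>H\<close> extends to a map from the whole space, which is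
  contractible, into the sphere. In dimension one, the closure is an interval and itself contractible.\<close>

lemma nullhomotopic_on_frontier:
  fixes U :: "'b::euclidean_space set" and H :: "'b \<Rightarrow> 'b"
  assumes hom: "U homeomorphic (UNIV :: 'b set)" and bU: "bounded U"
    and S: "frontier U homeomorphic sphere (0::'b) 1"
    and H: "continuous_on (closure U) H" "H \<in> closure U \<rightarrow> sphere 0 1"
  shows "\<exists>c. homotopic_with_canon (\<lambda>_. True) (frontier U) (sphere 0 1) H (\<lambda>_. c)"
proof -
  have oU: "open U" by (rule open_if_homeomorphic_UNIV[OF hom])
  have conU: "connected U" using hom connected_UNIV homeomorphic_connectedness by blast
  have neU: "U \<noteq> {}" using hom unfolding homeomorphic_def homeomorphism_def by auto
  have frsub: "frontier U \<subseteq> closure U" by (auto simp: frontier_def)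
  show ?thesis
  proof (cases "2 \<le> DIM('b)")
    case True
    have cc: "compact (closure U)" using bU by simp
    obtain K where K: "continuous_on UNIV K" "K \<in> UNIV \<rightarrow> sphere (0::'b) 1" "\<And>x. x \<in> closure U \<Longrightarrow> K x = H x"
      by (rule extend_map_UNIV_to_sphere_no_bounded_component[OF order_refl zero_le_one cc H
            no_bounded_component_outside[OF True oU conU bU neU S]]) (assumption, blast)
    obtain c where "homotopic_with_canon (\<lambda>_. True) UNIV (sphere 0 1) K (\<lambda>_. c)"
      by (rule nullhomotopic_from_contractible[OF K(1,2) contractible_UNIV])
    then have "homotopic_with_canon (\<lambda>_. True) (frontier U) (sphere 0 1) K (\<lambda>_. c)"
      by (rule homotopic_with_subset_left) simp
    then have "homotopic_with_canon (\<lambda>_. True) (frontier U) (sphere 0 1) H (\<lambda>_. c)"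
      by (rule homotopic_with_eq) (use K(3) frsub in auto)
    then show ?thesis ..
  next
    case False
    moreover have "DIM('b) \<ge> 1" using DIM_positive[where 'a='b] by linarith
    ultimately have d1: "DIM('b) = 1" by linarith
    have "convex U" using conU connected_convex_1_gen[OF d1] by blast
    then have "contractible (closure U)" by (simp add: convex_closure convex_imp_contractible)
    then obtain c where "homotopic_with_canon (\<lambda>_. True) (closure U) (sphere 0 1) H (\<lambda>_. c)"
      by (rule nullhomotopic_from_contractible[OF H])
    then have "homotopic_with_canon (\<lambda>_. True) (frontier U) (sphere 0 1) H (\<lambda>_. c)"
      by (rule homotopic_with_subset_left) (rule frsub)
    then show ?thesis ..
  qed
qed

text \<open>On the compact set \<open>G ` frontier U\<close> the map \<open>w\<close> is given; it extends to the complement of a finite set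
  \<open>K\<close>. Near each point of \<open>K\<close>, \<open>G\<close> is replaced by a perturbation that avoids this point. The resulting
  map \<open>G2\<close> avoids \<open>K\<close> and equals \<open>G\<close> on the frontier, so that \<open>w\<close> after \<open>G\<close> extends from the frontier to the
  closure of \<open>U\<close> as a map into the sphere.\<close>

lemma nullhomotopic_if_values_avoidable:
  fixes U :: "'b::euclidean_space set" and G w :: "'b \<Rightarrow> 'b"
  assumes hom: "U homeomorphic (UNIV :: 'b set)" and bU: "bounded U"
    and S: "frontier U homeomorphic sphere (0::'b) 1"
    and G: "continuous_on (closure U) G"
    and w: "continuous_on (G ` frontier U) w" "w \<in> G ` frontier U \<rightarrow> sphere 0 1"
    and unstable: "\<And>q \<epsilon>. \<epsilon> > 0 \<Longrightarrow> \<exists>G1. continuous_on (closure U) G1 \<and> (\<forall>x\<in>closure U. dist (G1 x) (G x) \<le> \<epsilon>) \<and> q \<notin> G1 ` closure U"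
  shows "\<exists>c. homotopic_with_canon (\<lambda>_. True) (frontier U) (sphere 0 1) (w \<circ> G) (\<lambda>_. c)"
proof -
  have frsub: "frontier U \<subseteq> closure U" by (auto simp: frontier_def)
  let ?S = "G ` frontier U"
  have cS: "compact ?S"
    by (rule compact_continuous_image[OF continuous_on_subset[OF G frsub] compact_frontier_bounded[OF bU]])
  obtain K w' where K: "finite K" "disjnt K ?S" "continuous_on (- K) w'" "w' \<in> - K \<rightarrow> sphere 0 1" "\<And>x. x \<in> ?S \<Longrightarrow> w' x = w x"
  proof (rule extend_map_UNIV_to_sphere_cofinite[OF order_refl zero_le_one cS w, of UNIV])
    fix C assume "C \<in> components (- ?S)"
    then show "C \<inter> UNIV \<noteq> {}" using in_components_nonempty by auto
  qed (use that in blast)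
  obtain \<delta> where \<delta>: "\<delta> > 0" "\<And>p q. p \<in> K \<Longrightarrow> q \<in> K \<Longrightarrow> p \<noteq> q \<Longrightarrow> 4 * \<delta> \<le> dist p q"
      "\<And>p x. p \<in> K \<Longrightarrow> x \<in> ?S \<Longrightarrow> 2 * \<delta> \<le> dist x p"
  proof -
    obtain d1 where d1: "d1 > 0" "\<And>p q. p \<in> K \<Longrightarrow> q \<in> K \<Longrightarrow> p \<noteq> q \<Longrightarrow> d1 \<le> dist p q"
    proof -
      have "\<forall>p\<in>K. \<exists>d>0. \<forall>q\<in>K. q \<noteq> p \<longrightarrow> d \<le> dist p q" using finite_set_avoid[OF K(1)] by blast
      then obtain d where d: "\<forall>p\<in>K. d p > 0 \<and> (\<forall>q\<in>K. q \<noteq> p \<longrightarrow> d p \<le> dist p q)" by (rule bchoice[THEN exE])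
      show ?thesis
      proof (rule that[of "Min (insert 1 (d ` K))"])
        show "Min (insert 1 (d ` K)) > 0" using K(1) d by simp
        fix p q assume pq: "p \<in> K" "q \<in> K" "p \<noteq> q"
        have "Min (insert 1 (d ` K)) \<le> d p" using K(1) pq by (intro Min_le) auto
        also have "\<dots> \<le> dist p q" using d pq by auto
        finally show "Min (insert 1 (d ` K)) \<le> dist p q" .
      qed
    qed
    obtain d2 where d2: "d2 > 0" "\<And>p x. p \<in> K \<Longrightarrow> x \<in> ?S \<Longrightarrow> d2 \<le> dist x p"
      using separate_compact_closed[OF cS finite_imp_closed[OF K(1)]] K(2) by (auto simp: disjnt_def Int_commute)
    show ?thesis
    proof (rule that[of "min d1 d2 / 4"])
      show "4 * (min d1 d2 / 4) \<le> dist p q" if "p \<in> K" "q \<in> K" "p \<noteq> q" for p q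
        using d1(2)[OF that] by simp
      show "2 * (min d1 d2 / 4) \<le> dist x p" if "p \<in> K" "x \<in> ?S" for p x
        using d2(2)[OF that] d2(1) d1(1) by simp
    qed (use d1 d2 in simp)
  qed
  have "\<forall>q\<in>K. \<exists>G1. continuous_on (closure U) G1 \<and> (\<forall>x\<in>closure U. dist (G1 x) (G x) \<le> \<delta>/2) \<and> q \<notin> G1 ` closure U"
    by (intro ballI unstable) (use \<delta>(1) in simp)
  then obtain G1 where G1: "\<forall>q\<in>K. continuous_on (closure U) (G1 q) \<and> (\<forall>x\<in>closure U. dist (G1 q x) (G x) \<le> \<delta>/2) \<and> q \<notin> G1 q ` closure U"
    by (rule bchoice[THEN exE])
  define \<rho> where "\<rho> r = max 0 (min 1 (2 - r / \<delta>))" for r :: real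
  have \<rho>: "\<rho> r = 0" if "r \<ge> 2 * \<delta>" for r using that \<delta>(1) unfolding \<rho>_def by (simp add: field_simps)
  have \<rho>1: "\<rho> r = 1" if "r \<le> \<delta>" for r using that \<delta>(1) unfolding \<rho>_def by (simp add: field_simps)
  have \<rho>01: "0 \<le> \<rho> r" "\<rho> r \<le> 1" for r unfolding \<rho>_def by auto
  \<comment> \<open>The cut-off function \<open>\<rho>\<close> is supported in the balls of radius \<open>2 * \<delta>\<close> around the points of \<open>K\<close>, which are disjoint and do not meet the image of the frontier.\<close>
  define G2 where "G2 x = G x + (\<Sum>q\<in>K. \<rho> (dist (G x) q) *\<^sub>R (G1 q x - G x))" for x
  have cG2: "continuous_on (closure U) G2"
    unfolding G2_def \<rho>_def using G1 G \<delta>(1) by (intro continuous_intros) auto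
  have one: "G2 x = G x + \<rho> (dist (G x) q) *\<^sub>R (G1 q x - G x)" if q: "q \<in> K" "dist (G x) q < 2 * \<delta>" for x q
  proof -
    have "(\<Sum>p\<in>K - {q}. \<rho> (dist (G x) p) *\<^sub>R (G1 p x - G x)) = 0"
    proof (rule sum.neutral, rule ballI)
      fix p assume p: "p \<in> K - {q}"
      have "4 * \<delta> \<le> dist p q" using \<delta>(2) p q by auto
      also have "\<dots> \<le> dist (G x) p + dist (G x) q" by (metis dist_commute dist_triangle)
      finally have "2 * \<delta> \<le> dist (G x) p" using q by simp
      then show "\<rho> (dist (G x) p) *\<^sub>R (G1 p x - G x) = 0" using \<rho> by simp
    qed
    then show ?thesis unfolding G2_def by (simp add: sum.remove[OF K(1) q(1)])
  qed
  have far: "G2 x = G x" if "\<And>q. q \<in> K \<Longrightarrow> 2 * \<delta> \<le> dist (G x) q" for x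
    unfolding G2_def using \<rho> that by simp
  have avoid: "G2 x \<notin> K" if x: "x \<in> closure U" for x
  proof
    assume K2: "G2 x \<in> K"
    show False
    proof (cases "\<exists>q\<in>K. dist (G x) q < 2 * \<delta>")
      case False
      then have "G2 x = G x" by (intro far) (auto simp: not_less)
      then show False using False K2 \<delta>(1) by auto
    next
      case True
      then obtain q where q: "q \<in> K" "dist (G x) q < 2 * \<delta>" by auto
      have d: "dist (G1 q x) (G x) \<le> \<delta>/2" using G1 q x by auto
      have near: "dist (G2 x) (G x) \<le> \<delta>/2"
      proof -
        have "dist (G2 x) (G x) = \<rho> (dist (G x) q) * dist (G1 q x) (G x)"
          unfolding one[OF q] dist_norm using \<rho>01 by simp
        also have "\<dots> \<le> 1 * dist (G1 q x) (G x)" using \<rho>01 by (intro mult_right_mono) auto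
        finally show ?thesis using d by simp
      qed
      have "dist (G2 x) q < 4 * \<delta>"
        using dist_triangle[of "G2 x" q "G x"] near q \<delta>(1) by simp
      then have Gq: "G2 x = q" using \<delta>(2)[OF K2 q(1)] by fastforce
      then have "dist (G x) q \<le> \<delta>" using near \<delta>(1) by (simp add: dist_commute)
      then have "G2 x = G1 q x" unfolding one[OF q] using \<rho>1 by simp
      then have "q \<in> G1 q ` closure U" using Gq x by (metis image_eqI)
      then show False using G1 q by blast
    qed
  qed
  have H: "continuous_on (closure U) (w' \<circ> G2)" "w' \<circ> G2 \<in> closure U \<rightarrow> sphere 0 1"
  proof -
    show "continuous_on (closure U) (w' \<circ> G2)"
      by (rule continuous_on_compose[OF cG2 continuous_on_subset[OF K(3)]]) (use avoid in auto)
    show "w' \<circ> G2 \<in> closure U \<rightarrow> sphere 0 1" using avoid K(4) by (auto simp: Pi_iff)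
  qed
  obtain c where hc: "homotopic_with_canon (\<lambda>_. True) (frontier U) (sphere 0 1) (w' \<circ> G2) (\<lambda>_. c)"
    using nullhomotopic_on_frontier[OF hom bU S H] ..
  have eq: "(w' \<circ> G2) x = (w \<circ> G) x" if "x \<in> frontier U" for x
    using far[of x] \<delta>(3) K(5) that by simp
  have "homotopic_with_canon (\<lambda>_. True) (frontier U) (sphere 0 1) (w \<circ> G) (\<lambda>_. c)"
    by (rule homotopic_with_eq[OF hc]) (use eq in auto)
  then show ?thesis ..
qed

text \<open>Up to homotopy the map factors through a point, in whose homology the reduced classes vanish.\<close>

lemma hom_induced_constant_if_nullhomotopic:
  assumes h: "homotopic_with (\<lambda>_. True) X Y g (\<lambda>_. y)" and ne: "topspace X \<noteq> {}"
  shows "hom_induced p X {} Y {} g constant_on carrier (reduced_homology_group p X)"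
proof -
  let ?pt = "discrete_topology {()}"
  have "continuous_map X Y (\<lambda>_. y)" using homotopic_with_imp_continuous_maps[OF h] by simp
  then have y: "y \<in> topspace Y" using ne by (auto simp: continuous_map_def)
  have h': "homotopic_with (\<lambda>h. h \<in> {} \<rightarrow> {}) X Y g (\<lambda>_. y)"
    using h by (rule homotopic_with_mono) auto
  have "hom_induced p X {} Y {} g c = hom_induced p ?pt {} Y {} (\<lambda>_. y) (one (homology_group p ?pt))"
    if c: "c \<in> carrier (reduced_homology_group p X)" for c
  proof -
    have k: "hom_induced p X {} ?pt {} (\<lambda>x. ()) c = one (homology_group p ?pt)"
      using c unfolding carrier_reduced_homology_group by (simp add: Coset.kernel_def)
    have "hom_induced p X {} Y {} g c = hom_induced p X {} Y {} ((\<lambda>_. y) \<circ> (\<lambda>x. ())) c"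
      using homology_homotopy_axiom[OF h'] by (simp add: o_def)
    also have "\<dots> = hom_induced p ?pt {} Y {} (\<lambda>_. y) (hom_induced p X {} ?pt {} (\<lambda>x. ()) c)"
      by (rule hom_induced_compose'[symmetric]) (use y in auto)
    finally show ?thesis unfolding k .
  qed
  then show ?thesis unfolding constant_on_def by blast
qed

text \<open>If no value were stable, the boundary map composed with the radial projection around \<open>g t\<close>, taken in
  coordinates of the ball \<open>V\<close>, would be null-homotopic. Radial projection is homotopic to the identity away from the centre, so the boundary map
  itself would be null-homotopic in \<open>V - {g t}\<close> and constant on reduced homology. The coordinates \<open>\<kappa>\<close>, in which perturbations
  are measured, are defined on a set \<open>W\<close> that is unrelated to \<open>V\<close>.\<close>

lemma essentially_open_stable_value:
  fixes g :: "(nat \<Rightarrow> real) \<Rightarrow> 'a::t2_space" and \<kappa> :: "'a \<Rightarrow> 'b::euclidean_space"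
  assumes \<Omega>: "openin (Euclidean_space (DIM('b))) \<Omega>" "\<Omega> \<subseteq> {s. L2_set s {..<DIM('b)} < T}"
    and eo: "essentially_open_at_scale (DIM('b)) (subtopology (Euclidean_space (DIM('b))) \<Omega>) euclidean g t U"
    and W: "g ` \<Omega> \<subseteq> W" "homeomorphism W (\<kappa> ` W) \<kappa> \<kappa>'"
  shows "\<exists>K q \<epsilon>. compactin (Euclidean_space (DIM('b))) K \<and> K \<subseteq> \<Omega> \<and> \<epsilon> > 0 \<and>
    (\<forall>G'. continuous_map (subtopology (Euclidean_space (DIM('b))) K) euclidean G' \<and> (\<forall>s\<in>K. dist (G' s) (\<kappa> (g s)) \<le> \<epsilon>) \<longrightarrow> q \<in> G' ` K)"
proof -
  let ?k = "DIM('b)"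
  let ?E = "Euclidean_space ?k"
  let ?P = "subtopology ?E \<Omega>"
  obtain f :: "(nat \<Rightarrow> real) \<Rightarrow> 'b" and h where fh: "homeomorphic_maps ?E euclidean f h"
    and nf: "\<And>x. x \<in> topspace ?E \<Longrightarrow> norm (f x) = L2_set x {..<?k}"
    using Euclidean_space_isometry by blast
  have f: "homeomorphic_map ?E euclidean f" and h: "homeomorphic_map euclidean ?E h"
    using fh homeomorphic_maps_imp_map homeomorphic_maps_sym by blast+
  have hf: "\<And>x. x \<in> topspace ?E \<Longrightarrow> h (f x) = x" and fhi: "\<And>y. f (h y) = y" and hE: "\<And>y. h y \<in> topspace ?E"
    using fh unfolding homeomorphic_maps_def continuous_map_def by auto
  have fim: "f ` topspace ?E = UNIV" using fhi hE by (metis image_eqI UNIV_eq_I)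
  have injf: "inj_on f (topspace ?E)" using hf by (metis inj_on_inverseI)
  have ch: "continuous_map euclidean ?E h" using fh unfolding homeomorphic_maps_def by simp
  have sub: "top_of_set (f ` X) homeomorphic_space subtopology ?E X" "homeomorphic_map (subtopology ?E X) (top_of_set (f ` X)) f"
    if "X \<subseteq> topspace ?E" for X
  proof -
    show m: "homeomorphic_map (subtopology ?E X) (top_of_set (f ` X)) f"
      by (rule homeomorphic_map_subtopologies[OF f]) (use that in auto)
    show "top_of_set (f ` X) homeomorphic_space subtopology ?E X"
      using m homeomorphic_map_imp_homeomorphic_space homeomorphic_space_sym by blast
  qed
  have \<Omega>E: "\<Omega> \<subseteq> topspace ?E" using \<Omega>(1) by (rule openin_subset)
  have ball: "open_ball_space ?k homeomorphic_space top_of_set (ball (0::'b) 1)"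
  proof -
    let ?X = "topspace ?E \<inter> {x. L2_set x {..<?k} < 1}"
    have "f ` ?X = ball 0 1"
    proof
      show "f ` ?X \<subseteq> ball 0 1" using nf by auto
      show "ball 0 1 \<subseteq> f ` ?X"
      proof
        fix z :: 'b assume "z \<in> ball 0 1"
        then have "h z \<in> ?X" using hE[of z] nf[OF hE[of z]] fhi[of z] by simp
        then show "z \<in> f ` ?X" using fhi[of z] by (metis image_eqI)
      qed
    qed
    moreover have "open_ball_space ?k = subtopology ?E ?X"
      unfolding open_ball_space_def by (metis subtopology_restrict)
    ultimately show ?thesis using sub(1)[of ?X] homeomorphic_space_sym by (metis inf_le1)
  qed
  have ballU: "ball (0::'b) 1 homeomorphic (UNIV :: 'b set)" by (rule homeomorphic_ball_UNIV) simp
  have eo': "continuous_map ?P euclidean g" "neighborhood_in ?P t U" "subtopology ?P U homeomorphic_space open_ball_space ?k"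
    "subtopology ?P (?P frontier_of U) homeomorphic_space nsphere (?k - 1)"
    using eo unfolding essentially_open_at_scale_def by auto
  obtain V where V: "neighborhood_in euclidean (g t) V" "subtopology euclidean V homeomorphic_space open_ball_space ?k"
    "g ` (?P frontier_of U) \<subseteq> V - {g t}"
    "\<not> hom_induced (int ?k - 1) (subtopology ?P (?P frontier_of U)) {} (subtopology euclidean (V - {g t})) {} g
            constant_on carrier (reduced_homology_group (int ?k - 1) (subtopology ?P (?P frontier_of U)))"
    using eo unfolding essentially_open_at_scale_def by auto
  define Fr where "Fr = ?P frontier_of U"
  have tP: "topspace ?P = \<Omega>" using \<Omega>E by auto
  have U\<Omega>: "U \<subseteq> \<Omega>" using eo'(2) tP unfolding neighborhood_in_def by blast
  have Fr\<Omega>: "Fr \<subseteq> \<Omega>" unfolding Fr_def using frontier_of_subset_topspace[of ?P U] tP by blast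
  have PU: "subtopology ?P U = subtopology ?E U" using U\<Omega> by (simp add: subtopology_subtopology inf.absorb2)
  have PFr: "subtopology ?P Fr = subtopology ?E Fr" using Fr\<Omega> by (simp add: subtopology_subtopology inf.absorb2)
  define D where "D = f ` \<Omega>"
  define U' where "U' = f ` U"
  define S where "S = f ` Fr"
  have Us: "U \<subseteq> topspace ?P" unfolding tP by (rule U\<Omega>)
  have oD: "open D" unfolding D_def using homeomorphic_map_openness[OF f \<Omega>E] \<Omega>(1) by simp
  have bD: "bounded D" unfolding D_def bounded_iff
  proof (intro exI[of _ T] ballI)
    fix z assume "z \<in> f ` \<Omega>"
    then obtain x where x: "x \<in> \<Omega>" "z = f x" by blast
    have "norm z = L2_set x {..<?k}" unfolding x(2) by (rule nf) (use x(1) \<Omega>E in blast)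
    also have "\<dots> < T" using x(1) \<Omega>(2) by blast
    finally show "norm z \<le> T" by simp
  qed
  have UD: "U' \<subseteq> D" unfolding U'_def D_def using U\<Omega> by blast
  have homU: "U' homeomorphic (UNIV :: 'b set)"
  proof -
    have "top_of_set U' homeomorphic_space top_of_set (ball (0::'b) 1)"
      using sub(1)[of U] U\<Omega> \<Omega>E eo'(3) ball unfolding U'_def PU by (meson homeomorphic_space_trans order_trans)
    then have "U' homeomorphic ball (0::'b) 1" by simp
    then show ?thesis using ballU homeomorphic_trans by blast
  qed
  have oU: "open U'" by (rule open_if_homeomorphic_UNIV[OF homU])
  have fP: "homeomorphic_map ?P (top_of_set D) f" unfolding D_def by (rule sub(2)[OF \<Omega>E])
  have S_eq: "S = D \<inter> closure U' - U'"
  proof -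
    have "S = top_of_set D frontier_of U'"
      unfolding S_def Fr_def U'_def by (rule homeomorphic_map_frontier_of[OF fP Us, symmetric])
    also have "\<dots> = D \<inter> closure U' - U'"
    proof -
      have "top_of_set D closure_of U' = D \<inter> closure U'"
        using closure_of_subtopology_open[of euclidean D U'] oD by simp
      moreover have "top_of_set D interior_of U' = U'"
        by (rule interior_of_openin) (use oU UD in \<open>simp add: openin_open_eq oD\<close>)
      ultimately show ?thesis unfolding frontier_of_def by simp
    qed
    finally show ?thesis .
  qed
  have homS: "S homeomorphic sphere (0::'b) 1"
  proof -
    let ?X = "topspace ?E \<inter> {x. (\<Sum>i\<le>?k - 1. (x i)\<^sup>2) = 1}"
    have k: "Suc (?k - 1) = ?k" by simp
    have le: "{..?k - 1} = {..<?k}" using k lessThan_Suc_atMost by metis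
    have iff: "norm (f x) = 1 \<longleftrightarrow> (\<Sum>i\<le>?k - 1. (x i)\<^sup>2) = 1" if "x \<in> topspace ?E" for x
      using nf[OF that] unfolding L2_set_def le by simp
    have "f ` ?X = sphere 0 1"
    proof
      show "f ` ?X \<subseteq> sphere 0 1" using iff by auto
      show "sphere 0 1 \<subseteq> f ` ?X"
      proof
        fix z :: 'b assume "z \<in> sphere 0 1"
        then have "h z \<in> ?X" using hE[of z] iff[OF hE[of z]] fhi[of z] by simp
        then show "z \<in> f ` ?X" using fhi[of z] by (metis image_eqI)
      qed
    qed
    moreover have "nsphere (?k - 1) = subtopology ?E ?X"
      unfolding nsphere_def k by (metis subtopology_restrict)
    ultimately have "nsphere (?k - 1) homeomorphic_space top_of_set (sphere (0::'b) 1)"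
      using sub(1)[of ?X] homeomorphic_space_sym by (metis inf_le1)
    moreover have "top_of_set S homeomorphic_space nsphere (?k - 1)"
      using sub(1)[of Fr] Fr\<Omega> \<Omega>E eo'(4) unfolding S_def Fr_def[symmetric] PFr by (meson homeomorphic_space_trans order_trans)
    ultimately have "top_of_set S homeomorphic_space top_of_set (sphere (0::'b) 1)" by (meson homeomorphic_space_trans)
    then show ?thesis by simp
  qed
  have cS: "compact S" using homS compact_sphere homeomorphic_compactness by blast
  have fr: "frontier U' = S" by (rule frontier_is_relative_frontier[OF oD bD UD homU S_eq cS homS])
  have bU: "bounded U'" using bD UD by (rule bounded_subset)
  have clU: "closure U' \<subseteq> D"
  proof
    fix x assume "x \<in> closure U'"
    then show "x \<in> D" using fr S_eq UD oU by (cases "x \<in> U'") (auto simp: frontier_def interior_open)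
  qed
  have frsub: "frontier U' \<subseteq> closure U'" by (auto simp: frontier_def)
  have hD: "h z \<in> \<Omega>" if "z \<in> D" for z using that \<Omega>E hf unfolding D_def by auto
  have hS: "h z \<in> Fr" if "z \<in> S" for z using that Fr\<Omega> \<Omega>E hf unfolding S_def by auto
  define G0 where "G0 = g \<circ> h"
  have cG0: "continuous_on D G0"
  proof -
    have "continuous_map (top_of_set D) ?P h"
      unfolding continuous_map_in_subtopology using hD ch by (auto intro: continuous_map_from_subtopology)
    then have "continuous_map (top_of_set D) euclidean (g \<circ> h)" using eo'(1) by (rule continuous_map_compose)
    then show ?thesis unfolding G0_def by simp
  qed
  have G0S: "G0 ` S \<subseteq> V - {g t}" using hS V(3) unfolding G0_def Fr_def by auto
  have G0W: "G0 ` D \<subseteq> W" using hD W(1) unfolding G0_def by auto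
  have cK: "continuous_on W \<kappa>" "continuous_on (\<kappa> ` W) \<kappa>'" "\<And>x. x \<in> W \<Longrightarrow> \<kappa>' (\<kappa> x) = x"
    using W(2) unfolding homeomorphism_def by auto
  define G where "G = \<kappa> \<circ> G0"
  have cG: "continuous_on (closure U') G" unfolding G_def
    by (rule continuous_on_compose[OF continuous_on_subset[OF cG0 clU] continuous_on_subset[OF cK(1)]]) (use G0W clU in auto)
  have "top_of_set V homeomorphic_space top_of_set (ball (0::'b) 1)"
    using V(2) ball by (rule homeomorphic_space_trans)
  then have "top_of_set V homeomorphic_space top_of_set (UNIV :: 'b set)"
    using ballU homeomorphic_space_trans homeomorphic_space_iff_homeomorphic by metis
  then obtain \<psi>0 \<psi>0' where \<psi>0: "homeomorphic_maps (top_of_set V) (top_of_set (UNIV :: 'b set)) \<psi>0 \<psi>0'"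
    unfolding homeomorphic_space_def by blast
  have gtV: "g t \<in> V" using V(1) unfolding neighborhood_in_def by blast
  define \<psi> where "\<psi> x = \<psi>0 x - \<psi>0 (g t)" for x
  define \<psi>' where "\<psi>' z = \<psi>0' (z + \<psi>0 (g t))" for z
  have c\<psi>: "continuous_on V \<psi>" unfolding \<psi>_def using \<psi>0 unfolding homeomorphic_maps_def by (intro continuous_intros) auto
  have c\<psi>': "continuous_on UNIV \<psi>'" unfolding \<psi>'_def
    by (rule continuous_on_compose2[of UNIV \<psi>0']) (use \<psi>0 in \<open>auto simp: homeomorphic_maps_def continuous_map_in_subtopology intro!: continuous_intros\<close>)
  have \<psi>'\<psi>: "\<psi>' (\<psi> x) = x" if "x \<in> V" for x using \<psi>0 that unfolding homeomorphic_maps_def \<psi>_def \<psi>'_def by auto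
  have \<psi>\<psi>': "\<psi> (\<psi>' z) = z" for z using \<psi>0 unfolding homeomorphic_maps_def \<psi>_def \<psi>'_def by auto
  have \<psi>'V: "\<psi>' z \<in> V" for z using \<psi>0 unfolding homeomorphic_maps_def \<psi>'_def continuous_map_in_subtopology by auto
  have \<psi>0e: "\<psi> (g t) = 0" unfolding \<psi>_def by simp
  have \<psi>ne: "\<psi> x \<noteq> 0" if "x \<in> V - {g t}" for x using \<psi>'\<psi>[of x] \<psi>'\<psi>[OF gtV] \<psi>0e that by auto
  have \<psi>'ne: "\<psi>' z \<in> V - {g t}" if "z \<noteq> 0" for z using \<psi>'V[of z] \<psi>\<psi>'[of z] \<psi>0e that by auto
  define w where "w z = (let x = \<psi> (\<kappa>' z) in (1 / norm x) *\<^sub>R x)" for z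
  have \<kappa>'G: "\<kappa>' (G x) = G0 x" if "x \<in> D" for x unfolding G_def using cK(3) G0W that by auto
  have SD: "S \<subseteq> D" using S_eq by blast
  have \<kappa>'S: "\<kappa>' z \<in> V - {g t}" if "z \<in> G ` S" for z
  proof -
    obtain x where "x \<in> S" "z = G x" using \<open>z \<in> G ` S\<close> by blast
    then show ?thesis using \<kappa>'G[of x] SD G0S by auto
  qed
  have GSW: "G ` S \<subseteq> \<kappa> ` W" unfolding G_def using G0W SD by auto
  have cw: "continuous_on (G ` S) w"
    unfolding w_def Let_def
  proof (intro continuous_intros ballI)
    show "continuous_on (G ` S) (\<lambda>z. \<psi> (\<kappa>' z))"
      by (rule continuous_on_compose2[OF c\<psi> continuous_on_subset[OF cK(2) GSW]]) (use \<kappa>'S in auto)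
    then show "continuous_on (G ` S) (\<lambda>z. \<psi> (\<kappa>' z))" .
    show "norm (\<psi> (\<kappa>' z)) \<noteq> 0" if "z \<in> G ` S" for z using \<psi>ne[OF \<kappa>'S[OF that]] by simp
  qed
  have ws: "w \<in> G ` S \<rightarrow> sphere 0 1"
  proof
    fix z assume "z \<in> G ` S"
    then have "\<psi> (\<kappa>' z) \<noteq> 0" using \<psi>ne \<kappa>'S by blast
    then show "w z \<in> sphere 0 1" unfolding w_def Let_def by simp
  qed
  \<comment> \<open>A null-homotopy into the unit sphere would carry over to \<open>V - {g t}\<close>.\<close>
  have not_null: "\<not> (\<exists>c. homotopic_with_canon (\<lambda>_. True) S (sphere 0 1) (w \<circ> G) (\<lambda>_. c))"
  proof
    assume "\<exists>c. homotopic_with_canon (\<lambda>_. True) S (sphere 0 1) (w \<circ> G) (\<lambda>_. c)"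
    then obtain c where "homotopic_with_canon (\<lambda>_. True) S (sphere 0 1) (w \<circ> G) (\<lambda>_. c)" ..
    then have 1: "homotopic_with_canon (\<lambda>_. True) S (- {0}) (w \<circ> G) (\<lambda>_. c)"
      by (rule homotopic_with_subset_right) auto
    have c\<psi>G: "continuous_on S (\<psi> \<circ> G0)"
      by (rule continuous_on_compose[OF continuous_on_subset[OF cG0 SD] continuous_on_subset[OF c\<psi>]]) (use G0S in auto)
    have cwG: "continuous_on S (w \<circ> G)"
      by (rule continuous_on_compose[OF continuous_on_subset[OF cG] cw]) (use fr frsub in auto)
    have 2: "homotopic_with_canon (\<lambda>_. True) S (- {0}) (\<psi> \<circ> G0) (w \<circ> G)"
    proof (rule homotopic_with_linear[OF c\<psi>G cwG])
      fix x assume x: "x \<in> S"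
      define z where "z = \<psi> (G0 x)"
      have z: "z \<noteq> 0" unfolding z_def using \<psi>ne G0S x by auto
      have wz: "(w \<circ> G) x = (1 / norm z) *\<^sub>R z" unfolding w_def z_def using \<kappa>'G[of x] x SD by (auto simp: Let_def)
      have "0 \<notin> closed_segment z ((1 / norm z) *\<^sub>R z)"
      proof
        assume "0 \<in> closed_segment z ((1 / norm z) *\<^sub>R z)"
        then obtain l where l: "0 \<le> l" "l \<le> 1" "0 = (1 - l) *\<^sub>R z + l *\<^sub>R ((1 / norm z) *\<^sub>R z)"
          unfolding closed_segment_def by auto
        then have "((1 - l) + l / norm z) *\<^sub>R z = 0" by (simp add: scaleR_add_left)
        then have "(1 - l) + l / norm z = 0" using z by simp
        moreover have "l / norm z \<ge> 0" using l by simp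
        ultimately have "l = 1" "l / norm z = 0" using l by linarith+
        then show False using z by simp
      qed
      then show "closed_segment ((\<psi> \<circ> G0) x) ((w \<circ> G) x) \<subseteq> - {0}" unfolding wz by (auto simp: z_def)
    qed
    have "homotopic_with_canon (\<lambda>_. True) S (- {0}) (\<psi> \<circ> G0) (\<lambda>_. c)"
      by (rule homotopic_with_trans[OF 2 1])
    then have "homotopic_with_canon (\<lambda>_. True) S (V - {g t}) (\<psi>' \<circ> (\<psi> \<circ> G0)) (\<psi>' \<circ> (\<lambda>_. c))"
      by (rule homotopic_with_compose_continuous_left[OF _ continuous_on_subset[OF c\<psi>']]) (use \<psi>'ne in auto)
    then have "homotopic_with (\<lambda>_. True) (top_of_set S) (top_of_set (V - {g t})) G0 (\<lambda>_. \<psi>' c)"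
      by (rule homotopic_with_eq) (use \<psi>'\<psi> G0S in auto)
    moreover have "continuous_map (subtopology ?E Fr) (top_of_set S) f"
      unfolding S_def using sub(2)[of Fr] Fr\<Omega> \<Omega>E homeomorphic_imp_continuous_map by blast
    ultimately have "homotopic_with (\<lambda>_. True) (subtopology ?E Fr) (top_of_set (V - {g t})) (G0 \<circ> f) ((\<lambda>_. \<psi>' c) \<circ> f)"
      by (rule homotopic_with_compose_continuous_map_right) simp
    then have "homotopic_with (\<lambda>_. True) (subtopology ?E Fr) (top_of_set (V - {g t})) g (\<lambda>_. \<psi>' c)"
      by (rule homotopic_with_eq) (use hf Fr\<Omega> \<Omega>E in \<open>auto simp: G0_def\<close>)
    moreover have "topspace (subtopology ?E Fr) \<noteq> {}"
    proof -
      have "S \<noteq> {}" using homS by (auto simp: homeomorphic_def homeomorphism_def)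
      then show ?thesis unfolding S_def using Fr\<Omega> \<Omega>E by auto
    qed
    ultimately have "hom_induced (int ?k - 1) (subtopology ?E Fr) {} (subtopology euclidean (V - {g t})) {} g
            constant_on carrier (reduced_homology_group (int ?k - 1) (subtopology ?E Fr))"
      by (rule hom_induced_constant_if_nullhomotopic)
    then show False using V(4) unfolding Fr_def[symmetric] PFr by simp
  qed
  have "\<not> (\<forall>q. \<forall>\<epsilon>>0. \<exists>G1. continuous_on (closure U') G1 \<and> (\<forall>x\<in>closure U'. dist (G1 x) (G x) \<le> \<epsilon>) \<and> q \<notin> G1 ` closure U')"
  proof
    assume un: "\<forall>q. \<forall>\<epsilon>>0. \<exists>G1. continuous_on (closure U') G1 \<and> (\<forall>x\<in>closure U'. dist (G1 x) (G x) \<le> \<epsilon>) \<and> q \<notin> G1 ` closure U'"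
    have "\<exists>c. homotopic_with_canon (\<lambda>_. True) (frontier U') (sphere 0 1) (w \<circ> G) (\<lambda>_. c)"
      by (rule nullhomotopic_if_values_avoidable[OF homU bU _ cG])
        (use fr homS cw ws un in simp_all)
    then show False using not_null fr by simp
  qed
  then have "\<exists>q \<epsilon>. \<epsilon> > 0 \<and> (\<forall>G1. continuous_on (closure U') G1 \<and> (\<forall>x\<in>closure U'. dist (G1 x) (G x) \<le> \<epsilon>) \<longrightarrow> q \<in> G1 ` closure U')"
    by blast
  then obtain q \<epsilon> where \<epsilon>: "\<epsilon> > 0" and st0: "\<forall>G1. continuous_on (closure U') G1 \<and> (\<forall>x\<in>closure U'. dist (G1 x) (G x) \<le> \<epsilon>) \<longrightarrow> q \<in> G1 ` closure U'"
    by (elim exE conjE)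
  have st: "q \<in> G1 ` closure U'" if "continuous_on (closure U') G1" "\<And>x. x \<in> closure U' \<Longrightarrow> dist (G1 x) (G x) \<le> \<epsilon>" for G1
    using st0 that by blast
  define K where "K = h ` closure U'"
  have hcl: "continuous_map (top_of_set (closure U')) (subtopology ?E K) h"
    unfolding continuous_map_in_subtopology K_def using ch by (auto intro: continuous_map_from_subtopology)
  show ?thesis
  proof (intro exI conjI allI impI)
    show "compactin ?E K" unfolding K_def
      by (rule image_compactin[OF _ ch]) (use bU in simp)
    show "K \<subseteq> \<Omega>" unfolding K_def using hD clU by blast
    show "\<epsilon> > 0" by (fact \<epsilon>)
    fix G' :: "(nat \<Rightarrow> real) \<Rightarrow> 'b"
    assume G': "continuous_map (subtopology ?E K) euclidean G' \<and> (\<forall>s\<in>K. dist (G' s) (\<kappa> (g s)) \<le> \<epsilon>)"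
    have "continuous_map (top_of_set (closure U')) euclidean (G' \<circ> h)"
      using hcl G' continuous_map_compose by blast
    then have "continuous_on (closure U') (G' \<circ> h)" by simp
    then have "q \<in> (G' \<circ> h) ` closure U'"
      by (rule st) (use G' in \<open>auto simp: K_def G_def G0_def\<close>)
    then show "q \<in> G' ` K" unfolding K_def by auto
  qed
qed

section \<open>Trajectories in a coordinate ball\<close>

text \<open>Extension by the nearest point of the ball preserves Lipschitz constants and bounds, so that solutions of the
  extended equation exist for the whole time interval.\<close>

definition ball_extension :: "'b::euclidean_space \<Rightarrow> real \<Rightarrow> ('b \<Rightarrow> 'c) \<Rightarrow> 'b \<Rightarrow> 'c" where
  "ball_extension z \<rho> F x = F (closest_point (cball z \<rho>) x)"

lemma ball_extension_eq: "x \<in> cball z \<rho> \<Longrightarrow> ball_extension z \<rho> F x = F x"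
  unfolding ball_extension_def by (simp add: closest_point_self)

lemma closest_point_in_ball: "\<rho> > 0 \<Longrightarrow> closest_point (cball z \<rho>) x \<in> cball z \<rho>"
  for z :: "'b::euclidean_space" by (rule closest_point_in_set) auto

lemma ball_extension_lipschitz:
  fixes F :: "'b::euclidean_space \<Rightarrow> 'c::metric_space"
  assumes F: "L-lipschitz_on (cball z \<rho>) F" and \<rho>: "\<rho> > 0"
  shows "L-lipschitz_on UNIV (ball_extension z \<rho> F)"
proof (rule lipschitz_onI)
  show L: "0 \<le> L" using F by (rule lipschitz_on_nonneg)
  fix x y :: 'b
  have "dist (ball_extension z \<rho> F x) (ball_extension z \<rho> F y) \<le> L * dist (closest_point (cball z \<rho>) x) (closest_point (cball z \<rho>) y)"
    unfolding ball_extension_def by (rule lipschitz_onD[OF F closest_point_in_ball[OF \<rho>] closest_point_in_ball[OF \<rho>]])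
  also have "\<dots> \<le> L * dist x y"
    by (rule mult_left_mono[OF closest_point_lipschitz L]) (use \<rho> in auto)
  finally show "dist (ball_extension z \<rho> F x) (ball_extension z \<rho> F y) \<le> L * dist x y" .
qed

context control_manifold
begin

text \<open>A coordinate ball together with a Lipschitz constant and a bound of the field on it. The constants are parameters
  because a converging sequence of structures shares them.\<close>

definition chart_data :: "('a, 'b) chart \<Rightarrow> 'b \<Rightarrow> real \<Rightarrow> real \<Rightarrow> real \<Rightarrow> ('a \<Rightarrow> 'e \<Rightarrow> ('a, 'b) tvec) \<Rightarrow> bool" where
  "chart_data c z \<rho> L Fm f \<longleftrightarrow> bundle_section A f \<and> c \<in> A \<and> \<rho> > 0 \<and> cball z \<rho> \<subseteq> chart_map c ` chart_dom c \<and>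
     L-lipschitz_on (cball z \<rho>) (local_rep c f) \<and> (\<forall>x\<in>cball z \<rho>. norm (local_rep c f x) \<le> Fm)"

definition ball_field :: "('a, 'b) chart \<Rightarrow> 'b \<Rightarrow> real \<Rightarrow> ('a \<Rightarrow> 'e \<Rightarrow> ('a, 'b) tvec) \<Rightarrow> 'b \<Rightarrow> 'e \<Rightarrow>\<^sub>L 'b" where
  "ball_field c z \<rho> f = ball_extension z \<rho> (local_rep c f)"

lemma chart_dataD:
  assumes "chart_data c z \<rho> L Fm f"
  shows "bundle_section A f" "c \<in> A" "\<rho> > 0" "cball z \<rho> \<subseteq> chart_map c ` chart_dom c"
    "L-lipschitz_on (cball z \<rho>) (local_rep c f)" "\<And>x. x \<in> cball z \<rho> \<Longrightarrow> norm (local_rep c f x) \<le> Fm"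
    "L-lipschitz_on UNIV (ball_field c z \<rho> f)" "\<And>x. norm (ball_field c z \<rho> f x) \<le> Fm" "Fm \<ge> 0"
    "\<And>x. x \<in> cball z \<rho> \<Longrightarrow> chart_inv c x \<in> chart_dom c \<and> chart_map c (chart_inv c x) = x"
proof -
  show 1: "bundle_section A f" "c \<in> A" "\<rho> > 0" "cball z \<rho> \<subseteq> chart_map c ` chart_dom c"
    "L-lipschitz_on (cball z \<rho>) (local_rep c f)" "\<And>x. x \<in> cball z \<rho> \<Longrightarrow> norm (local_rep c f x) \<le> Fm"
    using assms unfolding chart_data_def by auto
  show "L-lipschitz_on UNIV (ball_field c z \<rho> f)"
    unfolding ball_field_def by (rule ball_extension_lipschitz[OF 1(5,3)])
  show "norm (ball_field c z \<rho> f x) \<le> Fm" for x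
    unfolding ball_field_def ball_extension_def by (rule 1(6)[OF closest_point_in_ball[OF 1(3)]])
  have "z \<in> cball z \<rho>" using 1(3) by simp
  then show "Fm \<ge> 0" by (rule order_trans[OF norm_ge_zero 1(6)])
  show "chart_inv c x \<in> chart_dom c \<and> chart_map c (chart_inv c x) = x" if "x \<in> cball z \<rho>" for x
    using chart_props(6,7)[OF 1(2)] 1(4) that by blast
qed

lemma ball_field_differ:
  assumes \<rho>: "\<rho> > 0" and "\<And>x. x \<in> cball z \<rho> \<Longrightarrow> norm (local_rep c f1 x - local_rep c f2 x) \<le> \<eta>"
  shows "norm (ball_field c z \<rho> f1 x - ball_field c z \<rho> f2 x) \<le> \<eta>"
  unfolding ball_field_def ball_extension_def by (rule assms(2)[OF closest_point_in_ball[OF \<rho>]])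

lemma field_in_ball:
  assumes cd: "chart_data c z \<rho> L Fm f" and x: "x \<in> cball z \<rho>"
  shows "f (chart_inv c x) v c = blinfun_apply (ball_field c z \<rho> f x) v"
  unfolding ball_field_def ball_extension_eq[OF x] by (rule local_rep_apply[OF chart_dataD(1)[OF cd], symmetric])

text \<open>The solution moves by at most \<open>Fm * C\<close>, hence stays in the ball, where the extended field is the given one.\<close>

lemma ode_solution_in_ball:
  assumes cd: "chart_data c z \<rho> L Fm f" and y: "ode_solution (ball_field c z \<rho> f) u x y"
    and x: "x \<in> cball z (\<rho> / 2)" and u: "\<And>t. t \<in> {0..1} \<Longrightarrow> norm (u t) \<le> C" and small: "Fm * C \<le> \<rho> / 2"
  shows "\<And>t. t \<in> {0..1} \<Longrightarrow> y t \<in> cball z \<rho>" "itraj f u 0 1 (\<lambda>t. chart_inv c (y t))"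
proof -
  let ?F = "ball_field c z \<rho> f"
  have C0: "C \<ge> 0" using order_trans[OF norm_ge_zero u[of 0]] by simp
  have b: "norm (blinfun_apply (?F (y r)) (u r)) \<le> Fm * C" if "r \<in> {0..1}" for r
    by (rule order_trans[OF norm_blinfun mult_mono[OF chart_dataD(8)[OF cd] u[OF that] chart_dataD(9)[OF cd] norm_ge_zero]])
  show yb: "y t \<in> cball z \<rho>" if t: "t \<in> {0..1}" for t
  proof -
    have "((\<lambda>r. blinfun_apply (?F (y r)) (u r)) has_integral (y t - y 0)) (cbox 0 t)"
      using y[unfolded ode_solution_def, THEN conjunct2, THEN conjunct2, rule_format, of 0 t] t by simp
    then have "norm (y t - y 0) \<le> (Fm * C) * measure lborel (cbox 0 t)"
      by (intro has_integral_bound[of "Fm * C"]) (use b t C0 chart_dataD(9)[OF cd] in auto)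
    also have "\<dots> \<le> (Fm * C) * 1" using t C0 chart_dataD(9)[OF cd] by (intro mult_left_mono) auto
    finally have "norm (y t - y 0) \<le> \<rho> / 2" using small by simp
    moreover have "y 0 = x" using y unfolding ode_solution_def by simp
    ultimately have "dist x (y t) \<le> \<rho> / 2" by (simp add: dist_norm norm_minus_commute)
    then show ?thesis using x dist_triangle[of z "y t" x] by simp
  qed
  have cy: "continuous_on {0..1} y" using y unfolding ode_solution_def by simp
  show "itraj f u 0 1 (\<lambda>t. chart_inv c (y t))"
  proof (rule itraj_chartI[OF chart_dataD(1)[OF cd] _ chart_dataD(2)[OF cd]])
    show "continuous_on {0..1} (\<lambda>t. chart_inv c (y t))"
      by (rule continuous_on_compose2[OF continuous_on_subset[OF chart_props(4)[OF chart_dataD(2)[OF cd]] chart_dataD(4)[OF cd]] cy])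
        (use yb in auto)
    show "(\<lambda>t. chart_inv c (y t)) ` {0..1} \<subseteq> chart_dom c" using yb chart_dataD(10)[OF cd] by blast
    fix r :: real assume r: "r \<in> {0..1}"
    show "norm (f (chart_inv c (y r)) (u r) c) \<le> Fm * C"
      unfolding field_in_ball[OF cd yb[OF r]] by (rule b[OF r])
  next
    fix s t :: real assume st: "0 \<le> s" "s \<le> t" "t \<le> 1"
    have "((\<lambda>r. blinfun_apply (?F (y r)) (u r)) has_integral (y t - y s)) {s..t}"
      using y st unfolding ode_solution_def by simp
    then have "((\<lambda>r. f (chart_inv c (y r)) (u r) c) has_integral (y t - y s)) {s..t}"
      by (rule has_integral_eq[rotated]) (use st field_in_ball[OF cd yb] in auto)
    moreover have "chart_map c (chart_inv c (y t)) = y t" "chart_map c (chart_inv c (y s)) = y s"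
      using chart_dataD(10)[OF cd yb] st by auto
    ultimately show "((\<lambda>r. f (chart_inv c (y r)) (u r) c) has_integral
        (chart_map c (chart_inv c (y t)) - chart_map c (chart_inv c (y s)))) {s..t}" by simp
  qed
qed

lemma cccurve_in_ball:
  assumes cd: "chart_data c z \<rho> L Fm f" and N: "continuously_varying_norm N"
    and m: "m > 0" "\<And>x v. x \<in> cball z \<rho> \<Longrightarrow> m * norm v \<le> N (chart_inv c x) v"
    and g: "cccurve f N 0 1 g u r" and g0: "g 0 \<in> chart_dom c" "chart_map c (g 0) \<in> cball z (\<rho> / 2)"
    and small: "Fm * (r / m) < \<rho> / 2"
  shows "ode_solution (ball_field c z \<rho> f) u (chart_map c (g 0)) (\<lambda>t. chart_map c (g t))"
    "\<And>t. t \<in> {0..1} \<Longrightarrow> g t \<in> chart_dom c \<and> chart_map c (g t) \<in> cball z \<rho> \<and> norm (u t) \<le> r / m"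
proof -
  have cA: "c \<in> A" by (rule chart_dataD(2)[OF cd])
  have Fq: "norm (f q v c) \<le> Fm * norm v" if q: "q \<in> chart_dom c" "chart_map c q \<in> cball z \<rho>" for q v
  proof -
    have "f q v c = blinfun_apply (ball_field c z \<rho> f (chart_map c q)) v"
      using field_in_ball[OF cd q(2), of v] chart_props(5)[OF cA q(1)] by simp
    then have "norm (f q v c) \<le> norm (ball_field c z \<rho> f (chart_map c q)) * norm v" by (simp add: norm_blinfun)
    also have "\<dots> \<le> Fm * norm v" by (rule mult_right_mono[OF chart_dataD(8)[OF cd]]) simp
    finally show ?thesis .
  qed
  have mq: "m * norm v \<le> N q v" if q: "q \<in> chart_dom c" "chart_map c q \<in> cball z \<rho>" for q v
    using m(2)[OF q(2), of v] chart_props(5)[OF cA q(1)] by simp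
  have trap: "g t \<in> chart_dom c \<and> chart_map c (g t) \<in> ball z \<rho> \<and> norm (u t) \<le> r / m" if "t \<in> {0..1}" for t
    by (rule cccurve_trapped[OF N cA chart_dataD(4)[OF cd] chart_dataD(9)[OF cd] Fq m(1) mq g g0 small that])
  then show tr: "g t \<in> chart_dom c \<and> chart_map c (g t) \<in> cball z \<rho> \<and> norm (u t) \<le> r / m" if "t \<in> {0..1}" for t
    using that by fastforce
  show "ode_solution (ball_field c z \<rho> f) u (chart_map c (g 0)) (\<lambda>t. chart_map c (g t))"
    unfolding ode_solution_def
  proof (intro conjI allI impI refl)
    show "continuous_on {0..1} (\<lambda>t. chart_map c (g t))"
      by (rule continuous_on_compose2[OF chart_props(3)[OF cA] cccurveD(4)[OF g]]) (use tr in auto)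
    fix s t :: real assume st: "0 \<le> s \<and> s \<le> t \<and> t \<le> 1"
    have "((\<lambda>r. f (g r) (u r) c) has_integral (chart_map c (g t) - chart_map c (g s))) {s..t}"
      by (rule itraj_integral[OF cccurveD(1)[OF g] cA]) (use st tr in auto)
    then show "((\<lambda>r. blinfun_apply (ball_field c z \<rho> f (chart_map c (g r))) (u r)) has_integral (chart_map c (g t) - chart_map c (g s))) {s..t}"
    proof (rule has_integral_eq[rotated])
      fix r assume "r \<in> {s..t}"
      then have r: "r \<in> {0..1}" using st by auto
      show "f (g r) (u r) c = blinfun_apply (ball_field c z \<rho> f (chart_map c (g r))) (u r)"
        using field_in_ball[OF cd, of "chart_map c (g r)" "u r"] tr[OF r] chart_props(5)[OF cA, of "g r"] by simp
    qed
  qed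
qed

text \<open>The second structure is driven by the same control from the same point. The stability estimate bounds the distance of the
  endpoints, and the closeness of the norms bounds the energy of the new curve.\<close>

lemma ccpath_compare:
  assumes cd: "chart_data c z \<rho> L Fm f1" "chart_data c z \<rho> L Fm f2" and N: "continuously_varying_norm N1"
    and m: "m > 0" "\<And>x v. x \<in> cball z \<rho> \<Longrightarrow> m * norm v \<le> N1 (chart_inv c x) v"
    and \<eta>: "\<And>x. x \<in> cball z \<rho> \<Longrightarrow> norm (local_rep c f1 x - local_rep c f2 x) \<le> \<eta>"
    and NN: "\<And>x y v. x \<in> cball z \<rho> \<Longrightarrow> y \<in> cball z \<rho> \<Longrightarrow> norm (x - y) \<le> \<delta> \<Longrightarrow>
        N2 (chart_inv c y) v \<le> N1 (chart_inv c x) v + \<omega> * norm v" and \<omega>: "\<omega> \<ge> 0"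
    and p: "p \<in> chart_dom c" "chart_map c p \<in> cball z (\<rho> / 2)" and r: "ccpath f1 N1 p q r"
    and small: "Fm * (r / m) < \<rho> / 2" "L * (r / m) \<le> 1 / 2" "2 * (\<eta> * (r / m)) \<le> \<delta>"
  obtains q' where "ccpath f2 N2 p q' (r + \<omega> * (r / m))" "q \<in> chart_dom c" "q' \<in> chart_dom c"
    "chart_map c q \<in> cball z \<rho>" "chart_map c q' \<in> cball z \<rho>"
    "norm (chart_map c q - chart_map c q') \<le> 2 * (\<eta> * (r / m))"
proof -
  have cA: "c \<in> A" by (rule chart_dataD(2)[OF cd(1)])
  obtain g u where g: "cccurve f1 N1 0 1 g u r" "g 0 = p" "g 1 = q" using r unfolding ccpath_def by auto
  let ?y = "\<lambda>t. chart_map c (g t)"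
  have y: "ode_solution (ball_field c z \<rho> f1) u (chart_map c p) ?y"
    using cccurve_in_ball(1)[OF cd(1) N m g(1) _ _ small(1)] p g(2) by simp
  have tr: "g t \<in> chart_dom c \<and> ?y t \<in> cball z \<rho> \<and> norm (u t) \<le> r / m" if "t \<in> {0..1}" for t
    by (rule cccurve_in_ball(2)[OF cd(1) N m g(1) _ _ small(1) that]) (use p g(2) in auto)
  have ub: "norm (u t) \<le> r / m" if "t \<in> {0..1}" for t using tr[OF that] by simp
  obtain y2 where y2: "ode_solution (ball_field c z \<rho> f2) u (chart_map c p) y2"
    by (rule ode_solution_exists[OF fd chart_dataD(7,8)[OF cd(2)] cccurveD(2)[OF g(1)] ub small(2)])
  have y2b: "y2 t \<in> cball z \<rho>" if "t \<in> {0..1}" for t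
    by (rule ode_solution_in_ball(1)[OF cd(2) y2 p(2) ub _ that]) (use small(1) in simp_all)
  have it: "itraj f2 u 0 1 (\<lambda>t. chart_inv c (y2 t))"
    by (rule ode_solution_in_ball(2)[OF cd(2) y2 p(2) ub]) (use small(1) in simp_all)
  have close: "norm (?y t - y2 t) \<le> 2 * (\<eta> * (r / m))" if t: "t \<in> {0..1}" for t
    using ode_solution_stable[OF y y2 chart_dataD(7,8)[OF cd(1)] ball_field_differ[OF chart_dataD(3)[OF cd(1)] \<eta>] ub ub _ small(2) t, of 0]
    by simp
  have "cccurve f2 N2 0 1 (\<lambda>t. chart_inv c (y2 t)) u (r + \<omega> * (r / m))"
    unfolding cccurve_def
  proof (intro conjI ballI it cccurveD(2)[OF g(1)])
    fix t :: real assume t: "t \<in> {0..1}"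
    have "N2 (chart_inv c (y2 t)) (u t) \<le> N1 (chart_inv c (?y t)) (u t) + \<omega> * norm (u t)"
      by (rule NN) (use tr[OF t] y2b[OF t] close[OF t] small(3) in auto)
    also have "chart_inv c (?y t) = g t" using chart_props(5)[OF cA] tr[OF t] by simp
    also have "N1 (g t) (u t) + \<omega> * norm (u t) \<le> r + \<omega> * (r / m)"
      by (intro add_mono mult_left_mono cccurveD(3)[OF g(1) t] ub[OF t] \<omega>)
    finally show "N2 (chart_inv c (y2 t)) (u t) \<le> r + \<omega> * (r / m)" .
  qed
  moreover have "chart_inv c (y2 0) = p" using y2 chart_props(5)[OF cA p(1)] unfolding ode_solution_def by simp
  ultimately have P: "ccpath f2 N2 p (chart_inv c (y2 1)) (r + \<omega> * (r / m))" by (rule ccpathI) simp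
  have q': "chart_inv c (y2 1) \<in> chart_dom c" "chart_map c (chart_inv c (y2 1)) = y2 1"
    using chart_dataD(10)[OF cd(2) y2b[of 1]] by auto
  show ?thesis
    by (rule that[OF P]) (use q' tr[of 1] y2b[of 1] g(3) close[of 1] in auto)
qed

text \<open>The uniform Lipschitz bound and the convergence may hold in different charts. Convergence is carried to the chart of the Lipschitz
  bound by the derivative of the transition map, which is bounded near the point; the Lipschitz constant passes to the limit.\<close>

lemma converging_chart:
  fixes f :: "'a \<Rightarrow> 'e \<Rightarrow> ('a, 'b) tvec"
  assumes f: "lvf_structure A f" and fs: "\<And>n. lvf_structure A (fs n)" and conv: "lvf_converges A fs f"
  obtains c \<rho> L Fm where "c \<in> charts_at A o'" "chart_data c (chart_map c o') \<rho> L Fm f"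
    "\<forall>\<^sub>F n in sequentially. chart_data c (chart_map c o') \<rho> L Fm (fs n)"
    "uniform_limit (cball (chart_map c o') \<rho>) (\<lambda>n. local_rep c (fs n)) (local_rep c f) sequentially"
proof -
  have bs: "bundle_section A f" "bundle_section A (fs n)" for n using f fs by (auto simp: lvf_structure_def)
  obtain c L where c: "c \<in> charts_at A o'" and L: "L > 0" "\<And>n. L-lipschitz_on (chart_map c ` chart_dom c) (local_rep c (fs n))"
  proof -
    have "uniformly_locally_lipschitz A (range fs)" using conv unfolding lvf_converges_def by (rule conjunct1)
    then have "\<exists>c\<in>charts_at A o'. \<exists>L>0. \<forall>f\<in>range fs. L-lipschitz_on (chart_map c ` chart_dom c) (local_rep c f)"
      unfolding uniformly_locally_lipschitz_def by (rule spec)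
    then show ?thesis using that by auto
  qed
  obtain c2 where c2: "c2 \<in> charts_at A o'" and ul: "\<forall>K. compact K \<and> K \<subseteq> chart_map c2 ` chart_dom c2 \<longrightarrow>
        uniform_limit K (\<lambda>n. local_rep c2 (fs n)) (local_rep c2 f) sequentially"
    using conv[unfolded lvf_converges_def, THEN conjunct2, THEN spec, of o'] by (elim bexE)
  have cA: "c \<in> A" "c2 \<in> A" "o' \<in> chart_dom c" "o' \<in> chart_dom c2" using c c2 by (auto simp: charts_at_def)
  obtain r2 C where r2: "r2 > 0" "C \<ge> 0" "cball (chart_map c2 o') r2 \<subseteq> chart_map c2 ` (chart_dom c2 \<inter> chart_dom c)"
    and C: "\<And>y v. y \<in> cball (chart_map c2 o') r2 \<Longrightarrow> norm (frechet_derivative (transition c2 c) (at y) v) \<le> C * norm v"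
    using transition_locally_bounded[OF c2 c] by metis
  have op: "open (chart_map c ` (chart_dom c \<inter> (chart_dom c2 \<inter> chart_map c2 -` ball (chart_map c2 o') r2)))"
    by (rule open_chart_overlap[OF cA(1)]) (use chart_props(1,3)[OF cA(2)] in \<open>auto intro!: continuous_open_preimage\<close>)
  have mem: "chart_map c o' \<in> chart_map c ` (chart_dom c \<inter> (chart_dom c2 \<inter> chart_map c2 -` ball (chart_map c2 o') r2))"
    using cA r2 by auto
  obtain \<rho> where \<rho>: "\<rho> > 0" "cball (chart_map c o') \<rho> \<subseteq> chart_map c ` (chart_dom c \<inter> (chart_dom c2 \<inter> chart_map c2 -` ball (chart_map c2 o') r2))"
    using bspec[OF open_contains_cball[THEN iffD1, OF op] mem] by (elim exE conjE)
  let ?B = "cball (chart_map c o') \<rho>"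
  have pt: "\<exists>q. x = chart_map c q \<and> c \<in> charts_at A q \<and> c2 \<in> charts_at A q \<and> chart_map c2 q \<in> cball (chart_map c2 o') r2" if "x \<in> ?B" for x
    using \<rho>(2) that cA by (fastforce simp: charts_at_def)
  have diff: "norm (local_rep c (fs n) (chart_map c q) - local_rep c f (chart_map c q)) \<le> C * norm (local_rep c2 (fs n) (chart_map c2 q) - local_rep c2 f (chart_map c2 q))"
    if q: "c \<in> charts_at A q" "c2 \<in> charts_at A q" "chart_map c2 q \<in> cball (chart_map c2 o') r2" for q n
  proof (rule norm_blinfun_bound)
    show "0 \<le> C * norm (local_rep c2 (fs n) (chart_map c2 q) - local_rep c2 f (chart_map c2 q))" using r2(2) by simp
    fix v
    let ?D = "frechet_derivative (transition c2 c) (at (chart_map c2 q))"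
    have lin: "linear ?D" using transition_derivative[OF q(2,1)] has_derivative_linear by blast
    have "blinfun_apply (local_rep c (fs n) (chart_map c q) - local_rep c f (chart_map c q)) v = fs n q v c - f q v c"
      by (simp add: blinfun.diff_left local_rep_apply_chart[OF bs(1) q(1)] local_rep_apply_chart[OF bs(2) q(1)])
    also have "\<dots> = ?D (fs n q v c2) - ?D (f q v c2)"
      by (simp add: section_transition[OF bs(1) q(2,1)] section_transition[OF bs(2) q(2,1)])
    also have "\<dots> = ?D (fs n q v c2 - f q v c2)" by (rule linear_diff[OF lin, symmetric])
    also have "fs n q v c2 - f q v c2 = blinfun_apply (local_rep c2 (fs n) (chart_map c2 q) - local_rep c2 f (chart_map c2 q)) v"
      by (simp add: blinfun.diff_left local_rep_apply_chart[OF bs(1) q(2)] local_rep_apply_chart[OF bs(2) q(2)])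
    finally have eq: "blinfun_apply (local_rep c (fs n) (chart_map c q) - local_rep c f (chart_map c q)) v
        = ?D (blinfun_apply (local_rep c2 (fs n) (chart_map c2 q) - local_rep c2 f (chart_map c2 q)) v)" .
    have "norm (blinfun_apply (local_rep c (fs n) (chart_map c q) - local_rep c f (chart_map c q)) v)
        \<le> C * norm (blinfun_apply (local_rep c2 (fs n) (chart_map c2 q) - local_rep c2 f (chart_map c2 q)) v)"
      unfolding eq by (rule C[OF q(3)])
    also have "\<dots> \<le> C * (norm (local_rep c2 (fs n) (chart_map c2 q) - local_rep c2 f (chart_map c2 q)) * norm v)"
      by (rule mult_left_mono[OF norm_blinfun r2(2)])
    finally show "norm (blinfun_apply (local_rep c (fs n) (chart_map c q) - local_rep c f (chart_map c q)) v)
        \<le> C * norm (local_rep c2 (fs n) (chart_map c2 q) - local_rep c2 f (chart_map c2 q)) * norm v" by (simp add: mult.assoc)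
  qed
  have "cball (chart_map c2 o') r2 \<subseteq> chart_map c2 ` chart_dom c2" using r2(3) by auto
  then have ul2: "uniform_limit (cball (chart_map c2 o') r2) (\<lambda>n. local_rep c2 (fs n)) (local_rep c2 f) sequentially"
    using ul by simp
  have UL: "uniform_limit ?B (\<lambda>n. local_rep c (fs n)) (local_rep c f) sequentially"
  proof (rule uniform_limitI)
    fix e :: real assume "e > 0"
    then have "e / (C + 1) > 0" using r2(2) by simp
    from uniform_limitD[OF ul2 this]
    show "\<forall>\<^sub>F n in sequentially. \<forall>x\<in>?B. dist (local_rep c (fs n) x) (local_rep c f x) < e"
    proof eventually_elim
      case (elim n)
      show ?case
      proof
        fix x assume "x \<in> ?B"
        then obtain q where q: "x = chart_map c q" "c \<in> charts_at A q" "c2 \<in> charts_at A q" "chart_map c2 q \<in> cball (chart_map c2 o') r2"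
          using pt by blast
        have "dist (local_rep c (fs n) x) (local_rep c f x) \<le> C * dist (local_rep c2 (fs n) (chart_map c2 q)) (local_rep c2 f (chart_map c2 q))"
          unfolding q(1) dist_norm by (rule diff[OF q(2-4)])
        also have "\<dots> \<le> (C + 1) * dist (local_rep c2 (fs n) (chart_map c2 q)) (local_rep c2 f (chart_map c2 q))"
          by (intro mult_right_mono) auto
        also have "\<dots> < (C + 1) * (e / (C + 1))"
          using elim q(4) r2(2) by (intro mult_strict_left_mono) auto
        also have "\<dots> = e" using r2(2) by simp
        finally show "dist (local_rep c (fs n) x) (local_rep c f x) < e" .
      qed
    qed
  qed
  have Bsub: "?B \<subseteq> chart_map c ` chart_dom c" using \<rho>(2) by auto
  have Ln: "L-lipschitz_on ?B (local_rep c (fs n))" for n by (rule lipschitz_on_subset[OF L(2) Bsub])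
  have Lf: "L-lipschitz_on ?B (local_rep c f)"
  proof (rule lipschitz_onI)
    fix x y assume xy: "x \<in> ?B" "y \<in> ?B"
    have "(\<lambda>n. dist (local_rep c (fs n) x) (local_rep c (fs n) y)) \<longlonglongrightarrow> dist (local_rep c f x) (local_rep c f y)"
      by (intro tendsto_dist tendsto_uniform_limitI[OF UL] xy)
    moreover have "\<forall>n. dist (local_rep c (fs n) x) (local_rep c (fs n) y) \<le> L * dist x y"
      using lipschitz_onD[OF Ln xy] by blast
    ultimately show "dist (local_rep c f x) (local_rep c f y) \<le> L * dist x y"
      by (meson LIMSEQ_le_const2)
  qed (use L in simp)
  define Fm where "Fm = norm (local_rep c f (chart_map c o')) + L * \<rho> + 1"
  have fb: "norm (local_rep c f x) \<le> Fm - 1" if x: "x \<in> ?B" for x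
  proof -
    have "norm (local_rep c f x) \<le> norm (local_rep c f (chart_map c o')) + dist (local_rep c f x) (local_rep c f (chart_map c o'))"
      by (simp add: dist_norm norm_triangle_sub)
    also have "dist (local_rep c f x) (local_rep c f (chart_map c o')) \<le> L * dist x (chart_map c o')"
      by (rule lipschitz_onD[OF Lf x]) (use \<rho> in simp)
    also have "\<dots> \<le> L * \<rho>" using x L by (intro mult_left_mono) (auto simp: dist_commute)
    finally show ?thesis unfolding Fm_def by simp
  qed
  have 1: "chart_data c (chart_map c o') \<rho> L Fm f"
    unfolding chart_data_def using bs cA \<rho>(1) Bsub Lf fb by fastforce
  have "\<forall>\<^sub>F n in sequentially. \<forall>x\<in>?B. dist (local_rep c (fs n) x) (local_rep c f x) < 1"
    by (rule uniform_limitD[OF UL]) simp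
  then have 2: "\<forall>\<^sub>F n in sequentially. chart_data c (chart_map c o') \<rho> L Fm (fs n)"
  proof eventually_elim
    case (elim n)
    have "norm (local_rep c (fs n) x) \<le> Fm" if x: "x \<in> ?B" for x
    proof -
      have "norm (local_rep c (fs n) x) \<le> norm (local_rep c f x) + dist (local_rep c (fs n) x) (local_rep c f x)"
        by (simp add: dist_norm norm_triangle_sub)
      moreover have "dist (local_rep c (fs n) x) (local_rep c f x) < 1" using elim x by blast
      ultimately show ?thesis using fb[OF x] by linarith
    qed
    then show ?case unfolding chart_data_def using bs cA \<rho>(1) Bsub Ln by blast
  qed
  show ?thesis by (rule that[OF c 1 2 UL])
qed

end

section \<open>Uniform local controllability\<close>

text \<open>On the \<open>i\<close>-th of \<open>k\<close> intervals of length \<open>1 / k\<close> the system follows the \<open>i\<close>-th direction for the flow time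
  \<open>s i\<close>; the factor \<open>k\<close> makes up for the length of the interval.\<close>

definition step_control :: "nat \<Rightarrow> (nat \<Rightarrow> 'e::real_normed_vector) \<Rightarrow> (nat \<Rightarrow> real) \<Rightarrow> real \<Rightarrow> 'e" where
  "step_control k e s t = (let i = nat \<lfloor>real k * t\<rfloor> in (real k * s i) *\<^sub>R e i)"

lemma step_control_measurable: "step_control k e s \<in> borel_measurable (lebesgue_on S)"
proof -
  have "(\<lambda>t. \<lfloor>real k * t\<rfloor>) \<in> borel \<rightarrow>\<^sub>M count_space UNIV" by measurable
  then have "(\<lambda>t. (\<lambda>j. (real k * s (nat j)) *\<^sub>R e (nat j)) \<lfloor>real k * t\<rfloor>) \<in> borel_measurable borel"
    by (rule measurable_compose) simp
  then have "step_control k e s \<in> borel_measurable borel" by (simp add: step_control_def[abs_def] Let_def)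
  then have "step_control k e s \<in> borel_measurable lebesgue"
    by (metis borel_measurable_subalgebra measurable_completion measurable_lborel2 sets_completionI_sets)
  then show ?thesis by (rule measurable_restrict_space1)
qed

lemma step_control_on_interval:
  assumes "real i / real k \<le> t" "t < real (Suc i) / real k" "k > 0"
  shows "step_control k e s t = (real k * s i) *\<^sub>R e i"
proof -
  have "real i \<le> real k * t" "real k * t < real i + 1" using assms by (auto simp: field_simps)
  then have "\<lfloor>real k * t\<rfloor> = int i" by (intro floor_unique) auto
  then show ?thesis by (simp add: step_control_def)
qed

lemma step_control_bounds:
  assumes k: "k > 0" and t: "t \<in> {0..1}" and s: "s k = 0" "s' k = 0" and E: "E \<ge> 0" "\<And>i. i < k \<Longrightarrow> norm (e i) \<le> E"
  shows "(\<And>i. i < k \<Longrightarrow> \<bar>s i\<bar> \<le> T) \<Longrightarrow> T \<ge> 0 \<Longrightarrow> norm (step_control k e s t) \<le> real k * T * E"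
    "norm (step_control k e s t - step_control k e s' t) \<le> real k * E * (\<Sum>i<k. \<bar>s i - s' i\<bar>)"
proof -
  define i where "i = nat \<lfloor>real k * t\<rfloor>"
  have "real k * t \<le> real k" using t k by (simp add: mult_left_le)
  then have "\<lfloor>real k * t\<rfloor> \<le> int k" by linarith
  then have ik: "i \<le> k" unfolding i_def by linarith
  have sc: "step_control k e x t = (real k * x i) *\<^sub>R e i" for x by (simp add: step_control_def i_def Let_def)
  show "norm (step_control k e s t) \<le> real k * T * E" if T: "\<And>i. i < k \<Longrightarrow> \<bar>s i\<bar> \<le> T" "T \<ge> 0"
  proof (cases "i = k")
    case True then show ?thesis unfolding sc using s E T by simp
  next
    case False
    then have i: "i < k" using ik by simp
    have "norm (step_control k e s t) = real k * \<bar>s i\<bar> * norm (e i)" unfolding sc by (simp add: abs_mult)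
    also have "\<dots> \<le> real k * T * E" by (intro mult_mono T(1) E(2) i mult_left_mono) (use T(2) in auto)
    finally show ?thesis .
  qed
  have S0: "(\<Sum>i<k. \<bar>s i - s' i\<bar>) \<ge> 0" by (simp add: sum_nonneg)
  show "norm (step_control k e s t - step_control k e s' t) \<le> real k * E * (\<Sum>i<k. \<bar>s i - s' i\<bar>)"
  proof (cases "i = k")
    case True then show ?thesis unfolding sc using s E S0 by simp
  next
    case False
    then have i: "i < k" using ik by simp
    have "step_control k e s t - step_control k e s' t = (real k * (s i - s' i)) *\<^sub>R e i"
      unfolding sc by (simp add: algebra_simps)
    then have "norm (step_control k e s t - step_control k e s' t) = (real k * norm (e i)) * \<bar>s i - s' i\<bar>" by (simp add: abs_mult)
    also have "\<dots> \<le> (real k * E) * (\<Sum>i<k. \<bar>s i - s' i\<bar>)"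
    proof (rule mult_mono)
      show "\<bar>s i - s' i\<bar> \<le> (\<Sum>i<k. \<bar>s i - s' i\<bar>)"
        by (rule member_le_sum[of i "{..<k}" "\<lambda>i. \<bar>s i - s' i\<bar>"]) (use i in auto)
    qed (use E i in \<open>auto intro: mult_left_mono\<close>)
    finally show ?thesis .
  qed
qed

lemma continuous_map_if_dominated:
  fixes G :: "'x \<Rightarrow> 'b::metric_space"
  assumes "\<And>s0. s0 \<in> topspace X \<Longrightarrow> \<exists>h. continuous_map X euclideanreal h \<and> h s0 = 0 \<and> (\<forall>s\<in>topspace X. dist (G s) (G s0) \<le> h s)"
  shows "continuous_map X euclidean G"
  unfolding continuous_map_def
proof (intro conjI allI impI)
  show "G \<in> topspace X \<rightarrow> topspace euclidean" by simp
  fix V :: "'b set" assume "openin euclidean V"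
  then have V: "open V" by simp
  show "openin X {x \<in> topspace X. G x \<in> V}"
  proof (subst openin_subopen, intro ballI)
    fix s0 assume "s0 \<in> {x \<in> topspace X. G x \<in> V}"
    then have s0: "s0 \<in> topspace X" "G s0 \<in> V" by auto
    obtain e where e: "e > 0" "ball (G s0) e \<subseteq> V" using V s0 open_contains_ball by blast
    obtain h where h: "continuous_map X euclideanreal h" "h s0 = 0" "\<forall>s\<in>topspace X. dist (G s) (G s0) \<le> h s"
      using assms[OF s0(1)] by blast
    have "openin X {x \<in> topspace X. h x \<in> {..<e}}"
      by (rule openin_continuous_map_preimage[OF h(1)]) simp
    moreover have "s0 \<in> {x \<in> topspace X. h x \<in> {..<e}}" using s0 h e by simp
    moreover have "{x \<in> topspace X. h x \<in> {..<e}} \<subseteq> {x \<in> topspace X. G x \<in> V}"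
      using h(3) e(2) by (force simp: dist_commute)
    ultimately show "\<exists>T. openin X T \<and> s0 \<in> T \<and> T \<subseteq> {x \<in> topspace X. G x \<in> V}" by blast
  qed
qed

lemma continuous_map_Euclidean_space_coordinate:
  "continuous_map (subtopology (Euclidean_space k) K) euclideanreal (\<lambda>s. s i)"
  unfolding Euclidean_space_def
  by (intro continuous_map_from_subtopology continuous_map_product_projection) simp

context control_manifold
begin

lemma integral_curve_imp_itraj:
  assumes bs: "bundle_section A f" and \<beta>: "integral_curve_on A (\<lambda>p. f p e) (closed_segment 0 \<tau>) \<beta>"
  shows "itraj f (\<lambda>_. \<tau> *\<^sub>R e) 0 1 (\<lambda>t. \<beta> (\<tau> * t))"
proof (rule itrajI)
  have seg: "\<tau> * t \<in> closed_segment 0 \<tau>" if "t \<in> {0..1}" for t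
    using that unfolding in_segment by (intro exI[of _ t]) auto
  have c\<beta>: "continuous_on (closed_segment 0 \<tau>) \<beta>" using \<beta> unfolding integral_curve_on_def by simp
  show "continuous_on {0..1} (\<lambda>t. \<beta> (\<tau> * t))"
    by (rule continuous_on_compose2[OF c\<beta>]) (use seg in \<open>auto intro!: continuous_intros\<close>)
  fix c s t assume h: "c \<in> A" "0 \<le> s" "s \<le> t" "t \<le> (1::real)" "(\<lambda>t. \<beta> (\<tau> * t)) ` {s..t} \<subseteq> chart_dom c"
  have "((\<lambda>r. f (\<beta> (\<tau> * r)) (\<tau> *\<^sub>R e) c) has_integral ((chart_map c \<circ> \<beta> \<circ> (\<lambda>r. \<tau> * r)) t - (chart_map c \<circ> \<beta> \<circ> (\<lambda>r. \<tau> * r)) s)) {s..t}"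
  proof (rule fundamental_theorem_of_calculus[OF h(3)])
    fix r assume r: "r \<in> {s..t}"
    have r01: "\<tau> * r \<in> closed_segment 0 \<tau>" by (rule seg) (use r h in auto)
    have "c \<in> charts_at A (\<beta> (\<tau> * r))" using h r by (auto simp: charts_at_def)
    then have "((chart_map c \<circ> \<beta>) has_vector_derivative f (\<beta> (\<tau> * r)) e c) (at (\<tau> * r) within closed_segment 0 \<tau>)"
      using \<beta> r01 unfolding integral_curve_on_def has_velocity_def by blast
    then have "((chart_map c \<circ> \<beta>) has_vector_derivative f (\<beta> (\<tau> * r)) e c) (at (\<tau> * r) within (\<lambda>r. \<tau> * r) ` {s..t})"
      by (rule has_vector_derivative_within_subset) (use seg h in auto)
    moreover have "((\<lambda>r. \<tau> * r) has_vector_derivative \<tau>) (at r within {s..t})"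
      by (auto intro!: derivative_eq_intros simp: has_real_derivative_iff_has_vector_derivative[symmetric])
    ultimately have "((chart_map c \<circ> \<beta> \<circ> (\<lambda>r. \<tau> * r)) has_vector_derivative \<tau> *\<^sub>R f (\<beta> (\<tau> * r)) e c) (at r within {s..t})"
      by (intro vector_diff_chain_within)
    then show "((chart_map c \<circ> \<beta> \<circ> (\<lambda>r. \<tau> * r)) has_vector_derivative f (\<beta> (\<tau> * r)) (\<tau> *\<^sub>R e) c) (at r within {s..t})"
      by (simp add: bundle_sectionD(2)[OF bs])
  qed
  then show "((\<lambda>r. f (\<beta> (\<tau> * r)) (\<tau> *\<^sub>R e) c) has_integral (chart_map c (\<beta> (\<tau> * t)) - chart_map c (\<beta> (\<tau> * s)))) {s..t}"
    by simp
qed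

text \<open>The flows are defined by a choice among integral curves. By uniqueness, any such curve is the piece of the
  trajectory on the \<open>j\<close>-th interval after a change of time.\<close>

lemma flows_eq_trajectory:
  assumes f: "lvf_structure A f" and k: "k > 0" and fd: "flows_defined A (\<lambda>i p. f p (e i)) k x0 s"
    and g: "itraj f (step_control k e s) 0 1 g" "g 0 = x0"
    and C: "\<And>t. t \<in> {0..1} \<Longrightarrow> norm (step_control k e s t) \<le> C" and j: "j \<le> k"
  shows "flows A (\<lambda>i p. f p (e i)) j x0 s = g (real j / real k)"
  using j
proof (induction j)
  case 0
  then show ?case using g(2) by simp
next
  case (Suc j)
  have bs: "bundle_section A f" using f by (simp add: lvf_structure_def)
  let ?X = "\<lambda>i p. f p (e i)"
  define p where "p = flows A ?X j x0 s"
  have p: "p = g (real j / real k)" unfolding p_def using Suc by simp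
  have "flow_defined A (?X j) (s j) p" using fd Suc.prems unfolding flows_defined_def p_def by simp
  then obtain \<gamma> where \<gamma>: "\<gamma> 0 = p \<and> integral_curve_on A (?X j) (closed_segment 0 (s j)) \<gamma>"
    unfolding flow_defined_def by blast
  define \<beta> where "\<beta> = (SOME \<gamma>. \<gamma> 0 = p \<and> integral_curve_on A (?X j) (closed_segment 0 (s j)) \<gamma>)"
  have \<beta>: "\<beta> 0 = p \<and> integral_curve_on A (?X j) (closed_segment 0 (s j)) \<beta>"
    unfolding \<beta>_def by (rule someI[of "\<lambda>\<gamma>. \<gamma> 0 = p \<and> integral_curve_on A (?X j) (closed_segment 0 (s j)) \<gamma>", OF \<gamma>])
  have fl: "flows A ?X (Suc j) x0 s = \<beta> (s j)" unfolding \<beta>_def p_def by (simp add: flow_def)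
  let ?a = "real j / real k" and ?b = "real (Suc j) / real k"
  have ab: "real k * ?a = real j" "real k * ?b = real j + 1" using k by auto
  have ab01: "0 \<le> ?a" "?a \<le> ?b" "?b \<le> 1" using k Suc.prems by (auto simp: field_simps)
  have "itraj f (\<lambda>_. s j *\<^sub>R e j) 0 1 (\<lambda>t. \<beta> (s j * t))"
    by (rule integral_curve_imp_itraj[OF bs]) (use \<beta> in simp)
  then have "itraj f (\<lambda>r. real k *\<^sub>R (s j *\<^sub>R e j)) ?a ?b (\<lambda>r. \<beta> (s j * (real k * r + - real j)))"
    by (intro itraj_affine[OF bs, of "\<lambda>_. s j *\<^sub>R e j" "real k" ?a "- real j" ?b "\<lambda>t. \<beta> (s j * t)"])
      (use ab k in simp_all)
  then have h1: "itraj f (step_control k e s) ?a ?b (\<lambda>r. \<beta> (s j * (real k * r + - real j)))"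
    by (rule itraj_cong[OF _ negligible_sing[of ?b]])
      (use step_control_on_interval[of j k _ e s] k in auto)
  have h2: "itraj f (step_control k e s) ?a ?b g" by (rule itraj_subinterval[OF g(1) ab01(1,3)])
  have "\<beta> (s j * (real k * ?b + - real j)) = g ?b"
  proof (rule itraj_unique[OF f h1 h2])
    show "\<beta> (s j * (real k * ?a + - real j)) = g ?a" using \<beta> p ab by simp
    show "norm (step_control k e s r) \<le> C" if "r \<in> {?a..?b}" for r
      by (rule C) (use that order_trans[OF ab01(1), of r] order_trans[OF _ ab01(3), of r] in auto)
  qed (use ab01 in auto)
  then show ?case unfolding fl using ab by simp
qed

end

lemma varying_norm_scale:
  fixes N1 N2 :: "'a::topological_space \<Rightarrow> 'e::real_normed_vector \<Rightarrow> real"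
  assumes N: "continuously_varying_norm N1" "continuously_varying_norm N2"
    and le: "\<And>v. norm v \<le> 1 \<Longrightarrow> N2 q v \<le> N1 p v + \<omega>"
  shows "N2 q v \<le> N1 p v + \<omega> * norm v"
proof (cases "v = 0")
  case True
  then show ?thesis by (simp add: varying_normD(5)[OF N(1)] varying_normD(5)[OF N(2)])
next
  case False
  let ?w = "(1 / norm v) *\<^sub>R v"
  have "N2 q ?w \<le> N1 p ?w + \<omega>" by (rule le) simp
  then have "norm v * N2 q ?w \<le> norm v * (N1 p ?w + \<omega>)" by (rule mult_left_mono) simp
  moreover have "norm v * N2 q ?w = N2 q v" "norm v * N1 p ?w = N1 p v"
    using False by (simp_all add: varying_normD(4)[OF N(1)] varying_normD(4)[OF N(2)])
  ultimately show ?thesis by (simp add: algebra_simps)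
qed

context control_manifold
begin

lemma flows_cong:
  assumes "\<And>i. i < j \<Longrightarrow> X i = Y i"
  shows "flows A X j x s = flows A Y j x s"
  using assms by (induction j) auto

text \<open>An almost optimal curve of the first structure is followed by the second structure, and the gap between the endpoints is closed by
  \<open>ctrl\<close> at cost \<open>e\<close>. The three terms \<open>e\<close> are the lack of optimality, the change of the norm and this gap.\<close>

lemma cc_dist_compare:
  fixes f1 f2 :: "'a \<Rightarrow> 'e \<Rightarrow> ('a, 'b) tvec"
  assumes f: "lvf_structure A f1" "lvf_structure A f2" and N: "continuously_varying_norm N1" "continuously_varying_norm N2"
    and cd: "chart_data c z \<rho> L Fm f1" "chart_data c z \<rho> L Fm f2"
    and m: "m > 0" "\<And>x v. x \<in> cball z \<rho> \<Longrightarrow> m * norm v \<le> N1 (chart_inv c x) v"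
    and \<eta>: "\<And>x. x \<in> cball z \<rho> \<Longrightarrow> norm (local_rep c f1 x - local_rep c f2 x) \<le> \<eta>"
    and NN: "\<And>x y v. x \<in> cball z \<rho> \<Longrightarrow> y \<in> cball z \<rho> \<Longrightarrow> norm (x - y) \<le> \<delta> \<Longrightarrow>
        N2 (chart_inv c y) v \<le> N1 (chart_inv c x) v + \<omega> * norm v" and \<omega>: "\<omega> \<ge> 0"
    and ctrl: "\<And>x y. x \<in> cball z \<rho> \<Longrightarrow> y \<in> cball z \<rho> \<Longrightarrow> norm (x - y) \<le> \<delta> \<Longrightarrow> ccpath f2 N2 (chart_inv c x) (chart_inv c y) e"
    and p: "p \<in> chart_dom c" "chart_map c p \<in> cball z (\<rho> / 2)"
    and a: "a \<ge> 0" "cc_dist A f1 N1 p q \<le> ennreal a" and e: "e > 0" and R: "a + e \<le> R"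
    and small: "Fm * (R / m) < \<rho> / 2" "L * (R / m) \<le> 1 / 2" "2 * (\<eta> * (R / m)) \<le> \<delta>" "\<omega> * (R / m) \<le> e"
  shows "cc_dist A f2 N2 p q \<le> ennreal (a + 3 * e)"
proof -
  have bs: "bundle_section A f2" using f by (simp add: lvf_structure_def)
  have cA: "c \<in> A" by (rule chart_dataD(2)[OF cd(1)])
  have "cc_dist A f1 N1 p q < ennreal (a + e)" using a e by (intro le_less_trans[OF a(2)]) (simp add: ennreal_less_iff)
  then obtain r' where "0 < r'" "r' < a + e" "ccpath f1 N1 p q r'" by (rule cc_dist_less[OF f(1) N(1)])
  then have P: "ccpath f1 N1 p q (a + e)" using ccpath_mono by (metis less_imp_le)
  have L0: "L \<ge> 0" by (rule lipschitz_on_nonneg[OF chart_dataD(5)[OF cd(1)]])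
  have zb: "z \<in> cball z \<rho>" using chart_dataD(3)[OF cd(1)] by simp
  have \<eta>0: "\<eta> \<ge> 0" by (rule order_trans[OF norm_ge_zero \<eta>[OF zb]])
  have div: "(a + e) / m \<le> R / m" using R m(1) by (simp add: divide_right_mono)
  have s1: "Fm * ((a + e) / m) < \<rho> / 2"
    by (rule le_less_trans[OF mult_left_mono[OF div chart_dataD(9)[OF cd(1)]] small(1)])
  have s2: "L * ((a + e) / m) \<le> 1 / 2" by (rule order_trans[OF mult_left_mono[OF div L0] small(2)])
  have s3: "2 * (\<eta> * ((a + e) / m)) \<le> \<delta>"
    by (rule order_trans[OF mult_left_mono[OF mult_left_mono[OF div \<eta>0]] small(3)]) simp
  have s4: "\<omega> * ((a + e) / m) \<le> e" by (rule order_trans[OF mult_left_mono[OF div \<omega>] small(4)])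
  obtain q' where q': "ccpath f2 N2 p q' (a + e + \<omega> * ((a + e) / m))" "q \<in> chart_dom c" "q' \<in> chart_dom c"
    "chart_map c q \<in> cball z \<rho>" "chart_map c q' \<in> cball z \<rho>"
    "norm (chart_map c q - chart_map c q') \<le> 2 * (\<eta> * ((a + e) / m))"
    by (rule ccpath_compare[where c=c and z=z and ?f1.0=f1 and ?f2.0=f2 and ?N1.0=N1 and ?N2.0=N2 and \<omega>=\<omega> and \<eta>=\<eta> and \<delta>=\<delta>
          and m=m and r="a + e", OF cd N(1) m \<eta> NN \<omega> p P s1 s2 s3])
  have "ccpath f2 N2 (chart_inv c (chart_map c q')) (chart_inv c (chart_map c q)) e"
    by (rule ctrl[OF q'(5,4)]) (use q'(6) s3 in \<open>simp add: norm_minus_commute\<close>)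
  then have Q1: "ccpath f2 N2 q' q e" using chart_props(5)[OF cA] q'(2,3) by simp
  have Q2: "ccpath f2 N2 p q' (a + 2 * e)" by (rule ccpath_mono[OF q'(1)]) (use s4 in simp)
  have "ccpath f2 N2 p q (a + 2 * e + e)" by (rule ccpath_trans[OF bs N(2) Q2 Q1]) (use a e in auto)
  then have "ccpath f2 N2 p q (a + 3 * e)" by (rule ccpath_mono) simp
  then show ?thesis by (rule cc_dist_le[OF f(2) N(2)])
qed

end

locale converging_structures = control_manifold A control_space
  for A :: "('a::t2_space, 'b::euclidean_space) chart set" and control_space :: "'e::banach itself" +
  fixes f :: "'a \<Rightarrow> 'e \<Rightarrow> ('a, 'b) tvec" and N :: "'a \<Rightarrow> 'e \<Rightarrow> real"
    and fs :: "nat \<Rightarrow> 'a \<Rightarrow> 'e \<Rightarrow> ('a, 'b) tvec" and Ns :: "nat \<Rightarrow> 'a \<Rightarrow> 'e \<Rightarrow> real"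
  assumes lvf: "lvf_structure A f" and lvfs: "\<And>n. lvf_structure A (fs n)"
    and norm: "continuously_varying_norm N" and norms: "\<And>n. continuously_varying_norm (Ns n)"
    and conv: "lvf_converges A fs f"
    and norms_conv: "\<And>K. compact K \<Longrightarrow> uniform_limit K (\<lambda>n (p, v). Ns n p v) (\<lambda>(p, v). N p v) sequentially"
    and nonholonomic: "essentially_nonholonomic A f"
begin

text \<open>Uniform continuity and uniform convergence hold on a compact set of points and vectors in the unit ball;
  homogeneity turns the additive error there into a multiple of \<open>norm v\<close>.\<close>

lemma norms_close:
  assumes c: "c \<in> A" "cball z \<rho> \<subseteq> chart_map c ` chart_dom c" and \<omega>: "\<omega> > 0"
  obtains \<delta> where "\<delta> > 0" "\<forall>\<^sub>F n in sequentially. \<forall>x\<in>cball z \<rho>. \<forall>y\<in>cball z \<rho>. norm (x - y) \<le> \<delta> \<longrightarrow>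
     (\<forall>v. Ns n (chart_inv c y) v \<le> N (chart_inv c x) v + \<omega> * norm v \<and> N (chart_inv c y) v \<le> Ns n (chart_inv c x) v + \<omega> * norm v)"
proof -
  let ?B = "cball z \<rho>" and ?U = "cball (0::'e) 1"
  have cU: "compact ?U" by (rule compact_cball_finite_dimensional[OF fd])
  have ci: "continuous_on ?B (chart_inv c)" by (rule continuous_on_subset[OF chart_props(4)[OF c(1)] c(2)])
  have "continuous_on (?B \<times> ?U) (\<lambda>w. (\<lambda>(p, v). N p v) (chart_inv c (fst w), snd w))"
    by (rule continuous_on_compose2[OF varying_normD(1)[OF norm]])
      (auto intro!: continuous_intros continuous_on_compose2[OF ci])
  then have "uniformly_continuous_on (?B \<times> ?U) (\<lambda>w. N (chart_inv c (fst w)) (snd w))"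
    using cU by (intro compact_uniformly_continuous) (auto intro: compact_Times)
  then obtain d where d: "d > 0" "\<And>w w'. w \<in> ?B \<times> ?U \<Longrightarrow> w' \<in> ?B \<times> ?U \<Longrightarrow> dist w' w < d \<Longrightarrow>
      dist (N (chart_inv c (fst w')) (snd w')) (N (chart_inv c (fst w)) (snd w)) < \<omega> / 2"
    using \<omega> unfolding uniformly_continuous_on_def by (metis half_gt_zero)
  have near: "\<bar>N (chart_inv c y) v - N (chart_inv c x) v\<bar> < \<omega> / 2" if "x \<in> ?B" "y \<in> ?B" "norm (x - y) \<le> d / 2" "norm v \<le> 1" for x y v
  proof -
    have "dist (y, v) (x, v) < d" using that d(1) by (simp add: dist_Pair_Pair dist_norm norm_minus_commute)
    then show ?thesis using d(2)[of "(x, v)" "(y, v)"] that by (simp add: dist_real_def)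
  qed
  have "compact (chart_inv c ` ?B \<times> ?U)" by (intro compact_Times compact_continuous_image ci compact_cball cU)
  from uniform_limitD[OF norms_conv[OF this], of "\<omega> / 2"] \<omega>
  have ev: "\<forall>\<^sub>F n in sequentially. \<forall>w\<in>chart_inv c ` ?B \<times> ?U. dist ((\<lambda>(p, v). Ns n p v) w) ((\<lambda>(p, v). N p v) w) < \<omega> / 2" by simp
  show ?thesis
  proof (rule that[of "d / 2"])
    show "d / 2 > 0" using d by simp
    show "\<forall>\<^sub>F n in sequentially. \<forall>x\<in>?B. \<forall>y\<in>?B. norm (x - y) \<le> d / 2 \<longrightarrow>
     (\<forall>v. Ns n (chart_inv c y) v \<le> N (chart_inv c x) v + \<omega> * norm v \<and> N (chart_inv c y) v \<le> Ns n (chart_inv c x) v + \<omega> * norm v)"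
      using ev
    proof eventually_elim
      case (elim n)
      have nn: "\<bar>Ns n (chart_inv c x) v - N (chart_inv c x) v\<bar> < \<omega> / 2" if "x \<in> ?B" "norm v \<le> 1" for x v
        using bspec[OF elim, of "(chart_inv c x, v)"] that by (simp add: dist_real_def)
      show ?case
      proof (intro ballI impI allI conjI)
        fix x y v assume h: "x \<in> ?B" "y \<in> ?B" "norm (x - y) \<le> d / 2"
        show "Ns n (chart_inv c y) v \<le> N (chart_inv c x) v + \<omega> * norm v"
        proof (rule varying_norm_scale[OF norm norms])
          fix w :: 'e assume "norm w \<le> 1"
          then show "Ns n (chart_inv c y) w \<le> N (chart_inv c x) w + \<omega>"
            using near[OF h, of w] nn[OF h(2), of w] by linarith
        qed
        show "N (chart_inv c y) v \<le> Ns n (chart_inv c x) v + \<omega> * norm v"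
        proof (rule varying_norm_scale[OF norms norm])
          fix w :: 'e assume "norm w \<le> 1"
          then show "N (chart_inv c y) w \<le> Ns n (chart_inv c x) w + \<omega>"
            using near[OF h, of w] nn[OF h(1), of w] by linarith
        qed
      qed
    qed
  qed
qed

lemma norms_bounds:
  assumes c: "c \<in> A" "cball z \<rho> \<subseteq> chart_map c ` chart_dom c"
  obtains m M where "m > 0" "M > 0" "\<And>x v. x \<in> cball z \<rho> \<Longrightarrow> m * norm v \<le> N (chart_inv c x) v"
    "\<forall>\<^sub>F n in sequentially. \<forall>x\<in>cball z \<rho>. \<forall>v. m * norm v \<le> Ns n (chart_inv c x) v \<and> Ns n (chart_inv c x) v \<le> M * norm v"
proof -
  have "compact (chart_inv c ` cball z \<rho>)"
    by (rule compact_continuous_image[OF continuous_on_subset[OF chart_props(4)[OF c(1)] c(2)] compact_cball])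
  then obtain m M where mM: "m > 0" "M > 0" "\<And>p v. p \<in> chart_inv c ` cball z \<rho> \<Longrightarrow> m * norm v \<le> N p v"
    "\<And>p v. p \<in> chart_inv c ` cball z \<rho> \<Longrightarrow> N p v \<le> M * norm v"
    by (rule varying_norm_bounds[OF norm]) (use that in blast)
  obtain \<delta> where \<delta>: "\<delta> > 0" and ev: "\<forall>\<^sub>F n in sequentially. \<forall>x\<in>cball z \<rho>. \<forall>y\<in>cball z \<rho>. norm (x - y) \<le> \<delta> \<longrightarrow>
     (\<forall>v. Ns n (chart_inv c y) v \<le> N (chart_inv c x) v + (m / 2) * norm v \<and> N (chart_inv c y) v \<le> Ns n (chart_inv c x) v + (m / 2) * norm v)"
    by (rule norms_close[OF c half_gt_zero[OF mM(1)]])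
  show ?thesis
  proof (rule that[of "m / 2" "M + m / 2"])
    show "m / 2 > 0" "M + m / 2 > 0" using mM by auto
    show "(m / 2) * norm v \<le> N (chart_inv c x) v" if "x \<in> cball z \<rho>" for x v
    proof -
      have "(m / 2) * norm v \<le> m * norm v" using mM(1) by (intro mult_right_mono) auto
      also have "\<dots> \<le> N (chart_inv c x) v" using mM(3) that by simp
      finally show ?thesis .
    qed
    show "\<forall>\<^sub>F n in sequentially. \<forall>x\<in>cball z \<rho>. \<forall>v. (m / 2) * norm v \<le> Ns n (chart_inv c x) v \<and> Ns n (chart_inv c x) v \<le> (M + m / 2) * norm v"
      using ev
    proof eventually_elim
      case (elim n)
      show ?case
      proof (intro ballI allI)
        fix x v assume x: "x \<in> cball z \<rho>"
        have "Ns n (chart_inv c x) v \<le> N (chart_inv c x) v + (m / 2) * norm v \<and> N (chart_inv c x) v \<le> Ns n (chart_inv c x) v + (m / 2) * norm v"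
          using elim x \<delta> by simp
        moreover have "m * norm v \<le> N (chart_inv c x) v" "N (chart_inv c x) v \<le> M * norm v" using mM(3,4) x by auto
        ultimately show "(m / 2) * norm v \<le> Ns n (chart_inv c x) v \<and> Ns n (chart_inv c x) v \<le> (M + m / 2) * norm v"
          by (simp add: algebra_simps)
      qed
    qed
  qed
qed

text \<open>Let \<open>q\<close> be a stable value of the flow map at \<open>x0\<close>, attained at the times \<open>s1\<close>. From a point \<open>p\<close> near \<open>x0\<close>, the control of
  \<open>s1\<close> leads for \<open>fs n\<close> to a point with coordinates \<open>y\<close> near \<open>q\<close>. The endpoint map of \<open>fs n\<close> from \<open>x0\<close>, translated by \<open>q - y\<close>, is
  a small perturbation of the flow map. It attains \<open>q\<close>, so that \<open>y\<close> is an endpoint from \<open>x0\<close>, too. Hence \<open>p\<close> is joined to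
  \<open>x0\<close> through \<open>y\<close>.\<close>

lemma locally_controllable:
  assumes r: "r > 0"
  shows "\<exists>W. open W \<and> x0 \<in> W \<and> (\<forall>\<^sub>F n in sequentially. \<forall>p\<in>W. \<forall>q\<in>W. ccpath (fs n) (Ns n) p q r)"
proof -
  obtain c \<rho> L Fm where c: "c \<in> charts_at A x0" and cd: "chart_data c (chart_map c x0) \<rho> L Fm f"
    and cds: "\<forall>\<^sub>F n in sequentially. chart_data c (chart_map c x0) \<rho> L Fm (fs n)"
    and UL: "uniform_limit (cball (chart_map c x0) \<rho>) (\<lambda>n. local_rep c (fs n)) (local_rep c f) sequentially"
    by (rule converging_chart[OF lvf lvfs conv])
  define z where "z = chart_map c x0"
  note cd = cd[folded z_def] and cds = cds[folded z_def] and UL = UL[folded z_def]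
  have cA: "c \<in> A" "x0 \<in> chart_dom c" using c by (auto simp: charts_at_def)
  have iz: "chart_inv c z = x0" unfolding z_def by (rule chart_props(5)[OF cA])
  have \<rho>: "\<rho> > 0" and Fm0: "Fm \<ge> 0" by (rule chart_dataD(3)[OF cd], rule chart_dataD(9)[OF cd])
  have L0: "L \<ge> 0" by (rule lipschitz_on_nonneg[OF chart_dataD(5)[OF cd]])
  obtain m M where M: "M > 0" and Mn: "\<forall>\<^sub>F n in sequentially. \<forall>x\<in>cball z \<rho>. \<forall>v. m * norm v \<le> Ns n (chart_inv c x) v \<and> Ns n (chart_inv c x) v \<le> M * norm v"
    by (rule norms_bounds[OF cA(1) chart_dataD(4)[OF cd]])
  let ?k = "DIM('b)"
  let ?E = "Euclidean_space ?k"
  obtain Bs where Bs: "independent Bs" "span Bs = UNIV" and fam: "essentially_nonholonomic_family A ((\<lambda>e p. f p e) ` Bs)"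
    using nonholonomic unfolding essentially_nonholonomic_def by blast
  obtain B0 :: "'e set" where B0: "finite B0" "span B0 = UNIV" using fd by blast
  have finB: "finite Bs" using independent_span_bound[OF B0(1) Bs(1)] B0(2) by simp
  define E where "E = 1 + (\<Sum>b\<in>Bs. norm b)"
  have E: "E > 0" unfolding E_def by (simp add: add_pos_nonneg sum_nonneg)
  have Eb: "norm b \<le> E" if "b \<in> Bs" for b
    using member_le_sum[of b Bs norm] that finB unfolding E_def by simp
  \<comment> \<open>A bound for the controls: it makes the solution operator a contraction, keeps solutions in the ball, and makes the energy of a path that is composed of four pieces at most \<open>r\<close>.\<close>
  define C where "C = min (1 / (2 * (L + 1))) (min (\<rho> / (2 * (Fm + 1))) (r / (4 * M)))"
  have C: "C > 0" unfolding C_def using L0 \<rho> Fm0 r M by simp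
  have LC: "L * C \<le> 1 / 2"
  proof -
    have "C * (2 * (L + 1)) \<le> 1" using L0 min.cobounded1[of "1 / (2 * (L + 1))"] unfolding C_def by (simp add: pos_le_divide_eq[symmetric])
    then show ?thesis using C by (simp add: algebra_simps)
  qed
  have FC: "Fm * C \<le> \<rho> / 2"
  proof -
    have "C \<le> \<rho> / (2 * (Fm + 1))" unfolding C_def by simp
    then have "C * (2 * (Fm + 1)) \<le> \<rho>" using Fm0 by (simp add: pos_le_divide_eq)
    then show ?thesis using C by (simp add: algebra_simps)
  qed
  have MC: "4 * (M * C) \<le> r"
  proof -
    have "C \<le> r / (4 * M)" unfolding C_def by simp
    then have "C * (4 * M) \<le> r" using M by (simp add: pos_le_divide_eq)
    moreover have "4 * (M * C) = C * (4 * M)" by simp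
    ultimately show ?thesis by (simp only:)
  qed
  \<comment> \<open>Flow times less than \<open>T\<close> give controls bounded by \<open>C\<close>.\<close>
  define T where "T = C / (real ?k * E)"
  have T: "T > 0" unfolding T_def using C E by simp
  have kTE: "real ?k * T * E = C" unfolding T_def using E by simp
  from fam[unfolded essentially_nonholonomic_family_def Let_def, rule_format, OF T, of x0]
  obtain X t \<Omega> U where X: "\<forall>i<?k. X i \<in> (\<lambda>e p. f p e) ` Bs"
    and \<Omega>: "openin ?E \<Omega>" "\<Omega> \<subseteq> {s. L2_set s {..<?k} < T}" and fdef: "\<forall>s\<in>\<Omega>. flows_defined A X ?k x0 s"
    and eo: "essentially_open_at_scale ?k (subtopology ?E \<Omega>) euclidean (flows A X ?k x0) t U"
    by (elim exE bexE conjE) (rule that)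
  have "\<forall>i\<in>{..<?k}. \<exists>e. e \<in> Bs \<and> X i = (\<lambda>p. f p e)" using X by blast
  then obtain e where e: "\<forall>i\<in>{..<?k}. e i \<in> Bs \<and> X i = (\<lambda>p. f p (e i))" by (rule bchoice[THEN exE])
  let ?X = "\<lambda>i p. f p (e i)"
  have Xeq: "flows A X j x0 s = flows A ?X j x0 s" if "j \<le> ?k" for j s
    by (rule flows_cong) (use e that in auto)
  have fdef': "flows_defined A ?X ?k x0 s" if "s \<in> \<Omega>" for s
    using fdef[rule_format, OF that] e Xeq unfolding flows_defined_def by simp
  have Xeq': "flows A X ?k x0 = flows A ?X ?k x0" by (rule ext) (rule Xeq[OF order_refl])
  have eE: "norm (e i) \<le> E" if "i < ?k" for i using e Eb that by simp
  have \<Omega>E: "\<Omega> \<subseteq> topspace ?E" using \<Omega>(1) by (rule openin_subset)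
  have sk: "s ?k = 0" if "s \<in> \<Omega>" for s using that \<Omega>E unfolding topspace_Euclidean_space by blast
  have sT: "\<bar>s i\<bar> \<le> T" if "s \<in> \<Omega>" "i < ?k" for s i
  proof -
    have "\<bar>s i\<bar> \<le> L2_set (\<lambda>i. \<bar>s i\<bar>) {..<?k}" by (rule member_le_L2_set) (use that in auto)
    also have "\<dots> = L2_set s {..<?k}" by (simp add: L2_set_def)
    also have "\<dots> < T" using \<Omega>(2) that by blast
    finally show ?thesis by simp
  qed
  let ?u = "step_control ?k e"
  have k0: "?k > 0" by simp
  have ub: "norm (?u s \<tau>) \<le> C" if "s \<in> \<Omega>" "\<tau> \<in> {0..1}" for s \<tau>
    using step_control_bounds(1)[where k="?k" and e=e and s=s and s'=s and t=\<tau> and E=E and T=T, OF k0 that(2) sk[OF that(1)] sk[OF that(1)] less_imp_le[OF E] eE sT[OF that(1)]] T kTE by simp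
  define sol where "sol f' x s = (SOME y. ode_solution (ball_field c z \<rho> f') (?u s) x y)" for f' x s
  have sol: "ode_solution (ball_field c z \<rho> f') (?u s) x (sol f' x s)" if cd': "chart_data c z \<rho> L Fm f'" and s: "s \<in> \<Omega>" for f' x s
  proof -
    obtain y where "ode_solution (ball_field c z \<rho> f') (?u s) x y"
      by (rule ode_solution_exists[OF fd chart_dataD(7,8)[OF cd'] step_control_measurable ub[OF s] LC])
    then show ?thesis unfolding sol_def by (rule someI[of "ode_solution (ball_field c z \<rho> f') (?u s) x"])
  qed
  define En where "En f' x s = sol f' x s 1" for f' x s
  have stab: "norm (En f1 x s - En f2 x' s') \<le> 2 * (norm (x - x') + \<eta> * C + Fm * (real ?k * E * (\<Sum>i<?k. \<bar>s i - s' i\<bar>)))"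
    if cd': "chart_data c z \<rho> L Fm f1" "chart_data c z \<rho> L Fm f2" and \<eta>: "\<And>x. x \<in> cball z \<rho> \<Longrightarrow> norm (local_rep c f1 x - local_rep c f2 x) \<le> \<eta>"
      and s: "s \<in> \<Omega>" "s' \<in> \<Omega>" for f1 f2 x x' s s' \<eta>
    unfolding En_def
    by (rule ode_solution_stable[OF sol[OF cd'(1) s(1)] sol[OF cd'(2) s(2)] chart_dataD(7,8)[OF cd'(1)] ball_field_differ[OF \<rho> \<eta>]
          ub[OF s(1)] ub[OF s(2)] step_control_bounds(2)[where k="?k" and e=e and s=s and s'=s' and E=E, OF k0 _ sk[OF s(1)] sk[OF s(2)] less_imp_le[OF E] eE] LC]) auto
  have inball: "sol f' x s \<tau> \<in> cball z \<rho>" if "chart_data c z \<rho> L Fm f'" "s \<in> \<Omega>" "x \<in> cball z (\<rho> / 2)" "\<tau> \<in> {0..1}" for f' x s \<tau>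
    by (rule ode_solution_in_ball(1)[OF that(1) sol[OF that(1,2)] that(3) ub[OF that(2)] FC that(4)])
  have it: "itraj f' (?u s) 0 1 (\<lambda>t. chart_inv c (sol f' x s t))" if "chart_data c z \<rho> L Fm f'" "s \<in> \<Omega>" "x \<in> cball z (\<rho> / 2)" for f' x s
    by (rule ode_solution_in_ball(2)[OF that(1) sol[OF that(1,2)] that(3) ub[OF that(2)] FC])
  have sol0: "sol f' x s 0 = x" if "chart_data c z \<rho> L Fm f'" "s \<in> \<Omega>" for f' x s
    using sol[OF that] unfolding ode_solution_def by simp
  have zz: "z \<in> cball z (\<rho> / 2)" using \<rho> by simp
  have fl: "flows A X ?k x0 s = chart_inv c (En f z s)" if s: "s \<in> \<Omega>" for s
  proof -
    have "flows A ?X ?k x0 s = chart_inv c (sol f z s (real ?k / real ?k))"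
      by (rule flows_eq_trajectory[OF lvf k0 fdef'[OF s] it[OF cd s zz] _ ub[OF s] order_refl])
        (use sol0[OF cd s] iz in auto)
    then show ?thesis unfolding Xeq' En_def by simp
  qed
  have Enb: "En f' x s \<in> cball z \<rho>" if "chart_data c z \<rho> L Fm f'" "s \<in> \<Omega>" "x \<in> cball z (\<rho> / 2)" for f' x s
    unfolding En_def by (rule inball[OF that]) simp
  have fldom: "flows A X ?k x0 s \<in> chart_dom c" "chart_map c (flows A X ?k x0 s) = En f z s" if s: "s \<in> \<Omega>" for s
    using chart_dataD(10)[OF cd Enb[OF cd s zz]] fl[OF s] by auto
  have im\<Omega>: "flows A X ?k x0 ` \<Omega> \<subseteq> chart_dom c" using fldom by blast
  have homc: "homeomorphism (chart_dom c) (chart_map c ` chart_dom c) (chart_map c) (chart_inv c)"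
    using chart_props[OF cA(1)] unfolding homeomorphism_def by force
  obtain K q \<epsilon> where K: "K \<subseteq> \<Omega>" and \<epsilon>: "\<epsilon> > 0" and st: "\<forall>G'. continuous_map (subtopology ?E K) euclidean G' \<and>
      (\<forall>s\<in>K. dist (G' s) (chart_map c (flows A X ?k x0 s)) \<le> \<epsilon>) \<longrightarrow> q \<in> G' ` K"
    using essentially_open_stable_value[OF \<Omega> eo im\<Omega> homc] by (elim exE conjE) (rule that)
  have contE: "continuous_map (subtopology ?E K) euclidean (\<lambda>s. En f' z s + b)" if cd': "chart_data c z \<rho> L Fm f'" for f' b
  proof (rule continuous_map_if_dominated)
    fix s0 assume "s0 \<in> topspace (subtopology ?E K)"
    then have s0: "s0 \<in> \<Omega>" using K by auto
    show "\<exists>h. continuous_map (subtopology ?E K) euclideanreal h \<and> h s0 = 0 \<and>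
        (\<forall>s\<in>topspace (subtopology ?E K). dist (En f' z s + b) (En f' z s0 + b) \<le> h s)"
    proof (intro exI conjI ballI)
      show "continuous_map (subtopology ?E K) euclideanreal (\<lambda>s. 2 * (Fm * (real ?k * E * (\<Sum>i<?k. \<bar>s i - s0 i\<bar>))))"
        by (intro continuous_map_real_mult_left continuous_map_sum continuous_map_real_abs continuous_map_diff
            continuous_map_Euclidean_space_coordinate) auto
      fix s assume "s \<in> topspace (subtopology ?E K)"
      then have s: "s \<in> \<Omega>" using K by auto
      have "norm (En f' z s - En f' z s0) \<le> 2 * (norm (z - z) + 0 * C + Fm * (real ?k * E * (\<Sum>i<?k. \<bar>s i - s0 i\<bar>)))"
        by (rule stab[OF cd' cd' _ s s0]) simp
      then show "dist (En f' z s + b) (En f' z s0 + b) \<le> 2 * (Fm * (real ?k * E * (\<Sum>i<?k. \<bar>s i - s0 i\<bar>)))"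
        by (simp add: dist_norm)
    qed simp
  qed
  have "q \<in> (\<lambda>s. En f z s + 0) ` K"
    by (rule st[THEN spec, THEN mp]) (use contE[OF cd, of 0] fldom K \<epsilon> in \<open>auto simp: subset_iff\<close>)
  then obtain s1 where s1: "s1 \<in> K" "q = En f z s1" by auto
  have s1\<Omega>: "s1 \<in> \<Omega>" using s1 K by blast
  define \<eta> where "\<eta> = \<epsilon> / (8 * C)"
  have \<eta>: "\<eta> > 0" "2 * (\<eta> * C) = \<epsilon> / 4" unfolding \<eta>_def using \<epsilon> C by auto
  define d where "d = min (\<rho> / 2) (\<epsilon> / 8)"
  define W where "W = chart_dom c \<inter> chart_map c -` ball z d"
  have "open W" unfolding W_def using chart_props(1,3)[OF cA(1)] by (intro continuous_open_preimage) auto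
  moreover have "x0 \<in> W" unfolding W_def d_def using cA \<rho> \<epsilon> by (simp add: z_def)
  moreover have "\<forall>\<^sub>F n in sequentially. \<forall>p\<in>W. \<forall>q\<in>W. ccpath (fs n) (Ns n) p q r"
    using cds Mn uniform_limitD[OF UL \<eta>(1)]
  proof eventually_elim
    case (elim n)
    have cdn: "chart_data c z \<rho> L Fm (fs n)" using elim by simp
    have bsn: "bundle_section A (fs n)" by (rule chart_dataD(1)[OF cdn])
    have \<eta>n: "norm (local_rep c (fs n) x - local_rep c f x) \<le> \<eta>" if "x \<in> cball z \<rho>" for x
      using elim(3) that by (force simp: dist_norm)
    have path: "ccpath (fs n) (Ns n) (chart_inv c x) (chart_inv c (En (fs n) x s)) (M * C)"
      if x: "x \<in> cball z (\<rho> / 2)" and s: "s \<in> \<Omega>" for x s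
    proof (rule ccpathI)
      show "cccurve (fs n) (Ns n) 0 1 (\<lambda>t. chart_inv c (sol (fs n) x s t)) (?u s) (M * C)"
        unfolding cccurve_def
      proof (intro conjI ballI it[OF cdn s x] step_control_measurable)
        fix \<tau> :: real assume \<tau>: "\<tau> \<in> {0..1}"
        have "Ns n (chart_inv c (sol (fs n) x s \<tau>)) (?u s \<tau>) \<le> M * norm (?u s \<tau>)"
          using elim(2) inball[OF cdn s x \<tau>] by blast
        also have "\<dots> \<le> M * C" by (rule mult_left_mono[OF ub[OF s \<tau>] less_imp_le[OF M]])
        finally show "Ns n (chart_inv c (sol (fs n) x s \<tau>)) (?u s \<tau>) \<le> M * C" .
      qed
    qed (use sol0[OF cdn s] in \<open>auto simp: En_def\<close>)
    have half: "ccpath (fs n) (Ns n) p x0 (M * C + M * C)" if p: "p \<in> W" for p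
    proof -
      define x where "x = chart_map c p"
      have x: "norm (x - z) < d" "p = chart_inv c x" using p chart_props(5)[OF cA(1)] unfolding W_def x_def
        by (auto simp: dist_norm norm_minus_commute)
      have xb: "x \<in> cball z (\<rho> / 2)" using x(1) unfolding d_def by (simp add: dist_norm norm_minus_commute)
      define y where "y = En (fs n) x s1"
      have "norm (y - q) \<le> 2 * (norm (x - z) + \<eta> * C + Fm * (real ?k * E * (\<Sum>i<?k. \<bar>s1 i - s1 i\<bar>)))"
        unfolding y_def s1(2) by (rule stab[OF cdn cd \<eta>n s1\<Omega> s1\<Omega>])
      then have yq: "norm (y - q) \<le> \<epsilon> / 2" using x(1) \<eta>(2) unfolding d_def by simp
      \<comment> \<open>Stability of the value \<open>q\<close> is used for the translated endpoint map.\<close>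
      have "q \<in> (\<lambda>s. En (fs n) z s + (q - y)) ` K"
      proof (rule st[THEN spec, THEN mp], intro conjI ballI contE[OF cdn])
        fix s assume "s \<in> K"
        then have s: "s \<in> \<Omega>" using K by blast
        have "norm (En (fs n) z s - En f z s) \<le> 2 * (norm (z - z) + \<eta> * C + Fm * (real ?k * E * (\<Sum>i<?k. \<bar>s i - s i\<bar>)))"
          by (rule stab[OF cdn cd \<eta>n s s])
        then have 1: "norm (En (fs n) z s - En f z s) \<le> \<epsilon> / 4" using \<eta>(2) by simp
        have "norm ((En (fs n) z s - En f z s) + (q - y)) \<le> norm (En (fs n) z s - En f z s) + norm (q - y)"
          by (rule norm_triangle_ineq)
        also have "\<dots> \<le> \<epsilon>" using 1 yq \<epsilon> by (simp add: norm_minus_commute)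
        finally show "dist (En (fs n) z s + (q - y)) (chart_map c (flows A X ?k x0 s)) \<le> \<epsilon>"
          unfolding fldom(2)[OF s] dist_norm by (simp add: algebra_simps)
      qed
      then obtain s where s: "s \<in> K" "q = En (fs n) z s + (q - y)" by auto
      then have "En (fs n) z s = y" by (simp add: algebra_simps)
      then have "ccpath (fs n) (Ns n) x0 (chart_inv c y) (M * C)" using path[OF zz, of s] s K iz by auto
      then have b: "ccpath (fs n) (Ns n) (chart_inv c y) x0 (M * C)" by (rule ccpath_sym[OF bsn norms])
      have a: "ccpath (fs n) (Ns n) p (chart_inv c y) (M * C)" using path[OF xb s1\<Omega>] unfolding x(2)[symmetric] y_def .
      show ?thesis by (rule ccpath_trans[OF bsn norms a b]) (use M C in auto)
    qed
    show ?case
    proof (intro ballI)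
      fix p p' assume "p \<in> W" "p' \<in> W"
      then have "ccpath (fs n) (Ns n) p p' ((M * C + M * C) + (M * C + M * C))"
        by (intro ccpath_trans[OF bsn norms half] ccpath_sym[OF bsn norms half]) (use M C in auto)
      then show "ccpath (fs n) (Ns n) p p' r" by (rule ccpath_mono) (use MC in linarith)
    qed
  qed
  ultimately show ?thesis by blast
qed

end

section \<open>Local uniform convergence\<close>

context control_manifold
begin

lemma constant_converging:
  fixes f :: "'a \<Rightarrow> 'e \<Rightarrow> ('a, 'b) tvec" and N :: "'a \<Rightarrow> 'e \<Rightarrow> real"
  assumes lvf: "lvf_structure A f" and norm: "continuously_varying_norm N" and nonholonomic: "essentially_nonholonomic A f"
  shows "converging_structures A f N (\<lambda>_. f) (\<lambda>_. N)"
proof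
  show "lvf_structure A f" "lvf_structure A f" "continuously_varying_norm N" "continuously_varying_norm N"
    "essentially_nonholonomic A f" by (fact lvf norm nonholonomic)+
  show "lvf_converges A (\<lambda>_. f) f"
    unfolding lvf_converges_def
  proof (intro conjI allI)
    have "range (\<lambda>_::nat. f) = {f}" by auto
    then show "uniformly_locally_lipschitz A (range (\<lambda>_::nat. f))" using lvf unfolding lvf_structure_def by simp
    fix p
    obtain c where "c \<in> charts_at A p" using ex_chart_at by blast
    then show "\<exists>c\<in>charts_at A p. \<forall>K. compact K \<and> K \<subseteq> chart_map c ` chart_dom c \<longrightarrow>
        uniform_limit K (\<lambda>n. local_rep c f) (local_rep c f) sequentially"
      by (intro bexI[of _ c] allI impI uniform_limit_const)
  qed
  show "uniform_limit K (\<lambda>n (p, v). N p v) (\<lambda>(p, v). N p v) sequentially" if "compact K" for K :: "('a \<times> 'e) set"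
    by (rule uniform_limit_const)
qed

end

context converging_structures
begin

text \<open>A Lebesgue number of the cover by the neighbourhoods from local controllability.\<close>

lemma uniformly_controllable:
  assumes c: "c \<in> A" "cball z \<rho> \<subseteq> chart_map c ` chart_dom c" and r: "r > 0"
  obtains \<delta> where "\<delta> > 0" "\<forall>\<^sub>F n in sequentially. \<forall>x\<in>cball z \<rho>. \<forall>y\<in>cball z \<rho>. norm (x - y) \<le> \<delta> \<longrightarrow>
     ccpath (fs n) (Ns n) (chart_inv c x) (chart_inv c y) r"
proof -
  let ?B = "cball z \<rho>"
  let ?P = "\<lambda>n x y. ccpath (fs n) (Ns n) (chart_inv c x) (chart_inv c y) r"
  have ci: "continuous_on ?B (chart_inv c)" by (rule continuous_on_subset[OF chart_props(4)[OF c(1)] c(2)])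
  have "\<forall>x\<in>?B. \<exists>d>0. \<forall>\<^sub>F n in sequentially. \<forall>a\<in>?B \<inter> ball x (2 * d). \<forall>b\<in>?B \<inter> ball x (2 * d). ?P n a b"
  proof
    fix x assume x: "x \<in> ?B"
    obtain W where W: "open W" "chart_inv c x \<in> W" and ev: "\<forall>\<^sub>F n in sequentially. \<forall>p\<in>W. \<forall>q\<in>W. ccpath (fs n) (Ns n) p q r"
      using locally_controllable[OF r, of "chart_inv c x"] by (elim exE conjE)
    have "openin (top_of_set ?B) (?B \<inter> chart_inv c -` W)" using ci W(1) by (simp add: continuous_openin_preimage_gen)
    moreover have "x \<in> ?B \<inter> chart_inv c -` W" using x W by simp
    ultimately obtain e where e: "e > 0" "ball x e \<inter> ?B \<subseteq> ?B \<inter> chart_inv c -` W"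
      unfolding openin_contains_ball by blast
    have "\<forall>\<^sub>F n in sequentially. \<forall>a\<in>?B \<inter> ball x (2 * (e / 2)). \<forall>b\<in>?B \<inter> ball x (2 * (e / 2)). ?P n a b"
      using ev
    proof eventually_elim
      case (elim n)
      show ?case
      proof (intro ballI)
        fix a b assume "a \<in> ?B \<inter> ball x (2 * (e / 2))" "b \<in> ?B \<inter> ball x (2 * (e / 2))"
        then have "chart_inv c a \<in> W" "chart_inv c b \<in> W" using e(2) by auto
        then show "?P n a b" using elim by blast
      qed
    qed
    then show "\<exists>d>0. \<forall>\<^sub>F n in sequentially. \<forall>a\<in>?B \<inter> ball x (2 * d). \<forall>b\<in>?B \<inter> ball x (2 * d). ?P n a b"
      using e(1) by (intro exI[of _ "e / 2"]) simp
  qed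
  then obtain d where d: "\<forall>x\<in>?B. d x > 0 \<and> (\<forall>\<^sub>F n in sequentially. \<forall>a\<in>?B \<inter> ball x (2 * d x). \<forall>b\<in>?B \<inter> ball x (2 * d x). ?P n a b)"
    by (rule bchoice[THEN exE])
  have cov: "?B \<subseteq> (\<Union>x\<in>?B. ball x (d x))" using d by force
  obtain S where S: "S \<subseteq> ?B" "finite S" "?B \<subseteq> (\<Union>x\<in>S. ball x (d x))"
    by (rule compactE_image[OF compact_cball _ cov]) auto
  define \<delta> where "\<delta> = Min (insert 1 (d ` S)) / 2"
  have \<delta>m: "Min (insert 1 (d ` S)) > 0" using S d by auto
  have \<delta>: "\<delta> > 0" unfolding \<delta>_def using \<delta>m by simp
  have ev: "\<forall>\<^sub>F n in sequentially. \<forall>x\<in>S. \<forall>a\<in>?B \<inter> ball x (2 * d x). \<forall>b\<in>?B \<inter> ball x (2 * d x). ?P n a b"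
    by (rule eventually_ball_finite[OF S(2)]) (use d S(1) in blast)
  show ?thesis
  proof (rule that[OF \<delta>])
    show "\<forall>\<^sub>F n in sequentially. \<forall>x\<in>?B. \<forall>y\<in>?B. norm (x - y) \<le> \<delta> \<longrightarrow> ?P n x y"
      using ev
    proof eventually_elim
      case (elim n)
      show ?case
      proof (intro ballI impI)
        fix x y assume h: "x \<in> ?B" "y \<in> ?B" "norm (x - y) \<le> \<delta>"
        obtain s where s: "s \<in> S" "x \<in> ball s (d s)" using S(3) h(1) by blast
        have "Min (insert 1 (d ` S)) \<le> d s" using S s by (intro Min_le) auto
        then have "norm (x - y) < d s" using h(3) \<delta>m unfolding \<delta>_def by linarith
        then have "dist s y < 2 * d s" using s(2) dist_triangle[of s y x] by (simp add: dist_norm)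
        moreover have "dist s x < 2 * d s" using s(2) zero_le_dist[of s x] unfolding mem_ball by linarith
        ultimately show "?P n x y" using elim s(1) h(1,2) by auto
      qed
    qed
  qed
qed

text \<open>In a small neighbourhood all distances are at most a number \<open>R / 2\<close> such that curves of energy \<open>R\<close> stay in a coordinate
  ball with a contraction estimate. The comparison of the two structures is then applied in both directions.\<close>

lemma cc_dist_locally_uniform:
  "\<exists>U. open U \<and> x0 \<in> U \<and> ext_uniform_limit (U \<times> U) (\<lambda>n. cc_dist A (fs n) (Ns n)) (cc_dist A f N)"
proof -
  interpret const: converging_structures A control_space f N "\<lambda>_. f" "\<lambda>_. N" by (rule constant_converging[OF lvf norm nonholonomic])
  obtain c \<rho> L Fm where c: "c \<in> charts_at A x0" and cd: "chart_data c (chart_map c x0) \<rho> L Fm f"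
    and cds: "\<forall>\<^sub>F n in sequentially. chart_data c (chart_map c x0) \<rho> L Fm (fs n)"
    and UL: "uniform_limit (cball (chart_map c x0) \<rho>) (\<lambda>n. local_rep c (fs n)) (local_rep c f) sequentially"
    by (rule converging_chart[OF lvf lvfs conv])
  define z where "z = chart_map c x0"
  note cd = cd[folded z_def] and cds = cds[folded z_def] and UL = UL[folded z_def]
  have cA: "c \<in> A" "x0 \<in> chart_dom c" using c by (auto simp: charts_at_def)
  have \<rho>: "\<rho> > 0" and Fm0: "Fm \<ge> 0" by (rule chart_dataD(3)[OF cd], rule chart_dataD(9)[OF cd])
  have L0: "L \<ge> 0" by (rule lipschitz_on_nonneg[OF chart_dataD(5)[OF cd]])
  note B = chart_dataD(4)[OF cd]
  obtain m M where m: "m > 0" and M: "M > 0" and m': "\<And>x v. x \<in> cball z \<rho> \<Longrightarrow> m * norm v \<le> N (chart_inv c x) v"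
    and Mn: "\<forall>\<^sub>F n in sequentially. \<forall>x\<in>cball z \<rho>. \<forall>v. m * norm v \<le> Ns n (chart_inv c x) v \<and> Ns n (chart_inv c x) v \<le> M * norm v"
    by (rule norms_bounds[OF cA(1) B]) (use that in blast)
  note m = m m'
  \<comment> \<open>The controls of curves of energy \<open>R\<close> are bounded by \<open>R / m = D\<close> in the ball.\<close>
  define D where "D = min (1 / (2 * (L + 1))) (\<rho> / (4 * (Fm + 1)))"
  define R where "R = m * D"
  have D: "D > 0" unfolding D_def using L0 \<rho> Fm0 by simp
  have R: "R > 0" "R / m = D" unfolding R_def using D m(1) by auto
  have LD: "L * D \<le> 1 / 2"
  proof -
    have "D \<le> 1 / (2 * (L + 1))" unfolding D_def by simp
    then have "D * (2 * (L + 1)) \<le> 1" using L0 by (simp add: pos_le_divide_eq)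
    then show ?thesis using D by (simp add: algebra_simps)
  qed
  have FD: "Fm * D < \<rho> / 2"
  proof -
    have "D \<le> \<rho> / (4 * (Fm + 1))" unfolding D_def by simp
    then have "D * (4 * (Fm + 1)) \<le> \<rho>" using Fm0 by (simp add: pos_le_divide_eq)
    then have "4 * (Fm * D) + 4 * D \<le> \<rho>" by (simp add: algebra_simps)
    moreover have "Fm * D \<ge> 0" using Fm0 D by simp
    ultimately show ?thesis using D by linarith
  qed
  obtain W1 where W1: "open W1" "x0 \<in> W1" and ev1: "\<forall>\<^sub>F n in sequentially. \<forall>p\<in>W1. \<forall>q\<in>W1. ccpath (fs n) (Ns n) p q (R / 2)"
    using locally_controllable[OF half_gt_zero[OF R(1)], of x0] by (elim exE conjE)
  obtain W2 where W2: "open W2" "x0 \<in> W2" and ev2: "\<forall>\<^sub>F n::nat in sequentially. \<forall>p\<in>W2. \<forall>q\<in>W2. ccpath f N p q (R / 2)"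
    using const.locally_controllable[OF half_gt_zero[OF R(1)], of x0] by (elim exE conjE)
  define W3 where "W3 = chart_dom c \<inter> chart_map c -` ball z (\<rho> / 2)"
  have W3: "open W3" "x0 \<in> W3"
    unfolding W3_def using chart_props(1,3)[OF cA(1)] cA \<rho> by (auto intro!: continuous_open_preimage simp: z_def)
  define U where "U = W1 \<inter> W2 \<inter> W3"
  have "ext_uniform_limit (U \<times> U) (\<lambda>n. cc_dist A (fs n) (Ns n)) (cc_dist A f N)"
    unfolding ext_uniform_limit_def
  proof (intro allI impI)
    fix \<epsilon> :: real assume \<epsilon>: "\<epsilon> > 0"
    define e where "e = min (\<epsilon> / 4) (R / 2)"
    have e: "e > 0" "3 * e < \<epsilon>" "e \<le> R / 2" unfolding e_def using \<epsilon> R by auto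
    define \<omega> where "\<omega> = e / D"
    have \<omega>: "\<omega> > 0" "\<omega> * D = e" unfolding \<omega>_def using e D by auto
    obtain \<delta>1 where \<delta>1: "\<delta>1 > 0" and n1: "\<forall>\<^sub>F n in sequentially. \<forall>x\<in>cball z \<rho>. \<forall>y\<in>cball z \<rho>. norm (x - y) \<le> \<delta>1 \<longrightarrow>
     (\<forall>v. Ns n (chart_inv c y) v \<le> N (chart_inv c x) v + \<omega> * norm v \<and> N (chart_inv c y) v \<le> Ns n (chart_inv c x) v + \<omega> * norm v)"
      by (rule norms_close[OF cA(1) B \<omega>(1)])
    obtain \<delta>2 where \<delta>2: "\<delta>2 > 0" and n2: "\<forall>\<^sub>F n in sequentially. \<forall>x\<in>cball z \<rho>. \<forall>y\<in>cball z \<rho>. norm (x - y) \<le> \<delta>2 \<longrightarrow>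
     ccpath (fs n) (Ns n) (chart_inv c x) (chart_inv c y) e"
      by (rule uniformly_controllable[OF cA(1) B e(1)])
    obtain \<delta>3 where \<delta>3: "\<delta>3 > 0" and n3: "\<forall>\<^sub>F n::nat in sequentially. \<forall>x\<in>cball z \<rho>. \<forall>y\<in>cball z \<rho>. norm (x - y) \<le> \<delta>3 \<longrightarrow>
     ccpath f N (chart_inv c x) (chart_inv c y) e"
      by (rule const.uniformly_controllable[OF cA(1) B e(1)])
    define \<delta> where "\<delta> = min \<delta>1 (min \<delta>2 \<delta>3)"
    have \<delta>: "\<delta> > 0" "\<delta> \<le> \<delta>1" "\<delta> \<le> \<delta>2" "\<delta> \<le> \<delta>3" unfolding \<delta>_def using \<delta>1 \<delta>2 \<delta>3 by auto
    define \<eta> where "\<eta> = \<delta> / (2 * D)"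
    have \<eta>: "\<eta> > 0" "2 * (\<eta> * D) = \<delta>" unfolding \<eta>_def using \<delta> D by auto
    show "\<forall>\<^sub>F n in sequentially. \<forall>(p, q)\<in>U \<times> U. ext_absdiff (cc_dist A (fs n) (Ns n) p q) (cc_dist A f N p q) < ennreal \<epsilon>"
      using cds Mn ev1 ev2 n1 n2 n3 uniform_limitD[OF UL \<eta>(1)]
    proof eventually_elim
      case (elim n)
      note cdn = elim(1)
      have mn: "m * norm v \<le> Ns n (chart_inv c x) v" if "x \<in> cball z \<rho>" for x v using elim(2) that by blast
      have \<eta>n: "norm (local_rep c (fs n) x - local_rep c f x) \<le> \<eta>" "norm (local_rep c f x - local_rep c (fs n) x) \<le> \<eta>"
        if "x \<in> cball z \<rho>" for x
      proof -
        have d: "dist (local_rep c (fs n) x) (local_rep c f x) < \<eta>" using elim(8) that by blast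
        show "norm (local_rep c (fs n) x - local_rep c f x) \<le> \<eta>" using d by (simp add: dist_norm)
        show "norm (local_rep c f x - local_rep c (fs n) x) \<le> \<eta>" using d by (simp add: dist_norm norm_minus_commute)
      qed
      have nn: "Ns n (chart_inv c y) v \<le> N (chart_inv c x) v + \<omega> * norm v" "N (chart_inv c y) v \<le> Ns n (chart_inv c x) v + \<omega> * norm v"
        if "x \<in> cball z \<rho>" "y \<in> cball z \<rho>" "norm (x - y) \<le> \<delta>" for x y v
        using elim(5) that \<delta>(2) by (meson order_trans)+
      have c1: "ccpath (fs n) (Ns n) (chart_inv c x) (chart_inv c y) e" if "x \<in> cball z \<rho>" "y \<in> cball z \<rho>" "norm (x - y) \<le> \<delta>" for x y
        using elim(6) that \<delta>(3) by (meson order_trans)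
      have c2: "ccpath f N (chart_inv c x) (chart_inv c y) e" if "x \<in> cball z \<rho>" "y \<in> cball z \<rho>" "norm (x - y) \<le> \<delta>" for x y
        using elim(7) that \<delta>(4) by (meson order_trans)
      have main: "ext_absdiff (cc_dist A (fs n) (Ns n) p q) (cc_dist A f N p q) < ennreal \<epsilon>" if pq: "p \<in> U" "q \<in> U" for p q
      proof -
        have "ccpath (fs n) (Ns n) p q (R / 2)" "ccpath f N p q (R / 2)" using pq elim(3,4) unfolding U_def by auto
        then have le: "cc_dist A (fs n) (Ns n) p q \<le> ennreal (R / 2)" "cc_dist A f N p q \<le> ennreal (R / 2)"
          using cc_dist_le[OF lvfs norms] cc_dist_le[OF lvf norm] by auto
        obtain a where a: "cc_dist A (fs n) (Ns n) p q = ennreal a" "a \<ge> 0" "a \<le> R / 2"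
          using le(1) R by (cases "cc_dist A (fs n) (Ns n) p q") (auto simp: ennreal_le_iff top_unique)
        obtain b where b: "cc_dist A f N p q = ennreal b" "b \<ge> 0" "b \<le> R / 2"
          using le(2) R by (cases "cc_dist A f N p q") (auto simp: ennreal_le_iff top_unique)
        have p: "p \<in> chart_dom c" "chart_map c p \<in> cball z (\<rho> / 2)" using pq unfolding U_def W3_def by auto
        have "cc_dist A f N p q \<le> ennreal (a + 3 * e)"
          by (rule cc_dist_compare[where ?f1.0="fs n" and ?N1.0="Ns n" and c=c and z=z and \<omega>=\<omega> and \<eta>=\<eta> and \<delta>=\<delta> and m=m and R=R,
                OF lvfs lvf norms norm cdn cd m(1) mn \<eta>n(1) nn(2) less_imp_le[OF \<omega>(1)] c2 p a(2) _ e(1)])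
            (use a e R FD LD \<eta> \<omega> in simp_all)
        moreover have "cc_dist A (fs n) (Ns n) p q \<le> ennreal (b + 3 * e)"
          by (rule cc_dist_compare[where ?f1.0=f and ?N1.0=N and c=c and z=z and \<omega>=\<omega> and \<eta>=\<eta> and \<delta>=\<delta> and m=m and R=R,
                OF lvf lvfs norm norms cd cdn m \<eta>n(2) nn(1) less_imp_le[OF \<omega>(1)] c1 p b(2) _ e(1)])
            (use b e R FD LD \<eta> \<omega> in simp_all)
        ultimately have "ennreal b \<le> ennreal a + ennreal (3 * e)" "ennreal a \<le> ennreal b + ennreal (3 * e)"
          using a(1,2) b(1,2) e(1) by (simp_all only: ennreal_plus mult_nonneg_nonneg zero_le_numeral less_imp_le)
        then show ?thesis unfolding a(1) b(1)
          by (intro ext_absdiff_lessI[of _ _ "3 * e"]) (use e in auto)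
      qed
      then show ?case by auto
    qed
  qed
  moreover have "open U" "x0 \<in> U" unfolding U_def using W1 W2 W3 by auto
  ultimately show ?thesis by blast
qed

end

section \<open>Convergence of Carnot--Caratheodory distances\<close>

context control_manifold
begin

lemma path_distance_cc_dist:
  assumes f: "lvf_structure A f" and N: "continuously_varying_norm N"
  shows "path_distance (cc_dist A (f :: 'a \<Rightarrow> 'e \<Rightarrow> ('a, 'b) tvec) N)"
proof
  show "ext_distance (cc_dist A f N)" by (rule ext_distance_cc_dist[OF f N])
  fix p q r assume "cc_dist A f N p q < ennreal r"
  then obtain \<gamma> where "continuous_on {0..1} \<gamma>" "\<gamma> 0 = p" "\<gamma> 1 = q"
      "\<And>s t. 0 \<le> s \<Longrightarrow> s \<le> t \<Longrightarrow> t \<le> 1 \<Longrightarrow> cc_dist A f N (\<gamma> s) (\<gamma> t) \<le> ennreal ((t - s) * r)"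
    by (rule cc_dist_path[OF f N]) (use that in blast)
  then show "\<exists>\<gamma>. continuous_on {0..1} \<gamma> \<and> \<gamma> 0 = p \<and> \<gamma> 1 = q \<and>
      (\<forall>s t. 0 \<le> s \<longrightarrow> s \<le> t \<longrightarrow> t \<le> 1 \<longrightarrow> cc_dist A f N (\<gamma> s) (\<gamma> t) \<le> ennreal ((t - s) * r))"
    by (intro exI[of _ \<gamma>]) simp
qed

lemma locally_compact_manifold: "\<exists>U K. open U \<and> compact K \<and> x \<in> U \<and> U \<subseteq> (K :: 'a set)"
proof -
  obtain c where c: "c \<in> charts_at A x" using ex_chart_at by blast
  have cA: "c \<in> A" "x \<in> chart_dom c" using c by (auto simp: charts_at_def)
  note cp = chart_props[OF cA(1)]
  obtain \<rho> where \<rho>: "\<rho> > 0" "cball (chart_map c x) \<rho> \<subseteq> chart_map c ` chart_dom c"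
    using open_contains_cball[of "chart_map c ` chart_dom c"] cp cA by blast
  have "compact (chart_inv c ` cball (chart_map c x) \<rho>)"
    by (rule compact_continuous_image[OF continuous_on_subset[OF cp(4) \<rho>(2)] compact_cball])
  moreover have "open (chart_dom c \<inter> chart_map c -` ball (chart_map c x) \<rho>)"
    using cp by (intro continuous_open_preimage) auto
  moreover have "chart_dom c \<inter> chart_map c -` ball (chart_map c x) \<rho> \<subseteq> chart_inv c ` cball (chart_map c x) \<rho>"
  proof
    fix y assume y: "y \<in> chart_dom c \<inter> chart_map c -` ball (chart_map c x) \<rho>"
    then have "chart_inv c (chart_map c y) = y" using cp by auto
    moreover have "chart_map c y \<in> cball (chart_map c x) \<rho>" using y by simp
    ultimately show "y \<in> chart_inv c ` cball (chart_map c x) \<rho>" by (metis imageI)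
  qed
  ultimately show ?thesis using cA(2) \<rho>(1)
    by (intro exI[of _ "chart_dom c \<inter> chart_map c -` ball (chart_map c x) \<rho>"] exI conjI) auto
qed

end

context converging_structures
begin

text \<open>Small CC balls lie in a given neighbourhood as curves of small energy stay there. Conversely, small neighbourhoods lie in
  a given CC ball by local controllability of the constant sequence.\<close>

lemma dist_topology_cc_dist: "dist_topology (cc_dist A f N) = euclidean"
proof -
  let ?d = "cc_dist A f N"
  interpret const: converging_structures A control_space f N "\<lambda>_. f" "\<lambda>_. N" by (rule constant_converging[OF lvf norm nonholonomic])
  have "openin (dist_topology ?d) S \<longleftrightarrow> open S" for S
    unfolding openin_dist_topology
  proof
    assume S: "open S"
    show "\<forall>x\<in>S. \<exists>r>0. dball ?d x r \<subseteq> S"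
    proof
      fix x assume x: "x \<in> S"
      obtain r where r: "r > 0" and stay: "\<And>g u t. cccurve f N 0 1 g u r \<Longrightarrow> g 0 = x \<Longrightarrow> t \<in> {0..1} \<Longrightarrow> g t \<in> S"
        by (rule cccurve_stays_near[OF lvf norm S x]) (use that in blast)
      have "dball ?d x r \<subseteq> S"
      proof
        fix y assume "y \<in> dball ?d x r"
        then have "?d x y < ennreal r" by (simp add: dball_def)
        then obtain s where s: "s < r" "ccpath f N x y s" by (rule cc_dist_less[OF lvf norm])
        obtain g u where g: "cccurve f N 0 1 g u s" "g 0 = x" "g 1 = y" using s(2) unfolding ccpath_def by auto
        show "y \<in> S" using stay[OF cccurve_mono[OF g(1)] g(2), of 1] s(1) g(3) by simp
      qed
      then show "\<exists>r>0. dball ?d x r \<subseteq> S" using r by blast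
    qed
  next
    assume S: "\<forall>x\<in>S. \<exists>r>0. dball ?d x r \<subseteq> S"
    show "open S"
      unfolding open_subopen[of S]
    proof
      fix x assume x: "x \<in> S"
      then obtain r where r: "r > 0" "dball ?d x r \<subseteq> S" using S by blast
      obtain W where W: "open W" "x \<in> W"
          and ev: "\<forall>\<^sub>F n in sequentially. \<forall>p\<in>W. \<forall>q\<in>W. ccpath f N p q (r / 2)"
        using const.locally_controllable[OF half_gt_zero[OF r(1)], of x] by (elim exE conjE)
      have pq: "\<forall>p\<in>W. \<forall>q\<in>W. ccpath f N p q (r / 2)" using ev by simp
      have "W \<subseteq> S"
      proof
        fix y assume "y \<in> W"
        then have "?d x y \<le> ennreal (r / 2)" using pq W(2) by (intro cc_dist_le[OF lvf norm]) blast
        also have "\<dots> < ennreal r" using r(1) by (simp add: ennreal_less_iff)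
        finally show "y \<in> S" using r(2) by (auto simp: dball_def)
      qed
      then show "\<exists>T. open T \<and> x \<in> T \<and> T \<subseteq> S" using W by blast
    qed
  qed
  then show ?thesis by (simp add: topology_eq)
qed

sublocale cc: path_distances "cc_dist A f N" "\<lambda>n. cc_dist A (fs n) (Ns n)"
proof (intro path_distances.intro path_distances_axioms.intro)
  show "path_distance (cc_dist A f N)" by (rule path_distance_cc_dist[OF lvf norm])
  show "path_distance (cc_dist A (fs n) (Ns n))" for n by (rule path_distance_cc_dist[OF lvfs norms])
  show "dist_topology (cc_dist A f N) = euclidean" by (rule dist_topology_cc_dist)
  show "\<exists>U. open U \<and> x \<in> U \<and> ext_uniform_limit (U \<times> U) (\<lambda>n. cc_dist A (fs n) (Ns n)) (cc_dist A f N)" for x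
    by (rule cc_dist_locally_uniform)
qed

lemma cc_dist_boundedly_compact_iff_complete: "boundedly_compact (cc_dist A f N) \<longleftrightarrow> complete_distance (cc_dist A f N)"
  using cc.boundedly_compact_imp_complete[OF dist_topology_cc_dist]
    cc.complete_imp_boundedly_compact[OF dist_topology_cc_dist _ locally_compact_manifold] by (rule iffI)

lemma cc_dist_finite:
  assumes "connected (UNIV :: 'a set)"
  shows "cc_dist A f N p q < \<infinity>"
  by (rule cc.finite_propagates[OF dist_topology_cc_dist assms, of p]) simp_all

end

theorem theorem1p4:
  fixes A :: "('a::{t2_space, second_countable_topology}, 'b::euclidean_space) chart set"
    and f :: "'a \<Rightarrow> 'e::banach \<Rightarrow> ('a, 'b) tvec"
    and N :: "'a \<Rightarrow> 'e \<Rightarrow> real"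
  assumes manifold: "smooth_structure A"
    and finite_dimensional: "\<exists>B :: 'e set. finite B \<and> span B = UNIV"
    and lvf: "lvf_structure A f"
    and nonholonomic: "essentially_nonholonomic A f"
    and norm: "continuously_varying_norm N"
  shows
    "(connected (UNIV :: 'a set) \<longrightarrow> (\<forall>p q. cc_dist A f N p q < \<infinity>)) \<and>
     induces_manifold_topology (cc_dist A f N) \<and>
     (\<forall>(fs :: nat \<Rightarrow> 'a \<Rightarrow> 'e \<Rightarrow> ('a, 'b) tvec) (Ns :: nat \<Rightarrow> 'a \<Rightarrow> 'e \<Rightarrow> real).
        (\<forall>n. lvf_structure A (fs n)) \<and> (\<forall>n. continuously_varying_norm (Ns n)) \<and>
        lvf_converges A fs f \<and>
        (\<forall>K. compact K \<longrightarrow>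
           uniform_limit K (\<lambda>n (p, v). Ns n p v) (\<lambda>(p, v). N p v) sequentially)
        \<longrightarrow>
        (\<forall>x. \<exists>U. open U \<and> x \<in> U \<and>
           ext_uniform_limit (U \<times> U) (\<lambda>n. cc_dist A (fs n) (Ns n)) (cc_dist A f N)) \<and>
        (boundedly_compact (cc_dist A f N) \<longrightarrow>
           (\<forall>K. compact K \<longrightarrow>
              ext_uniform_limit K (\<lambda>n. cc_dist A (fs n) (Ns n)) (cc_dist A f N)) \<and>
           (\<forall>x. pointed_GH_converges (\<lambda>n. cc_dist A (fs n) (Ns n)) (\<lambda>n. x)
                  (cc_dist A f N) x))) \<and>
     (boundedly_compact (cc_dist A f N) \<longleftrightarrow> complete_distance (cc_dist A f N))"
proof -
  interpret control_manifold A "TYPE('e)"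
    using manifold finite_dimensional by unfold_locales
  have conv: "converging_structures A f N fs Ns"
    if "\<forall>n. lvf_structure A (fs n)" "\<forall>n. continuously_varying_norm (Ns n)" "lvf_converges A fs f"
      "\<forall>K. compact K \<longrightarrow> uniform_limit K (\<lambda>n (p, v). Ns n p v) (\<lambda>(p, v). N p v) sequentially"
    for fs :: "nat \<Rightarrow> 'a \<Rightarrow> 'e \<Rightarrow> ('a, 'b) tvec" and Ns :: "nat \<Rightarrow> 'a \<Rightarrow> 'e \<Rightarrow> real"
    by unfold_locales (use that lvf nonholonomic norm in auto)
  interpret const: converging_structures A "TYPE('e)" f N "\<lambda>_. f" "\<lambda>_. N"
    by (rule constant_converging[OF lvf norm nonholonomic])
  show ?thesis
  proof (intro conjI allI impI, goal_cases)
    case (1 p q)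
    then show ?case by (rule const.cc_dist_finite)
  next
    case 2
    show ?case unfolding induces_manifold_topology_def using const.cc.ext const.dist_topology_cc_dist ..
  next
    case (3 fs Ns x)
    then interpret s: converging_structures A "TYPE('e)" f N fs Ns by (elim conjE) (rule conv)
    show ?case by (rule s.cc_dist_locally_uniform)
  next
    case (4 fs Ns K)
    then interpret s: converging_structures A "TYPE('e)" f N fs Ns by (elim conjE) (rule conv)
    show ?case by (rule s.cc.compact_convergence) (use 4 in simp_all)
  next
    case (5 fs Ns x)
    then interpret s: converging_structures A "TYPE('e)" f N fs Ns by (elim conjE) (rule conv)
    show ?case by (rule s.cc.pointed_convergence) (use 5 in simp)
  next
    case 6
    show ?case by (rule const.cc_dist_boundedly_compact_iff_complete)
  qed
qed

end
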